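(* Let $(M,\mathcal V)$ be a smooth nondegenerate locally integrable structure of hypersurface type, of rank $n\ge1$, let $p\in M$ be a point with $T^\circ_p\ne0$, and assume that the Levi form of $\mathcal V$ at $p$ is definite. Fix coordinates $(x,y,s,t)\in\mathbb R^\nu\times\mathbb R^\nu\times\mathbb R\times\mathbb R^{n'}$ on $M$ centered at $p$ in which, near $0$, $T'=\mathcal V^\perp$ is spanned by the differentials of $$z_j=x_j+iy_j\ (j=1,\dots,\nu),\qquad w=s+i\phi(z,\bar z,s,t),$$ with $\phi$ smooth and real-valued, $\phi(0)=0$, $d\phi(0)=0$, and let $$M^\bullet=\{(z^\bullet,z,w)\in\mathbb C^{n'}\times\mathbb C^\nu\times\mathbb C:\ \operatorname{Im}w=\phi(z,\bar z,\operatorname{Im}z^\bullet,\operatorname{Re}w)\}$$ (near the origin; here $\operatorname{Im}z^\bullet$ is substituted for $t$ and $\operatorname{Re}w$ for $s$) be the corresponding external hypersurface. If $M^\bullet$ satisfies Condition (E) at the origin, then $\mathcal V$ is analytically regularizable near $p$.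
   Context: **Structures.** A smooth locally integrable structure on a smooth manifold $M$ of dimension $N$ is a smooth complex subbundle $\mathcal V\subset \mathbb C TM$ of complex rank $n$, closed under Lie brackets of sections, such that $T':=\mathcal V^\perp\subset \mathbb C T^*M$ is locally generated by exact one-forms. Put $m=N-n$. For $p\in M$, $T^\circ_p:=T'_p\cap T^*_pM$ (real covectors). The structure is of hypersurface type if $\dim_{\mathbb R}T^\circ_p\le 1$ for all $p$. Put $\nu=m-1$ and $n'=n-\nu$, so $N=2\nu+1+n'$. Near any point with $T^\circ_p\ne0$ coordinates of the kind used in the claim exist. **Levi form.** For $\omega\in T^\circ_p\setminus\{0\}$ the Levi form is the Hermitian form on $\mathcal V_p$ given by $(v,v')\mapsto \frac1{2i}\omega([L_1,\overline{L_2}]|_p)$, where $L_1,L_2$ are local sections of $\mathcal V$ with $L_1|_p=v$, $L_2|_p=v'$. It is determined up to a nonzero real factor. The structure is nondegenerate if the Levi form is nondegenerate at every $p$ with $T^\circ_p\ne0$. "Definite" means positive or negative definite. When the Levi form of $\mathcal V$ at $p$ is definite, $M^\bullet$ is strictly pseudoconvex near the origin. **Analytic regularizability.** $\mathcal V$ is analytically regularizable near $p$ if there are a real-analytic manifold $M'$, a real-analytic locally integrable structure $\mathcal V'$ on $M'$ (i.e. $\mathcal V'$ is a real-analytic subbundle), a point $p'\in M'$, and a smooth diffeomorphism $f$ from a neighborhood of $p$ to a neighborhood of $p'$ with $f(p)=p'$ and $df(\mathcal V)=\mathcal V'$. **Condition (E).** Let $d\ge1$, let $H\subset\mathbb C^{d+1}$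 be a smooth strictly pseudoconvex real hypersurface and $p\in H$. Choose coordinates $(z,w)\in\mathbb C^d\times\mathbb C$ and a real smooth local defining function $\rho$ of $H$ near $p$, $d\rho\ne0$, with $\rho_w(p)\neq0$ and with the sign chosen so that the complex Hessian of $\rho$ is positive on $T^{1,0}H$. Let $U$ be a small neighborhood of $p$, $U^+=U\cap\{\rho<0\}$ (the pseudoconvex side). In the bundle of 1-jets of complex hypersurfaces of $\mathbb C^{d+1}$, with local coordinates $(z,w,\zeta)\in\mathbb C^{d}\times\mathbb C\times\mathbb C^d$ ($\zeta_j$ standing for $w_{z_j}$), put $$H_J=\{(z,w,\zeta): (z,w)\in H,\ \zeta_j=-\rho_{z_j}/\rho_w\},$$ let $\widehat p\in H_J$ be the point over $p$, and let $\widehat H=H\times\mathbb C^d$, $\widehat U^+=U^+\times\mathbb C^d$. Define for $i,j=1,\dots,d$ the functions $$\Phi_{ij}=\frac1{(\rho_w)^3}\begin{vmatrix}\rho&\rho_{z_j}&\rho_w\\ \rho_{z_i}&\rho_{z_iz_j}&\rho_{z_iw}\\ \rho_w&\rho_{z_jw}&\rho_{ww}\end{vmatrix}$$ on $H$, regarded as functions on $H_J$. $H$ satisfies Condition (E) at $p$ if there are a neighborhood $\mathcal O$ of $\widehat p$ and functions that are smooth on $\mathcal O\cap(\widehat U^+\cup\widehat H)$ (up to the boundary), holomorphic in $\mathcal O\cap \widehat U^+$, and equal to $\Phi_{ij}$ on $\mathcal O\cap H_J$. For $H=M^\bullet$ one has $d=n=\nu+n'$, with $(z^\bullet,z)$ in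 the role of $z$. *)

theory Defs
  imports "HOL-Analysis.Analysis"
begin

section \<open>Smooth and real-analytic maps\<close>

primrec higher_differentiable_on ::
  "nat \<Rightarrow> 'a::real_normed_vector set \<Rightarrow> ('a \<Rightarrow> 'b::real_normed_vector) \<Rightarrow> bool" where
  "higher_differentiable_on 0 S f \<longleftrightarrow> continuous_on S f"
| "higher_differentiable_on (Suc k) S f \<longleftrightarrow>
     (\<forall>x\<in>S. f differentiable (at x)) \<and>
     (\<forall>v. higher_differentiable_on k S (\<lambda>x. frechet_derivative f (at x) v))"

(* Intended for open S only; smooth_up_to below covers sets that are not open. *)
definition smooth_on :: "'a::real_normed_vector set \<Rightarrow> ('a \<Rightarrow> 'b::real_normed_vector) \<Rightarrow> bool" where
  "smooth_on S f \<longleftrightarrow> (\<forall>k. higher_differentiable_on k S f)"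

definition smooth_up_to :: "'a::real_normed_vector set \<Rightarrow> ('a \<Rightarrow> 'b::real_normed_vector) \<Rightarrow> bool" where
  "smooth_up_to S f \<longleftrightarrow>
     (\<forall>x\<in>S. \<exists>W g. open W \<and> x \<in> W \<and> smooth_on W g \<and> (\<forall>y\<in>W \<inter> S. f y = g y))"

(* Since 'd is finite, 'd => nat is the set of all multi-indices. *)
definition real_analytic_on :: "(real^'d) set \<Rightarrow> (real^'d \<Rightarrow> 'b::real_normed_vector) \<Rightarrow> bool" where
  "real_analytic_on S f \<longleftrightarrow>
     (\<forall>a\<in>S. \<exists>r>0. \<exists>c :: ('d \<Rightarrow> nat) \<Rightarrow> 'b. \<forall>x\<in>ball a r.
        ((\<lambda>\<alpha>. (\<Prod>i\<in>UNIV. (x $ i - a $ i) ^ \<alpha> i) *\<^sub>R c \<alpha>) has_sum f x) UNIV)"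

definition partial :: "'d \<Rightarrow> (real^'d \<Rightarrow> 'b::real_normed_vector) \<Rightarrow> real^'d \<Rightarrow> 'b" where
  "partial i f x = frechet_derivative f (at x) (axis i 1)"


section \<open>Manifolds\<close>

(* A chart is a domain together with a coordinate map, whose values off the domain are irrelevant. *)
type_synonym ('a, 'd) chart = "'a set \<times> ('a \<Rightarrow> real^'d)"

definition is_chart :: "'a topology \<Rightarrow> ('a, 'd::finite) chart \<Rightarrow> bool" where
  "is_chart X c \<longleftrightarrow> (case c of (U, \<psi>) \<Rightarrow>
     openin X U \<and> open (\<psi> ` U) \<and>
     homeomorphic_map (subtopology X U) (top_of_set (\<psi> ` U)) \<psi>)"

(* The parameter reg is the regularity class of the coordinate changes. The atlas need not be
   maximal, so any coordinate system on the manifold may be taken to be one of its members. *)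
definition manifold ::
  "((real^'d) set \<Rightarrow> (real^'d \<Rightarrow> real^'d) \<Rightarrow> bool) \<Rightarrow> 'a topology \<Rightarrow> ('a, 'd::finite) chart set \<Rightarrow> bool" where
  "manifold reg X \<A> \<longleftrightarrow>
     Hausdorff_space X \<and> second_countable X \<and>
     (\<forall>c\<in>\<A>. is_chart X c) \<and> (\<Union>c\<in>\<A>. fst c) = topspace X \<and>
     (\<forall>(U, \<psi>)\<in>\<A>. \<forall>(U', \<psi>')\<in>\<A>. reg (\<psi> ` (U \<inter> U')) (\<psi>' \<circ> inv_into U \<psi>))"

definition smooth_map ::
  "('a, 'd::finite) chart set \<Rightarrow> ('b, 'd) chart set \<Rightarrow> 'a set \<Rightarrow> ('a \<Rightarrow> 'b) \<Rightarrow> bool" where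
  "smooth_map \<A> \<B> G f \<longleftrightarrow>
     (\<forall>(U, \<psi>)\<in>\<A>. \<forall>(U', \<psi>')\<in>\<B>.
        smooth_on (\<psi> ` {q \<in> G \<inter> U. f q \<in> U'}) (\<psi>' \<circ> f \<circ> inv_into U \<psi>))"

definition diffeo ::
  "'a topology \<Rightarrow> ('a, 'd::finite) chart set \<Rightarrow> 'b topology \<Rightarrow> ('b, 'd) chart set
     \<Rightarrow> 'a set \<Rightarrow> 'b set \<Rightarrow> ('a \<Rightarrow> 'b) \<Rightarrow> bool" where
  "diffeo X \<A> Y \<B> G G' f \<longleftrightarrow>
     homeomorphic_map (subtopology X G) (subtopology Y G') f \<and>
     smooth_map \<A> \<B> G f \<and> smooth_map \<B> \<A> G' (inv_into G f)"

(* The complexified differential of a map between open subsets of real^'d. *)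
definition cdiff :: "(real^'d \<Rightarrow> real^'d) \<Rightarrow> real^'d \<Rightarrow> complex^'d \<Rightarrow> complex^'d" where
  "cdiff g x v = (\<chi> j. \<Sum>i\<in>UNIV. v $ i * complex_of_real (partial i g x $ j))"


section \<open>Locally integrable structures in an open subset of Euclidean space\<close>

(* Complex tangent vectors and covectors at a point are both given by their component vectors
   with respect to the coordinate frames. V assigns to a point of an open set its fibre. *)

type_synonym 'd fibres = "real^'d \<Rightarrow> (complex^'d) set"

definition pairing :: "complex^'d \<Rightarrow> complex^'d \<Rightarrow> complex" where
  "pairing \<omega> v = (\<Sum>i\<in>UNIV. \<omega> $ i * v $ i)"

definition of_real_vec :: "real^'d \<Rightarrow> complex^'d" where
  "of_real_vec \<xi> = (\<chi> i. complex_of_real (\<xi> $ i))"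

definition cnj_vec :: "complex^'d \<Rightarrow> complex^'d" where
  "cnj_vec v = (\<chi> i. cnj (v $ i))"

definition differential :: "(real^'d \<Rightarrow> complex) \<Rightarrow> real^'d \<Rightarrow> complex^'d" where
  "differential g x = (\<chi> i. partial i g x)"

definition lie_bracket ::
  "(real^'d \<Rightarrow> complex^'d) \<Rightarrow> (real^'d \<Rightarrow> complex^'d) \<Rightarrow> real^'d \<Rightarrow> complex^'d" where
  "lie_bracket L M x =
     (\<Sum>i\<in>UNIV. (L x $ i) *s partial i M x - (M x $ i) *s partial i L x)"

definition subbundle ::
  "((real^'d) set \<Rightarrow> (real^'d \<Rightarrow> complex^'d) \<Rightarrow> bool) \<Rightarrow> nat \<Rightarrow> (real^'d) set \<Rightarrow> 'd::finite fibres \<Rightarrow> bool" where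
  "subbundle reg n \<Omega> V \<longleftrightarrow>
     (\<forall>x\<in>\<Omega>. \<exists>W L. open W \<and> x \<in> W \<and> W \<subseteq> \<Omega> \<and> (\<forall>i<n. reg W (L i)) \<and>
        (\<forall>y\<in>W. V y = vec.span ((\<lambda>i. L i y) ` {..<n}) \<and> vec.dim (V y) = n))"

definition smooth_section :: "(real^'d) set \<Rightarrow> 'd::finite fibres \<Rightarrow> (real^'d \<Rightarrow> complex^'d) \<Rightarrow> bool" where
  "smooth_section W V L \<longleftrightarrow> smooth_on W L \<and> (\<forall>y\<in>W. L y \<in> V y)"

definition involutive :: "(real^'d) set \<Rightarrow> 'd::finite fibres \<Rightarrow> bool" where
  "involutive \<Omega> V \<longleftrightarrow>
     (\<forall>W L M. open W \<and> W \<subseteq> \<Omega> \<and> smooth_section W V L \<and> smooth_section W V M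
        \<longrightarrow> smooth_section W V (lie_bracket L M))"

definition annihilator :: "'d::finite fibres \<Rightarrow> 'd fibres" where
  "annihilator V x = {\<omega>. \<forall>v\<in>V x. pairing \<omega> v = 0}"

definition locally_exact :: "(real^'d) set \<Rightarrow> 'd::finite fibres \<Rightarrow> bool" where
  "locally_exact \<Omega> T \<longleftrightarrow>
     (\<forall>x\<in>\<Omega>. \<exists>W k Z. open W \<and> x \<in> W \<and> W \<subseteq> \<Omega> \<and> (\<forall>j<k. smooth_on W (Z j)) \<and>
        (\<forall>y\<in>W. T y = vec.span ((\<lambda>j. differential (Z j) y) ` {..<(k::nat)})))"

definition char_set :: "'d::finite fibres \<Rightarrow> real^'d \<Rightarrow> (real^'d) set" where
  "char_set V x = {\<xi>. of_real_vec \<xi> \<in> annihilator V x}"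

(* The value does not depend on the choice of the sections L and M extending v and v'. *)
definition levi_form :: "'d::finite fibres \<Rightarrow> real^'d \<Rightarrow> real^'d \<Rightarrow> complex^'d \<Rightarrow> complex^'d \<Rightarrow> complex" where
  "levi_form V x \<xi> v v' =
     (THE a. \<exists>W L M. open W \<and> x \<in> W \<and> smooth_section W V L \<and> smooth_section W V M \<and>
        L x = v \<and> M x = v' \<and>
        a = 1 / (2 * \<i>) * pairing (of_real_vec \<xi>) (lie_bracket L (\<lambda>y. cnj_vec (M y)) x))"

definition levi_nondegenerate :: "'d::finite fibres \<Rightarrow> real^'d \<Rightarrow> bool" where
  "levi_nondegenerate V x \<longleftrightarrow>
     (\<forall>\<xi>\<in>char_set V x - {0}. \<forall>v\<in>V x. (\<forall>v'\<in>V x. levi_form V x \<xi> v v' = 0) \<longrightarrow> v = 0)"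

(* The Levi form is Hermitian, so its diagonal values are real. *)
definition levi_definite :: "'d::finite fibres \<Rightarrow> real^'d \<Rightarrow> bool" where
  "levi_definite V x \<longleftrightarrow>
     (\<forall>\<xi>\<in>char_set V x - {0}.
        (\<forall>v\<in>V x - {0}. Re (levi_form V x \<xi> v v) > 0) \<or>
        (\<forall>v\<in>V x - {0}. Re (levi_form V x \<xi> v v) < 0))"


section \<open>Locally integrable structures on manifolds\<close>

(* A family of subspaces of the complexified tangent spaces is given by its representatives in
   the charts of an atlas: V (U, \<psi>) (\<psi> q) consists of the component vectors, in the chart
   (U, \<psi>), of the elements of the fibre at q. Representatives in two charts are related by the
   differential of the coordinate change. Values off \<psi> ` U are irrelevant. *)

type_synonym ('a, 'd) structure_on = "('a, 'd) chart \<Rightarrow> 'd fibres"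

definition tangent_family :: "('a, 'd::finite) chart set \<Rightarrow> ('a, 'd) structure_on \<Rightarrow> bool" where
  "tangent_family \<A> V \<longleftrightarrow>
     (\<forall>(U, \<psi>)\<in>\<A>. \<forall>(U', \<psi>')\<in>\<A>. \<forall>q\<in>U \<inter> U'.
        V (U', \<psi>') (\<psi>' q) = cdiff (\<psi>' \<circ> inv_into U \<psi>) (\<psi> q) ` V (U, \<psi>) (\<psi> q))"

definition locally_integrable_structure ::
  "nat \<Rightarrow> ('a, 'd::finite) chart set \<Rightarrow> ('a, 'd) structure_on \<Rightarrow> bool" where
  "locally_integrable_structure n \<A> V \<longleftrightarrow>
     tangent_family \<A> V \<and>
     (\<forall>(U, \<psi>)\<in>\<A>.
        subbundle smooth_on n (\<psi> ` U) (V (U, \<psi>)) \<and>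
        involutive (\<psi> ` U) (V (U, \<psi>)) \<and>
        locally_exact (\<psi> ` U) (annihilator (V (U, \<psi>))))"

definition real_analytic_locally_integrable_structure ::
  "nat \<Rightarrow> ('a, 'd::finite) chart set \<Rightarrow> ('a, 'd) structure_on \<Rightarrow> bool" where
  "real_analytic_locally_integrable_structure n \<A> V \<longleftrightarrow>
     locally_integrable_structure n \<A> V \<and>
     (\<forall>(U, \<psi>)\<in>\<A>. subbundle real_analytic_on n (\<psi> ` U) (V (U, \<psi>)))"

definition hypersurface_type :: "('a, 'd::finite) chart set \<Rightarrow> ('a, 'd) structure_on \<Rightarrow> bool" where
  "hypersurface_type \<A> V \<longleftrightarrow> (\<forall>(U, \<psi>)\<in>\<A>. \<forall>x\<in>\<psi> ` U. dim (char_set (V (U, \<psi>)) x) \<le> 1)"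

definition nondegenerate_structure :: "('a, 'd::finite) chart set \<Rightarrow> ('a, 'd) structure_on \<Rightarrow> bool" where
  "nondegenerate_structure \<A> V \<longleftrightarrow>
     (\<forall>(U, \<psi>)\<in>\<A>. \<forall>x\<in>\<psi> ` U. char_set (V (U, \<psi>)) x \<noteq> {0} \<longrightarrow> levi_nondegenerate (V (U, \<psi>)) x)"

(* The points of the model manifold X' are taken from the type real^'d, with an arbitrary topology
   and atlas. This is no restriction: a second countable manifold has at most continuum many
   points, so every such manifold is isomorphic to one of this kind. *)
definition analytically_regularizable_near ::
  "nat \<Rightarrow> 'a topology \<Rightarrow> ('a, 'd::finite) chart set \<Rightarrow> ('a, 'd) structure_on \<Rightarrow> 'a \<Rightarrow> bool" where
  "analytically_regularizable_near n X \<A> V p \<longleftrightarrow>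
     (\<exists>(X' :: (real^'d) topology) \<A>' V' p' G G' f.
        manifold real_analytic_on X' \<A>' \<and>
        real_analytic_locally_integrable_structure n \<A>' V' \<and>
        openin X G \<and> p \<in> G \<and> openin X' G' \<and> p' \<in> G' \<and>
        diffeo X \<A> X' \<A>' G G' f \<and> f p = p' \<and>
        (\<forall>(U, \<psi>)\<in>\<A>. \<forall>(U', \<psi>')\<in>\<A>'. \<forall>q\<in>G \<inter> U. f q \<in> U' \<longrightarrow>
           V' (U', \<psi>') (\<psi>' (f q)) = cdiff (\<psi>' \<circ> f \<circ> inv_into U \<psi>) (\<psi> q) ` V (U, \<psi>) (\<psi> q)))"


section \<open>Coordinates and the external hypersurface\<close>

(* The coordinates of C^n are indexed by 'n. A set K of indices carries the coordinates z_j and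
   its complement the coordinates of z^bullet, so that nu = card K and n' = card (- K); either
   may be 0. Accordingly, the real coordinates (x, y, s, t) carry the labels coord_labels K, and a
   bijection lab from 'd onto these labels tells which component of a vector in real^'d is which
   coordinate. In particular CARD('d) = 2 nu + 1 + n'. *)

datatype 'n coord = CX 'n | CY 'n | CS | CT 'n

definition coord_labels :: "'n set \<Rightarrow> 'n coord set" where
  "coord_labels K = CX ` K \<union> CY ` K \<union> {CS} \<union> CT ` (- K)"

definition z_fun :: "('d \<Rightarrow> 'n coord) \<Rightarrow> 'n \<Rightarrow> real^'d \<Rightarrow> complex" where
  "z_fun lab k x = Complex (x $ inv lab (CX k)) (x $ inv lab (CY k))"

definition w_fun :: "('d \<Rightarrow> 'n coord) \<Rightarrow> (real^'d \<Rightarrow> real) \<Rightarrow> real^'d \<Rightarrow> complex" where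
  "w_fun lab \<phi> x = Complex (x $ inv lab CS) (\<phi> x)"

(* The substitution z = Z restricted to K, s = Re w, t = Im of Z restricted to - K. *)
definition ext_subst :: "('d \<Rightarrow> 'n coord) \<Rightarrow> (complex^'n) \<times> complex \<Rightarrow> real^'d" where
  "ext_subst lab q = (case q of (Z, w) \<Rightarrow>
     \<chi> i. (case lab i of CX k \<Rightarrow> Re (Z $ k) | CY k \<Rightarrow> Im (Z $ k) | CS \<Rightarrow> Re w | CT k \<Rightarrow> Im (Z $ k)))"

definition external_hypersurface ::
  "('d \<Rightarrow> 'n coord) \<Rightarrow> (real^'d) set \<Rightarrow> (real^'d \<Rightarrow> real) \<Rightarrow> ((complex^'n) \<times> complex) set" where
  "external_hypersurface lab \<Omega> \<phi> =
     {(Z, w). ext_subst lab (Z, w) \<in> \<Omega> \<and> Im w = \<phi> (ext_subst lab (Z, w))}"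


section \<open>Condition (E)\<close>

definition scale_pt :: "complex \<Rightarrow> (complex^'n) \<times> complex \<Rightarrow> (complex^'n) \<times> complex" where
  "scale_pt c q = (c *s fst q, c * snd q)"

(* For a constant vector v these are the sums over all k of v_k times the derivative of g in the
   k-th complex coordinate, and of cnj v_k times its derivative in the conjugate coordinate. *)

definition wirt ::
  "(complex^'n) \<times> complex \<Rightarrow> ((complex^'n) \<times> complex \<Rightarrow> complex) \<Rightarrow> (complex^'n) \<times> complex \<Rightarrow> complex" where
  "wirt v g q = (frechet_derivative g (at q) v - \<i> * frechet_derivative g (at q) (scale_pt \<i> v)) / 2"

definition wirt_bar ::
  "(complex^'n) \<times> complex \<Rightarrow> ((complex^'n) \<times> complex \<Rightarrow> complex) \<Rightarrow> (complex^'n) \<times> complex \<Rightarrow> complex" where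
  "wirt_bar v g q = (frechet_derivative g (at q) v + \<i> * frechet_derivative g (at q) (scale_pt \<i> v)) / 2"

abbreviation d_z ::
  "'n \<Rightarrow> ((complex^'n) \<times> complex \<Rightarrow> complex) \<Rightarrow> (complex^'n) \<times> complex \<Rightarrow> complex" where
  "d_z j \<equiv> wirt (axis j 1, 0)"

abbreviation d_w ::
  "((complex^'n) \<times> complex \<Rightarrow> complex) \<Rightarrow> (complex^'n) \<times> complex \<Rightarrow> complex" where
  "d_w \<equiv> wirt (0, 1)"

definition Phi ::
  "((complex^'n) \<times> complex \<Rightarrow> complex) \<Rightarrow> 'n \<Rightarrow> 'n \<Rightarrow> (complex^'n) \<times> complex \<Rightarrow> complex" where
  "Phi \<rho> i j q = 1 / (d_w \<rho> q) ^ 3 *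
     det (vector
       [vector [\<rho> q, d_z j \<rho> q, d_w \<rho> q],
        vector [d_z i \<rho> q, d_z i (d_z j \<rho>) q, d_z i (d_w \<rho>) q],
        vector [d_w \<rho> q, d_z j (d_w \<rho>) q, d_w (d_w \<rho>) q]] :: complex^3^3)"

(* A point ((z, w), \<zeta>) of the bundle of 1-jets of complex hypersurfaces. *)
type_synonym 'n jet = "((complex^'n) \<times> complex) \<times> (complex^'n)"

definition jet_lift :: "((complex^'n) \<times> complex \<Rightarrow> complex) \<Rightarrow> (complex^'n) \<times> complex \<Rightarrow> 'n jet" where
  "jet_lift \<rho> q = (q, \<chi> j. - d_z j \<rho> q / d_w \<rho> q)"

definition holomorphic_jet_on :: "('n::finite jet) set \<Rightarrow> ('n jet \<Rightarrow> complex) \<Rightarrow> bool" where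
  "holomorphic_jet_on S F \<longleftrightarrow>
     (\<forall>x\<in>S. \<exists>D. (F has_derivative D) (at x) \<and>
        (\<forall>q \<zeta>. D (scale_pt \<i> q, \<i> *s \<zeta>) = \<i> * D (q, \<zeta>)))"

(* \<rho> is a defining function of H in the neighbourhood U of p, and H is strictly pseudoconvex
   there with U intersected with {\<rho> < 0} as its pseudoconvex side. *)
definition spc_defining_function ::
  "((complex^'n) \<times> complex) set \<Rightarrow> (complex^'n) \<times> complex \<Rightarrow> ((complex^'n) \<times> complex) set
     \<Rightarrow> ((complex^'n) \<times> complex \<Rightarrow> real) \<Rightarrow> bool" where
  "spc_defining_function H p U \<rho> \<longleftrightarrow>
     (let R = (\<lambda>q. complex_of_real (\<rho> q)) in
      open U \<and> p \<in> U \<and> smooth_on U \<rho> \<and> H \<inter> U = {q\<in>U. \<rho> q = 0} \<and>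
      (\<forall>q\<in>U. frechet_derivative \<rho> (at q) \<noteq> (\<lambda>_. 0)) \<and>
      (\<forall>q\<in>U. d_w R q \<noteq> 0) \<and>
      (\<forall>q\<in>H \<inter> U. \<forall>v. v \<noteq> 0 \<and> wirt v R q = 0 \<longrightarrow> Re (wirt v (wirt_bar v R) q) > 0))"

(* The condition does not depend on the choice of \<rho> and U: on H the functions Phi and the lift
   jet_lift are unchanged when \<rho> is multiplied by a positive function. *)
definition condition_E :: "((complex^'n) \<times> complex) set \<Rightarrow> (complex^'n) \<times> complex \<Rightarrow> bool" where
  "condition_E H p \<longleftrightarrow> p \<in> H \<and>
     (\<exists>U \<rho>. spc_defining_function H p U \<rho> \<and>
       (let R = (\<lambda>q. complex_of_real (\<rho> q));
            Uplus = {q\<in>U. \<rho> q < 0};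
            HJ = jet_lift R ` (H \<inter> U)
        in \<exists>\<O> F. open \<O> \<and> jet_lift R p \<in> \<O> \<and> \<O> \<subseteq> U \<times> UNIV \<and>
             (\<forall>i j. smooth_up_to (\<O> \<inter> ((Uplus \<union> (H \<inter> U)) \<times> UNIV)) (F i j) \<and>
                    holomorphic_jet_on (\<O> \<inter> (Uplus \<times> UNIV)) (F i j) \<and>
                    (\<forall>x\<in>\<O> \<inter> HJ. F i j x = Phi R i j (fst x)))))"

end

theory Submission
 imports Defs "HOL-Complex_Analysis.Complex_Analysis"
begin

text \<open>Condition (E) is used to equip the external hypersurface with a connection whose coefficients are
  holomorphic on one side, and the development of this connection gives coordinates in which the
  structure is analytic.
  
  Parametrize the hypersurface H by (Z, s), with w = s + i ph. It carries the fields L i of type (1,0)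
  with L i (z j) = delta, their conjugates and a transversal field T. The jet coordinates of H are
  ze j = L j w, and L i (ze j) is the function Phi i j (graph_jet_lift, graph_Phi). By Condition (E) it
  is the boundary value of a function g i j of the jet, holomorphic over the pseudoconvex side. Hence
  L i acts on boundary values of holomorphic functions of the jet as a holomorphic operator (L_pull).
  
  If the w-coordinates of the Segre varieties are regarded as solutions of a second order system, then
  g is the right-hand side of that system, and the system determines a connection on a bundle of rank
  CARD('n) + 2, analogous to the projective connection of such a system or to the tractor connection of
  CR geometry. Its form conn is a holomorphic function of the jet over the pseudoconvex side. On H a
  Hermitian form h, built from a density sg normalized by the Levi determinant, is parallel for it
  (FD_h). The connection may have curvature; therefore it is developed along rays only. The
  development solves an ordinary differential equation with parameters y. For real y the equation
  preserves h, which forces the curve to stay on H (real_solution); where the rays run over the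
  pseudoconvex side, the solution is holomorphic in y (flow_cholo). Together these facts give a smooth
  map from a ball in a complex space into the jets, which maps real points to the lift of H, and a
  wedge with edge at the real points holomorphically to the pseudoconvex side (development_map, slice_map). Since
  M is obtained from H by forgetting the directions Re z for the indices outside K, a slice of
  real dimension CARD('d) of the parameters gives a chart of M.
  
  In this chart z k and w are boundary values of holomorphic functions on the wedge, so that the
  sections of the structure solve a linear system with coefficients holomorphic on the wedge, and a
  normalized frame extends holomorphically to it. The conjugate of the frame extends as well, because
  it solves another such system, which says that the image in the jets is tangent to the fields of
  type (1,0) up to the translations in Re z (type_10_modulo_symmetries, edge_conjugate); here the Levi
  form is inverted. So the frame extends to two opposite wedges, and by the edge of the wedge it is
  real analytic (analytic_frame). It remains to transport the structure by this chart
  (regularizable_by_analytic_frame).\<close>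

section \<open>Higher derivatives\<close>

abbreviation FD :: "('a::real_normed_vector => 'b::real_normed_vector) => 'a => 'a => 'b" where
 "FD f x \<equiv> frechet_derivative f (at x)"

abbreviation "hdiff \<equiv> higher_differentiable_on"
abbreviation "rv \<equiv> of_real_vec"
abbreviation usum (binder "SU " 10) where "usum f \<equiv> sum f UNIV"
abbreviation bsum (binder "SB " 10) where "bsum f \<equiv> sum f Basis"
notation scaleR (infixr ".*" 75)

lemma FD_eq: "(f has_derivative f') (at x) ==> FD f x = f'"
 by (rule frechet_derivative_at[symmetric])

lemma FD_works: "f differentiable (at x) ==> (f has_derivative FD f x) (at x)"
 using frechet_derivative_works by blast

lemma FD_cong:
 assumes "open S" "x : S" "!!y. y : S ==> f y = g y"
 shows "FD f x = FD g x"
proof -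
 have "(f has_derivative D) (at x) \<longleftrightarrow> (g has_derivative D) (at x)" for D
  using assms by (metis (no_types, lifting) has_derivative_transform_within_open)
 thus ?thesis unfolding frechet_derivative_def by simp
qed

lemma differentiable_cong_open:
 assumes "open S" "x : S" "!!y. y : S ==> f y = g y"
 shows "f differentiable (at x) \<longleftrightarrow> g differentiable (at x)"
 using assms unfolding differentiable_def
 by (metis (no_types, lifting) has_derivative_transform_within_open)

lemma hdiff_cong:
 assumes "open S" "!!y. y : S ==> f y = g y"
 shows "hdiff k S f \<longleftrightarrow> hdiff k S g"
 using assms(2)
proof (induction k arbitrary: f g)
 case 0 thus ?case by (auto cong: continuous_on_cong)
next
 case (Suc k)
 have 1: "FD f y = FD g y" if "y : S" for y
  using FD_cong[OF assms(1) that] Suc.prems by blast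
 have 2: "f differentiable (at x) \<longleftrightarrow> g differentiable (at x)" if "x : S" for x
  using differentiable_cong_open[OF assms(1) that] Suc.prems by blast
 have 3: "hdiff k S (%x. FD f x v) = hdiff k S (%x. FD g x v)" for v
  by (rule Suc.IH) (simp add: 1)
 show ?case using 2 3 by simp
qed

lemma hdiff_subset:
 "hdiff k S f ==> T <= S ==> hdiff k T f"
 by (induction k arbitrary: f) (auto intro: continuous_on_subset)

lemma hdiff_Suc_cont:
 "hdiff (Suc k) S f ==> continuous_on S f"
 by (auto simp: continuous_on_eq_continuous_at intro!: continuous_at_imp_continuous_on differentiable_imp_continuous_within)

lemma hdiff_SucD:
 "hdiff (Suc k) S f ==> hdiff k S f"
proof (induction k arbitrary: f)
 case 0 thus ?case using hdiff_Suc_cont[of 0] by simp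
next
 case (Suc k) thus ?case by auto
qed

lemma hdiff_local:
 assumes "!!x. x : S ==> EX W. open W & x : W & hdiff k W f"
 shows "hdiff k S f"
 using assms
proof (induction k arbitrary: f)
 case 0
 show ?case
 proof -
  have "continuous (at x) f" if "x : S" for x
   using 0[OF that] continuous_on_eq_continuous_at by force
  thus ?thesis by (simp add: continuous_at_imp_continuous_on)
 qed
next
 case (Suc k)
 have "f differentiable at x" if "x : S" for x using Suc.prems[OF that] by auto
 moreover have "hdiff k S (%x. FD f x v)" for v
  by (rule Suc.IH) (metis Suc.prems higher_differentiable_on.simps(2))
 ultimately show ?case by simp
qed

lemma hdiff_const: "hdiff k S (%x. c)"
proof (induction k arbitrary: c)
 case 0 show ?case by (simp)
next
 case (Suc k) show ?case using Suc by (simp add: frechet_derivative_const)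
qed

lemma hdiff_linear:
 assumes "bounded_linear f" shows "hdiff k S f"
proof (cases k)
 case 0 thus ?thesis using assms by (simp add: linear_continuous_on)
next
 case (Suc j)
 have "(f has_derivative f) (at x)" for x
  by (rule bounded_linear_imp_has_derivative[OF assms])
 hence "FD f x = f" "f differentiable (at x)" for x by (auto simp: FD_eq differentiable_def)
 thus ?thesis by (simp add: Suc hdiff_const)
qed

lemma FD_add: "f differentiable (at x) ==> g differentiable (at x) ==>
 FD (%x. f x + g x) x v = FD f x v + FD g x v"
 using FD_eq[OF has_derivative_add[OF FD_works FD_works]] by metis

lemma hdiff_add:
 assumes "open S"
 shows "hdiff k S f ==> hdiff k S g ==>
 hdiff k S (%x. f x + g x)"
proof (induction k arbitrary: f g)
 case 0 thus ?case by (simp add: continuous_on_add)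
next
 case (Suc k)
 have "hdiff k S (%x. FD (%x. f x + g x) x v)" for v
  apply (subst hdiff_cong[OF assms, where g="%x. FD f x v + FD g x v"])
  using Suc by (auto simp: FD_add)
 thus ?case using Suc by auto
qed

lemma (in bounded_bilinear) FD_bilinear:
 "f differentiable (at x) ==> g differentiable (at x) ==>
 FD (%x. prod (f x) (g x)) x v = prod (f x) (FD g x v) + prod (FD f x v) (g x)"
 using FD_eq[OF FDERIV[OF FD_works FD_works]] by metis

lemma (in bounded_bilinear) hdiff_bilinear:
 assumes "open S"
 shows "hdiff k S f ==> hdiff k S g ==>
 hdiff k S (%x. prod (f x) (g x))"
proof (induction k arbitrary: f g)
 case 0 thus ?case by (simp add: continuous_on)
next
 case (Suc k)
 have fg: "hdiff k S f" "hdiff k S g"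
  using Suc.prems hdiff_SucD by blast+
 have "hdiff k S (%x. FD (%x. prod (f x) (g x)) x v)" for v
  apply (subst hdiff_cong[OF assms, where g="%x. prod (f x) (FD g x v) + prod (FD f x v) (g x)"])
  using Suc.prems by (auto simp: FD_bilinear intro!: hdiff_add[OF assms] Suc.IH fg)
 moreover have "(%x. prod (f x) (g x)) differentiable at x" if "x : S" for x
  using FDERIV[OF FD_works FD_works, of f x g] Suc.prems that unfolding differentiable_def[of "%x. prod (f x) (g x)"] by auto
 ultimately show ?case by simp
qed

lemma hdiff_sum:
 assumes "open S"
 shows "(!!i. i : I ==> hdiff k S (f i)) ==>
 hdiff k S (%x. \<Sum>i\<in>I. f i x)"
 by (induction I rule: infinite_finite_induct)
  (auto simp: hdiff_const intro!: hdiff_add[OF assms])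

lemma FD_compose:
 "f differentiable (at x) ==> g differentiable (at (f x)) ==>
 FD (%x. g (f x)) x v = FD g (f x) (FD f x v)"
 using FD_eq[OF has_derivative_compose[OF FD_works FD_works]] by metis

lemma FD_linear: "f differentiable (at x) ==> bounded_linear (FD f x)"
 using FD_works has_derivative_bounded_linear by blast

lemma FD_basis_expand:
 fixes g :: "'a::euclidean_space => 'b::real_normed_vector"
 assumes "g differentiable (at x)"
 shows "FD g x v = (SB i. (v \<bullet> i) .* FD g x i)"
proof -
 interpret bounded_linear "FD g x" using FD_linear[OF assms] .
 have "FD g x v = FD g x (SB i. (v \<bullet> i) .* i)" by (simp add: euclidean_representation)
 also have "... = (SB i. (v \<bullet> i) .* FD g x i)" by (simp add: sum scaleR)
 finally show ?thesis .
qed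

lemma hdiff_compose:
 fixes f :: "'a::real_normed_vector => 'b::euclidean_space" and g :: "'b => 'c::real_normed_vector"
 assumes "open S" "open T" "!!x. x : S ==> f x : T"
 shows "hdiff k S f ==> hdiff k T g ==>
 hdiff k S (%x. g (f x))"
proof (induction k arbitrary: g)
 case 0 thus ?case using assms(3) by (auto intro: continuous_on_compose2[of T g])
next
 case (Suc k)
 have fk: "hdiff k S f" using Suc.prems hdiff_SucD by blast
 have df: "f differentiable at x" "g differentiable at (f x)" if "x : S" for x
  using Suc.prems that assms(3) by auto
 have eq: "FD (%x. g (f x)) x v = (SB i. (FD f x v \<bullet> i) .* FD g (f x) i)" if "x : S" for x v
  using FD_compose[OF df[OF that]] FD_basis_expand[OF df(2)[OF that]] by metis
 have 1: "hdiff k S (%x. FD g (f x) i)" for i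
  by (rule Suc.IH) (use Suc.prems fk in auto)
 have 2: "hdiff k S (%x. (FD f x v \<bullet> i))" for i v
  by (rule bounded_bilinear.hdiff_bilinear[OF bounded_bilinear_inner assms(1)])
   (use Suc.prems in \<open>auto simp: hdiff_const\<close>)
 have "hdiff k S (%x. FD (%x. g (f x)) x v)" for v
  apply (subst hdiff_cong[OF assms(1) eq], assumption)
  apply (rule hdiff_sum[OF assms(1)])
  apply (rule bounded_bilinear.hdiff_bilinear[OF bounded_bilinear_scaleR assms(1)])
  using 1 2 by auto
 moreover have "(%x. g (f x)) differentiable at x" if "x : S" for x
  using has_derivative_compose[OF FD_works FD_works, OF df[OF that]] by (auto simp: differentiable_def)
 ultimately show ?case by simp
qed

section \<open>Smooth maps\<close>

named_theorems smooths

lemma smooth_on_cong: "open S ==> (!!y. y : S ==> f y = g y) ==> smooth_on S f \<longleftrightarrow> smooth_on S g"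
 unfolding smooth_on_def using hdiff_cong by blast

lemma smooth_on_subset: "smooth_on S f ==> T <= S ==> smooth_on T f"
 unfolding smooth_on_def using hdiff_subset by blast

lemma smooth_cont: "smooth_on S f ==> continuous_on S f"
 unfolding smooth_on_def by (metis higher_differentiable_on.simps(1))

lemma smooth_diff: "smooth_on S f ==> x : S ==> f differentiable (at x)"
 unfolding smooth_on_def by (metis higher_differentiable_on.simps(2))

lemma smooth_on_FD: "smooth_on S f ==> smooth_on S (%x. FD f x v)"
 unfolding smooth_on_def by (metis higher_differentiable_on.simps(2))

lemma smooth_on_has_derivative: "smooth_on S f ==> x : S ==> (f has_derivative FD f x) (at x)"
 by (simp add: FD_works smooth_diff)

lemma smooth_on_const [smooths]: "smooth_on S (%x. c)"
 by (simp add: smooth_on_def hdiff_const)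

lemma smooth_on_linear: "bounded_linear f ==> smooth_on S f"
 by (simp add: smooth_on_def hdiff_linear)

lemma smooth_on_id [smooths]: "smooth_on S (%x. x)"
 by (rule smooth_on_linear) (rule bounded_linear_ident)

lemma smooth_on_add [smooths]:
 "open S ==> smooth_on S f ==> smooth_on S g ==> smooth_on S (%x. f x + g x)"
 by (simp add: smooth_on_def hdiff_add)

lemma smooth_on_bilinear:
 "bounded_bilinear P ==> open S ==> smooth_on S f ==> smooth_on S g ==> smooth_on S (%x. P (f x) (g x))"
 by (simp add: smooth_on_def bounded_bilinear.hdiff_bilinear)

lemma smooth_on_mult [smooths]:
 fixes f g :: "_ => 'b::real_normed_algebra"
 shows "open S ==> smooth_on S f ==> smooth_on S g ==> smooth_on S (%x. f x * g x)"
 by (rule smooth_on_bilinear[OF bounded_bilinear_mult])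

lemma smooth_on_scaleR [smooths]:
 shows "open S ==> smooth_on S f ==> smooth_on S g ==> smooth_on S (%x. f x .* g x)"
 by (rule smooth_on_bilinear[OF bounded_bilinear_scaleR])

lemma smooth_on_sum [smooths]:
 "open S ==> (!!i. i : I ==> smooth_on S (f i)) ==> smooth_on S (%x. \<Sum>i\<in>I. f i x)"
 by (simp add: smooth_on_def hdiff_sum)

lemma smooth_on_compose:
 fixes f :: "'a::real_normed_vector => 'b::euclidean_space" and g :: "'b => 'c::real_normed_vector"
 shows "smooth_on T g ==> smooth_on S f ==> open S ==> open T ==> (!!x. x : S ==> f x : T) ==>
 smooth_on S (%x. g (f x))"
 by (simp add: smooth_on_def hdiff_compose)

lemma smooth_linear_compose:
 assumes "bounded_linear l" "smooth_on S f" "open S"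
 shows "smooth_on S (%x. l (f x))"
proof -
 have "hdiff k S (%x. l (f x))" if "hdiff k S f" for k
  using that
 proof (induction k arbitrary: f)
  case 0 thus ?case
   by (auto intro: continuous_on_compose2[OF linear_continuous_on[OF assms(1), of UNIV]])
 next
  case (Suc k)
  have d: "((%x. l (f x)) has_derivative (%v. l (FD f x v))) (at x)" if "x : S" for x
   using bounded_linear.has_derivative[OF assms(1) FD_works] Suc.prems that by auto
  have "hdiff k S (%x. FD (%x. l (f x)) x v)" for v
   apply (subst hdiff_cong[OF assms(3), where g="%x. l (FD f x v)"])
   using FD_eq[OF d] Suc by auto
  thus ?case using d by (auto simp: differentiable_def)
 qed
 thus ?thesis using assms(2) by (simp add: smooth_on_def)
qed

lemma smooth_on_minus [smooths]: "smooth_on S f ==> open S ==> smooth_on S (%x. - f x)"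
 by (rule smooth_linear_compose[OF bounded_linear_minus[OF bounded_linear_ident]])

lemma smooth_on_diff [smooths]:
 "open S ==> smooth_on S f ==> smooth_on S g ==> smooth_on S (%x. f x - g x)"
 using smooth_on_add[of S f "%x. - g x"] smooth_on_minus[of S g] by simp

lemma smooth_on_prod [smooths]:
 fixes f :: "_ => _ => 'b::real_normed_field"
 shows "open S ==> (!!i. i : I ==> smooth_on S (f i)) ==> smooth_on S (%x. \<Prod>i\<in>I. f i x)"
 by (induction I rule: infinite_finite_induct) (auto intro!: smooths)

lemma smooth_on_power [smooths]:
 fixes f :: "_ => 'b::real_normed_field"
 shows "open S ==> smooth_on S f ==> smooth_on S (%x. f x ^ n)"
 by (induction n) (auto intro!: smooths)

lemmas smooth_on_of_real [smooths] = smooth_linear_compose[OF bounded_linear_of_real]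
lemmas smooth_on_cnj [smooths] = smooth_linear_compose[OF bounded_linear_cnj]
lemmas smooth_on_Re [smooths] = smooth_linear_compose[OF bounded_linear_Re]
lemmas smooth_on_Im [smooths] = smooth_linear_compose[OF bounded_linear_Im]
lemmas smooth_on_fst [smooths] = smooth_linear_compose[OF bounded_linear_fst]
lemmas smooth_on_snd [smooths] = smooth_linear_compose[OF bounded_linear_snd]
lemmas smooth_on_vec_nth [smooths] = smooth_linear_compose[OF bounded_linear_vec_nth]

lemma smooth_on_Pair [smooths]:
 assumes "open S" "smooth_on S f" "smooth_on S g" shows "smooth_on S (%x. (f x, g x))"
proof -
 have 1: "bounded_linear (%x. (x, 0))" "bounded_linear (%x. (0, x))"
  by (auto intro!: bounded_linear_intros)
 show ?thesis
  using smooth_on_add[OF assms(1) smooth_linear_compose[OF 1(1) assms(2,1)] smooth_linear_compose[OF 1(2) assms(3,1)]] by simp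
qed

lemma norm_axis_le: "norm (axis i (x::'a::real_normed_vector) :: 'a^'n::finite) <= norm x"
proof -
 have "norm (axis i x :: 'a^'n) = L2_set (%j. if j = i then norm x else 0) UNIV"
  unfolding norm_vec_def axis_def by (rule L2_set_cong) auto
 also have "... <= (SU j. \<bar>if j = i then norm x else 0\<bar>)" by (rule L2_set_le_sum_abs)
 also have "... = norm x" by (simp add: if_distrib cong: if_cong)
 finally show ?thesis .
qed

lemma bounded_linear_axis: "bounded_linear (%x::'a::real_normed_vector. axis i x :: 'a^'n)"
proof (rule bounded_linear_intro[where K=1])
 show "axis i (x + y) = axis i x + (axis i y :: 'a^'n)" for x y by (simp add: vec_eq_iff axis_def)
 show "axis i (r .* x) = r .* (axis i x :: 'a^'n)" for r x by (simp add: vec_eq_iff axis_def)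
 show "norm (axis i x :: 'a^'n) <= norm x * 1" for x by (simp add: norm_axis_le)
qed

lemma vec_lambda_axis: "(\<chi> i. f i) = (SU i. axis i (f i :: 'a::comm_monoid_add) :: 'a^'n::finite)"
proof -
 have "(SU i. axis i (f i) :: 'a^'n) $ j = f j" for j
 proof -
  have "(SU i. axis i (f i) :: 'a^'n) $ j = (SU i. if i = j then f i else 0)"
   unfolding sum_component axis_def by (rule sum.cong) auto
  thus ?thesis by simp
 qed
 thus ?thesis by (simp add: vec_eq_iff)
qed

lemma smooth_on_vec_lambda [smooths]:
 fixes f :: "'i::finite => 'a::real_normed_vector => 'b::real_normed_vector"
 assumes "open S" "!!i. smooth_on S (f i)" shows "smooth_on S (%x. \<chi> i. f i x)"
 unfolding vec_lambda_axis
 by (intro smooth_on_sum assms smooth_linear_compose[OF bounded_linear_axis])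

lemma FD_vec_nth: "f differentiable (at x) ==> FD (%x. f x $ i) x v = FD f x v $ i"
 using FD_eq[OF bounded_linear.has_derivative[OF bounded_linear_vec_nth FD_works]] by metis

lemma smooth_on_inverse [smooths]:
 fixes f :: "'a::real_normed_vector => 'b::real_normed_field"
 assumes "open S" "smooth_on S f" "!!x. x : S ==> f x ~= 0"
 shows "smooth_on S (%x. inverse (f x))"
proof -
 have "hdiff k S (%x. inverse (f x))" for k
 proof (induction k)
  case 0 show ?case using assms smooth_cont by (auto intro!: continuous_on_inverse)
 next
  case (Suc k)
  have d: "((%x. inverse (f x)) has_derivative (%h. - (inverse (f x) * FD f x h * inverse (f x)))) (at x)" if "x : S" for x
   using Deriv.has_derivative_inverse[OF assms(3)[OF that] smooth_on_has_derivative[OF assms(2) that]] by simp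
  have "hdiff k S (%x. FD (%x. inverse (f x)) x v)" for v
   apply (subst hdiff_cong[OF assms(1), where g="%x. (- 1) * (inverse (f x) * FD f x v * inverse (f x))"])
   apply (simp add: FD_eq[OF d])
   using Suc smooth_on_FD[OF assms(2)]
   by (intro bounded_bilinear.hdiff_bilinear[OF bounded_bilinear_mult assms(1)] hdiff_const)
    (auto simp: smooth_on_def)
  thus ?case using d by (auto simp: differentiable_def)
 qed
 thus ?thesis by (simp add: smooth_on_def)
qed

lemma smooth_on_divide [smooths]:
 fixes f :: "'a::real_normed_vector => 'b::real_normed_field"
 assumes "open S" "smooth_on S f" "smooth_on S g" "!!x. x : S ==> g x ~= 0"
 shows "smooth_on S (%x. f x / g x)"
 unfolding divide_inverse by (intro smooths assms)

lemma smooth_on_exp_real: "smooth_on (S::real set) exp"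
proof -
 have "hdiff k S (%x::real. c * exp x)" for k c
 proof (induction k arbitrary: c)
  case 0 show ?case by (auto intro!: continuous_intros)
 next
  case (Suc k)
  have d: "((%x::real. c * exp x) has_derivative (%h. (c * h) * exp x)) (at x)" for x
   by (auto intro!: derivative_eq_intros)
  show ?case using Suc d by (auto simp: FD_eq[OF d] differentiable_def)
 qed
 from this[of _ 1] show ?thesis by (simp add: smooth_on_def)
qed

lemma smooth_on_ln_real: "smooth_on {0::real<..} ln"
proof -
 have d: "(ln has_derivative (%h. h * inverse x)) (at x)" if "x > 0" for x::real
  using DERIV_ln[OF that] by (simp add: has_field_derivative_def mult_commute_abs)
 have "hdiff k {0<..} (%x. FD ln x v)" for k and v::real
  apply (subst hdiff_cong[where g="%x. v * inverse x"])
  using smooth_on_mult[OF _ smooth_on_const smooth_on_inverse[OF _ smooth_on_id], of "{0::real<..}" v]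
  by (auto simp: FD_eq[OF d] smooth_on_def)
 hence "hdiff (Suc k) {0::real<..} ln" for k
  using d by (auto simp: differentiable_def)
 thus ?thesis unfolding smooth_on_def using hdiff_SucD by blast
qed

section \<open>Symmetry of second derivatives\<close>

text \<open>Two applications of the mean value theorem. Since the left-hand side is symmetric in u and v, the mixed
  derivatives agree in the limit of small h.\<close>

lemma second_difference_quotient:
 fixes F :: "'a::real_normed_vector => real"
 assumes S: "ball x dl <= S" "open S" and F: "smooth_on S F"
  and h: "0 < h" "h * (norm u + norm v) < dl"
 shows "EX p. norm (p - x) <= h * (norm u + norm v) &
  F (x + h .* u + h .* v) - F (x + h .* u) - F (x + h .* v) + F x =
   h\<^sup>2 * FD (%y. FD F y u) p v"
proof -
 have inS: "x + s .* u + t .* v : S" if "0 <= s" "s <= h" "0 <= t" "t <= h" for s t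
 proof -
  have "norm (s .* u + t .* v) <= s * norm u + t * norm v"
   using that by (metis abs_of_nonneg norm_scaleR norm_triangle_ineq)
  also have "... <= h * (norm u + norm v)"
   using that by (simp add: distrib_left add_mono mult_right_mono)
  finally have "norm (s .* u + t .* v) < dl" using h by simp
  thus ?thesis using S(1) by (intro subsetD[OF S(1)]) (metis (no_types, lifting) add.assoc add_diff_cancel_left' dist_commute dist_norm mem_ball)
 qed
 define Fu where "Fu = (%y. FD F y u)"
 have dF: "(F has_derivative FD F y) (at y)" "(Fu has_derivative FD Fu y) (at y)" if "y : S" for y
  using smooth_on_has_derivative[OF F that] smooth_on_has_derivative[OF smooth_on_FD[OF F] that] by (auto simp: Fu_def)
 have lin: "linear (FD F y)" "linear (FD Fu y)" if "y : S" for y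
  using dF[OF that] has_derivative_linear by blast+
 define ph where "ph = (%s. F (x + s .* u + h .* v) - F (x + s .* u))"
 have "(ph has_real_derivative (Fu (x + s .* u + h .* v) - Fu (x + s .* u))) (at s)" if "0 <= s" "s <= h" for s
 proof -
  have 1: "((%s. F (x + s .* u + c .* v)) has_derivative (%r. FD F (x + s .* u + c .* v) (r .* u))) (at s)"
   if "0 <= c" "c <= h" for c
   by (rule has_derivative_compose[OF _ dF(1)]) (auto intro!: derivative_eq_intros inS that \<open>0<=s\<close> \<open>s<=h\<close>)
  have 2: "((%s. F (x + s .* u + c .* v)) has_real_derivative (Fu (x + s .* u + c .* v))) (at s)"
   if "0 <= c" "c <= h" for c
   using 1[OF that] lin(1)[OF inS[OF \<open>0<=s\<close> \<open>s<=h\<close> that]]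
   by (simp add: has_field_derivative_def Fu_def linear_cmul mult_commute_abs)
  show ?thesis using DERIV_diff[OF 2[of h] 2[of 0]] h by (simp add: ph_def)
 qed
 then obtain s where s: "0 < s" "s < h" "ph h - ph 0 = h * (Fu (x + s .* u + h .* v) - Fu (x + s .* u))"
  using MVT2[OF h(1), of ph "%s. Fu (x + s .* u + h .* v) - Fu (x + s .* u)"] by auto
 define ps where "ps = (%t. Fu (x + s .* u + t .* v))"
 have "(ps has_real_derivative (FD Fu (x + s .* u + t .* v) v)) (at t)" if "0 <= t" "t <= h" for t
 proof -
  have 1: "(ps has_derivative (%r. FD Fu (x + s .* u + t .* v) (r .* v))) (at t)"
   unfolding ps_def using s
   by (intro has_derivative_compose[OF _ dF(2)]) (auto intro!: derivative_eq_intros inS that)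
  show ?thesis
   using 1 lin(2)[OF inS[of s t]] s that by (simp add: has_field_derivative_def linear_cmul mult_commute_abs)
 qed
 then obtain t where t: "0 < t" "t < h" "ps h - ps 0 = h * FD Fu (x + s .* u + t .* v) v"
  using MVT2[OF h(1), of ps "%t. FD Fu (x + s .* u + t .* v) v"] by auto
 have "norm (s .* u + t .* v) <= s * norm u + t * norm v"
  using s t by (metis abs_of_nonneg less_imp_le norm_scaleR norm_triangle_ineq)
 also have "... <= h * (norm u + norm v)"
  using s t by (simp add: distrib_left add_mono mult_right_mono)
 finally have "norm ((x + s .* u + t .* v) - x) <= h * (norm u + norm v)" by (simp add: algebra_simps)
 moreover have "F (x + h .* u + h .* v) - F (x + h .* u) - F (x + h .* v) + F x = ph h - ph 0"
  by (simp add: ph_def)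
 moreover have "ph h - ph 0 = h\<^sup>2 * FD Fu (x + s .* u + t .* v) v"
  using s(3) t(3) by (simp add: ps_def power2_eq_square)
 ultimately show ?thesis unfolding Fu_def by metis
qed

lemma second_sym_real:
 fixes F :: "'a::real_normed_vector => real"
 assumes "open S" and F: "smooth_on S F" and x: "x : S"
 shows "FD (%y. FD F y u) x v = FD (%y. FD F y v) x u"
proof (rule ccontr)
 define a where "a = (%p. FD (%y. FD F y u) p v)"
 define b where "b = (%p. FD (%y. FD F y v) p u)"
 assume "\<not> ?thesis"
 hence e: "\<bar>a x - b x\<bar> / 2 > 0" by (simp add: a_def b_def)
 have "continuous_on S a" "continuous_on S b"
  unfolding a_def b_def by (intro smooth_cont smooth_on_FD F)+
 hence "isCont a x" "isCont b x" using assms continuous_on_eq_continuous_at by blast+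
 with e obtain d1 d2 where d: "d1 > 0" "d2 > 0"
  "!!p. dist p x < d1 ==> dist (a p) (a x) < \<bar>a x - b x\<bar> / 2"
  "!!p. dist p x < d2 ==> dist (b p) (b x) < \<bar>a x - b x\<bar> / 2"
  unfolding continuous_at_eps_delta by metis
 obtain d3 where d3: "d3 > 0" "ball x d3 <= S" using assms open_contains_ball by blast
 define dl where "dl = min d1 (min d2 d3)"
 have dl: "dl > 0" "ball x dl <= S" using d d3 by (auto simp: dl_def)
 define h where "h = dl / (2 * (norm u + norm v + 1))"
 have pos: "norm u + norm v + 1 > 0" by (simp add: add_nonneg_pos)
 have h0: "h > 0" using dl pos by (simp add: h_def)
 have "h * (norm u + norm v) <= h * (norm u + norm v + 1)" using h0 by simp
 also have "... = dl / 2" using pos unfolding h_def by (simp add: field_simps)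
 finally have hs: "h * (norm u + norm v) < dl" using dl by simp
 obtain p where p: "norm (p - x) <= h * (norm u + norm v)"
  "F (x + h .* u + h .* v) - F (x + h .* u) - F (x + h .* v) + F x = h\<^sup>2 * a p"
  using second_difference_quotient[OF dl(2) assms(1) F h0 hs] unfolding a_def by blast
 obtain q where q: "norm (q - x) <= h * (norm u + norm v)"
  "F (x + h .* v + h .* u) - F (x + h .* v) - F (x + h .* u) + F x = h\<^sup>2 * b q"
  using second_difference_quotient[OF dl(2) assms(1) F h0, of v u] hs unfolding b_def by (auto simp: add.commute)
 have "h\<^sup>2 * a p = h\<^sup>2 * b q" using p(2) q(2) by (simp add: algebra_simps)
 hence "a p = b q" using h0 by simp
 moreover have "dist (a p) (a x) < \<bar>a x - b x\<bar> / 2" "dist (b q) (b x) < \<bar>a x - b x\<bar> / 2"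
  using d p q hs by (auto simp: dl_def dist_norm)
 ultimately show False by (simp add: dist_real_def abs_if split: if_splits)
qed

lemma FD_Re: "f differentiable (at x) ==> FD (%x. Re (f x)) x v = Re (FD f x v)"
 using FD_eq[OF bounded_linear.has_derivative[OF bounded_linear_Re FD_works]] by metis

lemma FD_Im: "f differentiable (at x) ==> FD (%x. Im (f x)) x v = Im (FD f x v)"
 using FD_eq[OF bounded_linear.has_derivative[OF bounded_linear_Im FD_works]] by metis

lemma second_sym:
 fixes f :: "'a::real_normed_vector => complex"
 assumes S: "open S" and f: "smooth_on S f" and x: "x : S"
 shows "FD (%y. FD f y u) x v = FD (%y. FD f y v) x u"
proof (rule complex_eqI)
 have *: "FD (%y. Re (FD f y a)) x b = FD (%y. FD (%y. Re (f y)) y a) x b"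
  "FD (%y. Im (FD f y a)) x b = FD (%y. FD (%y. Im (f y)) y a) x b" for a b
  using FD_Re[of f] FD_Im[of f] smooth_diff[OF f]
  by (auto intro!: fun_cong[OF FD_cong[OF S x]])
 have d: "(%y. FD f y a) differentiable at x" for a
  using smooth_diff[OF smooth_on_FD[OF f] x] .
 show "Re (FD (%y. FD f y u) x v) = Re (FD (%y. FD f y v) x u)"
  unfolding FD_Re[OF d, symmetric] * by (rule second_sym_real[OF S smooth_on_Re[OF f S] x])
 show "Im (FD (%y. FD f y u) x v) = Im (FD (%y. FD f y v) x u)"
  unfolding FD_Im[OF d, symmetric] * by (rule second_sym_real[OF S smooth_on_Im[OF f S] x])
qed

section \<open>Radial integral equations\<close>

lemma geometric_limit:
 fixes x :: "nat => 'a => 'b::banach"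
 assumes q: "0 <= q" "q < 1" and le: "!!n y. y : B ==> norm (x (Suc n) y - x n y) <= C * q ^ n"
 shows "EX l. ALL y:B. ALL n. norm (x n y - l y) <= C * q ^ n / (1 - q)"
proof -
 have "EX l. ALL n. norm (x n y - l) <= C * q ^ n / (1 - q)" if y: "y : B" for y
 proof -
  have sm: "summable (%n. x (Suc n) y - x n y)"
   by (rule summable_comparison_test'[OF summable_mult[OF summable_geometric]]) (use q le[OF y] in auto)
  have sumd: "(\<Sum>i<k. x (Suc (i + n)) y - x (i + n) y) = x (k + n) y - x n y" for k n
   by (induction k) auto
  define l where "l = x 0 y + (\<Sum>n. x (Suc n) y - x n y)"
  have "norm (x n y - l) <= C * q ^ n / (1 - q)" for n
  proof -
   have s1: "summable (%i. x (Suc (i + n)) y - x (i + n) y)"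
    using sm summable_iff_shift[of "%n. x (Suc n) y - x n y" n] by simp
   have "(\<Sum>i. x (Suc i) y - x i y) = (\<Sum>i. x (Suc (i + n)) y - x (i + n) y) + (\<Sum>i<n. x (Suc i) y - x i y)"
    using suminf_split_initial_segment[OF sm, of n] by simp
   hence "l - x n y = (\<Sum>i. x (Suc (i + n)) y - x (i + n) y)"
    using sum_lessThan_telescope[of "%n. x n y" n] by (simp add: l_def)
   moreover have "norm (\<Sum>i. x (Suc (i + n)) y - x (i + n) y) <= (\<Sum>i. C * q ^ n * q ^ i)"
   proof (rule norm_suminf_le)
    show "norm (x (Suc (i + n)) y - x (i + n) y) <= C * q ^ n * q ^ i" for i
     using le[OF y, of "i + n"] by (simp add: power_add algebra_simps)
    show "summable (%i. C * q ^ n * q ^ i)"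
     using q by (intro summable_mult summable_geometric) auto
   qed
   moreover have "(\<Sum>i. C * q ^ n * q ^ i) = C * q ^ n / (1 - q)"
    using q by (subst suminf_mult) (auto simp: suminf_geometric intro!: summable_geometric)
   ultimately show ?thesis by (simp add: norm_minus_commute)
  qed
  thus ?thesis by blast
 qed
 thus ?thesis by (intro bchoice ballI)
qed

lemma norm_integral_unit_le:
 fixes f :: "real => 'a::banach"
 assumes "continuous_on {0..1} f" "!!t. t : {0..1} ==> norm (f t) <= c"
 shows "norm (integral {0..1} f) <= c"
 using integral_bound[OF _ assms] by simp

lemma uniform_limit_geometric:
 assumes "!!y n. y : S ==> norm (x n y - l y) <= C * q ^ n / (1 - q)" "0 <= q" "q < (1::real)"
 shows "uniform_limit S x l sequentially"
proof (rule uniform_limitI)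
 fix e :: real assume e: "e > 0"
 have "(%n. C * q ^ n / (1 - q)) \<longlonglongrightarrow> C * 0 / (1 - q)"
  by (intro tendsto_intros) (use assms in auto)
 hence "\<forall>\<^sub>F n in sequentially. C * q ^ n / (1 - q) < e" using e order_tendstoD(2) by fastforce
 thus "\<forall>\<^sub>F n in sequentially. ALL y:S. dist (x n y) (l y) < e"
  by eventually_elim (use assms in \<open>auto simp: dist_norm intro: le_less_trans\<close>)
qed

definition FDL :: "('a::euclidean_space => 'b::real_normed_vector) => 'a => 'a \<Rightarrow>\<^sub>L 'b" where
 "FDL f x = Blinfun (FD f x)"

lemma FDL_apply: "f differentiable (at x) ==> blinfun_apply (FDL f x) v = FD f x v"
 by (simp add: FDL_def bounded_linear_Blinfun_apply FD_linear)

lemma FDL_has_derivative: "f differentiable (at x) ==> (f has_derivative blinfun_apply (FDL f x)) (at x)"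
 using FD_works by (simp add: FDL_def bounded_linear_Blinfun_apply FD_linear)

lemma blinfun_expand:
 fixes A :: "'a::euclidean_space \<Rightarrow>\<^sub>L 'b::real_normed_vector"
 shows "A = (SB i. blinfun_scaleR_left (A i) o\<^sub>L blinfun_inner_right i)"
proof (rule blinfun_eqI)
 fix v
 have "blinfun_apply A v = blinfun_apply A (SB i. (v \<bullet> i) .* i)" by (simp add: euclidean_representation)
 also have "... = (SB i. (v \<bullet> i) .* A i)" by (simp add: blinfun.bilinear_simps)
 finally show "blinfun_apply A v = blinfun_apply (SB i. blinfun_scaleR_left (A i) o\<^sub>L blinfun_inner_right i) v"
  by (simp add: blinfun.sum_left inner_commute)
qed

lemma hdiff_linear_compose:
 assumes "bounded_linear l" "open S" "hdiff k S f"
 shows "hdiff k S (%x. l (f x))"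
 using assms(3)
proof (induction k arbitrary: f)
 case 0 thus ?case
  by (auto intro: continuous_on_compose2[OF linear_continuous_on[OF assms(1), of UNIV]])
next
 case (Suc k)
 have d: "((%x. l (f x)) has_derivative (%v. l (FD f x v))) (at x)" if "x : S" for x
  using bounded_linear.has_derivative[OF assms(1) FD_works] Suc.prems that by auto
 have "hdiff k S (%x. FD (%x. l (f x)) x v)" for v
  apply (subst hdiff_cong[OF assms(2), where g="%x. l (FD f x v)"])
  using FD_eq[OF d] Suc by auto
 thus ?case using d by (auto simp: differentiable_def)
qed

lemma hdiff_blinfun:
 fixes A :: "'x::real_normed_vector => 'a::euclidean_space \<Rightarrow>\<^sub>L 'b::real_normed_vector"
 assumes S: "open S" and A: "!!i. i : Basis ==> hdiff k S (%x. A x i)"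
 shows "hdiff k S A"
proof -
 have "hdiff k S (%x. SB i. blinfun_scaleR_left (A x i) o\<^sub>L blinfun_inner_right i)"
  by (intro hdiff_sum[OF S] bounded_bilinear.hdiff_bilinear[OF bounded_bilinear_blinfun_compose S]
    hdiff_const hdiff_linear_compose[OF bounded_linear_blinfun_scaleR_left S] A)
 thus ?thesis using blinfun_expand by (metis (no_types, lifting) ext)
qed

lemma higher_differentiable_on_FDL:
 assumes "open S" "hdiff (Suc k) S f"
 shows "hdiff k S (FDL f)"
proof (rule hdiff_blinfun[OF assms(1)])
 fix i :: 'a
 show "hdiff k S (%x. FDL f x i)"
  by (subst hdiff_cong[OF assms(1), where g="%x. FD f x i"]) (use assms(2) in \<open>auto simp: FDL_apply\<close>)
qed

lemma smooth_on_FDL: "open S ==> smooth_on S f ==> smooth_on S (FDL f)"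
 unfolding smooth_on_def using higher_differentiable_on_FDL by blast

lemma hdiff_Suc_imp_1: "hdiff (Suc k) S f ==> hdiff 1 S f"
proof (induction k)
 case (Suc k) thus ?case using hdiff_SucD by blast
qed simp

text \<open>A function Ps with Ps y = Y0 + integral of G y (Ps (t y)) over t, where G y is linear in y, contains
  the solutions of all equations x' = G y x with x 0 = Y0, as the functions of t with values Ps (t y).
  Smooth dependence on y then is the smoothness of one function. The power of t is there because each
  derivative in y raises it by one.\<close>

definition radial :: "nat => ('p::euclidean_space => 'e::euclidean_space) => 'p => 'e" where
 "radial j g y = integral {0..1} (%t. t ^ j .* g (t .* y))"

lemma scale_ball: "t : {0..1} ==> y : ball 0 r ==> t .* y : ball (0::'p::real_normed_vector) r"
 by (simp add: mult_le_one) (metis abs_of_nonneg le_less_trans mult_left_le_one_le norm_ge_zero)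

lemma cont_scale_ball:
 fixes g :: "'p::real_normed_vector => 'e::topological_space"
 assumes "continuous_on (ball 0 r) g" shows "continuous_on (ball 0 r \<times> {0..1}) (%(y, t). g (t .* y))"
proof -
 have "continuous_on (ball 0 r \<times> {0..1}) (%p. g (snd p .* fst p))"
  by (rule continuous_on_compose2[OF assms]) (auto intro!: continuous_intros dest: scale_ball)
 thus ?thesis by (simp add: case_prod_unfold)
qed

lemma cont_ray:
 fixes y :: "'p::real_normed_vector"
 assumes "continuous_on (ball 0 r) g" "y : ball 0 r" shows "continuous_on {0..1} (%t. g (t .* y))"
proof (rule continuous_on_compose2[OF assms(1) _ image_subsetI])
 show "continuous_on {0..1} (%t. t .* y)" by (intro continuous_intros)
qed (rule scale_ball[OF _ assms(2)])

lemma radial_cong: "y : ball 0 r ==> (!!z. z : ball 0 r ==> f z = g z) ==> radial j f y = radial j g y"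
 unfolding radial_def by (rule integral_cong) (metis scale_ball)

lemma radial_cont:
 assumes "continuous_on (ball 0 r) g" shows "continuous_on (ball 0 r) (radial j g)"
proof -
 have "continuous_on (ball 0 r \<times> cbox 0 1) (%(y, t). t ^ j .* g (t .* y))"
  using cont_scale_ball[OF assms] by (auto simp: case_prod_unfold intro!: continuous_intros)
 from integral_continuous_on_param[OF this] show ?thesis by (simp add: radial_def)
qed

lemma norm_radial_le:
 assumes "continuous_on (ball 0 r) g" "y : ball 0 r" "!!t. t : {0..1} ==> norm (g (t .* y)) <= c"
 shows "norm (radial j g y) <= c"
 unfolding radial_def
proof (rule norm_integral_unit_le)
 show "continuous_on {0..1} (%t. t ^ j .* g (t .* y))" by (intro continuous_intros cont_ray[OF assms(1,2)])
 fix t :: real assume t: "t : {0..1}"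
 hence "\<bar>t ^ j\<bar> * norm (g (t .* y)) <= 1 * c" by (intro mult_mono assms(3)) (auto simp: power_le_one)
 thus "norm (t ^ j .* g (t .* y)) <= c" by simp
qed

lemma radial_has_integral:
 "continuous_on (ball 0 r) g ==> y : ball 0 r ==> ((%t. t ^ j .* g (t .* y)) has_integral radial j g y) {0..1}"
 unfolding radial_def by (intro integrable_integral integrable_continuous_real continuous_intros cont_ray)

lemma radial_diff:
 assumes "continuous_on (ball 0 r) f" "continuous_on (ball 0 r) g" "y : ball 0 r"
 shows "radial j f y - radial j g y = radial j (%z. f z - g z) y"
 using integral_unique[OF has_integral_diff[OF radial_has_integral[OF assms(1,3)] radial_has_integral[OF assms(2,3)]]]
 by (simp add: radial_def[of j "%z. f z - g z"] scaleR_diff_right)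

lemma radial_has_derivative:
 assumes C1: "hdiff (Suc 0) (ball 0 r) g" and y: "y : ball 0 r"
 shows "(radial j g has_derivative (%v. radial (Suc j) (%y. FD g y v) y)) (at y)"
proof -
 have cg: "continuous_on (ball 0 r) g" by (rule hdiff_Suc_cont[OF C1])
 have dg: "g differentiable at y" if "y : ball 0 r" for y using C1 that by simp
 have cL: "continuous_on (ball 0 r) (FDL g)" using higher_differentiable_on_FDL[OF open_ball C1] by simp
 define fx where "fx = (%y t. t ^ Suc j .* FDL g (t .* y))"
 have cfx: "continuous_on (ball 0 r \<times> cbox 0 1) (%(y, t). fx y t)"
  using cont_scale_ball[OF cL] unfolding fx_def by (auto simp: case_prod_unfold intro!: continuous_intros)
 have "((%y. integral (cbox 0 1) (%t. t ^ j .* g (t .* y))) has_derivative integral (cbox 0 1) (fx y)) (at y within ball 0 r)"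
 proof (rule leibniz_rule[where U="ball 0 r" and fx=fx])
  fix x :: 'a and t :: real assume x: "x : ball 0 r" and t: "t : cbox 0 1"
  have d: "(g has_derivative blinfun_apply (FDL g (t .* x))) (at (t .* x))"
   by (rule FDL_has_derivative, rule dg, rule scale_ball) (use x t in auto)
  have "((%x. g (t .* x)) has_derivative (%v. FDL g (t .* x) (t .* v))) (at x within ball 0 r)"
   by (rule has_derivative_compose[of "%x. t .* x" "%v. t .* v" x "ball 0 r" g "blinfun_apply (FDL g (t .* x))", OF _ d]) (auto intro!: derivative_eq_intros)
  from has_derivative_scaleR_right[OF this, of "t ^ j"]
  show "((%x. t ^ j .* g (t .* x)) has_derivative blinfun_apply (fx x t)) (at x within ball 0 r)"
   by (rule has_derivative_eq_rhs) (auto simp: fx_def blinfun.bilinear_simps fun_eq_iff)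
 next
  fix x :: 'a assume "x : ball 0 r"
  thus "(%t. t ^ j .* g (t .* x)) integrable_on cbox 0 1"
   using cont_ray[OF cg] by (auto intro!: integrable_continuous_real continuous_intros)
 qed (use cfx y in auto)
 hence 1: "(radial j g has_derivative integral {0..1} (fx y)) (at y)"
  using y by (simp add: radial_def[abs_def] at_within_open[OF _ open_ball])
 have i: "fx y integrable_on {0..1}"
  unfolding fx_def by (intro integrable_continuous_real continuous_intros cont_ray[OF cL y])
 have "blinfun_apply (integral {0..1} (fx y)) v = radial (Suc j) (%y. FD g y v) y" for v
 proof -
  have "blinfun_apply (integral {0..1} (fx y)) v = integral {0..1} (%t. blinfun_apply (fx y t) v)"
   using integral_linear[OF i, of "%A. blinfun_apply A v"] by (simp add: o_def blinfun.bounded_linear_left)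
  also have "... = radial (Suc j) (%y. FD g y v) y"
   unfolding radial_def fx_def using FDL_apply[OF dg[OF scale_ball[OF _ y]]]
   by (intro integral_cong) (auto simp: blinfun.bilinear_simps)
  finally show ?thesis .
 qed
 thus ?thesis using has_derivative_eq_rhs[OF 1] by (simp add: fun_eq_iff)
qed

lemma radial_higher:
 "hdiff k (ball 0 r) g ==> hdiff k (ball 0 r) (radial j g)"
proof (induction k arbitrary: j g)
 case 0 thus ?case using radial_cont by simp
next
 case (Suc k)
 have der: "(radial j g has_derivative (%v. radial (Suc j) (%y. FD g y v) y)) (at y)" if "y : ball 0 r" for y
  using radial_has_derivative[OF _ that] hdiff_Suc_imp_1[OF Suc.prems] by simp
 have "hdiff k (ball 0 r) (%y. FD (radial j g) y v)" for v
  apply (subst hdiff_cong[OF open_ball, where g="radial (Suc j) (%y. FD g y v)"])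
  using FD_eq[OF der] Suc by auto
 moreover have "radial j g differentiable at y" if "y : ball 0 r" for y
  using der[OF that] unfolding differentiable_def by blast
 ultimately show ?case by simp
qed

text \<open>Geometric convergence of the derivatives makes the limit continuously differentiable; with it the
  regularity of a fixed point is read off from the Picard iterates.\<close>

lemma C1_limit:
 fixes F :: "nat => 'p::euclidean_space => 'e::euclidean_space"
 assumes r: "r > 0" and q: "0 <= q" "q < 1" and C: "C >= 0"
  and F: "!!n. hdiff (Suc 0) (ball 0 r) (F n)"
  and sol: "!!n y. y : ball 0 r ==> norm (F n y - sol y) <= A * q ^ n"
  and D: "!!n y v. y : ball 0 r ==> norm (FD (F (Suc n)) y v - FD (F n) y v) <= C * q ^ n * norm v"
 shows "hdiff (Suc 0) (ball 0 r) sol"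
proof -
 let ?B = "ball (0::'p) r"
 have dF: "F n differentiable (at y)" if "y : ?B" for n y using F[of n] that by simp
 have "norm (FDL (F (Suc n)) y - FDL (F n) y) <= C * q ^ n" if "y : ?B" for n y
  by (rule norm_blinfun_bound) (use D[OF that, of n] C q in \<open>simp_all add: blinfun.bilinear_simps FDL_apply[OF dF[OF that]]\<close>)
 then obtain D' where D': "!!y n. y : ?B ==> norm (FDL (F n) y - D' y) <= C * q ^ n / (1 - q)"
  using geometric_limit[where B="?B" and x="%n. FDL (F n)" and C=C, OF q] by blast
 have uD: "uniform_limit ?B (%n. FDL (F n)) D' sequentially" by (rule uniform_limit_geometric[OF D' q])
 have "norm (F n y - sol y) <= A * (1 - q) * q ^ n / (1 - q)" if "y : ?B" for n y using sol[OF that] q by simp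
 hence uF: "uniform_limit ?B F sol sequentially" by (rule uniform_limit_geometric[OF _ q])
 have lF: "(%n. F n y) \<longlonglongrightarrow> sol y" if "y : ?B" for y by (rule tendsto_uniform_limitI[OF uF that])
 have cD: "continuous_on ?B D'"
  by (rule uniform_limit_theorem[OF _ uD]) (use higher_differentiable_on_FDL[OF open_ball F] in auto)
 have "EX g. ALL x:?B. (%n. F n x) \<longlonglongrightarrow> g x & (g has_derivative blinfun_apply (D' x)) (at x within ?B)"
 proof (rule has_derivative_sequence[where f'="%n x. blinfun_apply (FDL (F n) x)" and ?x0.0=0 and ?l="sol 0"])
  show "(F n has_derivative blinfun_apply (FDL (F n) x)) (at x within ?B)" if "x : ?B" for n x
   using FDL_has_derivative[OF dF[OF that]] has_derivative_at_withinI by blast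
  show "\<forall>\<^sub>F n in sequentially. ALL x:?B. ALL h. norm (FDL (F n) x h - D' x h) <= e * norm h" if "e > 0" for e
   using uniform_limitD[OF uD that]
  proof eventually_elim
   case (elim n)
   show ?case
   proof (intro ballI allI)
    fix x h assume "x : ?B"
    hence "norm (FDL (F n) x - D' x) <= e" using elim by (force simp: dist_norm)
    thus "norm (FDL (F n) x h - D' x h) <= e * norm h"
     using norm_blinfun[of "FDL (F n) x - D' x" h] by (simp add: blinfun.bilinear_simps) (metis mult_right_mono norm_ge_zero order_trans)
   qed
  qed
 qed (use r lF in auto)
 then obtain g where g: "!!x. x : ?B ==> (%n. F n x) \<longlonglongrightarrow> g x" "!!x. x : ?B ==> (g has_derivative blinfun_apply (D' x)) (at x within ?B)" by blast
 have "g x = sol x" if "x : ?B" for x using LIMSEQ_unique g(1) lF that by blast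
 hence der: "(sol has_derivative blinfun_apply (D' x)) (at x)" if "x : ?B" for x
  using g(2)[OF that] that has_derivative_transform_within_open[of g _ x UNIV ?B sol] by (simp add: at_within_open[OF _ open_ball])
 have "continuous_on ?B (%x. FD sol x v)" for v
 proof (subst continuous_on_cong[OF refl])
  show "FD sol x v = D' x v" if "x : ?B" for x by (simp add: FD_eq[OF der[OF that]])
 qed (intro continuous_intros cD)
 moreover have "sol differentiable (at x)" if "x : ?B" for x using der[OF that] differentiable_def by blast
 ultimately show ?thesis by simp
qed

lemma compact_bound:
 fixes f :: "'p::topological_space => 'b::real_normed_vector"
 assumes "continuous_on S f" "compact T" "T <= S"
 obtains C where "C >= 0" "!!y. y : T ==> norm (f y) <= C"
proof -
 have "compact (f ` T)" by (intro compact_continuous_image continuous_on_subset[OF assms(1)] assms)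
 then obtain C where "ALL x:f ` T. norm x <= C" using compact_imp_bounded bounded_iff by metis
 thus ?thesis using that[of "max C 0"] by (meson imageI le_max_iff_disj max.cobounded2)
qed

text \<open>The Picard iterates F converge to the solution at the rate 1/2. Their derivatives satisfy the same
  kind of recursion with an additional term of size (1/2)^n, so they converge at the rate 3/4.\<close>

lemma radial_linear_C1:
 fixes N :: "'p::euclidean_space => 'e::euclidean_space \<Rightarrow>\<^sub>L 'e"
 assumes N: "hdiff (Suc 0) (ball 0 r) N" and b: "hdiff (Suc 0) (ball 0 r) b"
  and sol: "continuous_on (ball 0 r) sol" "!!y. y : ball 0 r ==> sol y = radial j (%y. b y + N y (sol y)) y"
  and half: "!!y. y : ball 0 r ==> norm (N y) <= 1/2"
  and r': "0 < r'" "r' < r"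
 shows "hdiff (Suc 0) (ball 0 r') sol"
proof -
 let ?B = "ball (0::'p) r"
 have cb: "cball 0 r' <= ?B" "compact (cball (0::'p) r')" and sub: "ball 0 r' <= ?B" using r' by auto
 have tB: "t .* y : ball 0 r'" "t .* y : cball 0 r'" "t .* y : ?B" if "t : {0..1}" "y : ball 0 r'" for t y
  using scale_ball[OF that] r' by auto
 note cNb = hdiff_Suc_cont[OF N] hdiff_Suc_cont[OF b]
 have cL: "continuous_on ?B (FDL N)" "continuous_on ?B (FDL b)"
  using higher_differentiable_on_FDL[OF open_ball N] higher_differentiable_on_FDL[OF open_ball b] by auto
 obtain Cs where Cs: "Cs >= 0" "!!y. y : cball 0 r' ==> norm (sol y) <= Cs" using compact_bound[OF sol(1) cb(2,1)] by blast
 obtain CN where CN: "CN >= 0" "!!y. y : cball 0 r' ==> norm (FDL N y) <= CN" using compact_bound[OF cL(1) cb(2,1)] by blast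
 obtain CB where CB: "CB >= 0" "!!y. y : cball 0 r' ==> norm (FDL b y) <= CB" using compact_bound[OF cL(2) cb(2,1)] by blast
 define F where "F = rec_nat (%y. 0) (%n f. radial j (%y. b y + N y (f y)))"
 have F0: "F 0 = (%y. 0)" and FS: "F (Suc n) = radial j (%y. b y + N y (F n y))" for n by (simp_all add: F_def)
 have inner: "hdiff (Suc 0) ?B (%y. b y + N y (f y))" if "hdiff (Suc 0) ?B f" for f
  by (intro hdiff_add bounded_bilinear.hdiff_bilinear[OF bounded_bilinear_blinfun_apply] open_ball N b that)
 have C1: "hdiff (Suc 0) ?B (F n)" for n
  by (induction n) (simp only: F0 hdiff_const, simp only: FS radial_higher inner)
 note cF = hdiff_Suc_cont[OF C1]
 have cD: "continuous_on ?B (%y. FD N y v)" "continuous_on ?B (%y. FD b y v)" "continuous_on ?B (%y. FD (F n) y v)" for n v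
  using N b C1[of n] by auto
 have FDF: "FD (F (Suc n)) y v = radial (Suc j) (%z. FD b z v + (N z (FD (F n) z v) + FD N z v (F n z))) y" if y: "y : ?B" for n y v
  unfolding FS FD_eq[OF radial_has_derivative[OF inner[OF C1] y]]
 proof (rule radial_cong[OF y])
  fix z assume z: "z : ?B"
  have d: "b differentiable (at z)" "N differentiable (at z)" "F n differentiable (at z)" using N b C1[of n] z by auto
  show "FD (%y. b y + N y (F n y)) z v = FD b z v + (N z (FD (F n) z v) + FD N z v (F n z))"
   using FD_eq[OF has_derivative_add[OF FD_works[OF d(1)] blinfun.FDERIV[OF FD_works[OF d(2)] FD_works[OF d(3)]]]] by simp
 qed
 have Nle: "norm (N z w) <= 1/2 * c" if "z : ?B" "norm w <= c" for z w c
  using order_trans[OF norm_blinfun mult_mono[OF half[OF that(1)] that(2)]] by simp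
 have 1: "norm (F n y - sol y) <= Cs * (1/2) ^ n" if "y : ball 0 r'" for n y
  using that
 proof (induction n arbitrary: y)
  case 0 thus ?case using Cs(2)[of y] by (simp add: F0)
 next
  case (Suc n)
  have y: "y : ?B" using Suc.prems sub by auto
  have "F (Suc n) y - sol y = radial j (%z. (b z + N z (F n z)) - (b z + N z (sol z))) y"
   unfolding FS sol(2)[OF y] by (rule radial_diff[OF _ _ y]) (intro continuous_intros cNb cF sol)+
  also have "... = radial j (%z. N z (F n z - sol z)) y" by (simp add: blinfun.bilinear_simps)
  also have "norm ... <= 1/2 * (Cs * (1/2) ^ n)"
   by (rule norm_radial_le[OF _ y]) (intro continuous_intros cNb cF sol, intro Nle Suc.IH scale_ball Suc.prems y)
  finally show ?case by simp
 qed
 \<comment> \<open>A / 4 is gained in each step by passing from the factor 1/2 to 3/4; the additional term needs 2 * CN * Cs.\<close>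
 define A where "A = CB + 8 * CN * Cs"
 have 2: "norm (FD (F (Suc n)) y v - FD (F n) y v) <= A * (3/4) ^ n * norm v" if "y : ball 0 r'" for n y v
  using that
 proof (induction n arbitrary: y)
  case 0
  have "FD (F 0) z w = 0" for z w by (simp add: F0)
  hence "FD (F (Suc 0)) y v - FD (F 0) y v = radial (Suc j) (%z. FD b z v) y"
   using FDF[of y 0 v] 0 sub by (auto simp: F0 blinfun.bilinear_simps)
  also have "norm ... <= CB * norm v"
  proof (rule norm_radial_le[OF cD(2)])
   fix t :: real assume "t : {0..1}"
   note t = tB(2,3)[OF this 0]
   thus "norm (FD b (t .* y) v) <= CB * norm v"
    using order_trans[OF norm_blinfun mult_right_mono[OF CB(2)[OF t(1)]], of v] b FDL_apply[of b] by (simp del: mem_ball)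
  qed (use 0 sub in auto)
  also have "... <= A * (3/4) ^ 0 * norm v" using CN Cs by (simp add: A_def mult_right_mono)
  finally show ?case .
 next
  case (Suc n)
  have y: "y : ?B" using Suc.prems sub by auto
  have "FD (F (Suc (Suc n))) y v - FD (F (Suc n)) y v = radial (Suc j) (%z. (FD b z v + (N z (FD (F (Suc n)) z v) + FD N z v (F (Suc n) z))) -
    (FD b z v + (N z (FD (F n) z v) + FD N z v (F n z)))) y"
   unfolding FDF[OF y] by (rule radial_diff[OF _ _ y]) (intro continuous_intros cNb cF cD)+
  also have "... = radial (Suc j) (%z. N z (FD (F (Suc n)) z v - FD (F n) z v) + FD N z v (F (Suc n) z - F n z)) y"
   by (simp add: blinfun.bilinear_simps algebra_simps)
  also have "norm ... <= 1/2 * (A * (3/4) ^ n * norm v) + CN * norm v * (2 * Cs * (3/4) ^ n)"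
  proof (rule norm_radial_le[OF _ y])
   fix t :: real assume "t : {0..1}"
   note t = tB[OF this Suc.prems]
   let ?z = "t .* y"
   have "norm (F (Suc n) ?z - F n ?z) <= Cs * (1/2) ^ Suc n + Cs * (1/2) ^ n"
    using norm_triangle_le_diff[OF add_mono[OF 1[OF t(1), of "Suc n"] 1[OF t(1), of n]]] by simp
   also have "... <= 2 * Cs * (1/2) ^ n" using Cs(1) by simp
   also have "... <= 2 * Cs * (3/4) ^ n" using Cs(1) by (intro mult_left_mono power_mono) auto
   finally have f: "norm (F (Suc n) ?z - F n ?z) <= 2 * Cs * (3/4) ^ n" .
   have "norm (FD N ?z v) <= CN * norm v"
    using order_trans[OF norm_blinfun mult_right_mono[OF CN(2)[OF t(2)]], of v] N t(3) FDL_apply[of N] by (simp del: mem_ball)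
   from order_trans[OF norm_blinfun mult_mono[OF this f]] CN(1)
   have "norm (FD N ?z v (F (Suc n) ?z - F n ?z)) <= CN * norm v * (2 * Cs * (3/4) ^ n)" by simp
   thus "norm (N ?z (FD (F (Suc n)) ?z v - FD (F n) ?z v) + FD N ?z v (F (Suc n) ?z - F n ?z))
     <= 1/2 * (A * (3/4) ^ n * norm v) + CN * norm v * (2 * Cs * (3/4) ^ n)"
    by (intro norm_triangle_le add_mono Nle Suc.IH t)
  qed (intro continuous_intros cNb cF cD)
  also have "... <= A * (3/4) ^ Suc n * norm v"
  proof -
   have "8 * CN * Cs * ((3/4) ^ n * norm v) <= A * ((3/4) ^ n * norm v)" using CB by (intro mult_right_mono) (auto simp: A_def)
   thus ?thesis by (simp add: algebra_simps)
  qed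
  finally show ?case .
 qed
 have "norm (F n y - sol y) <= Cs * (3/4) ^ n" if "y : ball 0 r'" for n y
  by (rule order_trans[OF 1[OF that] mult_left_mono[OF power_mono Cs(1)]]) auto
 moreover have "hdiff (Suc 0) (ball 0 r') (F n)" for n
  using C1[of n] sub by (auto intro: continuous_on_subset)
 ultimately show ?thesis
  using C1_limit[OF r'(1), of "3/4" A F sol Cs] 2 Cs CN CB by (auto simp: A_def)
qed

text \<open>The derivative of a solution solves an equation of the same kind, with j raised by one. So induction
  on k works on the full ball, without any loss of the domain.\<close>

lemma radial_linear_smooth:
 fixes N :: "'p::euclidean_space => 'e::euclidean_space \<Rightarrow>\<^sub>L 'e"
 assumes "hdiff k (ball 0 r) N" "hdiff k (ball 0 r) b"
  "continuous_on (ball 0 r) sol" "!!y. y : ball 0 r ==> sol y = radial j (%y. b y + N y (sol y)) y"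
  "!!y. y : ball 0 r ==> norm (N y) <= 1/2"
 shows "hdiff k (ball 0 r) sol"
 using assms(1-4)
proof (induction k arbitrary: j b sol)
 case 0 thus ?case by simp
next
 case (Suc k)
 have N1: "hdiff (Suc 0) (ball 0 r) N" and b1: "hdiff (Suc 0) (ball 0 r) b"
  using hdiff_Suc_imp_1[OF Suc.prems(1)] hdiff_Suc_imp_1[OF Suc.prems(2)] by simp_all
 have Nk: "hdiff k (ball 0 r) N" and bk: "hdiff k (ball 0 r) b"
  using Suc.prems(1,2) hdiff_SucD by blast+
 have solk: "hdiff k (ball 0 r) sol" by (rule Suc.IH[OF Nk bk Suc.prems(3,4)])
 have loc: "EX r'. y : ball 0 r' & hdiff (Suc 0) (ball 0 r') sol" if y: "y : ball 0 r" for y :: 'p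
 proof -
  obtain r' where r': "norm y < r'" "r' < r" using y dense[of "norm y" r] by auto
  hence "0 < r'" using norm_ge_zero le_less_trans by blast
  from radial_linear_C1[OF N1 b1 Suc.prems(3,4) assms(5) this r'(2)] r'(1) show ?thesis by auto
 qed
 have d: "sol differentiable (at y)" if "y : ball 0 r" for y using loc[OF that] by auto
 have c: "continuous_on (ball 0 r) (%y. FD sol y v)" for v
 proof (rule continuous_at_imp_continuous_on, rule ballI)
  fix y :: 'p assume "y : ball 0 r"
  thus "continuous (at y) (%y. FD sol y v)"
   using loc[of y] by (auto simp: continuous_on_eq_continuous_at simp del: mem_ball)
 qed
 have inner: "hdiff (Suc 0) (ball 0 r) (%y. b y + N y (sol y))"
  by (intro hdiff_add bounded_bilinear.hdiff_bilinear[OF bounded_bilinear_blinfun_apply] open_ball N1 b1)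
   (use d c in simp)
 have eq: "FD sol y v = radial (Suc j) (%y. (FD b y v + FD N y v (sol y)) + N y (FD sol y v)) y" if y: "y : ball 0 r" for y v
 proof -
  have "FD sol y v = radial (Suc j) (%y. FD (%y. b y + N y (sol y)) y v) y"
   using FD_cong[OF open_ball y, of sol "radial j (%y. b y + N y (sol y))"] Suc.prems(4) FD_eq[OF radial_has_derivative[OF inner y]] by simp
  also have "... = radial (Suc j) (%y. (FD b y v + FD N y v (sol y)) + N y (FD sol y v)) y"
  proof (rule radial_cong[OF y])
   fix z :: 'p assume z: "z : ball 0 r"
   have d: "b differentiable (at z)" "N differentiable (at z)" using N1 b1 z by auto
   show "FD (%y. b y + N y (sol y)) z v = (FD b z v + FD N z v (sol z)) + N z (FD sol z v)"
    using FD_eq[OF has_derivative_add[OF FD_works[OF d(1)] blinfun.FDERIV[OF FD_works[OF d(2)] FD_works[OF \<open>!!y. y : ball 0 r ==> sol differentiable (at y)\<close>[OF z]]]]]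
    by (simp add: algebra_simps)
  qed
  finally show ?thesis .
 qed
 have "hdiff k (ball 0 r) (%y. FD sol y v)" for v
 proof (rule Suc.IH[OF Nk _ c eq])
  show "hdiff k (ball 0 r) (%y. FD b y v + blinfun_apply (FD N y v) (sol y))"
   using Suc.prems(1,2) solk
   by (intro hdiff_add bounded_bilinear.hdiff_bilinear[OF bounded_bilinear_blinfun_apply]) auto
 qed
 thus ?case using d by simp
qed

text \<open>On a small ball G y is small together with its derivatives, so that the Picard iterates T^n Y0 and their
  derivatives converge. The derivative of the limit solves a linear radial equation, and the regularity
  of such solutions lifts the order of differentiability step by step.\<close>

theorem radial_flow:
 fixes g :: "'p::euclidean_space => 'e::euclidean_space => 'e"
 assumes U: "open U" "Y0 : U" and g: "!!i. i : Basis ==> smooth_on U (g i)"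
 defines "G \<equiv> %y e. SB i. (y \<bullet> i) .* g i e"
 obtains r Ps where "r > 0" "smooth_on (ball 0 r) Ps" "!!y. y : ball 0 r ==> Ps y : U"
  "!!y. y : ball 0 r ==> Ps y = Y0 + integral {0..1} (%t. G y (Ps (t .* y)))"
  "!!y v. y : ball 0 r ==> FD Ps y v = radial 0 (%y. G v (Ps y) + FD (G y) (Ps y) (FD Ps y v)) y"
  "!!y v. y : ball 0 r ==> norm (FD (G y) (Ps y) v) <= 1/2 * norm v"
proof -
 obtain rh where rho: "rh > 0" "cball Y0 rh <= U" using U open_contains_cball by blast
 let ?C = "cball Y0 rh"
 define g' where "g' = (%i. FDL (g i))"
 have dg: "g i differentiable at e" if "i : Basis" "e : U" for i e using smooth_diff[OF g that(2)] that by simp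
 have sg': "smooth_on U (g' i)" "smooth_on U (FDL (g' i))" if "i : Basis" for i
  unfolding g'_def by (intro smooth_on_FDL U g that)+
 note cont = smooth_cont[OF g] smooth_cont[OF sg'(1)] smooth_cont[OF sg'(2)]
 have "continuous_on U (%e. SB i. norm (g i e) + norm (g' i e) + norm (FDL (g' i) e))" by (intro continuous_intros cont)
 from compact_bound[OF this compact_cball rho(2)] obtain c where c: "c >= 0"
  "!!e. e : ?C ==> norm (SB i. norm (g i e) + norm (g' i e) + norm (FDL (g' i) e)) <= c" by blast
 have bnd: "norm (g i e) <= c" "norm (g' i e) <= c" "norm (FDL (g' i) e) <= c" if i: "i : Basis" and e: "e : ?C" for i e
 proof -
  have "norm (g i e) + norm (g' i e) + norm (FDL (g' i) e) <= c"
   using c(2)[OF e] member_le_sum[OF i, of "%i. norm (g i e) + norm (g' i e) + norm (FDL (g' i) e)"] by (simp add: sum_nonneg)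
  thus "norm (g i e) <= c" "norm (g' i e) <= c" "norm (FDL (g' i) e) <= c"
   using norm_ge_zero[of "g i e"] norm_ge_zero[of "g' i e"] norm_ge_zero[of "FDL (g' i) e"] by linarith+
 qed
 \<comment> \<open>m bounds the sums over the basis; the radius makes norm y * m at most 1/2, the contraction factor.\<close>
 define m where "m = real (card (Basis :: 'p set)) * c + 1"
 have m: "m > 0" using c by (simp add: m_def add_nonneg_pos)
 define r where "r = min (rh / m) (1 / (2 * m))"
 have r: "r > 0" using rho m by (simp add: r_def)
 have r1: "r * m <= rh" "r * m <= 1/2" using m by (auto simp: r_def min_def field_simps split: if_splits)
 let ?B = "ball (0::'p) r"
 have ym: "norm y * m <= rh" "norm y * m <= 1/2" if "y : ?B" for y
 proof -
  have "norm y * m <= r * m" using that m by simp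
  thus "norm y * m <= rh" "norm y * m <= 1/2" using r1 by linarith+
 qed
 have sumb: "norm (SB i. (y \<bullet> i) .* w i) <= norm y * m * C"
  if "!!i. i : Basis ==> norm (w i) <= c * C" "C >= 0" for y :: 'p and w :: "'p => 'z::real_normed_vector" and C
 proof -
  have "norm (SB i. (y \<bullet> i) .* w i) <= (\<Sum>i\<in>(Basis::'p set). norm y * (c * C))"
   by (rule sum_norm_le) (auto intro!: mult_mono that Basis_le_norm simp: c)
  also have "... = norm y * (real (card (Basis :: 'p set)) * c * C)" by simp
  also have "... <= norm y * (m * C)" using that(2) by (intro mult_left_mono mult_right_mono) (auto simp: m_def)
  finally show ?thesis by (simp add: mult.assoc)
 qed
 have lip: "norm (f e - f e') <= c * norm (e - e')"
  if "e : ?C" "e' : ?C" "smooth_on U f" "!!x. x : ?C ==> norm (FDL f x) <= c" for f :: "'e => 'z::real_normed_vector" and e e'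
 proof (rule differentiable_bound[of ?C f "%x. blinfun_apply (FDL f x)"])
  fix x assume x: "x : ?C"
  have "f differentiable (at x)" using smooth_diff[OF that(3)] rho(2) x by blast
  thus "(f has_derivative blinfun_apply (FDL f x)) (at x within ?C)" using FDL_has_derivative has_derivative_at_withinI by blast
  show "onorm (blinfun_apply (FDL f x)) <= c" using that(4)[OF x] by (simp add: norm_blinfun.rep_eq)
 qed (use that(1,2) in auto)
 have lip0: "norm (g i e - g i e') <= c * norm (e - e')" and lip1: "norm (g' i e - g' i e') <= c * norm (e - e')"
  if "i : Basis" "e : ?C" "e' : ?C" for i e e'
  using lip[OF that(2,3) g[OF that(1)]] lip[OF that(2,3) sg'(1)[OF that(1)]] bnd[OF that(1)] by (simp_all add: g'_def)
 define T where "T f y = Y0 + (SB i. (y \<bullet> i) .* radial 0 (%z. g i (f z)) y)" for f :: "'p => 'e" and y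
 have hT: "hdiff k ?B (T f)" if "hdiff k ?B f" "!!y. y : ?B ==> f y : U" for k f
 proof -
  have "hdiff k ?B (radial 0 (%z. g i (f z)))" if "i : Basis" for i
   by (rule radial_higher[OF hdiff_compose[OF open_ball U(1) \<open>!!y. y : ?B ==> f y : U\<close> \<open>hdiff k ?B f\<close>]])
    (use g[OF that] in \<open>auto simp: smooth_on_def\<close>)
  thus ?thesis unfolding T_def
   by (intro hdiff_add hdiff_sum hdiff_const open_ball
     bounded_bilinear.hdiff_bilinear[OF bounded_bilinear_scaleR] hdiff_linear[OF bounded_linear_inner_left])
 qed
 have cg: "continuous_on ?B (%y. g i (f y))" "continuous_on ?B (%y. g' i (f y))"
  if "continuous_on ?B f" "!!y. y : ?B ==> f y : ?C" "i : Basis" for f i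
  by (rule continuous_on_compose2[OF cont(1) that(1)], use that rho in auto)
   (rule continuous_on_compose2[OF cont(2) that(1)], use that rho in auto)
 have TC: "T f y : ?C" if f: "continuous_on ?B f" "!!y. y : ?B ==> f y : ?C" and y: "y : ?B" for f y
 proof -
  have "norm (radial 0 (%z. g i (f z)) y) <= c * 1" if "i : Basis" for i
   by (rule norm_radial_le[OF cg(1)[OF f that] y]) (use bnd(1)[OF that f(2)[OF scale_ball[OF _ y]]] in auto)
  hence "norm (SB i. (y \<bullet> i) .* radial 0 (%z. g i (f z)) y) <= norm y * m * 1" by (rule sumb) simp_all
  thus ?thesis using ym(1)[OF y] by (simp add: T_def dist_norm)
 qed
 have Tc: "norm (T f y - T h y) <= 1/2 * E"
  if f: "continuous_on ?B f" "!!y. y : ?B ==> f y : ?C" and h: "continuous_on ?B h" "!!y. y : ?B ==> h y : ?C"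
   and y: "y : ?B" and E: "E >= 0" "!!z. z : ?B ==> norm (f z - h z) <= E" for f h y E
 proof -
  have "T f y - T h y = (SB i. (y \<bullet> i) .* radial 0 (%z. g i (f z) - g i (h z)) y)"
   using radial_diff[OF cg(1)[OF f] cg(1)[OF h] y, symmetric] by (simp add: T_def sum_subtractf scaleR_diff_right)
  also have "norm ... <= norm y * m * E"
  proof (rule sumb[OF norm_radial_le[OF _ y]])
   fix i :: 'p and t :: real assume i: "i : Basis" and t: "t : {0..1}"
   note ty = scale_ball[OF t y]
   show "norm (g i (f (t .* y)) - g i (h (t .* y))) <= c * E"
    using lip0[OF i f(2)[OF ty] h(2)[OF ty]] mult_left_mono[OF E(2)[OF ty] c(1)] by linarith
  qed (use E in \<open>auto intro!: continuous_intros cg f h simp del: mem_ball mem_cball\<close>)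
  also have "... <= 1/2 * E" using ym(2)[OF y] E(1) by (rule mult_right_mono)
  finally show ?thesis .
 qed
 have FDT: "FD (T f) y v = (SB i. (v \<bullet> i) .* radial 0 (%z. g i (f z)) y) + (SB i. (y \<bullet> i) .* radial (Suc 0) (%z. g' i (f z) (FD f z v)) y)"
  if f: "hdiff (Suc 0) ?B f" "!!y. y : ?B ==> f y : ?C" and y: "y : ?B" for f y v
 proof -
  have fU: "f z : U" if "z : ?B" for z using f(2)[OF that] rho by blast
  have C1: "hdiff (Suc 0) ?B (%z. g i (f z))" if "i : Basis" for i
   by (rule hdiff_compose[OF open_ball U(1) fU f(1)]) (use g[OF that] in \<open>auto simp: smooth_on_def\<close>)
  have "((%y. (y \<bullet> i) .* radial 0 (%z. g i (f z)) y) has_derivative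
   (%v. (y \<bullet> i) .* radial (Suc 0) (%z. FD (%z. g i (f z)) z v) y + (v \<bullet> i) .* radial 0 (%z. g i (f z)) y)) (at y)" if "i : Basis" for i
   by (rule has_derivative_scaleR[OF _ radial_has_derivative[OF C1[OF that] y]]) (auto intro!: derivative_eq_intros)
  hence "(T f has_derivative (%v. 0 + (SB i. (y \<bullet> i) .* radial (Suc 0) (%z. FD (%z. g i (f z)) z v) y + (v \<bullet> i) .* radial 0 (%z. g i (f z)) y))) (at y)"
   unfolding T_def by (intro has_derivative_add has_derivative_const has_derivative_sum)
  note FD_eq[OF this]
  moreover have "radial (Suc 0) (%z. FD (%z. g i (f z)) z v) y = radial (Suc 0) (%z. g' i (f z) (FD f z v)) y" if "i : Basis" for i
   using FD_compose[where f=f and g="g i"] dg[OF that fU] f(1) FDL_apply[OF dg[OF that fU]]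
   by (intro radial_cong[OF y]) (simp add: g'_def del: mem_ball)
  ultimately show ?thesis by (simp add: sum.distrib)
 qed
 define F where "F = rec_nat (%y. Y0) (%n. T)"
 have F0: "F 0 = (%y. Y0)" and FS: "F (Suc n) = T (F n)" for n by (simp_all add: F_def)
 have F: "hdiff (Suc 0) ?B (F n) & (ALL y:?B. F n y : ?C)" for n
 proof (induction n)
  case 0 thus ?case using rho(1) by (simp add: F0 hdiff_const del: higher_differentiable_on.simps)
 next
  case (Suc n)
  thus ?case unfolding FS using rho(2) hdiff_Suc_cont[of 0 ?B "F n"] by (auto intro!: hT TC simp del: mem_ball mem_cball higher_differentiable_on.simps)
 qed
 hence C1: "hdiff (Suc 0) ?B (F n)" and FC: "y : ?B ==> F n y : ?C" for n y by blast+
 note cF = hdiff_Suc_cont[OF C1]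
 have cD: "continuous_on ?B (%y. FD (F n) y v)" for n v using C1[of n] by simp
 have FDF: "FD (F (Suc n)) y v = (SB i. (v \<bullet> i) .* radial 0 (%z. g i (F n z)) y) + (SB i. (y \<bullet> i) .* radial (Suc 0) (%z. g' i (F n z) (FD (F n) z v)) y)"
  if "y : ?B" for n y v unfolding FS by (rule FDT[OF C1 FC that])
 have step: "norm (F (Suc n) y - F n y) <= rh * (1/2) ^ n" if "y : ?B" for n y
  using that
 proof (induction n arbitrary: y)
  case 0 thus ?case using FC[OF 0, of "Suc 0"] by (simp add: F0 dist_norm norm_minus_commute)
 next
  case (Suc n) thus ?case using Tc[OF cF FC cF FC Suc.prems, of "rh * (1/2) ^ n" "Suc n" n] rho(1) by (simp add: FS)
 qed
 have "EX l. ALL y:?B. ALL n. norm (F n y - l y) <= rh * (1/2) ^ n / (1 - 1/2)"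
  by (rule geometric_limit) (use step in auto)
 then obtain Ps where Ps: "!!y n. y : ?B ==> norm (F n y - Ps y) <= rh * (1/2) ^ n / (1 - 1/2)" by blast
 have D: "norm (FD (F n) y v) <= 2 * m * norm v" if "y : ?B" for n y v
  using that
 proof (induction n arbitrary: y)
  case 0 thus ?case using m by (simp add: F0)
 next
  case (Suc n)
  have 1: "norm (SB i. (v \<bullet> i) .* radial 0 (%z. g i (F n z)) y) <= norm v * m * 1"
   by (rule sumb[OF norm_radial_le[OF cg(1)[OF cF FC] Suc.prems]]) (use bnd(1)[OF _ FC[OF scale_ball[OF _ Suc.prems]]] in auto)
  have 2: "norm (SB i. (y \<bullet> i) .* radial (Suc 0) (%z. g' i (F n z) (FD (F n) z v)) y) <= norm y * m * (2 * m * norm v)"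
  proof (rule sumb[OF norm_radial_le[OF _ Suc.prems]])
   fix i :: 'p and t :: real assume i: "i : Basis" and t: "t : {0..1}"
   note ty = scale_ball[OF t Suc.prems]
   show "norm (g' i (F n (t .* y)) (FD (F n) (t .* y) v)) <= c * (2 * m * norm v)"
    by (rule order_trans[OF norm_blinfun mult_mono[OF bnd(2)[OF i FC[OF ty]] Suc.IH[OF ty]]]) (use c in auto)
  qed (use m in \<open>auto intro!: continuous_intros cg cF FC cD simp del: mem_ball mem_cball\<close>)
  have "norm y * m * (2 * m * norm v) <= 1/2 * (2 * m * norm v)" using ym(2)[OF Suc.prems] m by (intro mult_right_mono) auto
  hence "norm v * m * 1 + norm y * m * (2 * m * norm v) <= 2 * m * norm v" by simp
  thus ?case unfolding FDF[OF Suc.prems] by (rule order_trans[OF norm_triangle_le[OF add_mono[OF 1 2]]])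
 qed
 define A where "A = 8 * (rh * m) + 2 * m"
 have A: "A >= 0" using rho m by (simp add: A_def)
 have DD: "norm (FD (F (Suc n)) y v - FD (F n) y v) <= A * (3/4) ^ n * norm v" if "y : ?B" for n y v
  using that
 proof (induction n arbitrary: y)
  case 0
  have "2 * m * norm v <= A * norm v" using rho m by (intro mult_right_mono) (auto simp: A_def)
  thus ?case using D[OF 0, of "Suc 0" v] by (simp add: F0)
 next
  case (Suc n)
  let ?p = "%n i z. g i (F n z)" and ?h = "%n i z. g' i (F n z) (FD (F n) z v)"
  have eq: "FD (F (Suc (Suc n))) y v - FD (F (Suc n)) y v = (SB i. (v \<bullet> i) .* radial 0 (%z. ?p (Suc n) i z - ?p n i z) y)
   + (SB i. (y \<bullet> i) .* radial (Suc 0) (%z. ?h (Suc n) i z - ?h n i z) y)"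
  proof -
   have "radial 0 (?p (Suc n) i) y - radial 0 (?p n i) y = radial 0 (%z. ?p (Suc n) i z - ?p n i z) y" if "i : Basis" for i
    by (rule radial_diff[OF _ _ Suc.prems]) (auto intro!: cg cF FC that simp del: mem_ball mem_cball)
   moreover have "radial (Suc 0) (?h (Suc n) i) y - radial (Suc 0) (?h n i) y = radial (Suc 0) (%z. ?h (Suc n) i z - ?h n i z) y" if "i : Basis" for i
    by (rule radial_diff[OF _ _ Suc.prems]) (auto intro!: continuous_intros cg cF FC cD that simp del: mem_ball mem_cball)
   ultimately show ?thesis
    unfolding FDF[OF Suc.prems]
    by (simp add: sum_subtractf[symmetric] scaleR_diff_right[symmetric] add_diff_add)
  qed
  have st: "norm (F (Suc n) z - F n z) <= rh * (3/4) ^ n" if "z : ?B" for z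
   by (rule order_trans[OF step[OF that] mult_left_mono[OF power_mono]]) (use rho in auto)
  have 1: "norm (SB i. (v \<bullet> i) .* radial 0 (%z. ?p (Suc n) i z - ?p n i z) y) <= norm v * m * (rh * (3/4) ^ n)"
  proof (rule sumb[OF norm_radial_le[OF _ Suc.prems]])
   fix i :: 'p and t :: real assume i: "i : Basis" and t: "t : {0..1}"
   note ty = scale_ball[OF t Suc.prems]
   show "norm (?p (Suc n) i (t .* y) - ?p n i (t .* y)) <= c * (rh * (3/4) ^ n)"
    by (rule order_trans[OF lip0[OF i FC[OF ty] FC[OF ty]] mult_left_mono[OF st[OF ty] c(1)]])
  qed (use rho in \<open>auto intro!: continuous_intros cg cF FC simp del: mem_ball mem_cball\<close>)
  let ?E = "A * (3/4) ^ n * norm v + rh * (3/4) ^ n * (2 * m * norm v)"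
  have 2: "norm (SB i. (y \<bullet> i) .* radial (Suc 0) (%z. ?h (Suc n) i z - ?h n i z) y) <= norm y * m * ?E"
  proof (rule sumb[OF norm_radial_le[OF _ Suc.prems]])
   fix i :: 'p and t :: real assume i: "i : Basis" and t: "t : {0..1}"
   let ?z = "t .* y"
   note z = scale_ball[OF t Suc.prems]
   have "?h (Suc n) i ?z - ?h n i ?z = g' i (F (Suc n) ?z) (FD (F (Suc n)) ?z v - FD (F n) ?z v) + (g' i (F (Suc n) ?z) - g' i (F n ?z)) (FD (F n) ?z v)"
    by (simp add: blinfun.bilinear_simps)
   also have "norm ... <= c * (A * (3/4) ^ n * norm v) + c * (rh * (3/4) ^ n) * (2 * m * norm v)"
   proof (rule norm_triangle_le[OF add_mono])
    show "norm (g' i (F (Suc n) ?z) (FD (F (Suc n)) ?z v - FD (F n) ?z v)) <= c * (A * (3/4) ^ n * norm v)"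
     by (rule order_trans[OF norm_blinfun mult_mono[OF bnd(2)[OF i FC[OF z]] Suc.IH[OF z]]]) (use c in auto)
    have "norm (g' i (F (Suc n) ?z) - g' i (F n ?z)) <= c * (rh * (3/4) ^ n)"
     by (rule order_trans[OF lip1[OF i FC[OF z] FC[OF z]] mult_left_mono[OF st[OF z] c(1)]])
    thus "norm ((g' i (F (Suc n) ?z) - g' i (F n ?z)) (FD (F n) ?z v)) <= c * (rh * (3/4) ^ n) * (2 * m * norm v)"
     by (rule order_trans[OF norm_blinfun mult_mono[OF _ D[OF z]]]) (use c rho in auto)
   qed
   finally show "norm (?h (Suc n) i ?z - ?h n i ?z) <= c * ?E" by (simp add: algebra_simps)
  qed (use A m rho in \<open>auto intro!: continuous_intros cg cF FC cD simp del: mem_ball mem_cball\<close>)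
  have "norm y * m * ?E <= 1/2 * ?E" using ym(2)[OF Suc.prems] A m rho by (intro mult_right_mono) auto
  hence "norm v * m * (rh * (3/4) ^ n) + norm y * m * ?E <= (2 * (rh * m) + A / 2) * ((3/4) ^ n * norm v)" by (simp add: algebra_simps)
  also have "... <= (3/4 * A) * ((3/4) ^ n * norm v)" using m by (intro mult_right_mono) (auto simp: A_def)
  finally show ?case unfolding eq by (intro order_trans[OF norm_triangle_le[OF add_mono[OF 1 2]]]) simp
 qed
 have "norm (F n y - Ps y) <= 2 * rh * (3/4) ^ n" if "y : ?B" for n y
 proof -
  have "2 * rh * (1/2) ^ n <= 2 * rh * (3/4) ^ n" using rho by (intro mult_left_mono power_mono) auto
  thus ?thesis using Ps[OF that, of n] by simp
 qed
 from C1_limit[OF r _ _ A C1 this DD] have Ps1: "hdiff (Suc 0) ?B Ps" by simp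
 note cPs = hdiff_Suc_cont[OF Ps1]
 have lF: "(%n. F n y) \<longlonglongrightarrow> Ps y" if "y : ?B" for y
  by (rule tendsto_uniform_limitI[OF uniform_limit_geometric[OF Ps] that]) auto
 have PsC: "Ps y : ?C" if "y : ?B" for y
  by (rule Lim_in_closed_set[OF closed_cball _ _ lF[OF that]]) (use FC[OF that] in auto)
 have PsU: "Ps y : U" if "y : ?B" for y using PsC[OF that] rho by blast
 have fp: "Ps y = T Ps y" if y: "y : ?B" for y
 proof -
  have "norm (F (Suc n) y - T Ps y) <= rh * (1/2) ^ n" for n
  proof -
   have "norm (T (F n) y - T Ps y) <= 1/2 * (rh * (1/2) ^ n / (1 - 1/2))"
    by (rule Tc[OF cF _ cPs _ y]) (erule FC, erule PsC, use rho in simp, erule Ps)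
   thus ?thesis by (simp add: FS)
  qed
  hence "\<forall>\<^sub>F n in sequentially. norm (F (Suc n) y - T Ps y) <= rh * (1/2) ^ n" by simp
  moreover have "(%n. rh * (1/2) ^ n) \<longlonglongrightarrow> rh * 0" by (intro tendsto_intros) auto
  ultimately have "(%n. F (Suc n) y - T Ps y) \<longlonglongrightarrow> 0" unfolding mult_zero_right by (rule Lim_null_comparison)
  from LIM_zero_cancel[OF this] have "(%n. F (Suc n) y) \<longlonglongrightarrow> T Ps y" .
  thus ?thesis using LIMSEQ_unique[OF LIMSEQ_Suc[OF lF[OF y]]] by blast
 qed
 define N where "N y e = (SB i. (y \<bullet> i) .* g' i e)" for y e
 have FDG: "FD (G y) e = blinfun_apply (N y e)" if "e : U" for y e
  unfolding G_def N_def
  by (rule FD_eq, rule has_derivative_eq_rhs[OF has_derivative_sum[OF has_derivative_scaleR_right[OF FDL_has_derivative[OF dg[OF _ that]]]]])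
   (auto simp: blinfun.bilinear_simps fun_eq_iff g'_def)
 have combine: "(SB i. (v \<bullet> i) .* radial 0 (p i) y) + (SB i. (y \<bullet> i) .* radial (Suc 0) (h i) y)
  = radial 0 (%z. (SB i. (v \<bullet> i) .* p i z) + (SB i. (z \<bullet> i) .* h i z)) y"
  if c: "!!i. i : Basis ==> continuous_on ?B (p i)" "!!i. i : Basis ==> continuous_on ?B (h i)" and y: "y : ?B" for p h :: "'p => 'p => 'e" and v y
 proof -
  have 1: "((%t. SB i. (v \<bullet> i) .* (t ^ 0 .* p i (t .* y))) has_integral (SB i. (v \<bullet> i) .* radial 0 (p i) y)) {0..1}"
   by (intro has_integral_sum has_integral_cmul radial_has_integral[where r=r] c y finite_Basis)
  have 2: "((%t. SB i. (y \<bullet> i) .* (t ^ Suc 0 .* h i (t .* y))) has_integral (SB i. (y \<bullet> i) .* radial (Suc 0) (h i) y)) {0..1}"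
   by (intro has_integral_sum has_integral_cmul radial_has_integral[where r=r] c y finite_Basis)
  from integral_unique[OF has_integral_add[OF 1 2]] show ?thesis
   by (simp add: radial_def[of 0 "%z. (SB i. (v \<bullet> i) .* p i z) + (SB i. (z \<bullet> i) .* h i z)"] mult.commute)
 qed
 have form: "FD Ps y v = radial 0 (%y. G v (Ps y) + N y (Ps y) (FD Ps y v)) y" if y: "y : ?B" for y v
 proof -
  have "FD Ps y v = FD (T Ps) y v" using FD_cong[OF open_ball y fp] by simp
  also have "... = (SB i. (v \<bullet> i) .* radial 0 (%z. g i (Ps z)) y) + (SB i. (y \<bullet> i) .* radial (Suc 0) (%z. g' i (Ps z) (FD Ps z v)) y)"
   by (rule FDT[OF Ps1 PsC y])
  also have "... = radial 0 (%z. (SB i. (v \<bullet> i) .* g i (Ps z)) + (SB i. (z \<bullet> i) .* g' i (Ps z) (FD Ps z v))) y"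
  proof (rule combine[OF cg(1)[OF cPs PsC] _ y])
   have "continuous_on ?B (%z. FD Ps z v)" using Ps1 by simp
   thus "continuous_on ?B (%z. g' i (Ps z) (FD Ps z v))" if "i : Basis" for i
    by (intro continuous_intros cg(2)[OF cPs PsC that])
  qed
  finally show ?thesis by (simp add: G_def N_def blinfun.bilinear_simps blinfun.sum_left)
 qed
 have Nhalf: "norm (N y (Ps y)) <= 1/2" if "y : ?B" for y
  using sumb[of "%i. g' i (Ps y)" 1 y] bnd(2)[OF _ PsC[OF that]] ym(2)[OF that] by (simp add: N_def)
 have "hdiff k ?B Ps" for k
 proof (induction k)
  case 0 thus ?case using cPs by simp
 next
  case (Suc k)
  have comp: "hdiff k ?B (%y. f (Ps y))" if "smooth_on U f" for f :: "'e => 'z::real_normed_vector"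
   by (rule hdiff_compose[OF open_ball U(1) PsU Suc]) (use that in \<open>auto simp: smooth_on_def\<close>)
  note hs = hdiff_sum[OF open_ball] bounded_bilinear.hdiff_bilinear[OF bounded_bilinear_scaleR open_ball]
   hdiff_const hdiff_linear bounded_linear_inner_left comp g sg'(1)
  have "hdiff k ?B (%y. N y (Ps y))" "hdiff k ?B (%y. G v (Ps y))" for v
   unfolding N_def G_def by (intro hs; assumption)+
  hence "hdiff k ?B (%y. FD Ps y v)" for v
   using radial_linear_smooth[OF _ _ _ form Nhalf] Ps1 by simp
  thus ?case using Ps1 by simp
 qed
 hence sm: "smooth_on ?B Ps" by (simp add: smooth_on_def)
 show ?thesis
 proof (rule that[OF r sm PsU])
  show "Ps y = Y0 + integral {0..1} (%t. G y (Ps (t .* y)))" if y: "y : ?B" for y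
  proof -
   have "((%t. SB i. (y \<bullet> i) .* (t ^ 0 .* g i (Ps (t .* y)))) has_integral (SB i. (y \<bullet> i) .* radial 0 (%z. g i (Ps z)) y)) {0..1}"
    by (intro has_integral_sum has_integral_cmul radial_has_integral[where r=r] cg cPs PsC y finite_Basis)
   from integral_unique[OF this] fp[OF y] show ?thesis by (simp add: T_def G_def)
  qed
  show "FD Ps y v = radial 0 (%y. G v (Ps y) + FD (G y) (Ps y) (FD Ps y v)) y" if "y : ?B" for y v
   unfolding form[OF that] by (rule radial_cong[OF that]) (simp add: FDG PsU del: mem_ball)
  show "norm (FD (G y) (Ps y) v) <= 1/2 * norm v" if "y : ?B" for y v
   unfolding FDG[OF PsU[OF that]]
   by (rule order_trans[OF norm_blinfun mult_right_mono[OF Nhalf[OF that]]]) auto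
 qed
qed

no_notation fps_nth (infixl "$" 75)

section \<open>Complex differentiability\<close>

text \<open>Complex differentiability is needed for maps between products of spaces of complex vectors and
  matrices. A multiplication by the imaginary unit is enough for this, since a real derivative is complex
  linear iff it commutes with it.\<close>

class complex_space = euclidean_space +
 fixes imul :: "'a => 'a"
 assumes imul_add: "imul (x + y) = imul x + imul y"
  and imul_scaleR: "imul (r .* x) = r .* imul x"
  and imul_imul: "imul (imul x) = - x"

instantiation complex :: complex_space
begin
definition imul_complex :: "complex => complex" where "imul_complex x = \<i> * x"
instance by standard (auto simp: imul_complex_def algebra_simps scaleR_conv_of_real)
end

instantiation vec :: (complex_space, finite) complex_space
begin
definition imul_vec :: "'a^'b => 'a^'b" where "imul_vec x = (\<chi> i. imul (x $ i))"
instance by standard (auto simp: imul_vec_def vec_eq_iff imul_add imul_scaleR imul_imul)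
end

instantiation prod :: (complex_space, complex_space) complex_space
begin
definition imul_prod :: "'a \<times> 'b => 'a \<times> 'b" where "imul_prod x = (imul (fst x), imul (snd x))"
instance by standard (auto simp: imul_prod_def imul_add imul_scaleR imul_imul)
end

lemma imul_nth [simp]: "imul x $ i = imul (x $ i)" by (simp add: imul_vec_def)
lemma imul_fst [simp]: "fst (imul x) = imul (fst x)" by (simp add: imul_prod_def)
lemma imul_snd [simp]: "snd (imul x) = imul (snd x)" by (simp add: imul_prod_def)
lemma imul_Pair [simp]: "imul (a, b) = (imul a, imul b)" by (simp add: imul_prod_def)
lemma imul_complex [simp]: "imul (z::complex) = \<i> * z" by (simp add: imul_complex_def)

lemma bounded_linear_imul: "bounded_linear (imul :: 'a::complex_space => 'a)"
 by (simp add: linear_conv_bounded_linear[symmetric] linear_iff imul_add imul_scaleR)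

definition cholo :: "('a::complex_space => 'b::complex_space) => 'a => bool" where
 "cholo f x \<longleftrightarrow> f differentiable (at x) & (ALL v. FD f x (imul v) = imul (FD f x v))"

lemma choloI: "(f has_derivative D) (at x) ==> (!!v. D (imul v) = imul (D v)) ==> cholo f x"
 unfolding cholo_def using FD_eq differentiable_def by metis

lemma cholo_differentiable: "cholo f x ==> f differentiable (at x)" by (simp add: cholo_def)
lemma cholo_imul: "cholo f x ==> FD f x (imul v) = imul (FD f x v)" by (simp add: cholo_def)

lemma cholo_cong: "open S ==> x : S ==> (!!y. y : S ==> f y = g y) ==> cholo f x \<longleftrightarrow> cholo g x"
 unfolding cholo_def using FD_cong[of S x f g] differentiable_cong_open[of S x f g] by simp

lemma cholo_compose: "cholo f x ==> cholo g (f x) ==> cholo (%x. g (f x)) x"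
 by (rule choloI[OF has_derivative_compose[OF FD_works FD_works]]) (auto simp: cholo_def)

lemma cholo_linear: "bounded_linear l ==> (!!v. l (imul v) = imul (l v)) ==> cholo l x"
 by (rule choloI[OF bounded_linear_imp_has_derivative])

lemma cholo_linear_compose:
 "bounded_linear l ==> (!!v. l (imul v) = imul (l v)) ==> cholo f x ==> cholo (%x. l (f x)) x"
 by (rule cholo_compose[where g=l]) (auto intro: cholo_linear)

named_theorems cholos

lemma imul_0 [simp]: "imul 0 = (0::'a::complex_space)" using imul_scaleR[of 0 "0::'a"] by simp

lemma cholo_const [cholos]: "cholo (%x. c) x" by (rule choloI[OF has_derivative_const]) simp
lemma cholo_id [cholos]: "cholo (%x. x) x" by (rule choloI[OF has_derivative_ident]) simp
lemma cholo_add [cholos]: "cholo f x ==> cholo g x ==> cholo (%x. f x + g x) x"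
 by (rule choloI[OF has_derivative_add[OF FD_works FD_works]]) (auto simp: cholo_def imul_add)
lemma cholo_mult [cholos]: "cholo f x ==> cholo g x ==> cholo (%x. f x * g x :: complex) x"
 by (rule choloI[OF has_derivative_mult[OF FD_works FD_works]]) (auto simp: cholo_def algebra_simps)
lemma cholo_minus [cholos]: "cholo f x ==> cholo (%x. - f x) x"
 by (rule cholo_linear_compose[OF bounded_linear_minus[OF bounded_linear_ident]])
  (metis imul_scaleR scaleR_minus1_left)
lemma cholo_diff [cholos]: "cholo f x ==> cholo g x ==> cholo (%x. f x - g x) x"
 using cholo_add[OF _ cholo_minus, of f x g] by simp
lemma cholo_sum [cholos]: "(!!i. i : I ==> cholo (f i) x) ==> cholo (%x. \<Sum>i\<in>I. f i x) x"
 by (induction I rule: infinite_finite_induct) (auto intro!: cholos)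
lemma cholo_inverse [cholos]: "cholo f x ==> f x ~= 0 ==> cholo (%x. inverse (f x) :: complex) x"
 by (rule choloI[OF Deriv.has_derivative_inverse[OF _ FD_works]]) (auto simp: cholo_def algebra_simps)
lemma cholo_divide [cholos]: "cholo f x ==> cholo g x ==> g x ~= 0 ==> cholo (%x. f x / g x :: complex) x"
 unfolding divide_inverse by (intro cholos)
lemma cholo_fst [cholos]: "cholo f x ==> cholo (%x. fst (f x)) x"
 by (rule cholo_linear_compose[OF bounded_linear_fst]) simp
lemma cholo_snd [cholos]: "cholo f x ==> cholo (%x. snd (f x)) x"
 by (rule cholo_linear_compose[OF bounded_linear_snd]) simp
lemma cholo_nth [cholos]: "cholo f x ==> cholo (%x. f x $ i) x"
 by (rule cholo_linear_compose[OF bounded_linear_vec_nth]) simp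
lemma cholo_Pair [cholos]: "cholo f x ==> cholo g x ==> cholo (%x. (f x, g x)) x"
 by (rule choloI[OF has_derivative_Pair[OF FD_works FD_works]]) (auto simp: cholo_def)
lemma cholo_vec_lambda [cholos]: "(!!i. cholo (f i) x) ==> cholo (%x. \<chi> i. f i x) x"
 unfolding vec_lambda_axis
 by (intro cholo_sum cholo_linear_compose[OF bounded_linear_axis]) (auto simp: vec_eq_iff axis_def)

lemma cholo_field_differentiable:
 assumes "cholo (f :: complex => complex) x" shows "f field_differentiable (at x)"
proof -
 have d: "(f has_derivative FD f x) (at x)" by (rule FD_works[OF cholo_differentiable[OF assms]])
 interpret linear "FD f x" using d has_derivative_linear by blast
 have "FD f x h = FD f x 1 * h" for h
 proof -
  have "FD f x h = FD f x (Re h .* 1 + Im h .* imul 1)" by (rule arg_cong[of _ _ "FD f x"]) (simp add: complex_eq_iff)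
  also have "... = FD f x 1 * h" unfolding add scale cholo_imul[OF assms]
   by (simp add: complex_eq_iff)
  finally show ?thesis .
 qed
 thus ?thesis using d unfolding field_differentiable_def has_field_derivative_def
  by (metis (no_types, lifting) has_derivative_eq_rhs ext)
qed

lemma cholo_holomorphic_on: "open S ==> (!!x. x : S ==> cholo (f::complex => complex) x) ==> f holomorphic_on S"
 by (simp add: holomorphic_on_open field_differentiable_def[symmetric] cholo_field_differentiable)

section \<open>Power series of separately holomorphic functions\<close>

lemma continuous_on_contour_integral_param:
 assumes "valid_path ga" "continuous_on {0..1} (%t. vector_derivative ga (at t))"
  "continuous_on (U \<times> path_image ga) (%(u, z). h u z)"
 shows "continuous_on U (%u. contour_integral ga (h u))"
proof -
 have g: "continuous_on {0..1} ga" using assms(1) by (simp add: valid_path_def piecewise_C1_differentiable_on_def)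
 have "continuous_on (U \<times> cbox 0 1) (%p. (%(u, z). h u z) (fst p, ga (snd p)) * vector_derivative ga (at (snd p)))"
  apply (intro continuous_intros continuous_on_compose2[OF assms(3)] continuous_on_compose2[OF g] continuous_on_compose2[OF assms(2)])
  by (auto simp: path_image_def)
 hence "continuous_on (U \<times> cbox 0 1) (%(u, t). h u (ga t) * vector_derivative ga (at t))"
  by (simp add: case_prod_unfold)
 from integral_continuous_on_param[OF this] show ?thesis by (simp add: contour_integral_integral)
qed

text \<open>Morera: the integral over a triangle is interchanged with the contour integral and vanishes.\<close>

lemma holomorphic_contour_integral_param:
 assumes "open U" and v: "valid_path ga" and vd: "continuous_on {0..1} (%t. vector_derivative ga (at t))"
  and c: "continuous_on (U \<times> path_image ga) (%(u, z). h u z)"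
  and hol: "!!z. z : path_image ga ==> (%u. h u z) holomorphic_on U"
 shows "(%u. contour_integral ga (h u)) holomorphic_on U"
proof -
 have "(%u. contour_integral ga (h u)) analytic_on U"
 proof (rule Morera_triangle[OF continuous_on_contour_integral_param[OF v vd c] \<open>open U\<close>], safe)
  fix a b d assume T: "convex hull {a, b, d} <= U"
  have seg: "closed_segment x y <= U" if "x : {a, b, d}" "y : {a, b, d}" for x y
   using T that by (meson closed_segment_subset convex_convex_hull hull_inc subset_trans)
  have vl: "continuous_on {0..1} (%t. vector_derivative (linepath x y) (at t))" for x y :: complex by simp
  have cs: "continuous_on (closed_segment x y \<times> path_image ga) (%(u, z). h u z)" if "x : {a, b, d}" "y : {a, b, d}" for x y
   by (rule continuous_on_subset[OF c]) (use seg[OF that] in auto)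
  have cs': "continuous_on (path_image ga \<times> path_image (linepath x y)) (%(z, u). h u z)" if "x : {a, b, d}" "y : {a, b, d}" for x y
  proof -
   have "continuous_on (path_image ga \<times> path_image (linepath x y)) (%p. (%(u, z). h u z) (snd p, fst p))"
    by (rule continuous_on_compose2[OF cs[OF that]]) (auto intro!: continuous_intros)
   thus ?thesis by (simp add: case_prod_unfold)
  qed
  have sw: "contour_integral (linepath x y) (%u. contour_integral ga (h u)) = contour_integral ga (%z. contour_integral (linepath x y) (%u. h u z))"
   if "x : {a, b, d}" "y : {a, b, d}" for x y
   by (rule contour_integral_swap) (use cs[OF that] v vd vl in auto)
  have ci: "(%z. contour_integral (linepath x y) (%u. h u z)) contour_integrable_on ga" if "x : {a, b, d}" "y : {a, b, d}" for x y
  proof -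
   have "continuous_on (path_image ga) (%z. contour_integral (linepath x y) (%u. h u z))"
    by (rule continuous_on_contour_integral_param[OF _ vl cs'[OF that]]) auto
   hence "continuous_on {0..1} (%t. contour_integral (linepath x y) (%u. h u (ga t)) * vector_derivative ga (at t))"
    using v by (intro continuous_intros vd) (auto simp: path_image_def valid_path_def piecewise_C1_differentiable_on_def intro: continuous_on_compose2)
   thus ?thesis unfolding contour_integrable_on by (rule integrable_continuous_real)
  qed
  have z0: "contour_integral (linepath a b) (%u. h u z) + contour_integral (linepath b d) (%u. h u z) + contour_integral (linepath d a) (%u. h u z) = 0"
   if z: "z : path_image ga" for z
  proof -
   have hz: "(%u. h u z) holomorphic_on U" by (rule hol[OF z])
   have int: "(%u. h u z) contour_integrable_on linepath x y" if "x : {a, b, d}" "y : {a, b, d}" for x y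
    by (rule contour_integrable_continuous_linepath[OF continuous_on_subset[OF holomorphic_on_imp_continuous_on[OF hz] seg[OF that]]])
   have "((%u. h u z) has_contour_integral 0) (linepath a b +++ linepath b d +++ linepath d a)"
    by (rule Cauchy_theorem_triangle[OF holomorphic_on_subset[OF hz T]])
   from contour_integral_unique[OF this] show ?thesis
    using int[of a b] int[of b d] int[of d a] by (simp add: contour_integral_join contour_integrable_join add.assoc)
  qed
  have "contour_integral (linepath a b) (%u. contour_integral ga (h u)) + contour_integral (linepath b d) (%u. contour_integral ga (h u)) +
   contour_integral (linepath d a) (%u. contour_integral ga (h u)) =
   contour_integral ga (%z. contour_integral (linepath a b) (%u. h u z) + contour_integral (linepath b d) (%u. h u z) + contour_integral (linepath d a) (%u. h u z))"
   using contour_integral_add[OF contour_integrable_add[OF ci[of a b] ci[of b d]] ci[of d a]] contour_integral_add[OF ci[of a b] ci[of b d]]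
    sw[of a b] sw[of b d] sw[of d a] by simp
  also have "... = contour_integral ga (%z. 0)" by (rule contour_integral_cong) (auto simp: z0)
  finally show "contour_integral (linepath a b) (%u. contour_integral ga (h u)) + contour_integral (linepath b d) (%u. contour_integral ga (h u)) +
   contour_integral (linepath d a) (%u. contour_integral ga (h u)) = 0" by simp
 qed
 thus ?thesis by (rule analytic_imp_holomorphic)
qed

definition slice :: "complex^'d => 'd => complex => complex^'d" where
 "slice w j u = (\<chi> i. if i = j then u else w $ i)"

definition polydisc :: "real => (complex^'d) set" where "polydisc r = {w. ALL i. norm (w $ i) < r}"

definition sephol :: "real => (complex^'d => complex) => bool" where
 "sephol r F \<longleftrightarrow> continuous_on (polydisc r) F & (ALL w:polydisc r. ALL j. (%u. F (slice w j u)) holomorphic_on ball 0 r)"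

lemma slice_simps [simp]: "slice (slice w j u) j v = slice w j v" "slice w j (w $ j) = w" "slice w j u $ j = u"
 by (auto simp: slice_def vec_eq_iff)
lemma slice_commute: "i ~= j ==> slice (slice w i u) j v = slice (slice w j v) i u"
 by (auto simp: slice_def vec_eq_iff)
lemma slice_polydisc: "w : polydisc r ==> norm u < r ==> slice w j u : polydisc r"
 by (auto simp: slice_def polydisc_def)

lemma continuous_on_slice [continuous_intros]:
 assumes "continuous_on S f" "continuous_on S g" shows "continuous_on S (%x. slice (f x) j (g x))"
proof -
 have "continuous_on S (%x. if i = j then g x else f x $ i)" for i
  by (cases "i = j") (use assms in \<open>auto intro!: continuous_intros\<close>)
 thus ?thesis unfolding slice_def by (intro continuous_on_vec_lambda)
qed

definition multi :: "'d set => ('d => nat) set" where "multi I = {al. ALL i. i ~: I --> al i = 0}"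

lemma multi_empty: "multi {} = {%_. 0}" by (auto simp: multi_def)

lemma multi_insert_bij: "j ~: I ==> bij_betw (%(k, bt). bt(j := k)) (UNIV \<times> multi I) (multi (insert j I))"
 by (rule bij_betw_byWitness[where f'="%al. (al j, al(j := 0))"]) (auto simp: multi_def fun_eq_iff)

lemma geometric_summable_multi:
 fixes q :: "'d => real"
 assumes "finite I" "!!i. 0 <= q i & q i < 1"
 shows "(%al. \<Prod>i\<in>I. q i ^ al i) summable_on multi I"
 using assms(1)
proof (induction I rule: finite_induct)
 case empty
 show ?case by (simp add: multi_empty)
next
 case (insert j I)
 define s where "s = infsum (%al. \<Prod>i\<in>I. q i ^ al i) (multi I)"
 have "((%al. \<Prod>i\<in>I. q i ^ al i) has_sum s) (multi I)" using insert by (simp add: s_def)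
 hence 1: "((%bt. q j ^ k * (\<Prod>i\<in>I. q i ^ bt i)) has_sum (q j ^ k * s)) (multi I)" for k
  by (rule has_sum_cmult_right)
 have 2: "(%k. q j ^ k * s) summable_on UNIV"
  using assms(2)[of j] by (intro summable_on_cmult_left norm_summable_imp_summable_on) (auto intro!: summable_geometric)
 have "(%(k, bt). q j ^ k * (\<Prod>i\<in>I. q i ^ bt i)) summable_on (UNIV \<times> multi I)"
  by (rule summable_on_SigmaI[where g="%k. q j ^ k * s", OF _ 2]) (use 1 assms(2) in \<open>auto intro!: mult_nonneg_nonneg prod_nonneg zero_le_power\<close>)
 also have "(%(k, bt). q j ^ k * (\<Prod>i\<in>I. q i ^ bt i)) = (%p. (%al. \<Prod>i\<in>insert j I. q i ^ al i) ((%(k, bt). bt(j := k)) p))"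
 proof
  fix p :: "nat \<times> ('d => nat)"
  obtain k bt where p: "p = (k, bt)" by force
  have "(\<Prod>i\<in>I. q i ^ (bt(j := k)) i) = (\<Prod>i\<in>I. q i ^ bt i)" using insert by (intro prod.cong) auto
  thus "(case p of (k, bt) => q j ^ k * (\<Prod>i\<in>I. q i ^ bt i)) = (\<Prod>i\<in>insert j I. q i ^ (case p of (k, bt) => bt(j := k)) i)"
   using insert by (simp add: p)
 qed
 finally show ?case using summable_on_reindex_bij_betw[OF multi_insert_bij[OF insert(2)]] by blast
qed

text \<open>By induction on the set of variables: the expansion in a new variable has coefficients which are again
  separately holomorphic in the others, by the Cauchy formula, and the Cauchy estimates give the
  summability of the multiple series.\<close>

lemma power_series_multi:
 fixes F :: "complex^'d::finite => complex"
 assumes "finite I" and rh: "0 < rh" "rh < r"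
  and F: "sephol r F" "!!w. (!!i. norm (w $ i) <= rh) ==> norm (F w) <= M"
 shows "EX c. (ALL al. norm (c al) <= M / rh ^ (\<Sum>i\<in>I. al i)) &
  (ALL w:polydisc rh. ((%al. (\<Prod>i\<in>I. w $ i ^ al i) * c al) has_sum F (\<chi> i. if i : I then w $ i else 0)) (multi I))"
 using assms(1) F
proof (induction I arbitrary: F M rule: finite_induct)
 case empty
 have "(\<chi> i. 0) = (0::complex^'d)" by (simp add: vec_eq_iff)
 thus ?case using empty(2)[of 0] rh
  by (intro exI[of _ "%_. F 0"]) (auto simp: multi_empty has_sum_finite_iff)
next
 case (insert j I)
 let ?C = "circlepath 0 rh"
 have pC: "z : path_image ?C \<longleftrightarrow> norm z = rh" for z using rh by auto
 have vC: "valid_path ?C" by simp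
 have vdC: "continuous_on {0..1} (%t. vector_derivative ?C (at t))"
  unfolding vector_derivative_circlepath by (intro continuous_intros)
 have cF: "continuous_on (polydisc r) F" and hF: "!!w j. w : polydisc r ==> (%u. F (slice w j u)) holomorphic_on ball 0 r"
  using insert.prems(1) by (auto simp: sephol_def)
 define G where "G = (%k w. contour_integral ?C (%xx. F (slice w j xx) / xx ^ Suc k) / (2 * of_real pi * \<i>))"
 have G_slice: "G k (slice w j u) = G k w" for k w u by (simp add: G_def)
 have Gint: "contour_integral ?C (%xx. F (slice w j xx) / (xx - 0) ^ Suc k) = (2 * pi * \<i>) / fact k * (deriv ^^ k) (%u. F (slice w j u)) 0"
  "(%xx. F (slice w j xx) / (xx - 0) ^ Suc k) contour_integrable_on ?C" if w: "w : polydisc r" for w k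
 proof -
  have "((%xx. F (slice w j xx) / (xx - 0) ^ Suc k) has_contour_integral ((2 * pi * \<i>) / fact k * (deriv ^^ k) (%u. F (slice w j u)) 0)) ?C"
  proof (rule Cauchy_has_contour_integral_higher_derivative_circlepath)
   have "cball 0 rh <= ball (0::complex) r" using rh by auto
   thus "continuous_on (cball 0 rh) (%u. F (slice w j u))"
    using holomorphic_on_imp_continuous_on[OF hF[OF w]] continuous_on_subset by blast
   show "(%u. F (slice w j u)) holomorphic_on ball 0 rh"
    using hF[OF w] by (rule holomorphic_on_subset) (use rh in auto)
  qed (use rh in auto)
  thus "contour_integral ?C (%xx. F (slice w j xx) / (xx - 0) ^ Suc k) = (2 * pi * \<i>) / fact k * (deriv ^^ k) (%u. F (slice w j u)) 0"
   "(%xx. F (slice w j xx) / (xx - 0) ^ Suc k) contour_integrable_on ?C"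
   using contour_integral_unique contour_integrable_on_def by blast+
 qed
 have Gder: "G k w = (deriv ^^ k) (%u. F (slice w j u)) 0 / fact k" if "w : polydisc r" for w k
  using Gint(1)[OF that, of k] by (simp add: G_def field_simps)
 have Gsep: "sephol r (G k)" for k unfolding sephol_def
 proof (intro conjI ballI allI)
  have c0: "continuous_on (polydisc r \<times> path_image ?C) (%(w, xx). F (slice w j xx) / xx ^ Suc k)"
   unfolding case_prod_unfold
   apply (intro continuous_intros continuous_on_compose2[OF cF])
   using rh by (auto intro!: slice_polydisc)
  show "continuous_on (polydisc r) (G k)" unfolding G_def
   by (intro continuous_intros continuous_on_contour_integral_param[OF vC vdC c0]) auto
  fix w :: "complex^'d" and i assume w: "w : polydisc r"
  show "(%u. G k (slice w i u)) holomorphic_on ball 0 r"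
  proof (cases "i = j")
   case True thus ?thesis by (simp add: G_slice)
  next
   case False
   have "(%u. contour_integral ?C (%xx. F (slice (slice w i u) j xx) / xx ^ Suc k)) holomorphic_on ball 0 r"
   proof (rule holomorphic_contour_integral_param[OF open_ball vC vdC])
    show "continuous_on (ball 0 r \<times> path_image ?C) (%(u, xx). F (slice (slice w i u) j xx) / xx ^ Suc k)"
     unfolding case_prod_unfold
     apply (intro continuous_intros continuous_on_compose2[OF cF])
     using rh w by (auto intro!: slice_polydisc)
    fix xx assume "xx : path_image ?C"
    hence xi: "norm xx = rh" using pC by simp
    have "(%u. F (slice (slice w j xx) i u)) holomorphic_on ball 0 r"
     by (rule hF, rule slice_polydisc[OF w]) (use xi rh in simp)
    thus "(%u. F (slice (slice w i u) j xx) / xx ^ Suc k) holomorphic_on ball 0 r"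
     using xi rh by (intro holomorphic_intros) (auto simp: slice_commute[OF False])
   qed
   thus ?thesis unfolding G_def by (intro holomorphic_intros) auto
  qed
 qed
 have in_poly: "w : polydisc r" if "!!i. norm (w $ i) <= rh" for w :: "complex^'d"
  using that rh le_less_trans by (auto simp: polydisc_def)
 have Gb: "norm (G k w) <= M / rh ^ k" if w: "!!i. norm (w $ i) <= rh" for k w
 proof -
  have M0: "0 <= M" using order_trans[OF norm_ge_zero insert.prems(2)[of 0]] rh by simp
  have "norm (contour_integral ?C (%xx. F (slice w j xx) / (xx - 0) ^ Suc k)) <= (M / rh ^ Suc k) * (2 * pi * rh)"
  proof (rule has_contour_integral_bound_circlepath[OF has_contour_integral_integral[OF Gint(2)[OF in_poly[OF w]]]])
   fix x :: complex assume "norm (x - 0) = rh"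
   hence x: "norm x = rh" by simp
   have "norm (F (slice w j x)) <= M" by (rule insert.prems(2)) (use w x in \<open>auto simp: slice_def\<close>)
   thus "norm (F (slice w j x) / (x - 0) ^ Suc k) <= M / rh ^ Suc k"
    unfolding norm_divide norm_power using x rh by (simp add: divide_right_mono del: power_Suc)
  qed (use rh M0 in auto)
  hence "norm (contour_integral ?C (%xx. F (slice w j xx) / xx ^ Suc k)) / (2 * pi) <= ((M / rh ^ Suc k) * (2 * pi * rh)) / (2 * pi)"
   by (intro divide_right_mono) simp_all
  also have "... = M / rh ^ k" using rh by simp
  finally show ?thesis unfolding G_def norm_divide by (simp add: norm_mult)
 qed
 have IH: "ALL k. EX c. (ALL al. norm (c al) <= M / rh ^ k / rh ^ (\<Sum>i\<in>I. al i)) &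
  (ALL w:polydisc rh. ((%al. (\<Prod>i\<in>I. w $ i ^ al i) * c al) has_sum G k (\<chi> i. if i : I then w $ i else 0)) (multi I))"
  by (intro allI insert.IH[OF Gsep Gb])
 from choice[OF IH] obtain c where c: "!!k al. norm (c k al) <= M / rh ^ k / rh ^ (\<Sum>i\<in>I. al i)"
  "!!k w. w : polydisc rh ==> ((%al. (\<Prod>i\<in>I. w $ i ^ al i) * c k al) has_sum G k (\<chi> i. if i : I then w $ i else 0)) (multi I)"
  by blast
 define cc where "cc = (%al. c (al j) (al(j := 0)))"
 have bcc: "norm (cc al) <= M / rh ^ (\<Sum>i\<in>insert j I. al i)" for al
 proof -
  have "(\<Sum>i\<in>I. (al(j := 0)) i) = (\<Sum>i\<in>I. al i)" using insert by (intro sum.cong) auto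
  thus ?thesis using c(1)[of "al j" "al(j := 0)"] insert by (simp add: cc_def power_add)
 qed
 have "((%al. (\<Prod>i\<in>insert j I. w $ i ^ al i) * cc al) has_sum F (\<chi> i. if i : insert j I then w $ i else 0)) (multi (insert j I))"
  if w: "w : polydisc rh" for w
 proof -
  define w1 :: "complex^'d" where "w1 = (\<chi> i. if i : insert j I then w $ i else 0)"
  define w0 :: "complex^'d" where "w0 = (\<chi> i. if i : I then w $ i else 0)"
  have w1: "w1 : polydisc r" using w rh by (auto simp: polydisc_def w1_def intro: less_trans)
  have w01: "w0 = slice w1 j 0" using insert(2) by (auto simp: w0_def w1_def slice_def vec_eq_iff)
  have wj: "norm (w $ j) < rh" using w by (simp add: polydisc_def)
  have sums: "(%k. w $ j ^ k * G k w0) sums F w1"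
  proof -
   have "(%n. (deriv ^^ n) (%u. F (slice w1 j u)) 0 / (fact n) * (w $ j - 0)^n) sums F (slice w1 j (w $ j))"
    by (rule holomorphic_power_series[OF hF[OF w1]]) (use wj rh in auto)
   moreover have "slice w1 j (w $ j) = w1" by (auto simp: slice_def w1_def vec_eq_iff)
   ultimately show ?thesis by (simp add: w01 G_slice Gder[OF w1] mult.commute)
  qed
  have q: "0 <= norm (w $ i) / rh & norm (w $ i) / rh < 1" for i using w rh by (simp add: polydisc_def)
  have summ: "(%al. (\<Prod>i\<in>insert j I. w $ i ^ al i) * cc al) summable_on multi (insert j I)"
  proof (rule abs_summable_summable, rule summable_on_comparison_test)
   show "(%al. M * (\<Prod>i\<in>insert j I. (norm (w $ i) / rh) ^ al i)) summable_on multi (insert j I)"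
    by (intro summable_on_cmult_right geometric_summable_multi q) (use insert in auto)
   fix al
   have "norm ((\<Prod>i\<in>insert j I. w $ i ^ al i) * cc al) <= (\<Prod>i\<in>insert j I. norm (w $ i) ^ al i) * (M / rh ^ (\<Sum>i\<in>insert j I. al i))"
    unfolding norm_mult prod_norm[symmetric] norm_power by (intro mult_left_mono bcc prod_nonneg) auto
   also have "... = M * (\<Prod>i\<in>insert j I. (norm (w $ i) / rh) ^ al i)"
    by (simp only: power_divide prod_dividef power_sum) simp
   finally show "norm ((\<Prod>i\<in>insert j I. w $ i ^ al i) * cc al) <= M * (\<Prod>i\<in>insert j I. (norm (w $ i) / rh) ^ al i)" .
  qed auto
  have trm: "(\<Prod>i\<in>insert j I. w $ i ^ (bt(j := k)) i) * cc (bt(j := k)) = w $ j ^ k * ((\<Prod>i\<in>I. w $ i ^ bt i) * c k bt)"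
   if "bt : multi I" for k bt
  proof -
   have "(\<Prod>i\<in>I. w $ i ^ (bt(j := k)) i) = (\<Prod>i\<in>I. w $ i ^ bt i)" using insert by (intro prod.cong) auto
   moreover have "(bt(j := k))(j := 0) = bt" using that insert(2) by (auto simp: multi_def fun_eq_iff)
   ultimately show ?thesis using insert by (simp add: cc_def)
  qed
  define g where "g = (%p. (%al. (\<Prod>i\<in>insert j I. w $ i ^ al i) * cc al) ((%(k, bt). bt(j := k)) p))"
  have "(g has_sum F w1) (UNIV \<times> multi I)"
  proof (rule has_sum_SigmaI[where g="%k. w $ j ^ k * G k w0"])
   show "((%bt. g (k, bt)) has_sum w $ j ^ k * G k w0) (multi I)" for k
   proof -
    have "((%bt. w $ j ^ k * ((\<Prod>i\<in>I. w $ i ^ bt i) * c k bt)) has_sum w $ j ^ k * G k w0) (multi I)"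
     unfolding w0_def by (rule has_sum_cmult_right[OF c(2)[OF w]])
    thus ?thesis by (rule has_sum_cong[THEN iffD1, rotated]) (simp only: g_def trm case_prod_conv)
   qed
   have w0b: "norm (w0 $ i) <= rh" for i using w rh less_imp_le by (auto simp: w0_def polydisc_def)
   have "summable (%k. norm (w $ j ^ k * G k w0))"
   proof (rule summable_comparison_test')
    show "summable (%k. M * (norm (w $ j) / rh) ^ k)" using q[of j] by (intro summable_mult summable_geometric) auto
    show "norm (norm (w $ j ^ k * G k w0)) <= M * (norm (w $ j) / rh) ^ k" for k
    proof -
     have "norm (w $ j ^ k * G k w0) <= norm (w $ j) ^ k * (M / rh ^ k)"
      unfolding norm_mult norm_power by (rule mult_left_mono[OF Gb[OF w0b]]) simp
     also have "... = M * (norm (w $ j) / rh) ^ k" by (simp only: power_divide) simp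
     finally show ?thesis by (simp only: real_norm_def abs_norm_cancel)
    qed
   qed
   thus "((%k. w $ j ^ k * G k w0) has_sum F w1) UNIV"
    by (rule norm_summable_imp_has_sum[OF _ sums])
   show "g summable_on UNIV \<times> multi I"
    unfolding g_def using summable_on_reindex_bij_betw[OF multi_insert_bij[OF insert(2)]] summ by (rule iffD2)
  qed
  thus ?thesis unfolding g_def w1_def by (rule iffD1[OF has_sum_reindex_bij_betw[OF multi_insert_bij[OF insert(2)]]])
 qed
 thus ?case using bcc by blast
qed

section \<open>The edge of the wedge\<close>

definition rc :: real where "rc = sqrt 2 - 1"

lemma rc: "0 < rc" "rc < 1" "1 / rc = sqrt 2 + 1"
proof -
 show 1: "0 < rc" by (simp add: rc_def)
 have "sqrt 2 < sqrt (2\<^sup>2)" by (simp only: real_sqrt_less_iff) simp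
 thus "rc < 1" by (simp add: rc_def)
 have "rc * (sqrt 2 + 1) = 1" by (simp add: rc_def algebra_simps)
 thus "1 / rc = sqrt 2 + 1" using 1 by (simp add: field_simps)
qed

abbreviation crc :: complex where "crc \<equiv> complex_of_real rc"

text \<open>The circle norm l = 1 is mapped by moeb w to a curve through the upper and lower half planes which
  meets the real axis for real l only, and moeb w 0 = w. For real w the same holds on all circles inside
  the disc.\<close>

definition moeb :: "complex => complex => complex" where
 "moeb w l = (w + l / crc) / (1 + crc * l * w)"

lemma moeb_denom: "norm w < 1 ==> norm l <= 1 ==> 1 - rc <= norm (1 + crc * l * w)"
proof -
 assume "norm w < 1" "norm l <= 1"
 hence "norm (crc * l * w) <= rc * 1 * 1"
  unfolding norm_mult using rc by (intro mult_mono) auto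
 thus ?thesis using norm_triangle_ineq2[of 1 "- (crc * l * w)"] by simp
qed

lemma moeb_denom_nz: "norm w < 1 ==> norm l <= 1 ==> 1 + crc * l * w ~= 0"
 using moeb_denom[of w l] rc by auto

lemma moeb_bound: assumes "norm w < 1" "norm l <= 1" shows "norm (moeb w l) < 6"
proof -
 have "norm (w + l / crc) <= norm w + norm l / rc" using norm_triangle_ineq[of w "l / crc"] rc by (simp add: norm_divide)
 also have "... < 1 + 1 / rc" using assms rc by (intro add_less_le_mono divide_right_mono) auto
 finally have n: "norm (w + l / crc) < 2 + sqrt 2" using rc by simp
 have s: "sqrt 2 < 14143 / 10000" by (rule real_less_lsqrt) (auto simp: power2_eq_square)
 have d: "2 - sqrt 2 <= norm (1 + crc * l * w)" using moeb_denom[OF assms] by (simp add: rc_def)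
 have "2 + sqrt 2 < 6 * (2 - sqrt 2)" using s by simp
 also have "... <= 6 * norm (1 + crc * l * w)" using d by simp
 finally show ?thesis using n d s unfolding moeb_def norm_divide by (simp add: divide_less_eq)
qed

lemma moeb_Im: assumes "norm w < 1" "norm l <= 1"
 shows "Im (moeb w l) * (norm (1 + crc * l * w))\<^sup>2 = Im w * (1 - (norm l)\<^sup>2) + Im l * (1 / rc - rc * (norm w)\<^sup>2)"
proof -
 have nz: "1 + crc * l * w ~= 0" by (rule moeb_denom_nz[OF assms])
 have "moeb w l * (norm (1 + crc * l * w))\<^sup>2 = (w + l / crc) * cnj (1 + crc * l * w)"
  using nz unfolding moeb_def complex_norm_square by (simp add: field_simps)
 hence "Im (moeb w l) * (norm (1 + crc * l * w))\<^sup>2 = Im ((w + l / crc) * cnj (1 + crc * l * w))"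
  by (metis Im_complex_of_real Re_complex_of_real add_0 mult.commute mult_zero_left of_real_power times_complex.sel(2) diff_zero)
 also have "... = Im w * (1 - (norm l)\<^sup>2) + Im l * (1 / rc - rc * (norm w)\<^sup>2)"
  unfolding cmod_power2 using rc(1) by (simp add: field_simps power2_eq_square)
 finally show ?thesis .
qed

lemma moeb_sgn: assumes "norm w < 1" "norm l <= 1" "norm l = 1 | Im w = 0"
 shows "sgn (Im (moeb w l)) = sgn (Im l)"
proof -
 have n: "(norm (1 + crc * l * w))\<^sup>2 > 0" using moeb_denom_nz[OF assms(1,2)] by simp
 have "rc * (norm w)\<^sup>2 < 1 / rc"
 proof -
  have "(norm w)\<^sup>2 <= 1" using assms by (simp add: power_le_one)
  hence "rc * (norm w)\<^sup>2 <= rc" using rc by (simp add: mult_left_le)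
  thus ?thesis using rc real_sqrt_ge_zero[of 2] by linarith
 qed
 hence p: "1 / rc - rc * (norm w)\<^sup>2 > 0" by simp
 have "Im (moeb w l) * (norm (1 + crc * l * w))\<^sup>2 = Im l * (1 / rc - rc * (norm w)\<^sup>2)"
  using moeb_Im[OF assms(1,2)] assms(3) by auto
 hence "sgn (Im (moeb w l)) * sgn ((norm (1 + crc * l * w))\<^sup>2) = sgn (Im l) * sgn (1 / rc - rc * (norm w)\<^sup>2)"
  by (metis sgn_mult)
 thus ?thesis using n p by (simp add: sgn_1_pos)
qed

definition tube :: "real => (complex^'d) set" where
 "tube R = {x : polydisc R. (ALL i. Im (x $ i) > 0) | (ALL i. Im (x $ i) < 0) | (ALL i. Im (x $ i) = 0)}"

definition moebv :: "complex^'d => complex => complex^'d" where "moebv w l = (\<chi> i. moeb (w $ i) l)"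

lemma moebv_tube:
 assumes "w : polydisc 1" "norm l <= 1" "norm l = 1 | (ALL i. Im (w $ i) = 0)"
 shows "moebv w l : tube 6"
  "Im l > 0 ==> Im (moebv w l $ i) > 0" "Im l < 0 ==> Im (moebv w l $ i) < 0" "Im l = 0 ==> Im (moebv w l $ i) = 0"
proof -
 have s: "sgn (Im (moebv w l $ i)) = sgn (Im l)" for i
  unfolding moebv_def using moeb_sgn[of "w $ i" l] assms by (auto simp: polydisc_def)
 show 1: "Im l > 0 ==> Im (moebv w l $ i) > 0" "Im l < 0 ==> Im (moebv w l $ i) < 0" "Im l = 0 ==> Im (moebv w l $ i) = 0" for i
  using s[of i] by (auto simp: sgn_real_def split: if_splits)
 have "moebv w l : polydisc 6" using moeb_bound assms by (auto simp: polydisc_def moebv_def)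
 thus "moebv w l : tube 6" unfolding tube_def using 1 by (cases "Im l" "0::real" rule: linorder_cases) auto
qed

lemma continuous_on_moebv [continuous_intros]:
 assumes "continuous_on S f" "continuous_on S g" "!!x. x : S ==> f x : polydisc 1" "!!x. x : S ==> norm (g x) <= 1"
 shows "continuous_on S (%x. moebv (f x) (g x))"
 unfolding moebv_def moeb_def
 by (intro continuous_on_vec_lambda continuous_intros assms(1,2)) (use moeb_denom_nz assms(3,4) rc in \<open>auto simp: polydisc_def\<close>)

lemma cholo_moebv:
 assumes "w : polydisc 1" "norm l <= 1"
 shows "cholo (moebv w) l" "cholo (%u. moebv (slice w j u) l) (w $ j)"
proof -
 have nz: "1 + crc * l * w $ i ~= 0" for i using moeb_denom_nz assms by (auto simp: polydisc_def)
 show "cholo (moebv w) l" unfolding moebv_def[abs_def] moeb_def using nz rc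
  by (intro cholos) auto
 have sl: "cholo (%u. slice w j u $ i) (w $ j)" for i
  by (cases "i = j") (auto simp: slice_def intro!: cholos)
 show "cholo (%u. moebv (slice w j u) l) (w $ j)" unfolding moebv_def[abs_def] moeb_def using nz rc
  by (intro cholos sl) auto
qed

text \<open>Rudin's discs: the boundary of the disc of moebv w lies in the two wedges and meets their edge only
  at the parameters 1 and -1. So the mean over this boundary depends holomorphically on w, also for
  w outside the wedges, and by the mean value property it equals f at the centre for real w.\<close>

locale wedge_function =
 fixes f :: "complex^'d::finite => complex"
 assumes cont: "continuous_on (tube 6) f"
  and holo: "!!x. x : tube 6 ==> (!!i. Im (x $ i) ~= 0) ==> cholo f x"
begin

definition Fext :: "complex^'d => complex" where
 "Fext w = contour_integral (linepath 0 1) (%z. f (moebv w (exp (2 * pi * \<i> * Re z))))"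

lemma norm_e: "norm (exp (2 * pi * \<i> * Re z)) = 1" by (simp add: norm_exp_eq_Re)

lemma Im_moeb_nz: "w : polydisc 1 ==> norm l = 1 ==> Im l ~= 0 ==> Im (moebv w l $ i) ~= 0"
 using moebv_tube(2,3)[of w l i] by (metis less_irrefl linorder_neqE_linordered_idom norm_ge_zero order_refl)

lemma cont_h: "continuous_on (polydisc 1 \<times> S) (%p. f (moebv (fst p) (exp (2 * pi * \<i> * Re (snd p)))))"
 by (rule continuous_on_compose2[OF cont]) (auto intro!: continuous_intros moebv_tube(1) simp: norm_e)

lemma holo_h:
 assumes w: "w : polydisc 1" and l: "norm l = 1"
 shows "(%u. f (moebv (slice w j u) l)) holomorphic_on ball 0 1"
proof (cases "Im l = 0")
 case False
 show ?thesis
 proof (rule cholo_holomorphic_on[OF open_ball])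
  fix u :: complex assume u: "u : ball 0 1"
  have w': "slice w j u : polydisc 1" by (rule slice_polydisc[OF w]) (use u in simp)
  have "cholo (%v. f (moebv (slice (slice w j u) j v) l)) (slice w j u $ j)"
  proof (rule cholo_compose[where f="%v. moebv (slice (slice w j u) j v) l" and g=f])
   show "cholo (%v. moebv (slice (slice w j u) j v) l) (slice w j u $ j)" using cholo_moebv(2)[OF w', of l j] l by simp
   show "cholo f (moebv (slice (slice w j u) j (slice w j u $ j)) l)"
    using holo[OF moebv_tube(1)[OF w']] Im_moeb_nz[OF w' l False] l by simp
  qed
  thus "cholo (%u. f (moebv (slice w j u) l)) u" by simp
 qed
next
 case True
 hence l': "l = 1 | l = -1" using l by (auto simp: cmod_def complex_eq_iff)
 have "moeb u l = l / crc" if "norm u < 1" for u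
 proof -
  have "u + l / crc = (l / crc) * (1 + crc * l * u)" using l' rc by (auto simp: field_simps)
  thus ?thesis using moeb_denom_nz[OF that, of l] l by (simp add: moeb_def)
 qed
 hence c: "moebv v l = (\<chi> i. l / crc)" if "v : polydisc 1" for v using that by (simp add: moebv_def polydisc_def)
 have "(%u. f (\<chi> i. l / crc)) holomorphic_on ball 0 1" by simp
 thus ?thesis by (rule holomorphic_transform) (metis c w dist_0_norm mem_ball slice_polydisc)
qed

lemma vd_line: "continuous_on {0..1} (%t. vector_derivative (linepath 0 (1::complex)) (at t))" by simp

lemma sephol_Fext: "sephol 1 Fext"
 unfolding sephol_def
proof (intro conjI ballI allI)
 have "continuous_on (polydisc 1 \<times> path_image (linepath 0 1)) (%(w, z). f (moebv w (exp (2 * pi * \<i> * Re z))))"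
  using cont_h by (simp add: case_prod_unfold)
 from continuous_on_contour_integral_param[OF _ vd_line this]
 show "continuous_on (polydisc 1) Fext" by (simp add: Fext_def[abs_def])
 fix w :: "complex^'d" and j assume w: "w : polydisc 1"
 have "continuous_on (ball 0 1 \<times> path_image (linepath 0 1)) (%p. (%p. f (moebv (fst p) (exp (2 * pi * \<i> * Re (snd p))))) (slice w j (fst p), snd p))"
  by (rule continuous_on_compose2[OF cont_h[of UNIV]]) (auto intro!: continuous_intros slice_polydisc w)
 hence "continuous_on (ball 0 1 \<times> path_image (linepath 0 1)) (%(u, z). f (moebv (slice w j u) (exp (2 * pi * \<i> * Re z))))"
  by (simp add: case_prod_unfold)
 from holomorphic_contour_integral_param[OF open_ball _ vd_line this holo_h[OF w norm_e]]
 show "(%u. Fext (slice w j u)) holomorphic_on ball 0 1" by (simp add: Fext_def)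
qed

lemma Fext_real:
 assumes w: "w : polydisc 1" "!!i. Im (w $ i) = 0"
 shows "Fext w = f w"
proof -
 define g where "g = (%l. f (moebv w l))"
 have cg: "continuous_on (cball 0 1) g" unfolding g_def
  by (rule continuous_on_compose2[OF cont]) (auto intro!: continuous_intros moebv_tube(1) w)
 have ch: "cholo g l" if "norm l < 1" "Im l ~= 0" for l
  unfolding g_def
 proof (rule cholo_compose[where f="moebv w" and g=f])
  show "cholo (moebv w) l" using cholo_moebv(1)[OF w(1)] that by simp
  have "Im (moebv w l $ i) ~= 0" for i
   using moebv_tube(2,3)[of w l i] that w by (metis less_irrefl less_imp_le linorder_neqE_linordered_idom)
  thus "cholo f (moebv w l)" using holo[OF moebv_tube(1)[OF w(1)]] that w by simp
 qed
 have hg: "g holomorphic_on ball 0 1"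
 proof (rule holomorphic_on_paste_across_line[where d="\<i>" and k=0, OF open_ball])
  show "continuous_on (ball 0 1) g" by (rule continuous_on_subset[OF cg]) auto
  have o: "open (ball 0 1 \<inter> {z. \<i> \<bullet> z < 0})" "open (ball 0 1 \<inter> {z. 0 < \<i> \<bullet> z})"
   by (auto intro!: open_Int open_Collect_less continuous_intros)
  show "g holomorphic_on ball 0 1 \<inter> {z. \<i> \<bullet> z < 0}" by (rule cholo_holomorphic_on[OF o(1)]) (auto intro!: ch)
  show "g holomorphic_on ball 0 1 \<inter> {z. 0 < \<i> \<bullet> z}" by (rule cholo_holomorphic_on[OF o(2)]) (auto intro!: ch)
 qed auto
 have "((%u. g u / (u - 0)) has_contour_integral (2 * of_real pi * \<i> * g 0)) (circlepath 0 1)"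
  by (rule Cauchy_integral_circlepath[OF cg hg]) simp
 from contour_integral_unique[OF this, unfolded contour_integral_integral]
 have "integral {0..1} (%t. g (circlepath 0 1 t) / circlepath 0 1 t * vector_derivative (circlepath 0 1) (at t)) = 2 * of_real pi * \<i> * g 0"
  by (simp only: diff_zero)
 moreover have "(%t. g (circlepath 0 1 t) / circlepath 0 1 t * vector_derivative (circlepath 0 1) (at t)) =
   (%t. (2 * of_real pi * \<i>) * g (exp (2 * pi * \<i> * complex_of_real t)))"
  by (simp add: fun_eq_iff vector_derivative_circlepath) (simp add: circlepath field_simps)
 ultimately have "(2 * of_real pi * \<i>) * integral {0..1} (%t. g (exp (2 * pi * \<i> * complex_of_real t))) = 2 * of_real pi * \<i> * g 0"
  by simp
 hence "integral {0..1} (%t. g (exp (2 * pi * \<i> * complex_of_real t))) = g 0" by simp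
 moreover have "Fext w = integral {0..1} (%t. g (exp (2 * pi * \<i> * complex_of_real t)))"
  unfolding Fext_def g_def contour_integral_integral by (simp add: linepath_def)
 moreover have "moebv w 0 = w" by (simp add: moebv_def moeb_def vec_eq_iff)
 ultimately show ?thesis by (simp add: g_def)
qed

theorem real_analytic: "real_analytic_on (ball 0 (1/4)) (%x. f (rv x))"
 unfolding real_analytic_on_def
proof (intro ballI exI[of _ "1/4"] conjI)
 fix a :: "real^'d" assume a: "a : ball 0 (1/4)"
 have a': "\<bar>a $ i\<bar> < 1/4" for i using a component_le_norm_cart[of a i] by simp
 define A where "A = rv a"
 have An: "norm (A $ i) < 1/4" for i using a' by (simp add: A_def of_real_vec_def)
 define F where "F = (%w. Fext (A + w))"
 have tr: "A + w : polydisc 1" if "w : polydisc (3/4)" for w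
 proof -
  have "norm (A $ i + w $ i) < 1" for i
   using that An[of i] norm_triangle_ineq[of "A $ i" "w $ i"] by (simp add: polydisc_def) (smt (verit))
  thus ?thesis by (simp add: polydisc_def)
 qed
 have sF: "sephol (3/4) F" unfolding sephol_def
 proof (intro conjI ballI allI)
  show "continuous_on (polydisc (3/4)) F" unfolding F_def
   using sephol_Fext tr by (auto simp: sephol_def intro!: continuous_intros continuous_on_compose2[of "polydisc 1" Fext])
  fix w :: "complex^'d" and j assume w: "w : polydisc (3/4)"
  have eq: "A + slice w j u = slice (A + w) j (A $ j + u)" for u by (auto simp: slice_def vec_eq_iff)
  have h: "(%u. Fext (slice (A + w) j u)) holomorphic_on ball 0 1" using sephol_Fext tr[OF w] by (simp add: sephol_def)
  have "((%u. Fext (slice (A + w) j u)) \<circ> (%u. A $ j + u)) holomorphic_on ball 0 (3/4)"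
  proof (rule holomorphic_on_compose)
   show "(+) (A $ j) holomorphic_on ball 0 (3 / 4)" by (intro holomorphic_intros)
   show "(%u. Fext (slice (A + w) j u)) holomorphic_on (+) (A $ j) ` ball 0 (3/4)"
    proof (rule holomorphic_on_subset[OF h], safe)
    fix u :: complex assume "u : ball 0 (3/4)"
    thus "A $ j + u : ball 0 1" using An[of j] norm_triangle_ineq[of "A $ j" u] by simp
   qed
  qed
  thus "(%u. F (slice w j u)) holomorphic_on ball 0 (3/4)" by (simp add: F_def eq o_def)
 qed
 define K where "K = {w :: complex^'d. ALL i. norm (w $ i) <= 1/2}"
 have "K = (\<Inter>i. {w :: complex^'d. norm (w $ i) <= 1/2})" by (auto simp: K_def)
 moreover have "closed {w :: complex^'d. norm (w $ i) <= 1/2}" for i by (intro closed_Collect_le continuous_intros)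
 ultimately have "closed K" by (simp add: closed_INT)
 moreover have "bounded K" unfolding bounded_iff
 proof (intro exI ballI)
  fix w assume "w : K"
  hence "(SU i. norm (w $ i)) <= (\<Sum>i\<in>(UNIV::'d set). 1/2)" by (intro sum_mono) (auto simp: K_def)
  thus "norm w <= (\<Sum>i\<in>(UNIV::'d set). 1/2)"
   using L2_set_le_sum_abs[of "%i. norm (w $ i)" UNIV] by (simp add: norm_vec_def)
 qed
 ultimately have "compact K" by (simp add: compact_eq_bounded_closed)
 moreover have "K <= polydisc (3/4)"
 proof
  fix x assume "x : K"
  hence "norm (x $ i) <= 1/2" for i by (simp add: K_def)
  hence "norm (x $ i) < 3/4" for i by (rule le_less_trans) simp
  thus "x : polydisc (3/4)" by (simp add: polydisc_def)
 qed
 ultimately have "compact (F ` K)"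
  using sF by (auto simp: sephol_def intro!: compact_continuous_image intro: continuous_on_subset)
 then obtain M where M: "!!w. w : K ==> norm (F w) <= M" using compact_imp_bounded bounded_iff by (metis imageI)
 have "EX c. (ALL al. norm (c al) <= M / (1/2) ^ (SU i. al i)) &
  (ALL w:polydisc (1/2). ((%al. (\<Prod>i\<in>UNIV. w $ i ^ al i) * c al) has_sum F (\<chi> i. if i : UNIV then w $ i else 0)) (multi UNIV))"
  by (rule power_series_multi[OF _ _ _ sF]) (auto simp: K_def intro!: M)
 then obtain c where c: "!!w. w : polydisc (1/2) ==> ((%al. (\<Prod>i\<in>UNIV. w $ i ^ al i) * c al) has_sum F (\<chi> i. if i : UNIV then w $ i else 0)) (multi UNIV)"
  by blast
 show "EX c. ALL x:ball a (1/4). ((%al. (\<Prod>i\<in>UNIV. (x $ i - a $ i) ^ al i) .* c al) has_sum f (rv x)) UNIV"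
 proof (intro exI[of _ c] ballI)
  fix x assume x: "x : ball a (1/4)"
  have xi: "\<bar>x $ i - a $ i\<bar> < 1/4" for i using x component_le_norm_cart[of "x - a" i] by (simp add: dist_norm norm_minus_commute)
  have "\<bar>x $ i - a $ i\<bar> < 1/2" for i using xi[of i] by linarith
  hence w: "rv (x - a) : polydisc (1/2)"
   by (simp only: polydisc_def of_real_vec_def vec_lambda_beta vector_minus_component norm_of_real mem_Collect_eq) simp
  have s: "A + rv (x - a) = rv x" by (simp add: A_def of_real_vec_def vec_eq_iff)
  have "\<bar>x $ i\<bar> < 1" for i using xi[of i] a'[of i] by linarith
  hence x1: "rv x : polydisc 1" by (simp add: polydisc_def of_real_vec_def)
  have "(%al. (\<Prod>i\<in>UNIV. (x $ i - a $ i) ^ al i) .* c al) = (%al. (\<Prod>i\<in>UNIV. rv (x - a) $ i ^ al i) * c al)"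
   by (simp add: of_real_vec_def fun_eq_iff scaleR_conv_of_real)
  moreover have "F (\<chi> i. if i : UNIV then rv (x - a) $ i else 0) = f (rv x)"
   using Fext_real[OF x1] by (simp add: F_def s of_real_vec_def[of x])
  ultimately show "((%al. (\<Prod>i\<in>UNIV. (x $ i - a $ i) ^ al i) .* c al) has_sum f (rv x)) UNIV"
   using c[OF w] by (simp add: multi_def)
 qed
qed simp

end

section \<open>Complex vector fields\<close>

definition vf :: "('e => 'e) => ('e => 'e) => ('e::real_normed_vector => complex) => 'e => complex" where
 "vf p q f e = FD f e (p e) + \<i> * FD f e (q e)"

lemma FD_linear_compose: "bounded_linear l ==> f differentiable (at x) ==> FD (%x. l (f x)) x v = l (FD f x v)"
 using FD_eq[OF bounded_linear.has_derivative[OF _ FD_works]] by metis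

lemma FD_bounded_linear: "bounded_linear l ==> FD l x v = l v"
 using FD_eq[OF bounded_linear_imp_has_derivative] by metis

lemma FD_cnj: "f differentiable (at x) ==> FD (%x. cnj (f x)) x v = cnj (FD f x v)"
 by (rule FD_linear_compose[OF bounded_linear_cnj])

lemma FD_mult: "f differentiable (at x) ==> g differentiable (at x) ==>
 FD (%x. f x * g x :: complex) x v = f x * FD g x v + FD f x v * g x"
 by (rule bounded_bilinear.FD_bilinear[OF bounded_bilinear_mult])

lemma vf_const [simp]: "vf p q (%x. c) e = 0" by (simp add: vf_def)
lemma vf_add: "f differentiable (at e) ==> g differentiable (at e) ==> vf p q (%x. f x + g x) e = vf p q f e + vf p q g e"
 by (simp add: vf_def FD_add algebra_simps)
lemma vf_mult: "f differentiable (at e) ==> g differentiable (at e) ==> vf p q (%x. f x * g x) e = f e * vf p q g e + g e * vf p q f e"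
 by (simp add: vf_def FD_mult algebra_simps)
lemma vf_cmult: "f differentiable (at e) ==> vf p q (%x. c * f x) e = c * vf p q f e"
 using vf_mult[of "%_. c" e f p q] by simp
lemma vf_uminus: "f differentiable (at e) ==> vf p q (%x. - f x) e = - vf p q f e"
 using vf_cmult[of f e p q "-1"] by simp
lemma vf_diff: "f differentiable (at e) ==> g differentiable (at e) ==> vf p q (%x. f x - g x) e = vf p q f e - vf p q g e"
 using vf_add[of f e "%x. - g x" p q] by (simp add: vf_uminus)
lemma vf_sum: "(!!i. i : I ==> f i differentiable (at e)) ==> vf p q (%x. \<Sum>i\<in>I. f i x) e = (\<Sum>i\<in>I. vf p q (f i) e)"
 by (induction I rule: infinite_finite_induct) (auto simp: vf_add)
lemma vf_cnj: "f differentiable (at e) ==> vf p q (%x. cnj (f x)) e = cnj (vf p (%e. - q e) f e)"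
 using bounded_linear.linear[OF FD_linear, of f e]
 by (simp add: vf_def FD_cnj linear_neg)
lemma vf_cong: "open S ==> e : S ==> (!!x. x : S ==> f x = g x) ==> vf p q f e = vf p q g e"
 unfolding vf_def using FD_cong[of S e f g] by simp

lemma smooth_on_inner [smooths]: "smooth_on S f ==> open S ==> smooth_on S (%x. f x \<bullet> c)"
 by (rule smooth_linear_compose[OF bounded_linear_inner_left])

lemma smooth_on_FD_field:
 fixes f :: "'e::euclidean_space => 'b::real_normed_vector"
 assumes "open S" "smooth_on S f" "smooth_on S p" shows "smooth_on S (%e. FD f e (p e))"
proof -
 have "smooth_on S (%e. SB i. (p e \<bullet> i) .* FD f e i)"
  by (intro smooths assms smooth_on_FD)
 thus ?thesis
  by (subst smooth_on_cong[OF assms(1), where g="%e. SB i. (p e \<bullet> i) .* FD f e i"])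
   (use assms in \<open>auto intro!: FD_basis_expand smooth_diff\<close>)
qed

lemma smooth_on_vf:
 fixes f :: "'e::euclidean_space => complex"
 shows "open S ==> smooth_on S f ==> smooth_on S p ==> smooth_on S q ==> smooth_on S (vf p q f)"
 unfolding vf_def[abs_def] by (intro smooths smooth_on_FD_field)

lemma FD_FD_field:
 fixes f :: "'e::euclidean_space => complex"
 assumes S: "open S" "smooth_on S f" "smooth_on S p" "e : S"
 shows "FD (%x. FD f x (p x)) e v = FD (%x. FD f x (p e)) e v + FD f e (FD p e v)"
proof -
 have sL: "smooth_on S (FDL f)" by (rule smooth_on_FDL[OF S(1,2)])
 have d: "FDL f differentiable (at e)" "p differentiable (at e)" using smooth_diff sL S by blast+
 have ap: "blinfun_apply (FDL f x) u = FD f x u" if "x : S" for x u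
  by (rule FDL_apply[OF smooth_diff[OF S(2) that]])
 have *: "FD (%x. FD f x (r x)) e v = FDL f e (FD r e v) + (FD (FDL f) e v) (r e)" if "r differentiable (at e)" for r
 proof -
  have "FD (%x. FD f x (r x)) e v = FD (%x. blinfun_apply (FDL f x) (r x)) e v"
   using FD_cong[OF S(1,4), of "%x. FD f x (r x)" "%x. blinfun_apply (FDL f x) (r x)"] ap by simp
  thus ?thesis using bounded_bilinear.FD_bilinear[OF bounded_bilinear_blinfun_apply d(1) that] by simp
 qed
 have "FDL f e 0 = 0" by (simp add: blinfun.zero_right)
 thus ?thesis using *[OF d(2)] *[of "%x. p e"] ap[OF S(4)] by simp
qed

text \<open>The second derivatives cancel, by their symmetry.\<close>

lemma vf_bracket:
 fixes e :: "'e::euclidean_space"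
 assumes S: "open S" "e : S" and pq: "smooth_on S p" "smooth_on S q" "smooth_on S p'" "smooth_on S q'"
 shows "EX P Q. ALL f. smooth_on S f -->
  vf p q (vf p' q' f) e - vf p' q' (vf p q f) e = FD f e P + \<i> * FD f e Q"
proof (intro exI allI impI)
 fix f :: "'e => complex" assume f: "smooth_on S f"
 interpret linear "FD f e" using FD_linear[OF smooth_diff[OF f S(2)]] by (rule bounded_linear.linear)
 have D: "FD (vf a b f) e v = FD (%x. FD f x (a e)) e v + FD f e (FD a e v) + \<i> * (FD (%x. FD f x (b e)) e v + FD f e (FD b e v))"
  if "smooth_on S a" "smooth_on S b" for a b v
 proof -
  have "(%x. FD f x (a x)) differentiable (at e)" "(%x. FD f x (b x)) differentiable (at e)"
   using that f S smooth_on_FD_field smooth_diff by blast+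
  thus ?thesis unfolding vf_def[abs_def]
   using FD_FD_field[OF S(1) f that(1) S(2)] FD_FD_field[OF S(1) f that(2) S(2)]
   by (subst FD_add) (auto simp: FD_mult intro: differentiable_mult)
 qed
 have sy: "FD (%x. FD f x u) e v = FD (%x. FD f x v) e u" for u v by (rule second_sym[OF S(1) f S(2)])
 show "vf p q (vf p' q' f) e - vf p' q' (vf p q f) e =
  FD f e (FD p' e (p e) - FD q' e (q e) - FD p e (p' e) + FD q e (q' e)) +
  \<i> * FD f e (FD q' e (p e) + FD p' e (q e) - FD q e (p' e) - FD p e (q' e))"
  unfolding vf_def[of p q "vf p' q' f"] vf_def[of p' q' "vf p q f"]
  using sy[of "p e" "p' e"] sy[of "p e" "q' e"] sy[of "q e" "p' e"] sy[of "q e" "q' e"]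
  by (simp add: D pq add diff algebra_simps)
qed

section \<open>Holomorphic functions on one side\<close>

text \<open>Functions which are holomorphic in P and smooth in a neighbourhood W of its closure. The values off the
  closure of P are an arbitrary extension; by continuity the derivative is complex linear also at the
  boundary points (cholo_closure).\<close>

definition hol_side :: "'a::complex_space set => 'a set => ('a => complex) => bool" where
 "hol_side W P a \<longleftrightarrow> smooth_on W a & (ALL x:P. cholo a x)"

lemma hol_side_FD:
 assumes "open W" "open P" "P <= W" "hol_side W P a"
 shows "hol_side W P (%x. FD a x v)"
 unfolding hol_side_def
proof (intro conjI ballI)
 have a: "smooth_on W a" and c: "!!x. x : P ==> cholo a x" using assms by (auto simp: hol_side_def)
 show "smooth_on W (%x. FD a x v)" by (rule smooth_on_FD[OF a])
 fix x assume x: "x : P"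
 have d: "(%y. FD a y w) differentiable (at x)" for w
  using smooth_diff[OF smooth_on_FD[OF a]] x assms(3) by blast
 have sP: "smooth_on P a" by (rule smooth_on_subset[OF a assms(3)])
 have "FD (%y. FD a y v) x (imul u) = imul (FD (%y. FD a y v) x u)" for u
 proof -
  have "FD (%y. FD a y v) x (imul u) = FD (%y. FD a y (imul u)) x v"
   by (rule second_sym[OF assms(2) sP x])
  also have "... = FD (%y. \<i> * FD a y u) x v"
   using FD_cong[OF assms(2) x, of "%y. FD a y (imul u)" "%y. \<i> * FD a y u"] c by (simp add: cholo_imul)
  also have "... = \<i> * FD (%y. FD a y u) x v" using d by (simp add: FD_mult)
  finally show ?thesis using second_sym[OF assms(2) sP x, of u v] by simp
 qed
 thus "cholo (%x. FD a x v) x" using d by (simp add: cholo_def)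
qed

lemma cholo_closure:
 fixes a :: "'a::complex_space => complex"
 assumes "open W" "P <= W" "hol_side W P a" "x : W" "x : closure P"
 shows "cholo a x"
proof -
 have a: "smooth_on W a" and c: "!!x. x : P ==> cholo a x" using assms by (auto simp: hol_side_def)
 have "FD a x (imul v) - imul (FD a x v) = 0" for v
 proof -
  have "continuous_on W (%y. FD a y (imul v) - imul (FD a y v))"
   unfolding imul_complex by (intro continuous_intros smooth_cont[OF smooth_on_FD[OF a]])
  hence c': "isCont (%y. FD a y (imul v) - imul (FD a y v)) x" using assms continuous_on_eq_continuous_at by blast
  from closure_sequential[THEN iffD1, OF assms(5)] obtain y where y: "!!n. y n : P" "y \<longlonglongrightarrow> x" by blast
  have "FD a (y n) (imul v) - imul (FD a (y n) v) = 0" for n using cholo_imul[OF c[OF y(1)]] by simp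
  with isCont_tendsto_compose[OF c' y(2)] have "(%n. 0) \<longlonglongrightarrow> FD a x (imul v) - imul (FD a x v)" by (simp only:)
  thus ?thesis using LIMSEQ_unique[OF tendsto_const] by metis
 qed
 thus ?thesis using smooth_diff[OF a assms(4)] by (simp add: cholo_def)
qed

named_theorems hol_sides

lemma hol_side_const [hol_sides]: "hol_side W P (%x. c)" by (simp add: hol_side_def smooths cholos)
lemma hol_side_add [hol_sides]: "open W ==> hol_side W P a ==> hol_side W P b ==> hol_side W P (%x. a x + b x)"
 by (simp add: hol_side_def smooths cholos)
lemma hol_side_mult [hol_sides]: "open W ==> hol_side W P a ==> hol_side W P b ==> hol_side W P (%x. a x * b x)"
 by (simp add: hol_side_def smooths cholos)
lemma hol_side_minus [hol_sides]: "open W ==> hol_side W P a ==> hol_side W P (%x. - a x)"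
 by (simp add: hol_side_def smooths cholos)
lemma hol_side_diff [hol_sides]: "open W ==> hol_side W P a ==> hol_side W P b ==> hol_side W P (%x. a x - b x)"
 by (simp add: hol_side_def smooths cholos)
lemma hol_side_sum [hol_sides]: "open W ==> (!!i. i : I ==> hol_side W P (a i)) ==> hol_side W P (%x. \<Sum>i\<in>I. a i x)"
 unfolding hol_side_def by (intro conjI ballI smooths cholos) auto
lemma hol_side_divide_const [hol_sides]: "open W ==> hol_side W P a ==> hol_side W P (%x. a x / c)"
 using hol_side_mult[OF _ _ hol_side_const, of W P a "inverse c"] by (simp add: divide_inverse)

lemma hol_side_linear: "bounded_linear l ==> (!!v. l (imul v) = imul (l v)) ==> hol_side W P l"
 by (simp add: hol_side_def smooth_on_linear cholo_linear)

section \<open>Derivation of a determinant\<close>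

definition replace_row :: "'a^'n^'n => 'n => 'a^'n => 'a^'n^'n" where
 "replace_row M k r = (\<chi> i. if i = k then r else M $ i)"

lemma sum_permutes_factor: "(\<Prod>i\<in>UNIV. replace_row M k r $ i $ p i) = r $ p k * (\<Prod>i\<in>UNIV - {k}. M $ i $ p i)"
 for M :: "complex^'n^'n"
proof -
 have "(\<Prod>i\<in>UNIV. replace_row M k r $ i $ p i) = replace_row M k r $ k $ p k * (\<Prod>i\<in>UNIV - {k}. replace_row M k r $ i $ p i)"
  by (rule prod.remove) auto
 also have "(\<Prod>i\<in>UNIV - {k}. replace_row M k r $ i $ p i) = (\<Prod>i\<in>UNIV - {k}. M $ i $ p i)"
  by (rule prod.cong) (auto simp: replace_row_def)
 finally show ?thesis by (simp add: replace_row_def)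
qed

lemma vf_prod:
 fixes f :: "'i => 'e::real_normed_vector => complex"
 assumes "finite I" "!!i. i : I ==> f i differentiable (at e)"
 shows "(%x. \<Prod>i\<in>I. f i x) differentiable (at e) & vf p q (%x. \<Prod>i\<in>I. f i x) e = (\<Sum>k\<in>I. vf p q (f k) e * (\<Prod>i\<in>I - {k}. f i e))"
 using assms
proof (induction I rule: finite_induct)
 case (insert j I)
 have "(\<Sum>k\<in>I. vf p q (f k) e * (\<Prod>i\<in>insert j I - {k}. f i e)) = (\<Sum>k\<in>I. f j e * (vf p q (f k) e * (\<Prod>i\<in>I - {k}. f i e)))"
 proof (rule sum.cong)
  fix k assume k: "k : I"
  hence "insert j I - {k} = insert j (I - {k})" using insert by auto
  thus "vf p q (f k) e * (\<Prod>i\<in>insert j I - {k}. f i e) = f j e * (vf p q (f k) e * (\<Prod>i\<in>I - {k}. f i e))"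
   using insert by simp
 qed simp
 moreover have "insert j I - {j} = I" using insert by auto
 ultimately show ?case using insert by (simp add: vf_mult sum_distrib_left differentiable_mult mult.commute)
qed simp

lemma vf_det:
 fixes M :: "'n::finite => 'n => 'e::real_normed_vector => complex"
 assumes M: "!!i j. M i j differentiable (at e)"
 shows "(%x. det (\<chi> i j. M i j x)) differentiable (at e)"
  "vf p q (%x. det (\<chi> i j. M i j x)) e =
  (SU k. det (replace_row (\<chi> i j. M i j e) k (\<chi> j. vf p q (M k j) e)))"
proof -
 have P: "(%x. \<Prod>i\<in>UNIV. M i (sg i) x) differentiable (at e)"
  "vf p q (%x. \<Prod>i\<in>UNIV. M i (sg i) x) e = (SU k. vf p q (M k (sg k)) e * (\<Prod>i\<in>UNIV - {k}. M i (sg i) e))" for sg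
  using vf_prod[of UNIV "%i. M i (sg i)" e p q] M by auto
 have dm: "(%x. c * (\<Prod>i\<in>UNIV. M i (sg i) x)) differentiable (at e)" for c sg
  using P(1)[of sg] by (intro differentiable_mult) auto
 show "(%x. det (\<chi> i j. M i j x)) differentiable (at e)"
  unfolding det_def by (intro differentiable_sum) (auto simp: dm P)
 have "vf p q (%x. det (\<chi> i j. M i j x)) e =
  (\<Sum>sg\<in>{sg. sg permutes UNIV}. of_int (sign sg) * (SU k. vf p q (M k (sg k)) e * (\<Prod>i\<in>UNIV - {k}. M i (sg i) e)))"
  unfolding det_def by (subst vf_sum) (auto simp: dm vf_cmult P)
 also have "... = (SU k. det (replace_row (\<chi> i j. M i j e) k (\<chi> j. vf p q (M k j) e)))"
  unfolding det_def sum_permutes_factor sum_distrib_left by (subst sum.swap) (simp add: mult.assoc)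
 finally show "vf p q (%x. det (\<chi> i j. M i j x)) e =
  (SU k. det (replace_row (\<chi> i j. M i j e) k (\<chi> j. vf p q (M k j) e)))" .
qed

lemma det_replace_row_combination:
 fixes M :: "complex^'n::finite^'n"
 shows "det (replace_row M k (SU m. a m *s M $ m)) = a k * det M"
proof -
 have "det (replace_row M k (SU m. a m *s M $ m)) = (SU m. det (replace_row M k (a m *s M $ m)))"
  unfolding replace_row_def by (rule det_linear_row_sum) simp
 also have "... = (SU m. if m = k then a k * det M else 0)"
 proof (rule sum.cong)
  fix m
  have "det (replace_row M k (a m *s M $ m)) = a m * det (replace_row M k (M $ m))"
   unfolding replace_row_def by (rule det_row_mul)
  moreover have "det (replace_row M k (M $ m)) = 0" if "m ~= k"
   by (rule det_identical_rows[OF that]) (use that in \<open>auto simp: row_def replace_row_def\<close>)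
  moreover have "replace_row M k (M $ k) = M" by (simp add: replace_row_def vec_eq_iff)
  ultimately show "det (replace_row M k (a m *s M $ m)) = (if m = k then a k * det M else 0)" by auto
 qed simp
 finally show ?thesis by simp
qed

text \<open>Jacobi's formula for a derivation of a matrix.\<close>

lemma vf_det_logarithmic:
 fixes M :: "'n::finite => 'n => 'e::real_normed_vector => complex"
 assumes M: "!!i j. M i j differentiable (at e)"
  and A: "!!i j. vf p q (M i j) e = (SU m. A i m * M m j e)"
 shows "vf p q (%x. det (\<chi> i j. M i j x)) e = (SU k. A k k) * det (\<chi> i j. M i j e)"
proof -
 have "(\<chi> j. vf p q (M k j) e) = (SU m. A k m *s (\<chi> i j. M i j e) $ m)" for k
  by (simp add: vec_eq_iff A sum_component)
 thus ?thesis by (simp only: vf_det(2)[OF M] det_replace_row_combination sum_distrib_right)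
qed

section \<open>The CR structure of a graph\<close>

type_synonym 'n omat = "complex^('n option option)^('n option option)"

text \<open>The hypersurface w = s + i ph over the coordinates (Z, s). The fields L i are of type (1,0) with L i z j = delta,
  the field T is normalized by T wb = 1 and T z = 0, and kap is its remaining invariant, kap = - T w; it
  measures by how much T fails to be real (T_cnj). With these choices L i commutes with T, and La is the
  Levi form.\<close>

locale cr_graph =
 fixes B :: "((complex^'n::finite) \<times> real) set" and ph :: "(complex^'n) \<times> real => real"
 assumes openB: "open B" and sphi: "smooth_on B ph"
begin

definition "w e = of_real (snd e) + \<i> * of_real (ph e)"
definition "wb e = of_real (snd e) - \<i> * of_real (ph e)"
definition "z j e = (fst e $ j :: complex)"
definition "phs e = FD ph e (0, 1)"
definition "phz i e = (of_real (FD ph e (axis i 1, 0)) - \<i> * of_real (FD ph e (axis i \<i>, 0))) / 2"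
definition "ch e = 1 / (1 - \<i> * of_real (phs e))"
definition "kap e = - (1 + \<i> * of_real (phs e)) * ch e"
definition "ze i e = 2 * \<i> * phz i e * ch e"
definition "pL i e = (axis i (1/2) :: complex^'n, Re (ze i e) / 2)"
definition "qL i e = (axis i (- \<i>/2) :: complex^'n, Im (ze i e) / 2)"
definition "L i = vf (pL i) (qL i)"
definition "Lb i = vf (pL i) (%e. - qL i e)"
definition "pT e = (0 :: complex^'n, Re (ch e))"
definition "qT e = (0 :: complex^'n, Im (ch e))"
definition "T = vf pT qT"
definition "ds f e = (FD f e (0, 1) :: complex)"
definition "La i j e = L i (%e. cnj (ze j e)) e"

lemma den_nz: "1 - \<i> * of_real (phs e) ~= 0" "1 + \<i> * of_real (phs e) ~= 0"
 by (auto simp: complex_eq_iff)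
lemma ch_nz: "ch e ~= 0" by (simp add: ch_def den_nz)
lemma kap_nz: "kap e ~= 0" by (simp add: kap_def ch_nz den_nz)
lemma ch_den: "ch e * (1 - \<i> * of_real (phs e)) = 1" by (simp add: ch_def den_nz)
lemma kap_quot: "kap e = - ((1 + \<i> * of_real (phs e)) / (1 - \<i> * of_real (phs e)))"
 unfolding kap_def ch_def by (simp only: times_divide_eq_right mult_1_right minus_divide_left[symmetric])
lemma cnj_kap_quot: "cnj (kap e) = - ((1 - \<i> * of_real (phs e)) / (1 + \<i> * of_real (phs e)))"
 unfolding kap_quot by (simp only: complex_cnj_minus complex_cnj_divide complex_cnj_add complex_cnj_diff complex_cnj_mult
   complex_cnj_complex_of_real complex_cnj_i complex_cnj_one mult_minus_left diff_minus_eq_add add_uminus_conv_diff)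
lemma kap_cnj: "kap e * cnj (kap e) = 1"
proof -
 have "- (a / b) * - (b / a) = 1" if "a ~= 0" "b ~= 0" for a b :: complex using that by (simp only: minus_mult_minus) simp
 from this[OF den_nz(2)[of e] den_nz(1)[of e]] show ?thesis unfolding cnj_kap_quot unfolding kap_quot .
qed
lemma ch_kap: "cnj (ch e) = - cnj (kap e) * ch e"
proof -
 have *: "1 / a = - (- (b / a)) * (1 / b)" if "b ~= 0" for a b :: complex using that by simp
 have "cnj (ch e) = 1 / (1 + \<i> * of_real (phs e))" by (simp add: ch_def)
 thus ?thesis using *[OF den_nz(1)] unfolding cnj_kap_quot by (simp only: ch_def)
qed

lemma smooth_phs: "smooth_on B phs" unfolding phs_def[abs_def] by (intro smooth_on_FD sphi)
lemma smooth_ch [smooths]: "smooth_on B ch"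
 unfolding ch_def[abs_def] by (intro smooths openB smooth_phs) (simp add: den_nz)
lemma smooth_kap [smooths]: "smooth_on B kap"
 unfolding kap_def[abs_def] by (intro smooths openB smooth_phs)
lemma smooth_ze [smooths]: "smooth_on B (ze i)"
 unfolding ze_def[abs_def] phz_def[abs_def] by (intro smooths openB smooth_on_FD sphi) simp_all
lemma smooth_w [smooths]: "smooth_on B w" "smooth_on B wb"
 unfolding w_def[abs_def] wb_def[abs_def] by (intro smooths openB sphi)+
lemma smooth_z [smooths]: "smooth_on B (z j)"
 unfolding z_def[abs_def] by (intro smooths openB)
lemma smooth_pq: "smooth_on B (pL i)" "smooth_on B (qL i)" "smooth_on B (%e. - qL i e)" "smooth_on B pT" "smooth_on B qT"
 unfolding pL_def[abs_def] qL_def[abs_def] pT_def[abs_def] qT_def[abs_def]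
 by (intro smooths openB; simp)+
lemma smooth_L [smooths]: "smooth_on B f ==> smooth_on B (L i f)" "smooth_on B f ==> smooth_on B (Lb i f)" "smooth_on B f ==> smooth_on B (T f)"
 unfolding L_def Lb_def T_def by (intro smooth_on_vf openB smooth_pq; assumption)+
lemma smooth_La [smooths]: "smooth_on B (La i j)"
 unfolding La_def[abs_def] by (intro smooths openB)

lemma dB: "smooth_on B f ==> e : B ==> f differentiable (at e)" by (rule smooth_diff)

lemma L_cnj: "f differentiable (at e) ==> L i (%e. cnj (f e)) e = cnj (Lb i f e)"
 "f differentiable (at e) ==> Lb i (%e. cnj (f e)) e = cnj (L i f e)"
 by (simp_all add: L_def Lb_def vf_cnj)

lemma T_ds: "f differentiable (at e) ==> T f e = ch e * ds f e"
proof -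
 assume d: "f differentiable (at e)"
 interpret linear "FD f e" using FD_linear[OF d] by (rule bounded_linear.linear)
 have r: "FD f e (0, r) = of_real r * ds f e" for r
  using scale[of r "(0, 1)"] by (simp add: scaleR_conv_of_real ds_def)
 have "T f e = (of_real (Re (ch e)) + \<i> * of_real (Im (ch e))) * ds f e"
  unfolding T_def vf_def pT_def qT_def r by (simp only: distrib_right mult.assoc)
 thus ?thesis by (simp only: complex_eq[symmetric])
qed

lemma T_cnj: "f differentiable (at e) ==> T (%e. cnj (f e)) e = - kap e * cnj (T f e)"
proof -
 assume d: "f differentiable (at e)"
 have d': "(%e. cnj (f e)) differentiable (at e)"
  using bounded_linear.has_derivative[OF bounded_linear_cnj FD_works[OF d]] differentiable_def by blast
 have "cnj (ds f e) = ds (%e. cnj (f e)) e" by (simp add: ds_def FD_cnj[OF d])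
 moreover have "kap e * cnj (ch e) = - ch e"
  using kap_cnj[of e] unfolding ch_kap by (simp add: algebra_simps)
 ultimately show ?thesis by (simp add: T_ds[OF d] T_ds[OF d'] mult.assoc[symmetric])
qed

lemma FD_z: "FD (z j) e v = fst v $ j"
 unfolding z_def[abs_def] by (intro FD_bounded_linear bounded_linear_compose[OF bounded_linear_vec_nth bounded_linear_fst])

lemma FD_zb: "FD (%e. cnj (z j e)) e v = cnj (fst v $ j)"
 using FD_cnj[of "z j" e v] FD_z[of j e v] smooth_diff[of UNIV "z j" e]
 by (simp add: z_def[abs_def] smooth_on_linear bounded_linear_compose[OF bounded_linear_vec_nth bounded_linear_fst])

lemma FD_w: assumes "e : B"
 shows "FD w e v = of_real (snd v) + \<i> * of_real (FD ph e v)" "FD wb e v = of_real (snd v) - \<i> * of_real (FD ph e v)"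
proof -
 have d: "(ph has_derivative FD ph e) (at e)" by (rule smooth_on_has_derivative[OF sphi assms])
 have d': "((%e. of_real (ph e)) has_derivative (%v. complex_of_real (FD ph e v))) (at e)"
  by (rule bounded_linear.has_derivative[OF bounded_linear_of_real d])
 have s': "((%e. of_real (snd e)) has_derivative (%v. complex_of_real (snd v))) (at e)"
  by (rule bounded_linear.has_derivative[OF bounded_linear_of_real has_derivative_snd[OF has_derivative_ident]])
 have "(w has_derivative (%v. of_real (snd v) + \<i> * of_real (FD ph e v))) (at e)"
  unfolding w_def[abs_def] by (rule has_derivative_add[OF s' has_derivative_mult_right[OF d']])
 thus "FD w e v = of_real (snd v) + \<i> * of_real (FD ph e v)" by (simp only: FD_eq)
 have "(wb has_derivative (%v. of_real (snd v) - \<i> * of_real (FD ph e v))) (at e)"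
  unfolding wb_def[abs_def] by (rule has_derivative_diff[OF s' has_derivative_mult_right[OF d']])
 thus "FD wb e v = of_real (snd v) - \<i> * of_real (FD ph e v)" by (simp only: FD_eq)
qed

lemma FD_ph_pq: assumes "e : B"
 shows "of_real (FD ph e (pL i e)) + \<i> * of_real (FD ph e (qL i e)) = phz i e + ze i e / 2 * phs e"
proof -
 interpret linear "FD ph e" using FD_linear[OF dB[OF sphi assms]] by (rule bounded_linear.linear)
 have "pL i e = (1/2) .* (axis i 1, 0) + (Re (ze i e) / 2) .* (0, 1)" "qL i e = (-1/2) .* (axis i \<i>, 0) + (Im (ze i e) / 2) .* (0, 1)"
  by (auto simp: pL_def qL_def vec_eq_iff axis_def complex_eq_iff)
 hence "FD ph e (pL i e) = 1/2 * FD ph e (axis i 1, 0) + Re (ze i e) / 2 * phs e"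
  "FD ph e (qL i e) = -1/2 * FD ph e (axis i \<i>, 0) + Im (ze i e) / 2 * phs e"
  by (simp_all only: add scale phs_def) simp_all
 thus ?thesis by (simp only: phz_def) (simp add: complex_eq_iff algebra_simps)
qed

lemma L_coord:
 "L i (z j) e = (if i = j then 1 else 0)" "L i (%e. cnj (z j e)) e = 0"
 "Lb i (z j) e = 0" "Lb i (%e. cnj (z j e)) e = (if i = j then 1 else 0)"
 "T (z j) e = 0" "T (%e. cnj (z j e)) e = 0"
 by (auto simp: L_def Lb_def T_def vf_def FD_z FD_zb pL_def qL_def pT_def qT_def axis_def)

lemma L_w: assumes "e : B"
 shows "L i w e = ze i e" "L i wb e = 0" "Lb i w e = 0" "Lb i wb e = cnj (ze i e)" "T w e = - kap e" "T wb e = 1"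
proof -
 have z2: "ze i e / 2 * (1 - \<i> * phs e) = \<i> * phz i e"
  using ch_den[of e] by (simp only: ze_def) (simp add: mult.assoc)
 have sn: "of_real (snd (pL i e)) + \<i> * of_real (snd (qL i e)) = ze i e / 2"
  by (simp add: pL_def qL_def complex_eq_iff)
 have "L i wb e = (of_real (snd (pL i e)) + \<i> * of_real (snd (qL i e))) - \<i> * (of_real (FD ph e (pL i e)) + \<i> * of_real (FD ph e (qL i e)))"
  by (simp add: L_def vf_def FD_w[OF assms] algebra_simps)
 also have "... = ze i e / 2 * (1 - \<i> * phs e) - \<i> * phz i e" unfolding sn FD_ph_pq[OF assms] by (simp add: algebra_simps)
 finally show 1: "L i wb e = 0" using z2 by simp
 have "L i w e = (of_real (snd (pL i e)) + \<i> * of_real (snd (qL i e))) + \<i> * (of_real (FD ph e (pL i e)) + \<i> * of_real (FD ph e (qL i e)))"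
  by (simp add: L_def vf_def FD_w[OF assms] algebra_simps)
 also have "... = ze i e / 2 * (1 + \<i> * phs e) + \<i> * phz i e" unfolding sn FD_ph_pq[OF assms] by (simp add: algebra_simps)
 also have "... = ze i e / 2 * (1 + \<i> * phs e) + ze i e / 2 * (1 - \<i> * phs e)" by (simp only: z2)
 finally show 2: "L i w e = ze i e" by (simp add: distrib_left right_diff_distrib)
 have wbw: "wb = (%e. cnj (w e))" "w = (%e. cnj (wb e))" by (auto simp: w_def wb_def fun_eq_iff)
 show "Lb i w e = 0" using L_cnj(2)[OF dB[OF smooth_w(2) assms], of i] 1 wbw(2) by simp
 show "Lb i wb e = cnj (ze i e)" using L_cnj(2)[OF dB[OF smooth_w(1) assms], of i] 2 wbw(1) by simp
 have "ds w e = 1 + \<i> * phs e" "ds wb e = 1 - \<i> * phs e" by (simp_all add: ds_def FD_w[OF assms] phs_def)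
 thus "T w e = - kap e" "T wb e = 1"
  using ch_den[of e] by (simp_all only: T_ds[OF dB[OF smooth_w(1) assms]] T_ds[OF dB[OF smooth_w(2) assms]] kap_def) (simp add: algebra_simps)
qed

text \<open>A complex vector field is determined by its values on the coordinates, and one which kills
 the z and their conjugates by its value on the conjugate of w.\<close>

lemma commutator:
 assumes e: "e : B" and pq: "smooth_on B p" "smooth_on B q" "smooth_on B p'" "smooth_on B q'"
  and z: "!!j. vf p q (vf p' q' (z j)) e = vf p' q' (vf p q (z j)) e"
   "!!j. vf p q (vf p' q' (%e. cnj (z j e))) e = vf p' q' (vf p q (%e. cnj (z j e))) e"
  and f: "smooth_on B f"
 shows "vf p q (vf p' q' f) e - vf p' q' (vf p q f) e = (vf p q (vf p' q' wb) e - vf p' q' (vf p q wb) e) * T f e"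
proof -
 obtain P Q where PQ: "!!f. smooth_on B f ==> vf p q (vf p' q' f) e - vf p' q' (vf p q f) e = FD f e P + \<i> * FD f e Q"
  using vf_bracket[OF openB e pq] by blast
 have "fst P $ j = 0 & fst Q $ j = 0" for j
 proof -
  have sc: "smooth_on B (%e. cnj (z j e))" by (intro smooths openB)
  have "fst P $ j + \<i> * fst Q $ j = 0" "cnj (fst P $ j) + \<i> * cnj (fst Q $ j) = 0"
   using PQ[OF smooth_z[of j]] PQ[OF sc] z[of j] by (simp_all add: FD_z FD_zb)
  thus ?thesis by (simp add: complex_eq_iff)
 qed
 hence fst0: "fst P = 0" "fst Q = 0" by (simp_all add: vec_eq_iff)
 have F: "FD f e P + \<i> * FD f e Q = Complex (snd P) (snd Q) * ds f e" if "smooth_on B f" for f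
 proof -
  interpret linear "FD f e" using FD_linear[OF dB[OF that e]] by (rule bounded_linear.linear)
  have "P = snd P .* (0, 1)" "Q = snd Q .* (0, 1)" using fst0 by (auto simp: prod_eq_iff)
  hence "FD f e P = snd P .* ds f e" "FD f e Q = snd Q .* ds f e" by (metis scale ds_def)+
  thus ?thesis by (simp add: complex_eq_iff algebra_simps)
 qed
 have "ds wb e = 1 - \<i> * phs e" by (simp add: ds_def FD_w[OF e] phs_def)
 hence "ds wb e * ch e = 1" by (simp add: ch_def den_nz)
 thus ?thesis
  unfolding PQ[OF f] PQ[OF smooth_w(2)] F[OF f] F[OF smooth_w(2)] T_ds[OF dB[OF f e]] by simp
qed

lemma vf_const_on: "e : B ==> (!!x. x : B ==> f x = c) ==> vf p q f e = 0"
 using vf_cong[OF openB, of e f "%_. c" p q] by simp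

lemma comm_LT: assumes "e : B" "smooth_on B f" shows "L i (T f) e = T (L i f) e"
proof -
 have c: "L i (T g) e = 0" if "!!x. x : B ==> T g x = c" for g c
  unfolding L_def[of i] using that by (rule vf_const_on[OF assms(1)])
 have c': "T (L i g) e = 0" if "!!x. x : B ==> L i g x = c" for g c
  unfolding T_def using that by (rule vf_const_on[OF assms(1)])
 have "L i (T f) e - T (L i f) e = (L i (T wb) e - T (L i wb) e) * T f e"
  by (rule commutator[OF assms(1) smooth_pq(1,2)[of i] smooth_pq(4,5) _ _ assms(2), folded L_def T_def]) (simp_all add: L_coord c c')
 moreover have "L i (T wb) e = 0" "T (L i wb) e = 0" by (auto intro: c c' simp: L_w)
 ultimately show ?thesis by simp
qed

lemma comm_LLb: assumes "e : B" "smooth_on B f" shows "L i (Lb j f) e - Lb j (L i f) e = La i j e * T f e"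
proof -
 have c: "L i (Lb j g) e = 0" if "!!x. x : B ==> Lb j g x = c" for g c
  unfolding L_def[of i] using that by (rule vf_const_on[OF assms(1)])
 have c': "Lb j (L i g) e = 0" if "!!x. x : B ==> L i g x = c" for g c
  unfolding Lb_def using that by (rule vf_const_on[OF assms(1)])
 have "L i (Lb j f) e - Lb j (L i f) e = (L i (Lb j wb) e - Lb j (L i wb) e) * T f e"
  by (rule commutator[OF assms(1) smooth_pq(1,2)[of i] smooth_pq(1,3)[of j] _ _ assms(2), folded L_def Lb_def]) (simp_all add: L_coord c c')
 moreover have "Lb j (L i wb) e = 0" by (auto intro: c' simp: L_w)
 moreover have "L i (Lb j wb) e = La i j e"
  unfolding La_def L_def by (rule vf_cong[OF openB assms(1)]) (simp add: L_w)
 ultimately show ?thesis by simp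
qed

lemma LT_mult:
 assumes "e : B" "smooth_on B f" "smooth_on B g"
 shows "L i (%x. f x * g x) e = f e * L i g e + g e * L i f e"
  "Lb i (%x. f x * g x) e = f e * Lb i g e + g e * Lb i f e"
  "T (%x. f x * g x) e = f e * T g e + g e * T f e"
 unfolding L_def Lb_def T_def by (intro vf_mult dB assms)+

lemma LT_add:
 assumes "e : B" "smooth_on B f" "smooth_on B g"
 shows "L i (%x. f x + g x) e = L i f e + L i g e"
  "Lb i (%x. f x + g x) e = Lb i f e + Lb i g e"
  "T (%x. f x + g x) e = T f e + T g e"
 unfolding L_def Lb_def T_def by (intro vf_add dB assms)+

lemma LT_diff:
 assumes "e : B" "smooth_on B f" "smooth_on B g"
 shows "L i (%x. f x - g x) e = L i f e - L i g e"
  "Lb i (%x. f x - g x) e = Lb i f e - Lb i g e"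
  "T (%x. f x - g x) e = T f e - T g e"
 unfolding L_def Lb_def T_def by (intro vf_diff dB assms)+

lemma LT_uminus:
 assumes "e : B" "smooth_on B f"
 shows "L i (%x. - f x) e = - L i f e" "Lb i (%x. - f x) e = - Lb i f e" "T (%x. - f x) e = - T f e"
 unfolding L_def Lb_def T_def by (intro vf_uminus dB assms)+

lemma LT_sum:
 assumes "e : B" "!!k. k : I ==> smooth_on B (f k)"
 shows "L i (%x. \<Sum>k\<in>I. f k x) e = (\<Sum>k\<in>I. L i (f k) e)"
  "Lb i (%x. \<Sum>k\<in>I. f k x) e = (\<Sum>k\<in>I. Lb i (f k) e)"
  "T (%x. \<Sum>k\<in>I. f k x) e = (\<Sum>k\<in>I. T (f k) e)"
 unfolding L_def Lb_def T_def by (intro vf_sum dB assms; assumption)+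

lemma LT_cong:
 assumes "e : B" "!!x. x : B ==> f x = g x"
 shows "L i f e = L i g e" "Lb i f e = Lb i g e" "T f e = T g e"
 unfolding L_def Lb_def T_def by (intro vf_cong[OF openB] assms; assumption)+

lemma LT_const [simp]: "L i (%x. c) e = 0" "Lb i (%x. c) e = 0" "T (%x. c) e = 0"
 by (simp_all add: L_def Lb_def T_def)

lemma Lb_ze: assumes "e : B" shows "Lb j (ze i) e = kap e * La i j e"
proof -
 have "Lb j (L i w) e = Lb j (ze i) e" by (rule LT_cong[OF assms]) (simp add: L_w)
 moreover have "L i (Lb j w) e = L i (%_. 0) e" by (rule LT_cong[OF assms]) (simp add: L_w)
 ultimately show ?thesis using comm_LLb[OF assms smooth_w(1), of i j] assms by (simp add: L_w)
qed

lemma T_ze: assumes "e : B" shows "T (ze i) e = - L i kap e"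
proof -
 have "T (L i w) e = T (ze i) e" by (rule LT_cong[OF assms]) (simp add: L_w)
 moreover have "L i (T w) e = L i (%e. - kap e) e" by (rule LT_cong[OF assms]) (simp add: L_w)
 ultimately show ?thesis using comm_LT[OF assms smooth_w(1), of i] assms by (simp add: LT_uminus smooth_kap)
qed

lemma La_cnj: assumes "e : B" shows "cnj (La i j e) = kap e * La j i e"
 using L_cnj(1)[OF dB[OF smooth_ze assms], of i j] Lb_ze[OF assms, of i j] by (simp add: La_def)

text \<open>The fields L, Lb and T form a frame. Its dual coframe consists of dz, its conjugate, and the conjugate
  of dw minus the sum of ze dz.\<close>

lemma FD_frame:
 assumes e: "e : B" and f: "smooth_on B f"
 shows "FD f e (al, s) = (SU i. al $ i * L i f e + cnj (al $ i) * Lb i f e) + cnj (FD w e (al, s) - (SU i. ze i e * al $ i)) * T f e"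
proof -
 have df: "f differentiable (at e)" by (rule dB[OF f e])
 interpret linear "FD f e" using FD_linear[OF df] by (rule bounded_linear.linear)
 have LL: "al $ i * L i f e + cnj (al $ i) * Lb i f e = FD f e (axis i (al $ i), 0) + of_real (Re (al $ i * ze i e)) * ds f e" for i
 proof -
  have P: "FD f e (pL i e) = FD f e (axis i 1, 0) / 2 + of_real (Re (ze i e) / 2) * ds f e"
  proof -
   have "pL i e = (1/2) .* (axis i 1, 0) + (Re (ze i e) / 2) .* (0, 1)" by (auto simp: pL_def vec_eq_iff axis_def complex_eq_iff)
   thus ?thesis by (simp only: add scale ds_def) (simp add: scaleR_conv_of_real)
  qed
  have Q: "FD f e (qL i e) = - FD f e (axis i \<i>, 0) / 2 + of_real (Im (ze i e) / 2) * ds f e"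
  proof -
   have "qL i e = (-1/2) .* (axis i \<i>, 0) + (Im (ze i e) / 2) .* (0, 1)" by (auto simp: qL_def vec_eq_iff axis_def complex_eq_iff)
   thus ?thesis by (simp only: add scale ds_def) (simp add: scaleR_conv_of_real)
  qed
  have A: "FD f e (axis i (al $ i), 0) = of_real (Re (al $ i)) * FD f e (axis i 1, 0) + of_real (Im (al $ i)) * FD f e (axis i \<i>, 0)"
  proof -
   have "(axis i (al $ i), 0) = Re (al $ i) .* (axis i 1, 0) + Im (al $ i) .* (axis i \<i>, 0::real)" by (auto simp: vec_eq_iff axis_def complex_eq_iff)
   thus ?thesis by (simp only: add scale) (simp add: scaleR_conv_of_real)
  qed
  have N: "FD f e (- qL i e) = - FD f e (qL i e)" by (rule neg)
  show ?thesis unfolding L_def Lb_def vf_def N P Q A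
   by (simp add: complex_eq_iff algebra_simps add_divide_distrib diff_divide_distrib)
 qed
 have sp: "(al, s) = (SU i. (axis i (al $ i), 0)) + s .* (0, 1)"
  using vec_lambda_axis[of "%i. al $ i"] by (simp add: prod_eq_iff fst_sum snd_sum)
 have ss: "FD f e (al, s) = (SU i. FD f e (axis i (al $ i), 0)) + of_real s * ds f e"
  by (subst sp) (simp only: add sum scale ds_def scaleR_conv_of_real)
 have d1: "FD f e (al, s) = (SU i. al $ i * L i f e + cnj (al $ i) * Lb i f e) + (of_real s - (SU i. of_real (Re (al $ i * ze i e)))) * ds f e"
  unfolding LL ss by (simp only: sum.distrib sum_distrib_right[symmetric] left_diff_distrib) simp
 show ?thesis
 proof -
  have c: "cnj (FD w e (al, s) - (SU i. ze i e * al $ i)) * ch e = of_real s - (SU i. of_real (Re (al $ i * ze i e)))"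
  proof -
   interpret P: linear "FD ph e" using FD_linear[OF dB[OF sphi e]] by (rule bounded_linear.linear)
   have A: "FD ph e (axis i (al $ i), 0) = 2 * Re (al $ i * phz i e)" for i
   proof -
    have "(axis i (al $ i), 0) = Re (al $ i) .* (axis i 1, 0) + Im (al $ i) .* (axis i \<i>, 0::real)" by (auto simp: vec_eq_iff axis_def complex_eq_iff)
    thus ?thesis by (simp only: P.add P.scale) (simp add: phz_def)
   qed
   have S: "FD ph e (al, s) = (SU i. 2 * Re (al $ i * phz i e)) + s * phs e"
    by (subst sp) (simp only: P.add P.sum P.scale A phs_def real_scaleR_def)
   have pz: "phz i e = - \<i> / 2 * ze i e * (1 - \<i> * phs e)" for i
   proof -
    have "- \<i> / 2 * (2 * \<i> * a * b) * c = a * (b * c)" for a b c :: complex by (simp add: algebra_simps)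
    thus ?thesis by (simp only: ze_def ch_den) simp
   qed
   have "cnj (FD w e (al, s) - (SU i. ze i e * al $ i)) = (of_real s - (SU i. of_real (Re (al $ i * ze i e)))) * (1 - \<i> * phs e)"
   proof -
    have "\<i> * of_real (2 * Re (al $ i * phz i e)) + cnj (ze i e * al $ i) = of_real (Re (al $ i * ze i e)) * (1 - \<i> * phs e)" for i
     unfolding pz by (simp add: complex_eq_iff field_simps)
    hence "(SU i. \<i> * of_real (2 * Re (al $ i * phz i e)) + cnj (ze i e * al $ i)) = (SU i. of_real (Re (al $ i * ze i e))) * (1 - \<i> * phs e)"
     by (simp only: sum_distrib_right)
    hence *: "\<i> * of_real (SU i. 2 * Re (al $ i * phz i e)) + cnj (SU i. ze i e * al $ i) = (SU i. of_real (Re (al $ i * ze i e))) * (1 - \<i> * phs e)"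
     by (simp only: sum.distrib sum_distrib_left[symmetric] of_real_sum[symmetric] cnj_sum[symmetric])
    have "cnj (of_real (snd (al, s)) + \<i> * of_real (A + s * p) - Z) = of_real s * (1 - \<i> * of_real p) - (\<i> * of_real A + cnj Z)" for A p Z
     by (simp add: algebra_simps)
    thus ?thesis unfolding FD_w[OF e] S by (simp only: * left_diff_distrib)
   qed
   thus ?thesis using den_nz(1)[of e] by (simp add: ch_def)
  qed
  show ?thesis unfolding T_ds[OF df] d1 mult.assoc[symmetric] c ..
 qed
qed

end

section \<open>One-sided holomorphic connections on a hypersurface\<close>

lemma cholo_scale: "cholo f x ==> FD f x (Re c .* v + Im c .* imul v) = c * FD f x v" for f :: "'a::complex_space => complex"
proof -
 assume f: "cholo f x"
 interpret linear "FD f x" using FD_linear[OF cholo_differentiable[OF f]] by (rule bounded_linear.linear)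
 have "of_real (Re c) * u + of_real (Im c) * (\<i> * u) = c * u" for u
  by (subst (3) complex_eq) (simp add: algebra_simps)
 thus ?thesis by (simp only: add scale cholo_imul[OF f] imul_complex scaleR_conv_of_real)
qed

lemma cholo_jet_expand:
 fixes a :: "'n::finite jet => complex"
 assumes a: "cholo a x"
 shows "FD a x ((al, c), et) = (SU i. al $ i * FD a x ((axis i 1, 0), 0)) + c * FD a x ((0, 1), 0)
  + (SU l. et $ l * FD a x (0, axis l 1))"
proof -
 interpret linear "FD a x" using FD_linear[OF cholo_differentiable[OF a]] by (rule bounded_linear.linear)
 have ax: "axis i u = Re u .* axis i 1 + Im u .* imul (axis i (1::complex) :: complex^'n)" for i u
  by (auto simp: vec_eq_iff axis_def complex_eq_iff)
 have "al = (SU i. axis i (al $ i))" "et = (SU l. axis l (et $ l))"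
  using vec_lambda_axis[of "%i. al $ i"] vec_lambda_axis[of "%i. et $ i"] by simp_all
 hence "((al, c), et) = (SU i. ((axis i (al $ i), 0), 0)) + ((0, c), 0) + (SU l. (0, axis l (et $ l)))"
  by (simp add: prod_eq_iff fst_sum snd_sum)
 also have "... = (SU i. Re (al $ i) .* ((axis i 1, 0), 0) + Im (al $ i) .* imul ((axis i 1, 0), 0))
  + (Re c .* ((0, 1), 0) + Im c .* imul ((0, 1), 0))
  + (SU l. Re (et $ l) .* (0, axis l 1) + Im (et $ l) .* imul (0, axis l 1))"
  by (simp add: ax[of _ "al $ _"] ax[of _ "et $ _"] complex_eq[symmetric])
   (simp add: complex_eq_iff)
 finally have *: "((al, c), et) = ..." .
 have "FD a x (Re c .* v) + FD a x (Im c .* imul v) = c * FD a x v" for c v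
  by (simp only: add[symmetric] cholo_scale[OF a])
 thus ?thesis by (subst *) (simp only: add sum)
qed

text \<open>Here g stands for the functions Phi, extended to the jets over one side. On the restriction of a
  one-sided holomorphic function to the lift of the hypersurface, L i acts as the operator D i (L_pull), and Lb i
  differentiates in the fibre of the jets, with the Levi form as coefficient (Lb_pull). The
  functions al and t are the lowest coefficients of the connection: al j is the logarithmic derivative of
  the density below along L j. The fields V b commute with all L i, and N b is minus the derivative of w along V b.\<close>

locale one_sided = cr_graph B ph for B :: "((complex^'n::finite) \<times> real) set" and ph +
 fixes W P :: "'n jet set" and g :: "'n => 'n => 'n jet => complex"
 assumes openW: "open W" and openP: "open P" and PW: "P <= W"
  and g: "!!i j. hol_side W P (g i j)"
  and lift_W: "!!e. e : B ==> ((fst e, w e), \<chi> k. ze k e) : W \<inter> closure P"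
  and L_ze: "!!i j e. e : B ==> L i (ze j) e = g i j ((fst e, w e), \<chi> k. ze k e)"
  and La_nondegenerate: "!!e. e : B ==> det (\<chi> i j. La i j e) ~= 0"
begin

definition "lift e = ((fst e, w e), \<chi> k. ze k e)"
definition "Dze l a x = (FD a x (0, axis l 1) :: complex)"
definition "Dw a x = (FD a x ((0, 1), 0) :: complex)"
definition "D i a x = FD a x ((axis i 1, 0), 0) + snd x $ i * Dw a x + (SU l. g i l x * Dze l a x)"
definition "al j x = - (SU k. Dze k (g j k) x) / of_nat (CARD('n) + 2)"
definition "t x = (SU m. Dze m (al m) x) / of_nat (CARD('n) + 1)"
definition V :: "'n option => ((complex^'n) \<times> real => complex) => (complex^'n) \<times> real => complex" where
 "V b f e = (case b of None => T f e | Some k => Lb k f e - cnj (ze k e) * T f e)"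
definition N :: "'n option => (complex^'n) \<times> real => complex" where
 "N b e = (case b of None => kap e | Some k => - (kap e * cnj (ze k e)))"

lemma lift_in: "e : B ==> lift e : W" "e : B ==> lift e : closure P"
 using lift_W[of e] by (simp_all add: lift_def)

lemma hol_D: "hol_side W P a ==> hol_side W P (Dze l a)" "hol_side W P a ==> hol_side W P (Dw a)"
 unfolding Dze_def[abs_def] Dw_def[abs_def] by (intro hol_side_FD openW openP PW; assumption)+

lemma hol_snd: "hol_side W P (%x. snd x $ i)"
 by (rule hol_side_linear) (auto intro: bounded_linear_compose[OF bounded_linear_vec_nth bounded_linear_snd])

lemma hol_Di: "hol_side W P a ==> hol_side W P (D i a)"
 unfolding D_def[abs_def] by (intro hol_sides openW hol_snd hol_D g hol_side_FD openP PW; assumption)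

lemma hol_al: "hol_side W P (al j)"
 unfolding al_def[abs_def] by (intro hol_sides openW hol_D g)

lemma hol_t: "hol_side W P t"
 unfolding t_def[abs_def] by (intro hol_sides openW hol_D hol_al)

lemma smooth_lift: "smooth_on B lift"
 unfolding lift_def[abs_def] by (intro smooths openB)

lemma smooth_pull [smooths]: "hol_side W P a ==> smooth_on B (%e. a (lift e))"
 by (rule smooth_on_compose[OF _ smooth_lift openB openW]) (auto simp: hol_side_def lift_in)

lemma smooth_N [smooths]: "smooth_on B (N b)"
 unfolding N_def[abs_def] by (cases b) (auto intro!: smooths openB)

lemma smooth_V [smooths]: "smooth_on B f ==> smooth_on B (V b f)"
 unfolding V_def[abs_def] by (cases b) (auto intro!: smooths openB)

lemma FD_lift: "e : B ==> FD lift e v = ((fst v, FD w e v), \<chi> k. FD (ze k) e v)"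
proof (rule FD_eq[THEN fun_cong])
 assume e: "e : B"
 have f: "((%e. \<chi> k. ze k e) has_derivative (%v. \<chi> k. FD (ze k) e v)) (at e)"
 proof -
  have d: "(%e. \<chi> k. ze k e) differentiable (at e)"
   by (rule smooth_diff[OF _ e]) (intro smooths openB)
  have "FD (%e. \<chi> k. ze k e) e = (%v. \<chi> k. FD (ze k) e v)"
   using FD_vec_nth[OF d] by (simp add: vec_eq_iff fun_eq_iff)
  thus ?thesis using FD_works[OF d] by simp
 qed
 show "(lift has_derivative (%v. ((fst v, FD w e v), \<chi> k. FD (ze k) e v))) (at e)"
  unfolding lift_def[abs_def]
  by (intro has_derivative_Pair f smooth_on_has_derivative[OF smooth_w(1) e] has_derivative_fst has_derivative_ident)
qed

lemma cholo_lift: "hol_side W P a ==> e : B ==> cholo a (lift e)"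
 by (rule cholo_closure[OF openW PW]) (simp_all add: lift_in)

lemma FD_pull:
 assumes a: "hol_side W P a" and e: "e : B"
 shows "FD (%e. a (lift e)) e v = (SU i. FD a (lift e) ((axis i 1, 0), 0) * FD (z i) e v) + Dw a (lift e) * FD w e v
  + (SU l. Dze l a (lift e) * FD (ze l) e v)"
proof -
 have "FD (%e. a (lift e)) e v = FD a (lift e) (FD lift e v)"
  by (rule FD_compose[OF smooth_diff[OF smooth_lift e] cholo_differentiable[OF cholo_lift[OF a e]]])
 also have "... = FD a (lift e) ((fst v, FD w e v), \<chi> k. FD (ze k) e v)" by (simp only: FD_lift[OF e])
 also note cholo_jet_expand[OF cholo_lift[OF a e]]
 finally show ?thesis by (simp add: FD_z Dw_def Dze_def mult.commute)
qed

lemma vf_pull: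
 assumes a: "hol_side W P a" and e: "e : B"
 shows "vf p q (%e. a (lift e)) e = (SU i. FD a (lift e) ((axis i 1, 0), 0) * vf p q (z i) e) + Dw a (lift e) * vf p q w e
  + (SU l. Dze l a (lift e) * vf p q (ze l) e)"
 by (simp add: vf_def FD_pull[OF a e] algebra_simps sum.distrib sum_distrib_left)

lemma L_pull: "hol_side W P a ==> e : B ==> L i (%e. a (lift e)) e = D i a (lift e)"
 unfolding L_def by (subst vf_pull) (simp_all add: L_def[symmetric] L_coord L_w L_ze lift_def[symmetric] D_def, simp add: lift_def if_distrib if_distribR sum.delta mult.commute cong: if_cong)

lemma Lb_pull: "hol_side W P a ==> e : B ==> Lb j (%e. a (lift e)) e = kap e * (SU l. Dze l a (lift e) * La l j e)"
 unfolding Lb_def by (subst vf_pull) (simp_all add: Lb_def[symmetric] L_coord L_w Lb_ze sum_distrib_left algebra_simps)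

lemma L_pull_cnj: "hol_side W P a ==> e : B ==> L i (%e. cnj (a (lift e))) e = (SU l. cnj (Dze l a (lift e)) * La i l e)"
proof -
 assume a: "hol_side W P a" and e: "e : B"
 have kk: "kap e * (cnj (kap e) * x) = x" for x using kap_cnj[of e] by (simp add: mult.assoc[symmetric])
 show ?thesis unfolding L_cnj(1)[OF dB[OF smooth_pull[OF a] e]] Lb_pull[OF a e]
  by (simp add: kk La_cnj[OF e] sum_distrib_left algebra_simps)
qed

lemma T_pull: "hol_side W P a ==> e : B ==> T (%e. a (lift e)) e = - (Dw a (lift e) * kap e) + (SU l. Dze l a (lift e) * T (ze l) e)"
 unfolding T_def by (subst vf_pull) (simp_all add: T_def[symmetric] L_coord L_w)

lemma comm_LV: assumes e: "e : B" and f: "smooth_on B f" shows "L i (V b f) e = V b (L i f) e"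
proof (cases b)
 case None thus ?thesis using comm_LT[OF assms, of i] by (simp add: V_def[abs_def])
next
 case (Some k)
 have "L i (%e. Lb k f e - cnj (ze k e) * T f e) e = L i (Lb k f) e - (cnj (ze k e) * L i (T f) e + T f e * La i k e)"
  unfolding La_def using e f by (subst LT_diff, (auto intro!: smooths openB)[3]) (subst LT_mult; (auto intro!: smooths openB))
 thus ?thesis using comm_LLb[OF assms, of i k] comm_LT[OF assms, of i] Some by (simp add: V_def[abs_def] algebra_simps)
qed

lemma V_w: "e : B ==> V b w e = - N b e"
 by (auto simp: V_def N_def L_w split: option.split)

lemma V_cong: "e : B ==> (!!x. x : B ==> f x = h x) ==> V b f e = V b h e"
 unfolding V_def using LT_cong[of e f h] by (cases b) simp_all

lemma V_ze: assumes e: "e : B" shows "V b (ze j) e = - L j (N b) e"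
proof -
 have "V b (ze j) e = V b (L j w) e" by (rule V_cong[OF e]) (simp add: L_w)
 also have "... = L j (V b w) e" by (simp add: comm_LV[OF e smooth_w(1)])
 also have "... = L j (%e. - N b e) e" by (rule LT_cong[OF e]) (simp add: V_w)
 finally show ?thesis by (simp add: LT_uminus[OF e smooth_N])
qed

lemma V_pull:
 assumes a: "hol_side W P a" and e: "e : B"
 shows "V b (%e. a (lift e)) e = - (Dw a (lift e) * N b e) - (SU l. Dze l a (lift e) * L l (N b) e)"
proof -
 have "V b (%e. a (lift e)) e = Dw a (lift e) * V b w e + (SU l. Dze l a (lift e) * V b (ze l) e)"
  by (cases b) (simp_all add: V_def T_pull[OF a e] Lb_pull[OF a e] L_w[OF e] Lb_ze[OF e] sum_distrib_left sum_subtractf algebra_simps)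
 thus ?thesis by (simp add: V_w[OF e] V_ze[OF e] sum_negf)
qed

text \<open>Apply V b, which commutes with L i, to the identity for L i (ze j) on the lift, and use the values of
  V b on w and ze. So the N b are solutions of the linearized second order system.\<close>

lemma LL_N: assumes e: "e : B"
 shows "L i (L j (N b)) e = (SU l. Dze l (g i j) (lift e) * L l (N b) e) + Dw (g i j) (lift e) * N b e"
proof -
 have "L i (L j (N b)) e = L i (%e. - V b (ze j) e) e" by (rule LT_cong[OF e]) (simp add: V_ze)
 also have "... = - V b (L i (ze j)) e" by (simp add: LT_uminus[OF e smooth_V[OF smooth_ze]] comm_LV[OF e smooth_ze])
 also have "V b (L i (ze j)) e = V b (%e. g i j (lift e)) e" by (rule V_cong[OF e]) (simp add: L_ze lift_def)
 finally show ?thesis by (simp add: V_pull[OF g e])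
qed

lemma L_La: assumes e: "e : B"
 shows "kap e * L j (La k l) e = (SU m. kap e * Dze m (g j k) (lift e) * La m l e) - L k kap e * La j l e - L j kap e * La k l e"
proof -
 have N0: "N None = kap" by (simp add: N_def[abs_def])
 have L1: "L m (N (Some l)) e = - (kap e * La m l e + cnj (ze l e) * L m kap e)" if "e : B" for m e
  unfolding N_def[abs_def] La_def using that by (simp add: LT_uminus LT_mult smooths openB)
 have "L j (L k (N (Some l))) e = L j (%e. - (kap e * La k l e + cnj (ze l e) * L k kap e)) e"
  by (rule LT_cong[OF e L1])
 also have "... = - (kap e * L j (La k l) e + La k l e * L j kap e + (cnj (ze l e) * L j (L k kap) e + L k kap e * La j l e))"
  unfolding La_def[of j] using e by (simp add: LT_uminus LT_mult LT_add LT_diff smooths openB)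
 finally have "L j (L k (N (Some l))) e = ..." .
 thus ?thesis unfolding LL_N[OF e] L1[OF e] using LL_N[OF e, of j k None] unfolding N0
  by (simp add: N_def sum_distrib_left sum.distrib sum_negf sum_subtractf algebra_simps)
qed

end

section \<open>The normalized density\<close>

lemma vf_power:
 assumes "f differentiable (at e)"
 shows "(%x. f x ^ n :: complex) differentiable (at e) & f e * vf p q (%x. f x ^ n) e = of_nat n * f e ^ n * vf p q f e"
proof (induction n)
 case (Suc n)
 hence "f e * vf p q (%x. f x * f x ^ n) e = f e * (f e * vf p q (%x. f x ^ n) e) + f e * f e ^ n * vf p q f e"
  using assms by (simp add: vf_mult algebra_simps)
 thus ?case using Suc assms by (simp add: algebra_simps differentiable_mult)
qed simp

lemma det_cnj: "cnj (det M) = det (\<chi> i j. cnj (M $ i $ j))" for M :: "complex^'n::finite^'n"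
 by (simp add: det_def)

context one_sided
begin

definition "Dt e = det (\<chi> i j. La i j e)"
definition "u e = (1 - \<i> * of_real (phs e)) / (2 * \<i>)"
definition "Q e = u e * cnj (u e) ^ (CARD('n) + 1) * Dt e"
definition "mu e = exp (- ln ((Re (Q e))\<^sup>2) / (2 * (CARD('n) + 2)))"
definition "sg e = of_real (mu e) * u e"

lemma u_nz: "u e ~= 0" by (simp add: u_def den_nz)
lemma u_cnj: "cnj (u e) = kap e * u e"
proof -
 have "cnj (u e) = - (1 + \<i> * of_real (phs e)) / (2 * \<i>)" by (simp add: u_def complex_eq_iff)
 moreover have "kap e * (1 - \<i> * of_real (phs e)) = - (1 + \<i> * of_real (phs e)) * (ch e * (1 - \<i> * of_real (phs e)))"
  by (simp only: kap_def mult.assoc)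
 ultimately show ?thesis by (simp add: u_def ch_den)
qed

lemma sg_nz: "sg e ~= 0" by (simp add: sg_def u_nz mu_def)
lemma sg_cnj: "cnj (sg e) = kap e * sg e" by (simp add: sg_def u_cnj)

lemma Dt_cnj: assumes "e : B" shows "cnj (Dt e) = kap e ^ CARD('n) * Dt e"
proof -
 have "cnj (Dt e) = det (\<chi> i. kap e *s (\<chi> j. La j i e))"
  unfolding Dt_def det_cnj by (rule arg_cong[where f=det]) (simp add: vec_eq_iff La_cnj[OF assms])
 also have "... = kap e ^ CARD('n) * det (transpose (\<chi> i j. La i j e))"
  by (simp add: det_rows_mul transpose_def)
 finally show ?thesis by (simp add: Dt_def det_transpose)
qed

lemma Q_real: assumes e: "e : B" shows "Q e = of_real (Re (Q e))" "Re (Q e) ~= 0"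
proof -
 have "cnj (Q e) = (kap e * u e) * u e ^ (CARD('n) + 1) * (kap e ^ CARD('n) * Dt e)"
  by (simp only: Q_def complex_cnj_mult complex_cnj_power complex_cnj_cnj Dt_cnj[OF e]) (simp add: u_cnj)
 also have "... = Q e" by (simp add: Q_def u_cnj power_mult_distrib mult_ac del: complex_cnj_mult)
 finally have "Im (Q e) = 0" by (simp add: complex_eq_iff)
 thus q: "Q e = of_real (Re (Q e))" by (simp add: complex_eq_iff)
 have "Q e ~= 0" using La_nondegenerate[OF e] by (simp add: Q_def u_nz Dt_def)
 thus "Re (Q e) ~= 0" by (subst (asm) q) simp
qed

lemma smooth_Dt: "smooth_on B Dt"
 unfolding Dt_def[abs_def] det_def by (intro smooths openB)

lemma smooth_u: "smooth_on B u"
 unfolding u_def[abs_def] by (intro smooths openB smooth_phs) simp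

lemma smooth_sg [smooths]: "smooth_on B sg"
proof -
 have Q: "smooth_on B (%e. (Re (Q e))\<^sup>2)" unfolding Q_def by (intro smooths openB smooth_u smooth_Dt)
 have "smooth_on B (%e. ln ((Re (Q e))\<^sup>2))"
  by (rule smooth_on_compose[OF smooth_on_ln_real Q openB]) (use Q_real in auto)
 hence "smooth_on B (%e. - ln ((Re (Q e))\<^sup>2) / (2 * (CARD('n) + 2)))"
  by (intro smooths openB) simp_all
 hence "smooth_on B mu" unfolding mu_def[abs_def]
  by (rule smooth_on_compose[OF smooth_on_exp_real[of UNIV]]) (auto simp: openB)
 thus ?thesis unfolding sg_def[abs_def] by (intro smooths openB smooth_u)
qed

text \<open>The density is normalized by the determinant of the Levi form, so that its logarithmic
 derivatives are determined by those of the Levi form.\<close>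

lemma sg_normalized: assumes e: "e : B" shows "(kap e ^ (CARD('n) + 1) * sg e ^ (CARD('n) + 2) * Dt e)\<^sup>2 = 1"
proof -
 let ?r = "Re (Q e)" and ?k = "CARD('n) + 2"
 have "kap e ^ (CARD('n) + 1) * sg e ^ ?k * Dt e = of_real (mu e ^ ?k) * Q e"
  by (simp add: sg_def Q_def u_cnj power_mult_distrib)
 also have "... = of_real (mu e ^ ?k * ?r)" by (subst Q_real(1)[OF e]) simp
 finally have "(kap e ^ (CARD('n) + 1) * sg e ^ ?k * Dt e)\<^sup>2 = of_real (mu e ^ (2 * ?k) * ?r\<^sup>2)"
  by (simp only: of_real_power[symmetric] power_mult_distrib power_mult[symmetric] mult.commute)
 also have "mu e ^ (2 * ?k) = exp (of_nat (2 * ?k) * (- ln (?r\<^sup>2) / (2 * ?k)))"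
  unfolding mu_def by (rule exp_of_nat_mult[symmetric])
 also have "of_nat (2 * ?k) * (- ln (?r\<^sup>2) / (2 * ?k)) = - ln (?r\<^sup>2)" by simp
 also have "exp (- ln (?r\<^sup>2)) * ?r\<^sup>2 = 1" using Q_real(2)[OF e] by (simp add: exp_minus)
 finally show ?thesis by simp
qed

text \<open>The differentiated normalization of the density; the determinant contributes a trace by Jacobi.\<close>

lemma sg_logarithmic:
 assumes e: "e : B" and A: "!!k l. vf p q (La k l) e = (SU m. A k m * La m l e)"
 shows "of_nat (CARD('n) + 1) * (vf p q kap e / kap e) + of_nat (CARD('n) + 2) * (vf p q sg e / sg e) + (SU k. A k k) = 0"
proof -
 let ?a = "%e. kap e ^ (CARD('n) + 1)" and ?b = "%e. sg e ^ (CARD('n) + 2)"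
 let ?K = "%e. ?a e * ?b e * Dt e" and ?X = "vf p q"
 have d: "kap differentiable (at e)" "sg differentiable (at e)" "Dt differentiable (at e)"
  using e smooth_kap smooth_sg smooth_Dt dB by blast+
 have da: "?a differentiable (at e)" "?b differentiable (at e)" using vf_power d by blast+
 have dK: "?K differentiable (at e)" by (intro differentiable_mult da d)
 have K0: "?K e ~= 0" using sg_normalized[OF e] by auto
 have "2 * ?K e * ?X ?K e = ?X (%e. ?K e * ?K e) e" by (simp only: vf_mult[OF dK dK]) simp
 also have "... = 0" by (rule vf_const_on[OF e, where c=1]) (simp only: sg_normalized power2_eq_square[symmetric])
 finally have XK: "?X ?K e = 0" using K0 by simp
 have XD: "?X Dt e = (SU k. A k k) * Dt e"
  using vf_det_logarithmic[of La e p q A] dB[OF smooth_La e] A unfolding Dt_def[abs_def] by blast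
 have Xa: "?X ?a e = of_nat (CARD('n) + 1) * ?a e * (?X kap e / kap e)"
  using vf_power[OF d(1), of "CARD('n) + 1" p q] kap_nz[of e] by (simp add: field_simps)
 have Xb: "?X ?b e = of_nat (CARD('n) + 2) * ?b e * (?X sg e / sg e)"
  using vf_power[OF d(2), of "CARD('n) + 2" p q] sg_nz[of e] by (simp add: field_simps)
 have "?X ?K e = ?a e * ?b e * ?X Dt e + Dt e * (?a e * ?X ?b e + ?b e * ?X ?a e)"
  by (simp only: vf_mult[OF differentiable_mult[OF da] d(3)] vf_mult[OF da])
 also have "... = ?K e * (of_nat (CARD('n) + 1) * (vf p q kap e / kap e) + of_nat (CARD('n) + 2) * (vf p q sg e / sg e) + (SU k. A k k))"
  unfolding XD Xa Xb by (simp only: algebra_simps)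
 finally show ?thesis using XK K0 by (simp only: mult_eq_0_iff) simp
qed

lemma L_sg: assumes e: "e : B" shows "L j sg e = al j (lift e) * sg e"
proof -
 define A where "A k m = Dze m (g j k) (lift e) - (if m = j then L k kap e / kap e else 0) - (if m = k then L j kap e / kap e else 0)" for k m
 have "vf (pL j) (qL j) (La k l) e = (SU m. A k m * La m l e)" for k l
 proof -
  have "(SU m. A k m * La m l e) = (SU m. Dze m (g j k) (lift e) * La m l e) - L k kap e / kap e * La j l e - L j kap e / kap e * La k l e"
   by (simp add: A_def left_diff_distrib sum_subtractf if_distrib[of "%x. x * _"] cong: if_cong)
  hence "kap e * (SU m. A k m * La m l e) = kap e * L j (La k l) e"
   unfolding L_La[OF e] using kap_nz[of e] by (simp add: sum_distrib_left right_diff_distrib mult.assoc)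
  thus ?thesis using kap_nz[of e] by (simp add: L_def)
 qed
 note this[THEN sg_logarithmic[OF e], folded L_def]
 moreover have "(SU k. A k k) = (SU k. Dze k (g j k) (lift e)) - of_nat (CARD('n) + 1) * (L j kap e / kap e)"
  by (simp add: A_def sum_subtractf) (simp add: algebra_simps add_divide_distrib)
 ultimately have "of_nat (CARD('n) + 2) * (L j sg e / sg e) = - (SU k. Dze k (g j k) (lift e))"
  by (simp add: algebra_simps eq_neg_iff_add_eq_0)
 hence "L j sg e / sg e = al j (lift e)"
  unfolding al_def by (subst eq_divide_eq) (auto simp: mult.commute simp del: of_nat_add of_nat_Suc)
 thus ?thesis using sg_nz[of e] by (simp add: divide_eq_eq)
qed

lemma L_sgb: "e : B ==> L j (%e. cnj (sg e)) e = (al j (lift e) * kap e + L j kap e) * sg e"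
 unfolding sg_cnj by (simp add: LT_mult smooths L_sg algebra_simps)

lemma T_zeb: assumes e: "e : B" shows "T (%e. cnj (ze j e)) e = kap e * cnj (L j kap e)"
 by (simp add: T_cnj[OF dB[OF smooth_ze e]] T_ze[OF e])

lemma Lb_sg: assumes e: "e : B" shows "Lb j sg e = (cnj (al j (lift e)) + T (%e. cnj (ze j e)) e) * sg e"
proof -
 have "Lb j sg e = cnj (L j (%e. cnj (sg e)) e)" by (simp add: L_cnj(1)[OF dB[OF smooth_sg e]])
 also have "... = (cnj (al j (lift e)) * (kap e * cnj (kap e)) + kap e * cnj (L j kap e)) * sg e"
  unfolding L_sgb[OF e] by (simp add: sg_cnj algebra_simps)
 finally show ?thesis by (simp add: kap_cnj T_zeb[OF e])
qed

lemma La_inverse: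
 assumes e: "e : B"
 obtains M where "!!i k. (SU j. La i j e * M j k) = (if i = k then 1 else 0)"
  "!!j m. (SU i. M j i * La i m e) = (if j = m then 1 else 0)"
proof -
 have "invertible (\<chi> i j. La i j e)" using La_nondegenerate[OF e] by (simp add: invertible_det_nz)
 then obtain M where M: "(\<chi> i j. La i j e) ** M = mat 1" "M ** (\<chi> i j. La i j e) = mat 1" by (auto simp: invertible_def)
 show ?thesis
  by (rule that[of "%i j. M $ i $ j"]) (use M in \<open>auto simp: vec_eq_iff matrix_matrix_mult_def mat_def\<close>)
qed

text \<open>The corner entry of the Hermitian form below. It is real by the commutators of L i and Lb j applied to
  the logarithm of the density; contraction with the inverse of the Levi form isolates T.\<close>

definition "hww e = T sg e + kap e * sg e * t (lift e)"

lemma hww_real: assumes e: "e : B" shows "cnj (hww e) = hww e"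
proof -
 obtain M where M: "!!i k. (SU j. La i j e * M j k) = (if i = k then 1 else 0)"
  "!!j m. (SU i. M j i * La i m e) = (if j = m then 1 else 0)" using La_inverse[OF e] by blast
 let ?d = "%i m. Dze m (al i) (lift e)"
 have cm: "(SU m. La i m e * cnj (?d j m)) + T (La i j) e - kap e * (SU m. ?d i m * La m j e) = La i j e * (T sg e / sg e)" for i j
 proof -
  have "L i (Lb j sg) e = L i (%e. (cnj (al j (lift e)) + T (%e. cnj (ze j e)) e) * sg e) e" by (rule LT_cong[OF e Lb_sg])
  also have "... = (cnj (al j (lift e)) + T (%e. cnj (ze j e)) e) * (al i (lift e) * sg e)
    + sg e * ((SU m. cnj (?d j m) * La i m e) + T (La i j) e)"
   using e by (simp add: LT_mult LT_add smooths openB hol_al L_sg L_pull_cnj comm_LT La_def[abs_def])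
  finally have 1: "L i (Lb j sg) e = ..." .
  have "Lb j (L i sg) e = Lb j (%e. al i (lift e) * sg e) e" by (rule LT_cong[OF e L_sg])
  also have "... = al i (lift e) * ((cnj (al j (lift e)) + T (%e. cnj (ze j e)) e) * sg e) + sg e * (kap e * (SU m. ?d i m * La m j e))"
   using e by (simp add: LT_mult smooths openB hol_al Lb_sg Lb_pull)
  finally have "La i j e * T sg e = sg e * ((SU m. cnj (?d j m) * La i m e) + T (La i j) e - kap e * (SU m. ?d i m * La m j e))"
   using comm_LLb[OF e smooth_sg, of i j] unfolding 1 by (simp add: algebra_simps)
  thus ?thesis using sg_nz[of e] by (simp add: field_simps)
 qed
 have c1: "(SU i. SU j. M j i * (La i j e * x)) = of_nat CARD('n) * x" for x
 proof -
  have "(SU j. M j i * (La i j e * x)) = (SU j. La i j e * M j i) * x" for i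
   by (simp add: sum_distrib_left mult_ac)
  thus ?thesis by (simp add: M)
 qed
 have c2: "(SU i. SU j. M j i * (SU m. La i m e * X j m)) = (SU m. X m m)" for X
 proof -
  have "(SU i. SU j. M j i * (SU m. La i m e * X j m)) = (SU j. SU m. (SU i. M j i * La i m e) * X j m)"
   unfolding sum_distrib_left sum_distrib_right mult.assoc[symmetric] by (subst sum.swap) (rule sum.cong[OF refl], rule sum.swap)
  thus ?thesis unfolding M by (simp add: if_distrib[of "%x. x * _"] cong: if_cong)
 qed
 have c3: "(SU i. SU j. M j i * (SU m. X i m * La m j e)) = (SU m. X m m)" for X
 proof -
  have "(SU j. M j i * (SU m. X i m * La m j e)) = (SU m. X i m * (SU j. La m j e * M j i))" for i
   unfolding sum_distrib_left by (subst sum.swap) (simp add: mult_ac)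
  thus ?thesis unfolding M by (simp add: if_distrib[of "%x. _ * x"] cong: if_cong)
 qed
 define ta where "ta = (SU m. ?d m m)"
 define S where "S = (SU i. SU j. M j i * T (La i j) e)"
 have "of_nat CARD('n) * (T sg e / sg e) = (SU i. SU j. M j i * ((SU m. La i m e * cnj (?d j m)) + T (La i j) e - kap e * (SU m. ?d i m * La m j e)))"
  unfolding cm c1 ..
 also have "... = (SU i. SU j. M j i * (SU m. La i m e * cnj (?d j m))) + S - kap e * (SU i. SU j. M j i * (SU m. ?d i m * La m j e))"
  unfolding S_def by (simp only: distrib_left right_diff_distrib sum.distrib sum_subtractf sum_distrib_left mult_ac)
 also have "... = cnj ta + S - kap e * ta" unfolding c2 c3 ta_def by simp
 finally have e1: "of_nat CARD('n) * (T sg e / sg e) = cnj ta + S - kap e * ta" .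
 have e2: "of_nat (CARD('n) + 1) * (T kap e / kap e) + of_nat (CARD('n) + 2) * (T sg e / sg e) + S = 0"
 proof -
  have "vf pT qT (La k l) e = (SU m. (SU j. M j m * T (La k j) e) * La m l e)" for k l
  proof -
   have "(SU m. (SU j. M j m * T (La k j) e) * La m l e) = (SU j. (SU m. M j m * La m l e) * T (La k j) e)"
    unfolding sum_distrib_right by (subst sum.swap) (simp add: mult_ac)
   thus ?thesis unfolding M by (simp add: T_def if_distrib[of "%x. x * _"] cong: if_cong)
  qed
  from sg_logarithmic[OF e this] show ?thesis unfolding S_def T_def by simp
 qed
 have "T (%e. cnj (sg e)) e = kap e * T sg e + sg e * T kap e"
  unfolding sg_cnj using e by (simp add: LT_mult smooths)
 hence "kap e * T sg e + sg e * T kap e = - (kap e * cnj (T sg e))"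
  unfolding T_cnj[OF dB[OF smooth_sg e]] by simp
 moreover have "T sg e / sg e + T kap e / kap e = (kap e * T sg e + sg e * T kap e) / (kap e * sg e)"
  using kap_nz[of e] sg_nz[of e] by (simp add: add_divide_distrib)
 ultimately have Tb: "T sg e / sg e + T kap e / kap e = - cnj (T sg e) / sg e" using kap_nz[of e] by simp
 have "of_nat (CARD('n) + 1) * (T sg e / sg e + (T sg e / sg e + T kap e / kap e)) = cnj ta - kap e * ta"
 proof -
  have "(n + 1) * (x + (x + y)) = c - k" if "n * x = c + S - k" "(n + 1) * y + (n + 2) * x + S = 0" for n x y c S k :: complex
   using that by algebra
  from this[OF e1] e2 show ?thesis by (simp only: of_nat_add of_nat_1 of_nat_numeral)
 qed
 moreover have "ta = of_nat (CARD('n) + 1) * t (lift e)"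
 proof -
  have "of_nat (CARD('n) + 1) ~= (0::complex)" by (simp only: of_nat_eq_0_iff)
  thus ?thesis unfolding t_def ta_def by (subst eq_commute) (simp only: times_divide_eq_right, rule nonzero_mult_div_cancel_left)
 qed
 ultimately have "of_nat (CARD('n) + 1) * (T sg e / sg e + (T sg e / sg e + T kap e / kap e)) = of_nat (CARD('n) + 1) * (cnj (t (lift e)) - kap e * t (lift e))"
  by (simp add: algebra_simps)
 hence "T sg e / sg e - cnj (T sg e) / sg e = cnj (t (lift e)) - kap e * t (lift e)"
  unfolding Tb by (simp only: mult_cancel_left) (simp del: of_nat_add of_nat_Suc)
 hence "T sg e - cnj (T sg e) = sg e * cnj (t (lift e)) - kap e * sg e * t (lift e)"
  using sg_nz[of e] by (simp add: field_simps)
 moreover have "cnj (kap e * sg e) = sg e" using sg_cnj[of e] by (metis complex_cnj_cnj)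
 ultimately show ?thesis unfolding hww_def by (simp add: algebra_simps sg_cnj)
qed

end

section \<open>The parallel Hermitian form\<close>

lemma sum_option: "(SU c. f c) = f None + (SU k. f (Some k))"
 for f :: "'n::finite option => 'b::comm_monoid_add"
 by (simp add: UNIV_option_conv sum.reindex)

lemma option2_cases:
 obtains "a = None" | "a = Some None" | j where "a = Some (Some j)"
 by (metis option.exhaust)

lemma sum_option2: "(SU c. f c) = f None + f (Some None) + (SU k. f (Some (Some k)))"
 for f :: "'n::finite option option => 'b::comm_monoid_add"
 by (simp only: sum_option add.assoc)

context one_sided
begin

text \<open>The matrices have indices None, Some None and Some (Some j), which belong to a constant, to w and to
  z j. The rows of h are R0, Wr and the derivatives of R0 along the L j, corrected by ze. The
  definitions of C, w0, wk, q0, qk, qw and Ga record the coefficients with which the fields L i act on these rows.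
  Differentiation by the commutators yields the remaining coefficient Om, for T, from Ga.\<close>

definition NN :: "'n option option => (complex^'n) \<times> real => complex" where
 "NN b e = (case b of None => 0 | Some c => N c e)"
definition Vs :: "'n option option => (complex^'n) \<times> real => complex" where
 "Vs b e = (case b of None => sg e | Some c => V c sg e)"
definition "R0 b e = sg e * NN b e"
definition "Wr b e = Vs b e + NN b e * (sg e * t (lift e))"
definition h :: "'n option option => 'n option option => (complex^'n) \<times> real => complex" where
 "h a b e = (case a of None => R0 b e | Some None => Wr b e | Some (Some j) => L j (R0 b) e - ze j e * Wr b e)"

definition "C i j x = Dw (g i j) x - (SU k. Dze k (g i j) x * al k x) - al i x * al j x + D i (al j) x"
definition "w0 i x = (SU k. Dze k (al i) x * al k x) - t x * al i x + D i t x - Dw (al i) x"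
definition "wk i k x = (if k = i then t x else 0) - Dze k (al i) x"
definition "q0 i a x = (case a of None => 0 | Some None => w0 i x | Some (Some j) => C i j x - snd x $ j * w0 i x)"
definition "qk i a k x = (case a of None => if k = i then 1 else 0 | Some None => wk i k x
 | Some (Some j) => Dze k (g i j) x + (if k = j then al i x else 0) + (if k = i then al j x else 0) - snd x $ j * wk i k x)"
definition "qw i a x = (case a of None => 0 | Some None => al i x | Some (Some j) => - g i j x - snd x $ j * al i x)"
definition Ga :: "'n => 'n option option => 'n option option => 'n jet => complex" where
 "Ga i a b x = (case b of None => q0 i a x | Some None => qw i a x + (SU k. snd x $ k * qk i a k x) | Some (Some k) => qk i a k x)"
definition "Om a b x = (SU m. Dze m (Ga m a b) x) / of_nat CARD('n)"

lemma hol_if: "hol_side W P a ==> hol_side W P b ==> hol_side W P (%x. if c then a x else b x)" by (cases c) simp_all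

lemma hol_w0: "hol_side W P (w0 i)"
 unfolding w0_def[abs_def] by (intro hol_sides openW hol_D hol_Di hol_al hol_t)
lemma hol_wk: "hol_side W P (wk i k)"
 unfolding wk_def[abs_def] by (intro hol_sides openW hol_D hol_if hol_al hol_t)
lemma hol_C: "hol_side W P (C i j)"
 unfolding C_def[abs_def] by (intro hol_sides openW hol_D hol_Di g hol_al hol_t)
lemma hol_q0: "hol_side W P (q0 i a)"
 unfolding q0_def[abs_def]
 by (cases a rule: option2_cases; simp; intro hol_sides openW hol_C hol_w0 hol_snd)
lemma hol_qk: "hol_side W P (qk i a k)"
 unfolding qk_def[abs_def]
 by (cases a rule: option2_cases; simp; intro hol_sides openW hol_wk hol_D g hol_al hol_snd hol_if conjI impI)
lemma hol_qw: "hol_side W P (qw i a)"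
 unfolding qw_def[abs_def]
 by (cases a rule: option2_cases; simp; intro hol_sides openW g hol_al hol_snd)
lemma hol_Ga: "hol_side W P (Ga i a b)"
 unfolding Ga_def[abs_def]
 by (cases b rule: option2_cases; simp; intro hol_sides openW hol_q0 hol_qk hol_qw hol_snd)
lemma hol_Om: "hol_side W P (Om a b)"
 unfolding Om_def[abs_def] by (intro hol_sides openW hol_D hol_Ga)

lemma smooth_NN [smooths]: "smooth_on B (NN b)"
 unfolding NN_def[abs_def] by (cases b) (auto intro!: smooths)
lemma smooth_Vs [smooths]: "smooth_on B (Vs b)"
 unfolding Vs_def[abs_def] by (cases b) (auto intro!: smooths)
lemma smooth_R0 [smooths]: "smooth_on B (R0 b)"
 unfolding R0_def[abs_def] by (intro smooths openB)
lemma smooth_Wr [smooths]: "smooth_on B (Wr b)"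
 unfolding Wr_def[abs_def] by (intro smooths openB hol_t)
lemma smooth_h [smooths]: "smooth_on B (h a b)"
 unfolding h_def[abs_def] by (cases a rule: option2_cases; simp; intro smooths openB)

lemma LL_NN: assumes e: "e : B"
 shows "L i (L j (NN b)) e = (SU l. Dze l (g i j) (lift e) * L l (NN b) e) + Dw (g i j) (lift e) * NN b e"
proof (cases b)
 case None
 have "L i (L j (%e. 0)) e = L i (%e. 0) e" by (rule LT_cong[OF e]) simp
 moreover have "NN b = (%e. 0)" using None by (simp add: NN_def[abs_def])
 ultimately show ?thesis by simp
next
 case (Some c) thus ?thesis using LL_N[OF e, of i j c] by (simp add: NN_def[abs_def])
qed

lemma L_R0: "e : B ==> L j (R0 b) e = sg e * (L j (NN b) e + al j (lift e) * NN b e)"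
 unfolding R0_def[abs_def] by (simp add: LT_mult smooths L_sg algebra_simps)

lemma L_NN: "e : B ==> sg e * L j (NN b) e = L j (R0 b) e - al j (lift e) * R0 b e"
 by (simp add: L_R0 R0_def algebra_simps)

lemma L_L_R0: assumes e: "e : B"
 shows "L i (L j (R0 b)) e = (SU k. Dze k (g i j) (lift e) * L k (R0 b) e) + al i (lift e) * L j (R0 b) e
  + al j (lift e) * L i (R0 b) e + C i j (lift e) * R0 b e"
proof -
 have "L i (L j (R0 b)) e = L i (%e. sg e * (L j (NN b) e + al j (lift e) * NN b e)) e" by (rule LT_cong[OF e L_R0])
 also have "... = sg e * L i (L j (NN b)) e + al j (lift e) * (sg e * L i (NN b) e) + sg e * NN b e * D i (al j) (lift e)
   + al i (lift e) * (sg e * L j (NN b) e + sg e * NN b e * al j (lift e))"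
  using e by (simp add: LT_mult LT_add smooths openB hol_al L_sg L_pull algebra_simps)
 also have "sg e * L i (L j (NN b)) e = (SU k. Dze k (g i j) (lift e) * (sg e * L k (NN b) e)) + Dw (g i j) (lift e) * (sg e * NN b e)"
  unfolding LL_NN[OF e] by (simp add: sum_distrib_left algebra_simps)
 finally show ?thesis unfolding L_NN[OF e] R0_def[symmetric]
  by (simp add: C_def algebra_simps sum_distrib_left sum_subtractf)
qed

lemma L_Vs: assumes e: "e : B"
 shows "L i (Vs b) e = al i (lift e) * Vs b e - (Dw (al i) (lift e) * (sg e * NN b e) + (SU l. Dze l (al i) (lift e) * (sg e * L l (NN b) e)))"
proof (cases b)
 case None
 thus ?thesis by (simp add: Vs_def[abs_def] NN_def[abs_def] L_sg[OF e])
next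
 case (Some c)
 have "V c (L i sg) e = V c (%e. al i (lift e) * sg e) e" by (rule V_cong[OF e L_sg])
 also have "... = al i (lift e) * V c sg e + sg e * V c (%e. al i (lift e)) e"
  using e by (cases c) (simp_all add: V_def LT_mult smooths openB hol_al algebra_simps)
 finally show ?thesis using comm_LV[OF e smooth_sg, of i c] Some
  by (simp add: Vs_def[abs_def] NN_def[abs_def] V_pull[OF hol_al e] algebra_simps sum_distrib_left)
qed

lemma L_Wr: assumes e: "e : B"
 shows "L i (Wr b) e = al i (lift e) * Wr b e + (SU k. wk i k (lift e) * L k (R0 b) e) + w0 i (lift e) * R0 b e"
proof -
 have "L i (Wr b) e = L i (Vs b) e + (sg e * L i (NN b) e) * t (lift e) + (sg e * NN b e) * (al i (lift e) * t (lift e) + D i t (lift e))"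
  unfolding Wr_def[abs_def] using e by (simp add: LT_mult LT_add smooths openB hol_t L_sg L_pull algebra_simps)
 thus ?thesis unfolding L_Vs[OF e] L_NN[OF e] R0_def[symmetric]
  by (simp add: w0_def wk_def Wr_def R0_def algebra_simps sum_subtractf sum.distrib sum_distrib_left if_distrib[of "%x. x * _"] if_distrib[of "%x. _ * x"] cong: if_cong)
qed

lemma Ga_rows: "(SU c. Ga i a c (lift e) * h c b e) = q0 i a (lift e) * R0 b e + qw i a (lift e) * Wr b e + (SU k. qk i a k (lift e) * L k (R0 b) e)"
proof -
 have "snd (lift e) $ k = ze k e" for k by (simp add: lift_def)
 thus ?thesis
  by (simp add: sum_option2 Ga_def h_def algebra_simps sum_subtractf sum_distrib_left)
qed

text \<open>The L i map R0, its derivatives and Wr to combinations of these rows: this is the second order system for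
  N, multiplied by the density, and t is chosen so that the system closes at Wr.\<close>

lemma L_h: assumes e: "e : B" shows "L i (h a b) e = (SU c. Ga i a c (lift e) * h c b e)"
proof -
 have ze: "snd (lift e) $ k = ze k e" for k by (simp add: lift_def)
 show ?thesis
 proof (cases a rule: option2_cases)
  case 1 thus ?thesis unfolding Ga_rows
   by (simp add: h_def[abs_def] q0_def qw_def qk_def if_distrib[of "%x. x * _"] cong: if_cong)
 next
  case 2 thus ?thesis unfolding Ga_rows by (simp add: h_def[abs_def] q0_def qw_def qk_def L_Wr[OF e])
 next
  case (3 j)
  hence "L i (h a b) e = L i (L j (R0 b)) e - (ze j e * L i (Wr b) e + Wr b e * g i j (lift e))"
   using e L_ze[OF e, of i j] unfolding lift_def[symmetric] by (simp add: h_def[abs_def] LT_diff LT_mult smooths openB)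
  thus ?thesis unfolding Ga_rows L_L_R0[OF e] L_Wr[OF e] 3
   by (simp add: q0_def qw_def qk_def ze distrib_right left_diff_distrib sum.distrib sum_subtractf if_distrib[of "%x. x * _"] cong: if_cong)
   (simp add: algebra_simps sum_distrib_left)
 qed
qed

lemma h_hermitian: assumes e: "e : B" shows "cnj (h a b e) = h b a e"
proof -
 have k: "cnj (kap e) * cnj (sg e) = sg e" using sg_cnj[of e] by (metis complex_cnj_cnj complex_cnj_mult)
 have LV: "Wr (Some (Some k)) e = Lb k sg e - cnj (ze k e) * hww e" for k
  by (simp add: Wr_def Vs_def NN_def N_def V_def hww_def algebra_simps)
 have Ww: "Wr (Some None) e = hww e" by (simp add: Wr_def Vs_def NN_def N_def V_def hww_def algebra_simps)
 have W0: "Wr None e = sg e" by (simp add: Wr_def Vs_def NN_def)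
 have R0w: "R0 (Some None) = (%e. cnj (sg e))" by (simp add: R0_def[abs_def] NN_def N_def sg_cnj mult.commute)
 have R00: "R0 None = (%e. 0)" by (simp add: R0_def[abs_def] NN_def)
 have R0k: "R0 (Some (Some k)) = (%e. - (cnj (sg e) * cnj (ze k e)))" for k by (simp add: R0_def[abs_def] NN_def N_def sg_cnj fun_eq_iff)
 have Lk: "L j (R0 (Some (Some k))) e = - (cnj (sg e) * La j k e + cnj (ze k e) * cnj (Lb j sg e))" for j k
  unfolding R0k using e by (simp add: LT_uminus LT_diff LT_mult smooths openB La_def L_cnj(1)[OF dB[OF smooth_sg e]])
 have La': "sg e * cnj (La j k e) = cnj (sg e) * La k j e" for j k
  by (simp add: La_cnj[OF e] sg_cnj)
 note S = h_def LV Ww W0 R0w R00 R0k Lk[unfolded R0k] La' hww_real[OF e] L_cnj(1)[OF dB[OF smooth_sg e]]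
 show ?thesis
 proof (cases a rule: option2_cases)
  case 1 thus ?thesis by (cases b rule: option2_cases; simp add: S)
 next
  case 2 thus ?thesis by (cases b rule: option2_cases; simp add: S)
 next
  case (3 j) thus ?thesis by (cases b rule: option2_cases; simp add: S algebra_simps)
 qed
qed

text \<open>The Hermitian symmetry turns the derivatives along L i into those along Lb i.\<close>

lemma Lb_h: assumes e: "e : B" shows "Lb i (h a b) e = (SU c. h a c e * cnj (Ga i b c (lift e)))"
proof -
 have "Lb i (h a b) e = Lb i (%e. cnj (h b a e)) e" by (rule LT_cong[OF e]) (simp add: h_hermitian)
 thus ?thesis by (simp add: L_cnj(2)[OF dB[OF smooth_h e]] L_h[OF e] h_hermitian[OF e] mult.commute)
qed

text \<open>The commutators of the fields of type (1,0) and (0,1) yield the derivative in the remaining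
 direction; contraction with the inverse of the Levi form isolates it.\<close>

lemma T_h: assumes e: "e : B"
 shows "T (h a b) e = (SU c. h a c e * cnj (Om b c (lift e))) - kap e * (SU c. Om a c (lift e) * h c b e)"
proof -
 obtain M where M: "!!i k. (SU j. La i j e * M j k) = (if i = k then 1 else 0)"
  "!!j m. (SU i. M j i * La i m e) = (if j = m then 1 else 0)" using La_inverse[OF e] by blast
 let ?u = "%j m. (SU c. h a c e * cnj (Dze m (Ga j b c) (lift e)))"
 let ?v = "%i m. (SU c. Dze m (Ga i a c) (lift e) * h c b e)"
 have cm: "La i j e * T (h a b) e = (SU m. La i m e * ?u j m) - kap e * (SU m. ?v i m * La m j e)" for i j
 proof -
  have "L i (Lb j (h a b)) e = L i (%e. SU c. h a c e * cnj (Ga j b c (lift e))) e" by (rule LT_cong[OF e Lb_h])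
  also have "... = (SU c. cnj (Ga j b c (lift e)) * L i (h a c) e) + (SU m. La i m e * ?u j m)"
   using e by (simp add: LT_mult LT_sum smooths openB hol_Ga L_pull_cnj sum.distrib sum_distrib_left mult_ac)
   (rule sum.swap)
  finally have 1: "L i (Lb j (h a b)) e = ..." .
  have "Lb j (L i (h a b)) e = Lb j (%e. SU c. Ga i a c (lift e) * h c b e) e" by (rule LT_cong[OF e L_h])
  also have "... = (SU c. Ga i a c (lift e) * Lb j (h c b) e) + kap e * (SU m. ?v i m * La m j e)"
   using e by (simp add: LT_mult LT_sum smooths openB hol_Ga Lb_pull sum.distrib sum_distrib_left sum_distrib_right mult_ac)
   (rule sum.swap)
  finally have 2: "Lb j (L i (h a b)) e = ..." .
  have "(SU c. cnj (Ga j b c (lift e)) * L i (h a c) e) = (SU c. Ga i a c (lift e) * Lb j (h c b) e)"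
   unfolding L_h[OF e] Lb_h[OF e] sum_distrib_left by (subst sum.swap) (simp add: mult_ac)
  thus ?thesis using comm_LLb[OF e smooth_h, of i j a b] unfolding 1 2 by simp
 qed
 have c1: "(SU i. SU j. M j i * (La i j e * x)) = of_nat CARD('n) * x" for x
 proof -
  have "(SU j. M j i * (La i j e * x)) = (SU j. La i j e * M j i) * x" for i
   by (simp add: sum_distrib_left mult_ac)
  thus ?thesis by (simp add: M)
 qed
 have c2: "(SU i. SU j. M j i * (SU m. La i m e * X j m)) = (SU m. X m m)" for X
 proof -
  have "(SU i. SU j. M j i * (SU m. La i m e * X j m)) = (SU j. SU m. (SU i. M j i * La i m e) * X j m)"
   unfolding sum_distrib_left sum_distrib_right mult.assoc[symmetric] by (subst sum.swap) (rule sum.cong[OF refl], rule sum.swap)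
  thus ?thesis unfolding M by (simp add: if_distrib[of "%x. x * _"] cong: if_cong)
 qed
 have c3: "(SU i. SU j. M j i * (SU m. X i m * La m j e)) = (SU m. X m m)" for X
 proof -
  have "(SU j. M j i * (SU m. X i m * La m j e)) = (SU m. X i m * (SU j. La m j e * M j i))" for i
   unfolding sum_distrib_left by (subst sum.swap) (simp add: mult_ac)
  thus ?thesis unfolding M by (simp add: if_distrib[of "%x. _ * x"] cong: if_cong)
 qed
 have om: "of_nat CARD('n) * Om a c x = (SU m. Dze m (Ga m a c) x)" for a c x by (simp add: Om_def)
 have "of_nat CARD('n) * T (h a b) e = (SU i. SU j. M j i * ((SU m. La i m e * ?u j m) - kap e * (SU m. ?v i m * La m j e)))"
  unfolding c1[symmetric] cm ..
 also have "... = (SU i. SU j. M j i * (SU m. La i m e * ?u j m)) - kap e * (SU i. SU j. M j i * (SU m. ?v i m * La m j e))"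
  by (simp only: right_diff_distrib sum_subtractf sum_distrib_left[of "kap e"] mult.left_commute[of "kap e"])
 also have "... = (SU m. ?u m m) - kap e * (SU m. ?v m m)" unfolding c2 c3 ..
 also have "(SU m. ?u m m) = (SU c. h a c e * cnj (of_nat CARD('n) * Om b c (lift e)))"
  unfolding om by (subst sum.swap) (simp add: sum_distrib_left)
 also have "... = of_nat CARD('n) * (SU c. h a c e * cnj (Om b c (lift e)))"
  by (simp add: sum_distrib_left mult_ac)
 also have "(SU m. ?v m m) = (SU c. of_nat CARD('n) * Om a c (lift e) * h c b e)"
  unfolding om by (subst sum.swap) (simp add: sum_distrib_right)
 also have "... = of_nat CARD('n) * (SU c. Om a c (lift e) * h c b e)"
  by (simp add: sum_distrib_left mult_ac)
 finally have "of_nat CARD('n) * T (h a b) e = of_nat CARD('n) * ((SU c. h a c e * cnj (Om b c (lift e))) - kap e * (SU c. Om a c (lift e) * h c b e))"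
  by (simp add: algebra_simps)
 thus ?thesis by (simp only: mult_cancel_left) simp
qed

text \<open>The connection form, as a function on the jets with values in the dual of the directions
 in the base; on the hypersurface it is compatible with the Hermitian form.\<close>

definition conn :: "complex^'n => complex => 'n option option => 'n option option => 'n jet => complex" where
 "conn v c a b x = (SU i. v $ i * Ga i a b x) + (c - (SU i. snd x $ i * v $ i)) * Om a b x"

text \<open>On the three parts of the frame this is L_h, Lb_h and T_h.\<close>

theorem FD_h: assumes e: "e : B"
 shows "FD (h a b) e (v, s) = (SU c. conn v (FD w e (v, s)) a c (lift e) * h c b e)
  + (SU c. h a c e * cnj (conn v (FD w e (v, s)) b c (lift e)))"
proof -
 define th where "th = FD w e (v, s) - (SU i. ze i e * v $ i)"
 have th: "th = - kap e * cnj th"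
  using FD_frame[OF e smooth_w(1), of v s] by (simp add: L_w[OF e] th_def algebra_simps)
 have c: "conn v (FD w e (v, s)) a b (lift e) = (SU i. v $ i * Ga i a b (lift e)) + th * Om a b (lift e)" for a b
  by (simp add: conn_def th_def lift_def)
 have "FD (h a b) e (v, s) = (SU i. v $ i * L i (h a b) e) + (SU i. cnj (v $ i) * Lb i (h a b) e) + cnj th * T (h a b) e"
  unfolding FD_frame[OF e smooth_h] th_def by (simp add: sum.distrib)
 also have "cnj th * T (h a b) e = cnj th * (SU c. h a c e * cnj (Om b c (lift e))) + th * (SU c. Om a c (lift e) * h c b e)"
  unfolding T_h[OF e] by (subst (2) th) (simp add: algebra_simps)
 also have "(SU i. v $ i * L i (h a b) e) = (SU c. (SU i. v $ i * Ga i a c (lift e)) * h c b e)"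
  unfolding L_h[OF e] sum_distrib_left sum_distrib_right by (subst sum.swap) (simp add: mult_ac)
 also have "(SU i. cnj (v $ i) * Lb i (h a b) e) = (SU c. h a c e * cnj (SU i. v $ i * Ga i b c (lift e)))"
  unfolding Lb_h[OF e] by (simp add: sum_distrib_left, subst sum.swap) (simp add: mult_ac)
 finally show ?thesis unfolding c
  by (simp add: distrib_left distrib_right sum.distrib sum_distrib_left sum_distrib_right mult_ac)
qed

lemma Dze_const: "Dze l (%x. c) x = 0" by (simp add: Dze_def)

text \<open>In the first row the connection form is the tautological form of the base.\<close>

lemma conn_row:
 "conn v c None b x = (case b of None => 0 | Some None => c | Some (Some k) => v $ k)"
proof -
 have l: "FD (%x::'n jet. snd x $ i) x v = snd v $ i" for i x v
  by (rule FD_bounded_linear[OF bounded_linear_compose[OF bounded_linear_vec_nth bounded_linear_snd]])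
 have "Ga i None (Some None) = (%x. snd x $ i)" for i
  by (simp add: Ga_def[abs_def] qw_def qk_def if_distrib[of "%x. _ * x"] cong: if_cong)
 hence *: "Dze l (Ga i None (Some None)) x = (if l = i then 1 else 0)" "Ga i None (Some None) x = snd x $ i" for l i x
  by (simp_all add: Dze_def l axis_def)
 show ?thesis
 proof (cases b rule: option2_cases)
  case 1 thus ?thesis by (simp add: conn_def Om_def Ga_def[abs_def] q0_def Dze_const)
 next
  case 2 thus ?thesis by (simp add: conn_def Om_def * mult.commute)
 next
  case (3 k) thus ?thesis by (simp add: conn_def Om_def Ga_def[abs_def] qk_def Dze_const if_distrib[of "%x. _ * x"] cong: if_cong)
 qed
qed

end

section \<open>Uniqueness for ordinary differential equations\<close>

text \<open>The function exp (- 2 K t) times the squared norm is decreasing.\<close>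

lemma gronwall_zero:
 fixes dl :: "real => 'a::real_inner"
 assumes d: "!!t. t : {0..1} ==> (dl has_vector_derivative dl' t) (at t within {0..1})"
  and 0: "dl 0 = 0" and K: "!!t. t : {0..1} ==> norm (dl' t) <= K * norm (dl t)" and t: "t : {0..1}"
 shows "dl t = 0"
proof -
 define f where "f t = exp (- 2 * K * t) * (dl t \<bullet> dl t)" for t
 have c: "continuous_on {0..1} dl"
  using d has_vector_derivative_continuous continuous_on_eq_continuous_within by blast
 have "f 0 >= f t"
 proof (rule DERIV_nonpos_imp_decreasing_open[of 0 t f])
  show "0 <= t" using t by simp
  show "continuous_on {0..t} f" unfolding f_def
   by (intro continuous_intros continuous_on_subset[OF c]) (use t in auto)
  fix x assume x: "0 < x" "x < t"
  hence "x : {0<..<1}" "x : {0..1}" using t by auto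
  hence dx: "(dl has_vector_derivative dl' x) (at x)"
   using d[of x] at_within_Icc_at[of 0 x 1] by simp
  have "((%t. dl t \<bullet> dl t) has_derivative (%s. dl x \<bullet> (s .* dl' x) + (s .* dl' x) \<bullet> dl x)) (at x)"
   using has_derivative_inner[OF dx[unfolded has_vector_derivative_def] dx[unfolded has_vector_derivative_def]] .
  hence "((%t. dl t \<bullet> dl t) has_real_derivative 2 * (dl x \<bullet> dl' x)) (at x)"
   unfolding has_field_derivative_def by (rule has_derivative_eq_rhs) (auto simp: inner_commute)
  hence "(f has_real_derivative exp (- 2 * K * x) * (2 * (dl x \<bullet> dl' x) - 2 * K * (dl x \<bullet> dl x))) (at x)"
   unfolding f_def by (auto intro!: derivative_eq_intros simp: algebra_simps)
  moreover have "dl x \<bullet> dl' x <= K * (dl x \<bullet> dl x)"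
  proof -
   have "dl x \<bullet> dl' x <= norm (dl x) * norm (dl' x)" by (rule norm_cauchy_schwarz)
   also have "... <= norm (dl x) * (K * norm (dl x))" by (intro mult_left_mono K \<open>x : {0..1}\<close>) simp
   finally show ?thesis by (simp add: dot_square_norm power2_eq_square mult_ac)
  qed
  ultimately show "EX y. (f has_real_derivative y) (at x) & y <= 0"
   by (intro exI conjI) (assumption, simp add: mult_le_0_iff)
 qed
 hence "exp (- 2 * K * t) * (dl t \<bullet> dl t) <= 0" by (simp add: f_def 0)
 hence "dl t \<bullet> dl t <= 0" by (simp add: mult_le_0_iff)
 thus ?thesis using inner_ge_zero[of "dl t"] inner_eq_zero_iff[of "dl t"] by linarith
qed

text \<open>By the homogeneity of G in y, a substitution turns the integral over [0,1] into one over [0,t].\<close>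

lemma ray_ode:
 fixes Ps :: "'p::euclidean_space => 'e::euclidean_space"
 assumes Ps: "!!y. y : ball 0 r ==> Ps y = Y0 + integral {0..1} (%t. G y (Ps (t .* y)))"
  and G: "!!t y e. G (t .* y) e = t .* G y e"
  and c: "continuous_on {0..1} (%t. G y (Ps (t .* y)))"
  and y: "y : ball 0 r" and t: "t : {0..1}"
 shows "((%t. Ps (t .* y)) has_vector_derivative G y (Ps (t .* y))) (at t within {0..1})"
proof -
 have eq: "Ps (t .* y) = Y0 + integral {0..t} (%t. G y (Ps (t .* y)))" if t: "t : {0..1}" for t
 proof -
  have g: "(%s. t * s) ` {0..1} <= {0..1}" using t by (auto simp: mult_le_one)
  have "((%s. t .* G y (Ps ((t * s) .* y))) has_integral (integral {t * 0..t * 1} (%t. G y (Ps (t .* y))))) {0..1}"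
   by (rule has_integral_substitution[OF _ _ g c]) (use t in \<open>auto intro!: derivative_eq_intros\<close>)
  from integral_unique[OF this] have "integral {0..1} (%s. G (t .* y) (Ps (s .* (t .* y)))) = integral {0..t} (%t. G y (Ps (t .* y)))"
   by (simp add: G mult.commute)
  thus ?thesis using Ps[OF scale_ball[OF t y]] by simp
 qed
 have "((%t. Y0 + integral {0..t} (%t. G y (Ps (t .* y)))) has_vector_derivative G y (Ps (t .* y))) (at t within {0..1})"
  using has_vector_derivative_add[OF has_vector_derivative_const integral_has_vector_derivative[OF c t]] by simp
 thus ?thesis by (rule has_vector_derivative_transform[OF t, rotated]) (rule eq)
qed

lemma FDL_bounded_on_compact:
 fixes g :: "'e::euclidean_space => 'f::euclidean_space"
 assumes "open U" "smooth_on U g" "compact S" "S <= U"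
 obtains K where "K >= 0" "!!x v. x : S ==> norm (FD g x v) <= K * norm v"
proof -
 have "continuous_on S (FDL g)"
  using smooth_cont[OF smooth_on_FDL[OF assms(1,2)]] assms(4) continuous_on_subset by blast
 from compact_imp_bounded[OF compact_continuous_image[OF this assms(3)]]
 obtain K where K: "!!x. x : S ==> norm (FDL g x) <= K"
  by (auto simp: bounded_iff)
 show ?thesis
 proof (rule that[of "max K 0"])
  fix x v assume x: "x : S"
  have "norm (FD g x v) <= norm (FDL g x) * norm v"
   using norm_blinfun[of "FDL g x" v] FDL_apply[OF smooth_diff[OF assms(2)]] x assms(4) by auto
  also have "... <= max K 0 * norm v" using K[OF x] by (intro mult_right_mono) auto
  finally show "norm (FD g x v) <= max K 0 * norm v" .
 qed simp
qed

lemma ode_unique: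
 fixes g :: "'e::euclidean_space => 'e"
 assumes g: "open U" "smooth_on U g" and S: "compact S" "convex S" "S <= U"
  and a: "!!t. t : {0..1} ==> (a has_vector_derivative g (a t)) (at t within {0..1})" "!!t. t : {0..1} ==> a t : S"
  and b: "!!t. t : {0..1} ==> (b has_vector_derivative g (b t)) (at t within {0..1})" "!!t. t : {0..1} ==> b t : S"
  and ab: "a 0 = b 0" and t: "t : {0..1}"
 shows "a t = b t"
proof -
 obtain K where K: "K >= 0" "!!x v. x : S ==> norm (FD g x v) <= K * norm v"
  using FDL_bounded_on_compact[OF g S(1,3)] by blast
 have lip: "norm (g x - g y) <= K * norm (x - y)" if "x : S" "y : S" for x y
 proof (rule differentiable_bound[OF S(2) _ _ that, where f'="FD g"])
  fix x assume x: "x : S"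
  thus "(g has_derivative FD g x) (at x within S)"
   using smooth_on_has_derivative[OF g(2)] S(3) has_derivative_at_withinI by blast
  show "onorm (FD g x) <= K" using K(2)[OF x] by (rule onorm_le)
 qed
 have "a t - b t = 0"
 proof (rule gronwall_zero[where dl'="%t. g (a t) - g (b t)" and K=K])
  show "((%t. a t - b t) has_vector_derivative g (a t) - g (b t)) (at t within {0..1})" if "t : {0..1}" for t
   using has_vector_derivative_diff[OF a(1) b(1)] that by blast
 qed (use ab lip a b t in auto)
 thus ?thesis by simp
qed

text \<open>A solution of a linear equation with zero initial value vanishes; in this form the linear
 equation is given by a bilinear map with continuous coefficients.\<close>

lemma linear_ode_zero:
 fixes dl :: "real => 'a::euclidean_space"
 assumes P: "bounded_bilinear P" and u: "continuous_on {0..1} u"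
  and d: "!!t. t : {0..1} ==> (dl has_vector_derivative P (u t) (dl t)) (at t within {0..1})"
  and 0: "dl 0 = 0" and t: "t : {0..1}"
 shows "dl t = 0"
proof -
 obtain k where k: "k > 0" "!!a b. norm (P a b) <= norm a * norm b * k" using bounded_bilinear.pos_bounded[OF P] by blast
 obtain U where U: "!!t. t : {0..1} ==> norm (u t) <= U"
  using compact_imp_bounded[OF compact_continuous_image[OF u compact_Icc]] by (meson bounded_iff imageI)
 show ?thesis
 proof (rule gronwall_zero[OF d 0 _ t, where K="U * k"])
  fix t :: real assume t: "t : {0..1}"
  have "norm (P (u t) (dl t)) <= norm (u t) * (norm (dl t) * k)" using k(2)[of "u t" "dl t"] by (simp add: mult.assoc)
  also have "... <= U * (norm (dl t) * k)" using U[OF t] k(1) by (intro mult_right_mono) auto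
  finally show "norm (P (u t) (dl t)) <= U * k * norm (dl t)" by (simp add: mult_ac)
 qed
qed

lemma bounded_bilinear_matrix_mult: "bounded_bilinear ((**) :: complex^'a::finite^'b::finite => complex^'c::finite^'a => _)"
proof -
 have "bilinear ((**) :: complex^'a^'b => complex^'c^'a => complex^'c^'b)"
  unfolding bilinear_def linear_iff
  by (auto simp: vec_eq_iff matrix_matrix_mult_def sum.distrib algebra_simps scaleR_sum_right)
 thus ?thesis by (simp add: bilinear_conv_bounded_bilinear)
qed

definition adj :: "complex^'a^'b => complex^'b^'a" where
 "adj M = (\<chi> i j. cnj (M $ j $ i))"

lemma adjoint_mult: "adj (M ** N) = adj N ** adj M"
 for M :: "complex^'a::finite^'b::finite" and N :: "complex^'c::finite^'a"
 by (simp add: adj_def matrix_matrix_mult_def vec_eq_iff mult.commute)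

lemma adjoint_diff: "adj (M - N) = adj M - adj N"
 and adjoint_add: "adj (M + N) = adj M + adj N"
 and adjoint_one: "adj (mat 1) = (mat 1 :: complex^'a::finite^'a)"
 by (auto simp: adj_def vec_eq_iff mat_def)

lemma bounded_linear_adjoint: "bounded_linear (adj :: complex^'a::finite^'b::finite => _)"
 by (subst linear_conv_bounded_linear[symmetric]) (auto simp: linear_iff adj_def vec_eq_iff)

lemma matrix_mult_diff: "A ** (X - Y) = A ** X - A ** Y" "(X' - Y') ** A = X' ** A - Y' ** A"
 for A :: "complex^'a::finite^'a"
 by (simp_all add: matrix_matrix_mult_def vec_eq_iff algebra_simps sum_subtractf)

lemma matrix_mult_add: "A ** (X + Y) = A ** X + A ** Y" "(X' + Y') ** A = X' ** A + Y' ** A"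
 for A :: "complex^'a::finite^'a"
 by (simp_all add: matrix_matrix_mult_def vec_eq_iff algebra_simps sum.distrib)

lemmas matrix_vector_derivative = bounded_bilinear.has_vector_derivative[OF bounded_bilinear_matrix_mult]

section \<open>Development of the connection\<close>

definition vz :: "complex^('n::finite option option) => complex^'n" where "vz r = (\<chi> k. r $ Some (Some k))"
definition vw :: "complex^('n::finite option option) => complex" where "vw r = r $ Some None"

lemma vz_vw_linear: "vz (a + b) = vz a + vz b" "vw (a + b) = vw a + vw b" "vz (c *s a) = c *s vz a" "vw (c *s a) = c * vw a"
 by (auto simp: vz_def vw_def vec_eq_iff)

text \<open>The coordinates are normalized at the origin, where h takes the simple form J_0. The function rh defines the
  side of the hypersurface on which the coefficients of the connection are holomorphic.\<close>

locale development = one_sided B ph W P g for B :: "((complex^'n::finite) \<times> real) set" and ph W P g +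
 fixes rh :: "(complex^'n) \<times> complex => real" and U :: "((complex^'n) \<times> complex) set" and c0 :: real
 assumes zero_B: "0 : B" and phi_0: "ph 0 = 0" and dphi_0: "FD ph 0 = (%_. 0)"
  and P_eq: "P = {X:W. rh (fst X) < 0}" and openU: "open U" and srh: "smooth_on U rh" and WU: "fst ` W <= U"
  and rh_graph: "!!e. e : B ==> rh (fst e, w e) = 0" and drh: "!!v c. FD rh 0 (v, c) = c0 * Im c" and c0: "c0 ~= 0"
begin

lemma at_0: "phs 0 = 0" "ze i 0 = 0" "kap 0 = - 1" "w 0 = 0" "lift 0 = 0"
proof -
 show 1: "phs 0 = 0" "ze i 0 = 0" for i by (simp_all add: phs_def ze_def phz_def dphi_0)
 thus "kap 0 = - 1" by (simp add: kap_def ch_def)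
 show "w 0 = 0" by (simp add: w_def phi_0)
 thus "lift 0 = 0" by (simp add: lift_def 1 prod_eq_iff vec_eq_iff)
qed

lemma h_col0: assumes "e : B" shows "h None None e = 0" "h (Some None) None e = sg e" "h (Some (Some j)) None e = - ze j e * sg e"
proof -
 have "R0 None = (%e. 0)" by (simp add: R0_def[abs_def] NN_def)
 thus "h None None e = 0" "h (Some None) None e = sg e" "h (Some (Some j)) None e = - ze j e * sg e"
  by (simp_all add: h_def Wr_def Vs_def NN_def)
qed

definition "J = (\<chi> p q. h p q 0)"
definition "hm e = (\<chi> p q. h p q e)"
definition "cm v c X = (\<chi> p q. conn v c p q X)"

lemma J_hermitian: "cnj (J $ p $ q) = J $ q $ p" by (simp add: J_def h_hermitian zero_B)
lemma J_0: "J $ None $ None = 0" "J $ Some None $ None = sg 0" "J $ Some (Some j) $ None = 0" "J $ None $ Some None = - sg 0" "J $ None $ Some (Some j) = 0"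
proof -
 show 1: "J $ None $ None = 0" "J $ Some None $ None = sg 0" "J $ Some (Some j) $ None = 0" for j
  by (simp_all add: J_def h_col0 zero_B at_0)
 show "J $ None $ Some None = - sg 0" "J $ None $ Some (Some j) = 0"
  using J_hermitian[of "Some None" None] J_hermitian[of "Some (Some j)" None] 1 sg_cnj[of 0] by (simp_all add: at_0)
qed

text \<open>The parameters are the complexified tangent directions of the hypersurface: the components
  Inr (Some k), Inl k and Inr None are the values of dz, of its conjugate and of dw, and ioR is the
  inclusion of the real directions. The matrix xi y is a complex linear function of y whose first row is
  the velocity av y; the other rows make it skew with respect to J for real y (xi_skew).\<close>

definition av :: "complex^('n + 'n option) => 'n option option => complex" where
 "av y q = (case q of None => 0 | Some None => y $ Inr None | Some (Some k) => y $ Inr (Some k))"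
definition bv :: "complex^('n + 'n option) => 'n option option => complex" where
 "bv y q = (case q of None => 0 | Some None => y $ Inr None | Some (Some k) => y $ Inl k)"
definition "aw = inverse (cnj (J $ None $ Some None))"
definition "uu p = J $ p $ Some None * cnj aw"
definition "Bv y p = (SU r. J $ p $ r * bv y r)"
definition xi :: "complex^('n + 'n option) => 'n omat" where
 "xi y = (\<chi> p q. uu p * av y q - (Bv y p - Bv y None * uu p) * (if q = Some None then aw else 0))"
definition ioR :: "(complex^'n) \<times> real => complex^('n + 'n option)" where
 "ioR y = (\<chi> q. case q of Inl k => cnj (fst y $ k) | Inr None => of_real (snd y) | Inr (Some k) => fst y $ k)"

lemma uu_0: "uu None = 1" using sg_nz[of 0] by (simp add: uu_def aw_def J_0)

lemma xi_row: "xi y $ None $ q = av y q" by (simp add: xi_def uu_0)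

lemma xi_add: "xi (y + y') = xi y + xi y'"
proof -
 have "av (y + y') q = av y q + av y' q" "bv (y + y') q = bv y q + bv y' q" for q
  by (cases q rule: option2_cases; simp add: av_def bv_def)+
 thus ?thesis by (simp add: xi_def Bv_def vec_eq_iff algebra_simps sum.distrib)
qed

lemma xi_scale: "xi (c *s y) $ p $ q = c * xi y $ p $ q"
proof -
 have "av (c *s y) q = c * av y q" "bv (c *s y) q = c * bv y q" for q
  by (cases q rule: option2_cases; simp add: av_def bv_def)+
 moreover have "(SU r. J $ p $ r * (c * bv y r)) = c * (SU r. J $ p $ r * bv y r)" for p
  by (simp add: sum_distrib_left mult_ac)
 ultimately show ?thesis by (simp add: xi_def Bv_def algebra_simps)
qed

lemma J_self: "adj J = J" by (simp add: adj_def J_hermitian vec_eq_iff)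

text \<open>This is what keeps the developed curves with real parameters on the hypersurface. The vector uu with uu None = 1 and
  the covector aw complete the first row to a skew matrix.\<close>

lemma xi_skew: "xi (ioR y) ** J + J ** adj (xi (ioR y)) = 0"
proof -
 let ?y = "ioR y"
 have b: "bv ?y r = cnj (av ?y r)" for r
  by (cases r rule: option2_cases) (simp_all add: av_def bv_def ioR_def)
 have B0: "Bv ?y None = - sg 0 * of_real (snd y)" by (simp add: Bv_def sum_option2 J_0 bv_def ioR_def)
 have "cnj (sg 0) = - sg 0" by (simp add: sg_cnj at_0)
 hence B0': "cnj (Bv ?y None) = - Bv ?y None" unfolding B0 by simp
 have E: "(xi ?y ** J) $ p $ q = uu p * cnj (Bv ?y q) - (Bv ?y p - Bv ?y None * uu p) * cnj (uu q)" for p q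
 proof -
  have 1: "(SU r. av ?y r * J $ r $ q) = cnj (Bv ?y q)" by (simp add: Bv_def b J_hermitian mult.commute)
  have 2: "aw * J $ Some None $ q = cnj (uu q)" by (simp add: uu_def J_hermitian mult.commute)
  have "(xi ?y ** J) $ p $ q = (SU r. uu p * (av ?y r * J $ r $ q) - (if r = Some None then (Bv ?y p - Bv ?y None * uu p) * (aw * J $ r $ q) else 0))"
   by (simp add: matrix_matrix_mult_def xi_def) (rule sum.cong, auto simp: algebra_simps)
  also have "... = uu p * cnj (Bv ?y q) - (Bv ?y p - Bv ?y None * uu p) * (aw * J $ Some None $ q)"
   unfolding sum_subtractf by (simp add: sum_distrib_left[symmetric] 1)
  finally show ?thesis unfolding 2 .
 qed
 have "J ** adj (xi ?y) = adj (xi ?y ** J)" by (simp add: adjoint_mult J_self)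
 hence "(J ** adj (xi ?y)) $ p $ q = cnj ((xi ?y ** J) $ q $ p)" for p q by (simp add: adj_def)
 thus ?thesis by (simp add: vec_eq_iff E B0' algebra_simps)
qed

text \<open>The development: a moving frame A solves A' = conn A - A xi, and the base point moves with the
  velocity which the first row of A xi A^-1 prescribes. The inverse of A is carried along as the component C, so
  that no matrix has to be inverted. In the system G the jet coordinate is recovered from A by zt, so that
  its coefficients are holomorphic in the state; in the system GR the base point lies on the
  hypersurface and the jet coordinate is that of the lift.\<close>

definition GR :: "(complex^'n) \<times> real => ((complex^'n) \<times> real) \<times> ('n omat) \<times> ('n omat) => _" where
 "GR y E = (let A = fst (snd E); C = snd (snd E); e = fst E; r = (A ** xi (ioR y) ** C) $ None;
   v = (vz r, Re (vw r)); wm = cm (fst v) (FD w e v) (lift e)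
  in (v, wm ** A - A ** xi (ioR y), xi (ioR y) ** C - C ** wm))"

definition zt :: "'n omat => complex^'n" where
 "zt A = (\<chi> i. - A $ Some (Some i) $ Some None / A $ Some None $ Some None)"
definition jt :: "((complex^'n) \<times> complex) \<times> ('n omat) \<times> ('n omat) => 'n jet" where
 "jt E = (fst E, zt (fst (snd E)))"
definition G :: "complex^('n + 'n option) => ((complex^'n) \<times> complex) \<times> ('n omat) \<times> ('n omat) => _" where
 "G y E = (let A = fst (snd E); C = snd (snd E); r = (A ** xi y ** C) $ None; wm = cm (vz r) (vw r) (jt E)
  in ((vz r, vw r), wm ** A - A ** xi y, xi y ** C - C ** wm))"

lemma FD_hm: assumes e: "e : B"
 shows "FD hm e v = cm (fst v) (FD w e v) (lift e) ** hm e + hm e ** adj (cm (fst v) (FD w e v) (lift e))"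
proof -
 have s: "smooth_on B (%e. \<chi> q. h p q e)" for p by (intro smooths openB)
 have "smooth_on B hm" unfolding hm_def[abs_def] by (intro smooths openB)
 hence "FD hm e v $ p = FD (%e. \<chi> q. h p q e) e v" for p
  using FD_vec_nth[OF dB[OF _ e], of hm p v] by (simp add: hm_def)
 moreover have "FD (%e. \<chi> q. h p q e) e v $ q = FD (h p q) e v" for p q
  using FD_vec_nth[OF dB[OF s e], of p q v] by simp
 ultimately have "FD hm e v $ p $ q = FD (h p q) e (fst v, snd v)" for p q by simp
 thus ?thesis unfolding FD_h[OF e]
  by (simp add: vec_eq_iff hm_def cm_def matrix_matrix_mult_def adj_def)
qed

lemma smooth_hm: "smooth_on B hm" unfolding hm_def[abs_def] by (intro smooths openB)

lemma Im_sg: "Im (sg e) ~= 0" by (simp add: sg_def u_def mu_def Im_divide)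

lemma FD_w_tangent: assumes e: "e : B" shows "cnj (sg e * (FD w e (v, s) - (SU i. ze i e * v $ i))) = - (sg e * (FD w e (v, s) - (SU i. ze i e * v $ i)))"
proof -
 have "FD w e (v, s) - (SU i. ze i e * v $ i) = - kap e * cnj (FD w e (v, s) - (SU i. ze i e * v $ i))"
  using FD_frame[OF e smooth_w(1), of v s] by (simp add: L_w[OF e] algebra_simps)
 moreover have "cnj (sg e * th) = - (sg e * th)" if "th = - kap e * cnj th" for th
 proof -
  have "cnj (sg e * th) = - (sg e * (- kap e * cnj th))" by (simp only: complex_cnj_mult sg_cnj) simp
  thus ?thesis using that by (simp only:)
 qed
 ultimately show ?thesis by blast
qed

lemma bounded_bilinear_ad: "bounded_bilinear (%wm dl. wm ** dl - dl ** wm :: complex^'a::finite^'a)"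
 and bounded_bilinear_ad': "bounded_bilinear (%wm dl. wm ** dl + dl ** adj wm :: complex^'a::finite^'a)"
proof -
 have "bilinear (%wm dl. wm ** dl - dl ** wm :: complex^'a^'a)" "bilinear (%wm dl. wm ** dl + dl ** adj wm :: complex^'a^'a)"
  unfolding bilinear_def linear_iff
  by (auto simp: vec_eq_iff matrix_matrix_mult_def adj_def sum.distrib algebra_simps scaleR_sum_right)
 thus "bounded_bilinear (%wm dl. wm ** dl - dl ** wm :: complex^'a::finite^'a)"
  "bounded_bilinear (%wm dl. wm ** dl + dl ** adj wm :: complex^'a::finite^'a)" by (simp_all add: bilinear_conv_bounded_bilinear)
qed

text \<open>Along a solution of the real system A J A^* equals the form h at the base point, by the uniqueness for
  linear equations. The vanishing first entry of h then shows that the velocity prescribed by A is tangent to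
  the hypersurface, and the first column of h shows that zt A is the jet coordinate of the lift.\<close>

lemma real_solution:
 fixes t :: real
 assumes E: "!!t. t : {0..1} ==> (E has_vector_derivative GR y (E t)) (at t within {0..1})" "!!t. t : {0..1} ==> fst (E t) : B"
  and E0: "E 0 = (0, mat 1, mat 1)"
 defines "X \<equiv> %t. ((fst (fst (E t)), w (fst (E t))), snd (E t))"
 assumes t: "t : {0..1}"
 shows "(X has_vector_derivative G (ioR y) (X t)) (at t within {0..1})" "jt (X t) = lift (fst (E t))"
  "fst (snd (X t)) $ Some None $ Some None ~= 0"
proof -
 define e A C where "e t = fst (E t)" and "A t = fst (snd (E t))" and "C t = snd (snd (E t))" for t
 let ?xx = "xi (ioR y)"
 define r where "r t = (A t ** ?xx ** C t) $ None" for t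
 define v where "v t = (vz (r t), Re (vw (r t)))" for t
 define wm where "wm t = cm (fst (v t)) (FD w (e t) (v t)) (lift (e t))" for t
 have GR: "GR y (E t) = (v t, wm t ** A t - A t ** ?xx, ?xx ** C t - C t ** wm t)" for t
  by (simp add: GR_def Let_def v_def wm_def r_def e_def A_def C_def)
 have eB: "e t : B" if "t : {0..1}" for t using E(2) that by (simp add: e_def)
 have dd: "((%t. l (E t)) has_vector_derivative l (GR y (E t))) (at t within {0..1})" if "t : {0..1}" "bounded_linear l" for t and l :: "_ => 'b::real_normed_vector"
  using bounded_linear.has_vector_derivative[OF that(2) E(1)[OF that(1)]] .
 have de: "(e has_vector_derivative v t) (at t within {0..1})" if "t : {0..1}" for t :: real
  using dd[OF that bounded_linear_fst] by (simp add: e_def[abs_def] GR)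
 have dA: "(A has_vector_derivative wm t ** A t - A t ** ?xx) (at t within {0..1})" if "t : {0..1}" for t :: real
  using dd[OF that bounded_linear_compose[OF bounded_linear_fst bounded_linear_snd]] by (simp add: A_def[abs_def] GR)
 have dC: "(C has_vector_derivative ?xx ** C t - C t ** wm t) (at t within {0..1})" if "t : {0..1}" for t :: real
  using dd[OF that bounded_linear_compose[OF bounded_linear_snd bounded_linear_snd]] by (simp add: C_def[abs_def] GR)
 have cont: "continuous_on {0..1} e" "continuous_on {0..1} A" "continuous_on {0..1} C"
  using de dA dC has_vector_derivative_continuous continuous_on_eq_continuous_within by blast+
 have cr: "continuous_on {0..1} r"
  unfolding r_def by (intro continuous_intros bounded_bilinear.continuous_on[OF bounded_bilinear_matrix_mult] cont)
 have cv: "continuous_on {0..1} (%t. vz (r t))" "continuous_on {0..1} (%t. vw (r t))"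
  unfolding vz_def vw_def by (intro continuous_intros cr)+
 have cw: "continuous_on {0..1} (%t. FD w (e t) (v t))"
 proof -
  have "continuous_on {0..1} (%t. FDL w (e t) (v t))" unfolding v_def
   by (intro continuous_intros cv continuous_on_compose2[OF smooth_cont[OF smooth_on_FDL[OF openB smooth_w(1)]] cont(1)])
    (use eB in auto)
  thus ?thesis by (rule continuous_on_eq) (simp add: FDL_apply dB[OF smooth_w(1) eB])
 qed
 have cl: "continuous_on {0..1} (%t. a (lift (e t)))" if "hol_side W P a" for a
  by (rule continuous_on_compose2[OF smooth_cont[OF smooth_pull[OF that]] cont(1)]) (use eB in auto)
 have cwm: "continuous_on {0..1} wm"
 proof -
  have l: "continuous_on {0..1} (%t. snd (lift (e t)) $ i)" for i by (rule cl[OF hol_snd])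
  show ?thesis unfolding wm_def cm_def conn_def v_def[of t for t, THEN arg_cong[where f=fst], simplified]
   by (intro continuous_intros cv(1) cw cl hol_Ga hol_Om l)
 qed
 have AC: "A t ** C t = mat 1" if t: "t : {0..1}" for t :: real
 proof -
  have "A t ** C t - mat 1 = 0"
  proof (rule linear_ode_zero[OF bounded_bilinear_ad cwm _ _ t])
   fix t :: real assume t: "t : {0..1}"
   have "A t ** (?xx ** C t - C t ** wm t) + (wm t ** A t - A t ** ?xx) ** C t = wm t ** (A t ** C t - mat 1) - (A t ** C t - mat 1) ** wm t"
    by (simp add: matrix_mult_diff matrix_mul_assoc)
   thus "((%t. A t ** C t - mat 1) has_vector_derivative wm t ** (A t ** C t - mat 1) - (A t ** C t - mat 1) ** wm t) (at t within {0..1})"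
    using has_vector_derivative_diff[OF matrix_vector_derivative[OF dA[OF t] dC[OF t]] has_vector_derivative_const, of "mat 1"] by simp
  qed (simp add: A_def C_def E0)
  thus ?thesis by simp
 qed
 have AJ: "A t ** J ** adj (A t) = hm (e t)" if t: "t : {0..1}" for t :: real
 proof -
  have "A t ** J ** adj (A t) - hm (e t) = 0"
  proof (rule linear_ode_zero[OF bounded_bilinear_ad' cwm _ _ t])
   fix t :: real assume t: "t : {0..1}"
   have 1: "((%t. A t ** J) has_vector_derivative (wm t ** A t - A t ** ?xx) ** J) (at t within {0..1})"
    using matrix_vector_derivative[OF dA[OF t] has_vector_derivative_const, of J] by simp
   have 2: "((%t. adj (A t)) has_vector_derivative adj (wm t ** A t - A t ** ?xx)) (at t within {0..1})"
    by (rule bounded_linear.has_vector_derivative[OF bounded_linear_adjoint dA[OF t]])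
   have 3: "((%t. hm (e t)) has_vector_derivative FD hm (e t) (v t)) (at t within {0..1})"
    using vector_derivative_diff_chain_within[OF de[OF t] has_derivative_at_withinI[OF smooth_on_has_derivative[OF smooth_hm eB[OF t]]]]
    by (simp add: o_def)
   have 4: "FD hm (e t) (v t) = wm t ** hm (e t) + hm (e t) ** adj (wm t)" by (simp add: FD_hm[OF eB[OF t]] wm_def)
   have z: "A t ** ?xx ** J ** adj (A t) + A t ** J ** adj ?xx ** adj (A t) = 0"
   proof -
    have "A t ** (?xx ** J + J ** adj ?xx) ** adj (A t) = 0" unfolding xi_skew by (simp add: matrix_matrix_mult_def vec_eq_iff)
    thus ?thesis by (simp add: matrix_mult_add matrix_mul_assoc)
   qed
   have "A t ** J ** adj (wm t ** A t - A t ** ?xx) + (wm t ** A t - A t ** ?xx) ** J ** adj (A t) - FD hm (e t) (v t)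
    = wm t ** (A t ** J ** adj (A t) - hm (e t)) + (A t ** J ** adj (A t) - hm (e t)) ** adj (wm t)"
    unfolding 4 using z by (simp add: matrix_mult_diff matrix_mul_assoc adjoint_diff adjoint_mult) (simp add: algebra_simps add_eq_0_iff2)
   thus "((%t. A t ** J ** adj (A t) - hm (e t)) has_vector_derivative
    wm t ** (A t ** J ** adj (A t) - hm (e t)) + (A t ** J ** adj (A t) - hm (e t)) ** adj (wm t)) (at t within {0..1})"
    using has_vector_derivative_diff[OF matrix_vector_derivative[OF 1 2] 3] by simp
  qed (simp add: A_def e_def E0 adjoint_one J_def hm_def)
  thus ?thesis by simp
 qed
 have CA: "C t ** A t = mat 1" if "t : {0..1}" for t using AC[OF that] matrix_left_right_inverse by blast
 have tang: "FD w (e t) (v t) = vw (r t)" if t: "t : {0..1}" for t :: real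
 proof -
  have im: "Re x = 0" if "cnj x = - x" for x using that by (simp add: complex_eq_iff)
  have "A t ** ?xx ** C t ** hm (e t) = A t ** (?xx ** J) ** adj (A t)"
  proof -
   have "A t ** ?xx ** C t ** (A t ** J ** adj (A t)) = A t ** ?xx ** (C t ** A t) ** J ** adj (A t)"
    by (simp only: matrix_mul_assoc)
   thus ?thesis by (simp add: AJ[OF t] CA[OF t] matrix_mul_assoc)
  qed
  moreover have "adj (A t ** (?xx ** J) ** adj (A t)) = - (A t ** (?xx ** J) ** adj (A t))"
  proof -
   have aa: "adj (adj M) = M" for M :: "complex^'b::finite^'b" by (simp add: adj_def vec_eq_iff)
   have "adj (?xx ** J) = - (?xx ** J)" using xi_skew[of y] by (simp only: adjoint_mult J_self eq_neg_iff_add_eq_0 add.commute)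
   hence "adj (A t ** (?xx ** J) ** adj (A t)) = A t ** (- (?xx ** J)) ** adj (A t)"
    by (simp add: adjoint_mult aa matrix_mul_assoc)
   also have "... = - (A t ** (?xx ** J) ** adj (A t))"
    by (simp add: matrix_matrix_mult_def vec_eq_iff sum_negf)
   finally show ?thesis .
  qed
  ultimately have "adj (A t ** ?xx ** C t ** hm (e t)) = - (A t ** ?xx ** C t ** hm (e t))" by simp
  hence "cnj ((A t ** ?xx ** C t ** hm (e t)) $ None $ None) = - (A t ** ?xx ** C t ** hm (e t)) $ None $ None"
   by (simp add: adj_def vec_eq_iff)
  moreover have "(A t ** ?xx ** C t ** hm (e t)) $ None $ None = (SU p. r t $ p * h p None (e t))"
   by (subst matrix_matrix_mult_def) (simp add: r_def hm_def)
  moreover have "... = sg (e t) * (vw (r t) - (SU i. ze i (e t) * fst (v t) $ i))"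
   by (simp add: sum_option2 h_col0[OF eB[OF t]] v_def vz_def vw_def algebra_simps sum_distrib_left sum_negf)
  ultimately have "cnj (sg (e t) * (vw (r t) - (SU i. ze i (e t) * fst (v t) $ i))) = - (sg (e t) * (vw (r t) - (SU i. ze i (e t) * fst (v t) $ i)))"
   by (simp only:)
  hence "Re (sg (e t) * (vw (r t) - (SU i. ze i (e t) * fst (v t) $ i))) = 0" by (rule im)
  moreover have "Re (sg (e t) * (FD w (e t) (v t) - (SU i. ze i (e t) * fst (v t) $ i))) = 0"
   using FD_w_tangent[OF eB[OF t], of "fst (v t)" "snd (v t)"] unfolding prod.collapse by (rule im)
  ultimately have "Re (sg (e t) * (vw (r t) - FD w (e t) (v t))) = 0"
   by (simp add: algebra_simps)
  moreover have re: "Re (FD w (e t) (v t)) = Re (vw (r t))" by (simp add: FD_w[OF eB[OF t]] v_def)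
  ultimately have "Im (sg (e t)) * (Im (vw (r t)) - Im (FD w (e t) (v t))) = 0" by simp
  hence "Im (vw (r t)) = Im (FD w (e t) (v t))" using Im_sg by simp
  thus ?thesis using re by (simp add: complex_eq_iff)
 qed
 have row: "wm t $ None = (\<chi> q. if q = None then 0 else r t $ q)" if t: "t : {0..1}" for t :: real
 proof -
  have "wm t $ None $ q = (if q = None then 0 else r t $ q)" for q
   by (cases q rule: option2_cases) (simp_all add: wm_def cm_def conn_row tang[OF t, unfolded v_def vz_def vw_def] v_def vz_def vw_def)
  thus ?thesis by (simp add: vec_eq_iff)
 qed
 have A0: "A t $ None $ q = 0" if q: "q ~= None" and t: "t : {0..1}" for q t
 proof (rule linear_ode_zero[OF bounded_bilinear_mult _ _ _ t, where u="%t. - r t $ None"])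
  show "continuous_on {0..1} (%t. - r t $ None)" by (intro continuous_intros cr)
  show "A 0 $ None $ q = 0" using q by (auto simp: A_def E0 mat_def)
  fix t :: real assume t: "t : {0..1}"
  have "(wm t ** A t) $ None $ q = (SU p. r t $ p * A t $ p $ q) - r t $ None * A t $ None $ q"
   by (simp add: matrix_matrix_mult_def row[OF t] sum_option2)
  also have "(SU p. r t $ p * A t $ p $ q) = (A t ** ?xx ** (C t ** A t)) $ None $ q"
   unfolding matrix_mul_assoc r_def by (subst (4) matrix_matrix_mult_def) simp
  finally have "(wm t ** A t - A t ** ?xx) $ None $ q = - r t $ None * A t $ None $ q" by (simp add: CA[OF t])
  thus "((%t. A t $ None $ q) has_vector_derivative - r t $ None * A t $ None $ q) (at t within {0..1})"
   using bounded_linear.has_vector_derivative[OF bounded_linear_compose[OF bounded_linear_vec_nth[of q] bounded_linear_vec_nth[of None]] dA[OF t]] by simp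
 qed
 have hA: "h p None (e t) = A t $ p $ Some None * sg 0 * cnj (A t $ None $ None)" if t: "t : {0..1}" for t p
 proof -
  have "h p None (e t) = (A t ** J ** adj (A t)) $ p $ None" by (simp add: AJ[OF t] hm_def)
  also have "... = (A t ** J) $ p $ None * cnj (A t $ None $ None)"
   by (subst matrix_matrix_mult_def) (simp add: sum_option2 adj_def A0[OF _ t])
  also have "(A t ** J) $ p $ None = A t $ p $ Some None * sg 0" by (simp add: matrix_matrix_mult_def sum_option2 J_0)
  finally show ?thesis .
 qed
 have nz: "A t $ Some None $ Some None ~= 0" "cnj (A t $ None $ None) ~= 0"
  using hA[OF t, of "Some None"] sg_nz[of "e t"] by (auto simp: h_col0[OF eB[OF t]])
 thus "fst (snd (X t)) $ Some None $ Some None ~= 0" by (simp add: X_def A_def)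
 have "zt (A t) = (\<chi> i. ze i (e t))"
 proof -
  have "- A t $ Some (Some i) $ Some None = ze i (e t) * A t $ Some None $ Some None" for i
  proof -
   have "- (A t $ Some (Some i) $ Some None * (sg 0 * cnj (A t $ None $ None))) = ze i (e t) * A t $ Some None $ Some None * (sg 0 * cnj (A t $ None $ None))"
    using hA[OF t, of "Some None"] hA[OF t, of "Some (Some i)"] by (simp add: h_col0[OF eB[OF t]] mult.assoc) (metis minus_equation_iff mult.assoc)
   hence "- A t $ Some (Some i) $ Some None * (sg 0 * cnj (A t $ None $ None)) = ze i (e t) * A t $ Some None $ Some None * (sg 0 * cnj (A t $ None $ None))"
    by simp
   moreover have "sg 0 * cnj (A t $ None $ None) ~= 0" using nz(2) sg_nz[of 0] by simp
   ultimately show ?thesis using mult_right_cancel by blast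
  qed
  thus ?thesis unfolding zt_def using nz(1) by simp
 qed
 thus jt: "jt (X t) = lift (fst (E t))" by (simp add: jt_def X_def A_def e_def lift_def)
 have G: "G (ioR y) (X t) = ((fst (v t), FD w (e t) (v t)), wm t ** A t - A t ** ?xx, ?xx ** C t - C t ** wm t)"
  unfolding G_def Let_def jt tang[OF t] wm_def by (simp add: X_def A_def C_def r_def v_def e_def)
 have dw: "((%t. w (e t)) has_vector_derivative FD w (e t) (v t)) (at t within {0..1})"
  using vector_derivative_diff_chain_within[OF de[OF t] has_derivative_at_withinI[OF smooth_on_has_derivative[OF smooth_w(1) eB[OF t]]]]
  by (simp add: o_def)
 have X: "X = (%t. ((fst (e t), w (e t)), A t, C t))" by (simp add: X_def e_def A_def C_def fun_eq_iff)
 show "(X has_vector_derivative G (ioR y) (X t)) (at t within {0..1})"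
  unfolding G unfolding X
  by (intro has_vector_derivative_Pair dw dA dC t bounded_linear.has_vector_derivative[OF bounded_linear_fst de])
qed

end

lemma imul_vec_scale: "imul (x::complex^'a) = \<i> *s x" by (simp add: vec_eq_iff)
lemma scaleR_vec_scale: "t .* (x::complex^'a) = of_real t *s x" by (simp add: vec_eq_iff) (simp add: complex_eq_iff)

definition cs :: "complex => complex^'a^'b => complex^'a^'b" where "cs k M = (\<chi> p q. k * M $ p $ q)"

lemma cs_mult: "cs k M ** N = cs k (M ** N)" "M' ** cs k N' = cs k (M' ** N')"
 for M :: "complex^'a::finite^'b::finite" and M' :: "complex^'b::finite^'c::finite"
 by (simp_all add: cs_def matrix_matrix_mult_def vec_eq_iff sum_distrib_left mult_ac)
lemma cs_diff: "cs k (M - N) = cs k M - cs k N" by (simp add: cs_def vec_eq_iff algebra_simps)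
lemma cs_row: "cs k M $ p = k *s M $ p" by (simp add: cs_def vec_eq_iff)
lemma cs_imul: "cs \<i> M = imul M" by (simp add: cs_def vec_eq_iff)
lemma cs_scaleR: "cs (of_real t) M = t .* M" by (simp add: cs_def vec_eq_iff) (simp add: scaleR_conv_of_real)

lemma linear_basis_expand:
 fixes f :: "'a::euclidean_space => 'b::real_vector"
 assumes "!!x y. f (x + y) = f x + f y" "!!t x. f (t .* x) = t .* f x"
 shows "f y = (SB i. (y \<bullet> i) .* f i)"
proof -
 have l: "linear f" by (rule linearI) (rule assms)+
 have "f y = f (SB i. (y \<bullet> i) .* i)" by (simp add: euclidean_representation)
 thus ?thesis by (simp add: linear_sum[OF l] linear_scale[OF l])
qed

context development
begin

definition GL :: "'n omat => ((complex^'n) \<times> complex) \<times> ('n omat) \<times> ('n omat) => _" where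
 "GL M E = (let A = fst (snd E); C = snd (snd E); r = (A ** M ** C) $ None; wm = cm (vz r) (vw r) (jt E)
  in ((vz r, vw r), wm ** A - A ** M, M ** C - C ** wm))"

lemma G_GL: "G y E = GL (xi y) E" by (simp add: G_def GL_def)

lemma cm_add: "cm (v + v') (c + c') X = cm v c X + cm v' c' X"
 by (simp add: cm_def conn_def vec_eq_iff algebra_simps sum.distrib)
lemma cm_scale: "cm (k *s v) (k * c) X = cs k (cm v c X)"
 by (simp add: cm_def cs_def conn_def vec_eq_iff algebra_simps sum_distrib_left)

lemma GL_add: "GL (M + M') E = GL M E + GL M' E"
 by (simp add: GL_def Let_def matrix_mult_add vz_vw_linear cm_add matrix_mult_diff)
lemma GL_scale: "GL (cs k M) E = ((k *s fst (fst (GL M E)), k * snd (fst (GL M E))), cs k (fst (snd (GL M E))), cs k (snd (snd (GL M E))))"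
 by (simp add: GL_def Let_def cs_mult cs_row vz_vw_linear cm_scale cs_diff)

lemma xi_cs: "xi (k *s y) = cs k (xi y)" by (simp add: cs_def xi_scale vec_eq_iff)

lemma G_add: "G (y + y') E = G y E + G y' E" by (simp only: G_GL xi_add GL_add)
lemma G_imul: "G (imul y) E = imul (G y E)"
 by (simp add: G_GL imul_vec_scale[of y] xi_cs GL_scale) (simp add: prod_eq_iff cs_imul imul_vec_scale)
lemma G_scaleR: "G (k .* y) E = k .* G y E"
 by (simp add: G_GL scaleR_vec_scale[of _ y] xi_cs GL_scale) (simp add: prod_eq_iff cs_scaleR scaleR_vec_scale scaleR_conv_of_real)

lemma G_basis: "G y E = (SB i. (y \<bullet> i) .* G i E)"
 by (rule linear_basis_expand) (simp_all add: G_add G_scaleR)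

definition "UA = {E :: ((complex^'n) \<times> complex) \<times> ('n omat) \<times> ('n omat). fst (snd E) $ Some None $ Some None ~= 0}"
definition "UE = {E:UA. jt E : W}"
definition "PE = {E:UE. jt E : closure P}"

lemma open_UA: "open UA" unfolding UA_def
 by (intro open_Collect_neq continuous_intros)

lemma lin_A: "bounded_linear (%E. fst (snd E) $ p $ q)" "bounded_linear (%E. snd (snd E) $ p $ q)"
 by (intro bounded_linear_compose[OF bounded_linear_vec_nth] bounded_linear_compose[OF bounded_linear_fst] bounded_linear_compose[OF bounded_linear_snd] bounded_linear_fst bounded_linear_snd)+

lemma smooth_jt: "smooth_on UA jt"
 unfolding jt_def[abs_def] zt_def
 by (intro smooths open_UA smooth_on_linear lin_A bounded_linear_fst) (simp add: UA_def)

lemma cholo_jt: "E : UA ==> cholo jt E"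
 unfolding jt_def[abs_def] zt_def by (intro cholos) (simp add: UA_def)

lemma open_UE: "open UE"
proof -
 have "UE = UA \<inter> jt -` W" by (auto simp: UE_def)
 thus ?thesis using continuous_open_preimage[OF smooth_cont[OF smooth_jt] open_UA openW] by simp
qed

lemma hol_A: "hol_side UE PE (%E. fst (snd E) $ p $ q)" "hol_side UE PE (%E. snd (snd E) $ p $ q)"
 by (rule hol_side_linear[OF lin_A(1)], simp) (rule hol_side_linear[OF lin_A(2)], simp)

lemma hol_jt: assumes a: "hol_side W P a" shows "hol_side UE PE (%E. a (jt E))"
 unfolding hol_side_def
proof (intro conjI ballI)
 have s: "smooth_on W a" using a by (simp add: hol_side_def)
 have "smooth_on UE jt" by (rule smooth_on_subset[OF smooth_jt]) (auto simp: UE_def)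
 thus "smooth_on UE (%E. a (jt E))" by (rule smooth_on_compose[OF s _ open_UE openW]) (simp add: UE_def)
 fix E assume "E : PE"
 hence "E : UA" "jt E : W" "jt E : closure P" by (auto simp: PE_def UE_def)
 thus "cholo (%E. a (jt E)) E" using cholo_compose[OF cholo_jt cholo_closure[OF openW PW a]] by blast
qed

lemma hol_mm: "(!!p q. hol_side UE PE (%E. X E $ p $ q)) ==> (!!p q. hol_side UE PE (%E. Y E $ p $ q)) ==>
 hol_side UE PE (%E. ((X E :: complex^'a^'b) ** (Y E :: complex^'c^'a::finite)) $ p $ q)"
 by (simp add: matrix_matrix_mult_def) (intro hol_sides open_UE; assumption)

lemma hol_G: "smooth_on UE (G y)" "E : PE ==> cholo (G y) E"
proof -
 let ?A = "%E. fst (snd E) :: 'n omat"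
 let ?C = "%E. snd (snd E) :: 'n omat"
 let ?r = "%E :: ((complex^'n) \<times> complex) \<times> ('n omat) \<times> ('n omat). (?A E ** xi y ** ?C E) $ None"
 let ?wm = "%E. cm (vz (?r E)) (vw (?r E)) (jt E)"
 have r: "hol_side UE PE (%E. ?r E $ q)" for q
  by (intro hol_mm hol_A hol_side_const)
 have wm: "hol_side UE PE (%E. ?wm E $ p $ q)" for p q
  unfolding cm_def conn_def vz_def vw_def
  by (simp) (intro hol_sides open_UE r hol_jt hol_Ga hol_Om hol_snd)
 have dA: "hol_side UE PE (%E. (?wm E ** ?A E - ?A E ** xi y) $ p $ q)" "hol_side UE PE (%E. (xi y ** ?C E - ?C E ** ?wm E) $ p $ q)" for p q
  by (simp_all only: vector_minus_component) (intro hol_side_diff open_UE hol_mm wm hol_A hol_side_const)+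
 have G: "G y = (%E. ((\<chi> k. ?r E $ Some (Some k), ?r E $ Some None),
   (\<chi> p q. (?wm E ** ?A E - ?A E ** xi y) $ p $ q), (\<chi> p q. (xi y ** ?C E - ?C E ** ?wm E) $ p $ q)))"
  by (simp add: fun_eq_iff G_def Let_def vz_def vw_def vec_eq_iff)
 show "smooth_on UE (G y)" unfolding G
  by (intro smooth_on_Pair smooth_on_vec_lambda open_UE) (use r dA in \<open>simp_all only: hol_side_def\<close>)
 show "E : PE ==> cholo (G y) E" unfolding G
  by (intro cholo_Pair cholo_vec_lambda) (use r dA in \<open>simp_all only: hol_side_def\<close>)
qed

definition "UR = {E :: ((complex^'n) \<times> real) \<times> ('n omat) \<times> ('n omat). fst E : B}"

lemma open_UR: "open UR"
proof -
 have "UR = B \<times> UNIV" by (auto simp: UR_def)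
 thus ?thesis by (simp add: open_Times openB)
qed

lemma smooth_GR: "smooth_on UR (GR y)"
proof -
 let ?A = "%E. fst (snd E) :: 'n omat"
 let ?C = "%E. snd (snd E) :: 'n omat"
 let ?xx = "xi (ioR y)"
 let ?r = "%E :: ((complex^'n) \<times> real) \<times> ('n omat) \<times> ('n omat). (?A E ** ?xx ** ?C E) $ None"
 let ?v = "%E. (vz (?r E), Re (vw (?r E)))"
 let ?wm = "%E. cm (vz (?r E)) (FD w (fst E) (?v E)) (lift (fst E))"
 have A: "smooth_on UR ?A" "smooth_on UR ?C"
  by (intro smooth_on_linear bounded_linear_compose[OF bounded_linear_fst] bounded_linear_compose[OF bounded_linear_snd] bounded_linear_snd)+
 note mm = smooth_on_bilinear[OF bounded_bilinear_matrix_mult open_UR]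
 have r: "smooth_on UR ?r" by (intro smooths open_UR mm A)
 have v: "smooth_on UR ?v" unfolding vz_def vw_def by (intro smooths open_UR r)
 have f: "smooth_on UR fst" by (intro smooth_on_linear bounded_linear_fst)
 have lf: "smooth_on UR (%E. a (lift (fst E)))" if "hol_side W P a" for a
  by (rule smooth_on_compose[OF smooth_pull[OF that] f open_UR openB]) (simp add: UR_def)
 have "smooth_on UR (%E. FDL w (fst E) (?v E))"
  by (intro smooth_on_bilinear[OF bounded_bilinear_blinfun_apply] open_UR v
   smooth_on_compose[OF smooth_on_FDL[OF openB smooth_w(1)] f open_UR openB]) (simp add: UR_def)
 hence w: "smooth_on UR (%E. FD w (fst E) (?v E))"
  by (subst (asm) smooth_on_cong[OF open_UR, where g="%E. FD w (fst E) (?v E)"])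
   (auto simp: FDL_apply UR_def intro!: FDL_apply dB[OF smooth_w(1)])
 have vzs: "smooth_on UR (%E. vz (?r E) $ i)" for i unfolding vz_def by (simp) (intro smooths open_UR r)
 have "smooth_on UR ?wm" unfolding cm_def conn_def
  by (intro smooth_on_vec_lambda smooth_on_add smooth_on_diff smooth_on_mult smooth_on_sum open_UR vzs w lf hol_Ga hol_Om hol_snd)
 thus ?thesis unfolding GR_def[abs_def] Let_def fst_conv
  by (intro smooth_on_Pair smooth_on_diff open_UR mm A v smooth_on_const)
qed

lemma ioR_linear: "ioR (y + y') = ioR y + ioR y'" "ioR (k .* y) = k .* ioR y"
 by (auto simp: ioR_def vec_eq_iff split: sum.split option.split) (auto simp: complex_eq_iff)

lemma GR_linear: "GR (y + y') E = GR y E + GR y' E" "GR (k .* y) E = k .* GR y E" if E: "fst E : B"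
proof -
 interpret linear "FD w (fst E)" by (rule bounded_linear.linear[OF FD_linear[OF dB[OF smooth_w(1) E]]])
 let ?A = "fst (snd E)" and ?C = "snd (snd E)"
 define r where "r M = (?A ** M ** ?C) $ None" for M
 define F where "F M = ((vz (r M), Re (vw (r M))), cm (vz (r M)) (FD w (fst E) (vz (r M), Re (vw (r M)))) (lift (fst E)) ** ?A - ?A ** M, M ** ?C - ?C ** cm (vz (r M)) (FD w (fst E) (vz (r M), Re (vw (r M)))) (lift (fst E)))" for M
 have G: "GR y E = F (xi (ioR y))" for y by (simp add: GR_def F_def r_def Let_def)
 have r: "r (M + M') = r M + r M'" "r (k .* M) = of_real k *s r M" for M M'
  by (simp_all add: r_def matrix_mult_add cs_scaleR[symmetric] cs_mult cs_row)
 have p: "(vz a + vz b, Re (vw a) + Re (vw b)) = (vz a, Re (vw a)) + (vz b, Re (vw b))" "(k .* vz a, k * Re (vw a)) = k .* (vz a, Re (vw a))" for a b :: "complex^('n option option)" by simp_all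
 have "F (M + M') = F M + F M'" for M M'
  by (simp add: F_def r vz_vw_linear p(1) add cm_add matrix_mult_add matrix_mult_diff del: add_Pair)
   (simp add: prod_eq_iff)
 moreover have "F (k .* M) = k .* F M" for M
 proof -
  have "cm (k .* v) (k .* c) X = k .* cm v c X" for v c X
   using cm_scale[of "of_real k" v c X] by (simp add: cs_scaleR scaleR_vec_scale scaleR_conv_of_real)
  moreover have "(k .* M) ** N = k .* (M ** N)" "N ** (k .* M) = k .* (N ** M)" for M N :: "'n omat"
   by (simp_all add: cs_scaleR[symmetric] cs_mult)
  moreover have "vz (k .* a) = k .* vz a" "vw (k .* a) = k .* vw a" for a :: "complex^('n option option)"
   by (simp_all add: vz_def vw_def vec_eq_iff)
  ultimately show ?thesis
   by (simp add: F_def r scaleR_vec_scale[symmetric] p(2) scale del: scaleR_Pair)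
    (simp add: prod_eq_iff scaleR_diff_right)
 qed
 moreover have "xi (k .* y) = k .* xi y" for y by (simp add: scaleR_vec_scale[of _ y] xi_cs cs_scaleR)
 ultimately show "GR (y + y') E = GR y E + GR y' E" "GR (k .* y) E = k .* GR y E"
  by (simp_all add: G ioR_linear xi_add)
qed

lemma GR_basis: "fst E : B ==> GR y E = (SB i. (y \<bullet> i) .* GR i E)"
 by (rule linear_basis_expand) (simp_all only: GR_linear)

end

context development
begin

definition Y0 :: "((complex^'n) \<times> complex) \<times> ('n omat) \<times> ('n omat)" where
 "Y0 = ((0, 0), mat 1, mat 1)"

lemma Y0_UE: "Y0 : UE"
proof -
 have "jt Y0 = 0" by (simp add: jt_def Y0_def zt_def mat_def prod_eq_iff vec_eq_iff)
 thus ?thesis using lift_in(1)[OF zero_B] by (simp add: UE_def UA_def Y0_def mat_def at_0)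
qed

lemma FD_G: assumes "E : UE" shows "FD (G y) E x = (SB i. (y \<bullet> i) .* FDL (G i) E x)"
proof -
 have d: "G i differentiable (at E)" for i using smooth_diff[OF hol_G(1) assms] .
 have "((%E. SB i. (y \<bullet> i) .* G i E) has_derivative (%x. SB i. (y \<bullet> i) .* FDL (G i) E x)) (at E)"
  by (intro has_derivative_sum has_derivative_scaleR_right FDL_has_derivative d)
 moreover have "(%E. SB i. (y \<bullet> i) .* G i E) = G y" by (rule ext) (rule G_basis[symmetric])
 ultimately show ?thesis by (simp only: FD_eq)
qed

text \<open>Along rays on which the coefficients are holomorphic, the antiholomorphic part of the
 derivative solves a homogeneous contraction equation.\<close>

lemma flow_cholo:
 assumes Ps: "smooth_on (ball 0 r) Ps" "!!y. y : ball 0 r ==> Ps y : UE"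
  and D: "!!y v. y : ball 0 r ==> FD Ps y v = radial 0 (%y. G v (Ps y) + FD (G y) (Ps y) (FD Ps y v)) y"
  and half: "!!y v. y : ball 0 r ==> norm (FD (G y) (Ps y) v) <= 1/2 * norm v"
  and y: "y : ball 0 r" and PE: "!!t. t : {0..1} ==> Ps (t .* y) : PE"
 shows "cholo Ps y"
proof -
 have dd: "Ps differentiable (at y)" if "y : ball 0 r" for y using smooth_diff[OF Ps(1) that] .
 have "FD Ps y (imul v) = imul (FD Ps y v)" for v
 proof -
  define F where "F v y = G v (Ps y) + FD (G y) (Ps y) (FD Ps y v)" for v y
  have cF: "continuous_on (ball 0 r) (F v)" for v
  proof -
   have "smooth_on (ball 0 r) (%y. G v (Ps y) + (SB i. (y \<bullet> i) .* FDL (G i) (Ps y) (FD Ps y v)))"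
    by (intro smooths open_ball smooth_on_compose[OF hol_G(1) Ps(1) _ open_UE] smooth_on_bilinear[OF bounded_bilinear_blinfun_apply]
      smooth_on_compose[OF smooth_on_FDL[OF open_UE hol_G(1)] Ps(1) _ open_UE] smooth_on_FD[OF Ps(1)] Ps(2))
   from smooth_cont[OF this] show ?thesis by (rule continuous_on_eq) (simp add: F_def FD_G Ps(2))
  qed
  define dl where "dl ta = FD Ps (ta .* y) (imul v) - imul (FD Ps (ta .* y) v)" for ta
  have cdl: "continuous_on {0..1} dl" unfolding dl_def
   by (intro continuous_intros bounded_linear.continuous_on[OF bounded_linear_imul] cont_ray[OF _ y] smooth_cont[OF smooth_on_FD[OF Ps(1)]])
  obtain ta0 where ta0: "ta0 : {0..1}" "!!ta. ta : {0..1} ==> norm (dl ta) <= norm (dl ta0)"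
   using continuous_attains_sup[OF _ _ continuous_on_norm[OF cdl]] by auto
  let ?z = "ta0 .* y"
  have z: "?z : ball 0 r" by (rule scale_ball[OF ta0(1) y])
  have I: "((%t. F v (t .* ?z)) has_integral FD Ps ?z v) {0..1}" for v
   using integrable_integral[OF integrable_continuous_real[OF cont_ray[OF cF z]], of v] D[OF z, of v]
   by (simp add: radial_def F_def)
  have "((%t. F (imul v) (t .* ?z) - imul (F v (t .* ?z))) has_integral dl ta0) {0..1}"
   using has_integral_diff[OF I has_integral_linear[OF I bounded_linear_imul], of "imul v" v] by (simp add: dl_def o_def)
  moreover have "norm (F (imul v) (t .* ?z) - imul (F v (t .* ?z))) <= 1/2 * norm (dl ta0)" if t: "t : {0..1}" for t
  proof -
   have t': "t * ta0 : {0..1}" using t ta0(1) by (auto simp: mult_le_one)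
   let ?x = "(t * ta0) .* y"
   have x: "?x : ball 0 r" by (rule scale_ball[OF t' y])
   interpret linear "FD (G ?x) (Ps ?x)"
    by (rule bounded_linear.linear[OF FD_linear[OF smooth_diff[OF hol_G(1) Ps(2)[OF x]]]])
   have "F (imul v) ?x - imul (F v ?x) = FD (G ?x) (Ps ?x) (dl (t * ta0))"
    by (simp add: F_def dl_def G_imul imul_add diff cholo_imul[OF hol_G(2)[OF PE[OF t']]])
   hence "norm (F (imul v) ?x - imul (F v ?x)) <= 1/2 * norm (dl (t * ta0))" using half[OF x] by simp
   also have "... <= 1/2 * norm (dl ta0)" using ta0(2)[OF t'] by simp
   finally show ?thesis by simp
  qed
  ultimately have "norm (dl ta0) <= 1/2 * norm (dl ta0) * measure lborel {0..1::real}"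
   by (intro has_integral_bound_real[where S="{}"]) auto
  hence "dl 1 = 0" using ta0(2)[of 1] by simp
  thus ?thesis by (simp add: dl_def)
 qed
 thus ?thesis using dd[OF y] by (simp add: cholo_def)
qed

text \<open>For real parameters the uniqueness of solutions identifies the solution of the holomorphic system
  with that of the system on the hypersurface.\<close>

theorem development_map:
 obtains r Ps where "r > 0" "smooth_on (ball 0 r) Ps" "!!y. y : ball 0 r ==> Ps y : UE" "Ps 0 = Y0"
  "!!v. FD Ps 0 v = G v Y0"
  "!!y. y : ball 0 r ==> (!!t. t : {0..1} ==> Ps (t .* y) : PE) ==> cholo Ps y"
  "!!u. norm u < r ==> norm (ioR u) < r ==> EX e:B. jt (Ps (ioR u)) = lift e"
proof -
 have Gb: "(%e. SB i. (y \<bullet> i) .* G i e) = G y" for y by (rule ext) (rule G_basis[symmetric])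
 obtain r Ps where r: "r > 0" and Ps: "smooth_on (ball 0 r) Ps" "!!y. y : ball 0 r ==> Ps y : UE"
  "!!y. y : ball 0 r ==> Ps y = Y0 + integral {0..1} (%t. G y (Ps (t .* y)))"
  "!!y v. y : ball 0 r ==> FD Ps y v = radial 0 (%y. G v (Ps y) + FD (G y) (Ps y) (FD Ps y v)) y"
  "!!y v. y : ball 0 r ==> norm (FD (G y) (Ps y) v) <= 1/2 * norm v"
  by (rule radial_flow[where g=G, OF open_UE Y0_UE hol_G(1)]) (simp only: Gb G_basis[symmetric])
 have G0: "G 0 E = 0" for E using G_scaleR[of 0 0 E] by simp
 have Ps0: "Ps 0 = Y0" using Ps(3)[of 0] r by (simp add: G0)
 have D0: "FD Ps 0 v = G v Y0" for v
 proof -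
  have "G 0 = (%E. 0)" using G0 by auto
  thus ?thesis using Ps(4)[of 0 v] r by (simp add: radial_def Ps0)
 qed
 let ?GR = "%y E. SB i. (y \<bullet> i) .* GR i E"
 have "(0, mat 1, mat 1) : UR" using zero_B by (simp add: UR_def)
 then obtain r' Fi where r': "r' > 0" and Fi: "smooth_on (ball 0 r') Fi" "!!y. y : ball 0 r' ==> Fi y : UR"
  "!!y. y : ball 0 r' ==> Fi y = (0, mat 1, mat 1) + integral {0..1} (%t. ?GR y (Fi (t .* y)))"
  by (rule radial_flow[where g=GR, OF open_UR _ smooth_GR]) blast
 have Fi0: "Fi 0 = (0, mat 1, mat 1)" using Fi(3)[of 0] r' by simp
 define H where "H E = ((fst (fst E), w (fst E)), snd E)" for E :: "((complex^'n) \<times> real) \<times> ('n omat) \<times> ('n omat)"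
 have cH: "continuous_on (ball 0 r') (%u. H (Fi u))" unfolding H_def
  by (intro continuous_intros continuous_on_compose2[OF smooth_cont[OF smooth_w(1)]] smooth_cont[OF Fi(1)])
   (use Fi(2) in \<open>auto simp: UR_def\<close>)
 have H0: "H (Fi 0) = Y0" by (simp add: H_def Fi0 at_0 Y0_def)
 obtain ep where ep: "ep > 0" "cball Y0 ep <= UE" using open_contains_cball[THEN iffD1, OF open_UE] Y0_UE by blast
 have near: "EX d>0. ALL y. norm y < d --> f y : cball Y0 ep" if "continuous_on (ball 0 R) f" "R > 0" "f 0 = Y0" for f :: "'z::real_normed_vector => _" and R
 proof -
  have "isCont f 0" using continuous_on_eq_continuous_at[OF open_ball, THEN iffD1, OF that(1)] that(2) by simp
  then obtain d where "d > 0" "!!y. dist y 0 < d ==> dist (f y) (f 0) < ep" using ep(1) unfolding continuous_at_eps_delta by blast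
  thus ?thesis using that(3) by (intro exI[of _ d]) (auto simp: dist_commute less_imp_le)
 qed
 obtain d1 where d1: "d1 > 0" "!!y. norm y < d1 ==> Ps y : cball Y0 ep" using near[OF smooth_cont[OF Ps(1)] r Ps0] by blast
 obtain d2 where d2: "d2 > 0" "!!u. norm u < d2 ==> H (Fi u) : cball Y0 ep" using near[OF cH r' H0] by blast
 define R where "R = min (min r d1) (min r' d2)"
 have R: "R > 0" "R <= r" "R <= d1" "R <= r'" "R <= d2" using r r' d1 d2 by (auto simp: R_def)
 have real: "EX e:B. jt (Ps (ioR u)) = lift e" if u: "norm u < R" "norm (ioR u) < R" for u
 proof -
  have ub: "u : ball 0 r'" "ioR u : ball 0 r" using u R by auto
  have sc: "norm (t .* x) < R" if "t : {0..1}" "norm x < R" for t and x :: "'z::real_normed_vector"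
  proof -
   have "norm (t .* x) <= norm x" using that(1) by (simp add: mult_left_le_one_le)
   thus ?thesis using that(2) by simp
  qed
  have E: "((%t. Fi (t .* u)) has_vector_derivative GR u (Fi (t .* u))) (at t within {0..1})" if t: "t : {0..1}" for t
  proof -
   have "continuous_on (ball 0 r') (%z. ?GR u (Fi z))"
    by (intro continuous_intros continuous_on_compose2[OF smooth_cont[OF smooth_GR] smooth_cont[OF Fi(1)]])
     (use Fi(2) in auto)
   from ray_ode[where G="?GR", OF Fi(3) _ cont_ray[OF this ub(1)] ub(1) t]
   have "((%t. Fi (t .* u)) has_vector_derivative ?GR u (Fi (t .* u))) (at t within {0..1})"
    by (simp add: scaleR_sum_right)
   thus ?thesis using GR_basis[of "Fi (t .* u)" u] Fi(2)[OF scale_ball[OF t ub(1)]] by (simp add: UR_def)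
  qed
  have EB: "fst (Fi (t .* u)) : B" if "t : {0..1}" for t using Fi(2)[OF scale_ball[OF that ub(1)]] by (simp add: UR_def)
  have E0: "Fi (0 .* u) = (0, mat 1, mat 1)" by (simp add: Fi0)
  note rs = real_solution[of "%t. Fi (t .* u)" u, OF E EB E0, folded H_def]
  have P: "((%t. Ps (t .* ioR u)) has_vector_derivative G (ioR u) (Ps (t .* ioR u))) (at t within {0..1})" if t: "t : {0..1}" for t
  proof (rule ray_ode[where G=G, OF Ps(3) G_scaleR _ ub(2) t])
   show "continuous_on {0..1} (%t. G (ioR u) (Ps (t .* ioR u)))"
    by (rule cont_ray[OF _ ub(2)], rule continuous_on_compose2[OF smooth_cont[OF hol_G(1)] smooth_cont[OF Ps(1)]])
     (use Ps(2) in auto)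
  qed
  have "Ps (1 .* ioR u) = H (Fi (1 .* u))"
  proof (rule ode_unique[OF open_UE hol_G(1)[of "ioR u"] compact_cball convex_cball ep(2), where a="%t. Ps (t .* ioR u)" and b="%t. H (Fi (t .* u))" and t=1])
   show "Ps (t .* ioR u) : cball Y0 ep" "H (Fi (t .* u)) : cball Y0 ep" if "t : {0..1}" for t
    by (rule d1(2), use sc[OF that u(2)] R(3) in linarith) (rule d2(2), use sc[OF that u(1)] R(5) in linarith)
  qed (use P rs(1) in \<open>auto simp: Ps0 H0\<close>)
  hence "jt (Ps (ioR u)) = lift (fst (Fi u))" using rs(2)[of 1] by simp
  thus ?thesis using EB[of 1] by auto
 qed
 show ?thesis
 proof (rule that[of R Ps])
  show "smooth_on (ball 0 R) Ps" by (rule smooth_on_subset[OF Ps(1)]) (use R in auto)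
  show "cholo Ps y" if "y : ball 0 R" "!!t. t : {0..1} ==> Ps (t .* y) : PE" for y
   by (rule flow_cholo[OF Ps(1,2,4,5)]) (use that R in auto)
 qed (use R Ps(2) Ps0 D0 real in auto)
qed

lemma FD_base_0: "fst (G v Y0) = (\<chi> k. v $ Inr (Some k), v $ Inr None)"
 by (simp add: G_def Let_def Y0_def vz_def vw_def xi_row av_def vec_eq_iff)

end

section \<open>Restriction to a totally real slice\<close>

text \<open>The hypersurface is invariant under the real translations of the coordinates z j with j outside K. The
  slice io omits these directions: it has one parameter for each coordinate of M. Its components of type
  (1,0), (0,1) and along w are ioal, iobt and ios.\<close>

locale real_slice = development B ph W P g rh U c0 for B :: "((complex^'n::finite) \<times> real) set" and ph W P g rh U c0 +
 fixes K :: "'n set" and lab :: "'d::finite => 'n coord"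
 assumes lab: "bij_betw lab UNIV (coord_labels K)"
  and rigid: "!!e j. e : B ==> j ~: K ==> FD ph e (axis j 1, 0) = 0"
begin

definition "lc c = inv lab c"

lemma lab_lc: "c : coord_labels K ==> lab (lc c) = c"
 using lab by (simp add: lc_def bij_betw_def f_inv_into_f)
lemma labels: "k : K ==> CX k : coord_labels K" "k : K ==> CY k : coord_labels K" "CS : coord_labels K" "k ~: K ==> CT k : coord_labels K"
 by (auto simp: coord_labels_def)
lemma lab_in: "lab i : coord_labels K" using lab by (auto simp: bij_betw_def)
lemma lc_lab: "lc (lab i) = i" using lab by (simp add: lc_def bij_betw_def)

text \<open>The last component is chosen so that positive imaginary parts of the coordinates lead to
 the pseudoconvex side.\<close>

definition "ta = - sgn c0"
definition ioal :: "complex^'d => 'n => complex" where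
 "ioal v k = (if k : K then v $ lc (CX k) + \<i> * v $ lc (CY k) else \<i> * v $ lc (CT k))"
definition iobt :: "complex^'d => 'n => complex" where
 "iobt v k = (if k : K then v $ lc (CX k) - \<i> * v $ lc (CY k) else - \<i> * v $ lc (CT k))"
definition ios :: "complex^'d => complex" where "ios v = of_real ta * (SU i. v $ i)"
definition io :: "complex^'d => complex^('n + 'n option)" where
 "io v = (\<chi> q. case q of Inl k => iobt v k | Inr None => ios v | Inr (Some k) => ioal v k)"
definition ior :: "real^'d => (complex^'n) \<times> real" where
 "ior a = (\<chi> k. ioal (rv a) k, ta * (SU i. a $ i))"

lemma ta: "ta ~= 0" "c0 * ta = - \<bar>c0\<bar>" using c0 by (auto simp: ta_def sgn_if)

lemma io_linear: "io (v + v') = io v + io v'" "io (k .* v) = k .* io v" "io (imul v) = imul (io v)"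
proof -
 show "io (v + v') = io v + io v'"
  by (auto simp: io_def vec_eq_iff ioal_def iobt_def ios_def algebra_simps sum.distrib split: sum.split option.split)
 have c: "io (k *s v) = k *s io v" for k v
  by (auto simp: io_def vec_eq_iff ioal_def iobt_def ios_def algebra_simps sum_distrib_left split: sum.split option.split)
 show "io (k .* v) = k .* io v" "io (imul v) = imul (io v)" unfolding scaleR_vec_scale imul_vec_scale by (rule c)+
qed

lemma bounded_linear_io: "bounded_linear io"
 by (subst linear_conv_bounded_linear[symmetric]) (rule linearI; rule io_linear)

lemma io_real: "io (rv a) = ioR (ior a)"
 by (auto simp: io_def ioR_def ior_def vec_eq_iff ioal_def iobt_def ios_def of_real_vec_def split: sum.split option.split)

lemma bounded_linear_of_real_vec: "bounded_linear (rv :: real^'d => complex^'d)"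
 by (subst linear_conv_bounded_linear[symmetric]) (auto intro!: linearI simp: of_real_vec_def vec_eq_iff complex_eq_iff)

lemma bounded_linear_ior: "bounded_linear ior"
proof (subst linear_conv_bounded_linear[symmetric], rule linearI)
 show "ior (a + b) = ior a + ior b" for a b
  by (auto simp: ior_def ioal_def of_real_vec_def vec_eq_iff sum.distrib algebra_simps)
 show "ior (k .* a) = k .* ior a" for k a
  by (auto simp: ior_def ioal_def of_real_vec_def vec_eq_iff sum_distrib_left algebra_simps complex_eq_iff)
qed

lemma complex_vec_Re_Im: "v = rv (\<chi> i. Re (v $ i)) + imul (rv (\<chi> i. Im (v $ i)))" for v :: "complex^'d"
 by (simp add: vec_eq_iff of_real_vec_def complex_eq_iff)

text \<open>Near the origin rh vanishes on the images of the real points and decreases in the directions with positive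
  imaginary parts. So the wedge is mapped to the side P, and as it contains the rays from the origin
  to its points, the development is holomorphic on it.\<close>

theorem slice_map:
 obtains r f where "r > 0" "smooth_on (ball 0 r) f" "!!v. v : ball 0 r ==> f v : W" "f (0 :: complex^'d) = 0"
  "!!v. fst (FD f 0 v) = (\<chi> k. ioal v k, ios v)"
  "!!a. rv a : ball 0 r ==> EX e:B. f (rv a) = lift e"
  "!!v. v : ball 0 r ==> (ALL i. Im (v $ i) > 0) | (ALL i. Im (v $ i) = 0) ==> cholo f v & f v : closure P"
proof -
 obtain r Ps where r: "r > 0" and Ps: "smooth_on (ball 0 r) Ps" "!!y. y : ball 0 r ==> Ps y : UE" "Ps 0 = Y0"
  "!!v. FD Ps 0 v = G v Y0"
  "!!y. y : ball 0 r ==> (!!t. t : {0..1} ==> Ps (t .* y) : PE) ==> cholo Ps y"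
  "!!u. norm u < r ==> norm (ioR u) < r ==> EX e:B. jt (Ps (ioR u)) = lift e" using development_map by metis
 obtain k where k: "k > 0" "!!v. norm (io v) <= norm v * k" using bounded_linear.pos_bounded[OF bounded_linear_io] by blast
 obtain k' where k': "k' > 0" "!!a. norm (ior a) <= norm a * k'" using bounded_linear.pos_bounded[OF bounded_linear_ior] by blast
 define r1 where "r1 = min (r / k) (r / k')"
 have r1: "r1 > 0" using r k k' by (simp add: r1_def)
 define f where "f v = jt (Ps (io v))" for v
 have iob: "io v : ball 0 r" if "v : ball 0 r1" for v
 proof -
  have "norm v * k < r" using that k(1) by (simp add: r1_def pos_less_divide_eq)
  thus ?thesis using k(2)[of v] by simp
 qed
 have nr: "norm (rv a :: complex^'d) = norm a" for a :: "real^'d" by (simp add: norm_vec_def of_real_vec_def)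
 have io0: "io 0 = 0" using io_linear(2)[of 0 0] by simp
 have sio: "smooth_on (ball 0 r1) (%v. Ps (io v))"
  by (rule smooth_on_compose[OF Ps(1) smooth_on_linear[OF bounded_linear_io] open_ball open_ball iob])
 have UEA: "UE <= UA" by (auto simp: UE_def)
 have sf: "smooth_on (ball 0 r1) f" unfolding f_def[abs_def]
  by (rule smooth_on_compose[OF smooth_jt sio _ open_UA]) (use Ps(2) iob UEA in auto)
 have f0: "f 0 = 0" using Y0_UE by (simp add: f_def io0 Ps(3) jt_def Y0_def zt_def mat_def prod_eq_iff vec_eq_iff)
 have fW: "f v : W" if "v : ball 0 r1" for v using Ps(2)[OF iob[OF that]] by (simp add: f_def UE_def)
 have freal: "EX e:B. f (rv a) = lift e" if "rv a : ball 0 r1" for a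
 proof -
  have "norm a * k' < r" using that k'(1) by (simp add: r1_def pos_less_divide_eq nr)
  hence "norm (ior a) < r" using k'(2)[of a] by simp
  thus ?thesis unfolding f_def io_real using iob[OF that] by (intro Ps(6)) (simp_all add: io_real)
 qed
 have df: "FD f 0 v = FD jt Y0 (G (io v) Y0)" for v
 proof -
  have "FD (%v. Ps (io v)) 0 v = FD Ps 0 (io v)"
   using FD_compose[OF bounded_linear_imp_differentiable[OF bounded_linear_io], of Ps 0 v] smooth_diff[OF Ps(1), of 0] r
   by (simp add: io0 FD_bounded_linear[OF bounded_linear_io])
  moreover have "FD f 0 v = FD jt (Ps (io 0)) (FD (%v. Ps (io v)) 0 v)" unfolding f_def[abs_def]
   by (rule FD_compose[OF smooth_diff[OF sio] smooth_diff[OF smooth_jt]]) (use r1 Y0_UE UEA in \<open>auto simp: io0 Ps(3)\<close>)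
  ultimately show ?thesis by (simp add: io0 Ps(3,4))
 qed
 have "fst (FD jt Y0 x) = fst x" for x
 proof -
  have d: "jt differentiable (at Y0)" using smooth_diff[OF smooth_jt] Y0_UE UEA by blast
  have "FD (%E. fst (jt E)) Y0 x = fst (FD jt Y0 x)" by (rule FD_linear_compose[OF bounded_linear_fst d])
  moreover have "(%E. fst (jt E)) = fst" by (simp add: jt_def fun_eq_iff)
  ultimately show ?thesis by (simp add: FD_bounded_linear[OF bounded_linear_fst])
 qed
 hence dfb: "fst (FD f 0 v) = (\<chi> k. ioal v k, ios v)" for v
  by (simp add: df FD_base_0 io_def)
 define R where "R v = rh (fst (f v))" for v
 have sR: "smooth_on (ball 0 r1) R" unfolding R_def[abs_def]
  by (rule smooth_on_compose[OF srh smooth_on_fst[OF sf] _ openU]) (use fW WU in auto)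
 have dR: "FD R 0 v = c0 * Im (ios v)" for v
 proof -
  have d: "f differentiable (at 0)" using smooth_diff[OF sf] r1 by simp
  have "FD R 0 v = FD rh (fst (f 0)) (FD (%v. fst (f v)) 0 v)" unfolding R_def[abs_def]
   using smooth_diff[OF smooth_on_fst[OF sf], of 0] smooth_diff[OF srh, of "fst (f 0)"] fW[of 0] WU r1
   by (intro FD_compose) auto
  also have "... = FD rh 0 (fst (FD f 0 v))" by (simp add: FD_linear_compose[OF bounded_linear_fst d] f0)
  finally show ?thesis by (simp add: dfb drh)
 qed
 have "isCont (FDL R) 0"
  using continuous_on_eq_continuous_at[OF open_ball, THEN iffD1, OF smooth_cont[OF smooth_on_FDL[OF open_ball sR]]] r1 by simp
 then obtain d where d: "d > 0" "!!v. norm v < d ==> norm (FDL R v - FDL R 0) < \<bar>c0\<bar> / 2"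
  using c0 unfolding continuous_at_eps_delta by (auto simp: dist_norm dest: spec[of _ "\<bar>c0\<bar> / 2"])
 define r2 where "r2 = min r1 d"
 have r2: "r2 > 0" "r2 <= r1" "r2 <= d" using r1 d by (auto simp: r2_def)
 have neg: "R v < 0" if v: "v : ball 0 r2" and im: "!!i. Im (v $ i) > 0" for v
 proof -
  define a b where "a = (\<chi> i. Re (v $ i))" and "b = (\<chi> i. Im (v $ i))"
  have vab: "v = rv a + imul (rv b)" unfolding a_def b_def by (rule complex_vec_Re_Im)
  define p where "p t = rv a + t .* imul (rv b)" for t
  have pb: "norm (p t) < r2" if "t : {0..1}" for t
  proof -
   have "cmod (p t $ i) <= cmod (v $ i)" for i
   proof -
    have "p t $ i = Complex (Re (v $ i)) (t * Im (v $ i))" by (simp add: p_def a_def b_def of_real_vec_def complex_eq_iff)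
    moreover have "(t * Im (v $ i))\<^sup>2 <= (Im (v $ i))\<^sup>2" using that by (simp add: power_mult_distrib mult_left_le_one_le power_le_one)
    ultimately show ?thesis by (simp add: cmod_def)
   qed
   hence "norm (p t) <= norm v" unfolding norm_vec_def by (rule L2_set_mono) simp
   thus ?thesis using v by simp
  qed
  have b: "!!i. b $ i > 0" using im by (simp add: b_def)
  have sb: "norm (imul (rv b :: complex^'d)) <= (SU i. b $ i)"
  proof -
   have "norm (imul (rv b :: complex^'d)) = norm b" by (simp add: norm_vec_def of_real_vec_def norm_mult)
   also have "... <= (SU i. \<bar>b $ i\<bar>)" by (rule norm_le_l1_cart)
   finally show ?thesis using b by (simp add: abs_of_pos)
  qed
  have spos: "(SU i. b $ i) > 0" by (rule sum_pos) (use b in auto)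
  have dp: "((%t. R (p t)) has_real_derivative FD R (p t) (imul (rv b))) (at t)" if "t : {0..1}" for t
  proof -
   have pt: "(p has_derivative (%s. s .* imul (rv b))) (at t)" unfolding p_def by (auto intro!: derivative_eq_intros)
   have "p t : ball 0 r1" using pb[OF that] r2 by simp
   hence Rd: "(R has_derivative FD R (p t)) (at (p t))" by (rule smooth_on_has_derivative[OF sR])
   have "((%t. R (p t)) has_derivative (%s. FD R (p t) (s .* imul (rv b)))) (at t)"
    by (rule has_derivative_compose[OF pt Rd])
   moreover have "FD R (p t) (s .* x) = x' * s" if "x' = FD R (p t) x" for s x x'
    using linear_scale[OF bounded_linear.linear[OF has_derivative_bounded_linear[OF Rd]]] that by simp
   ultimately show ?thesis unfolding has_field_derivative_def by simp
  qed
  obtain s where s: "0 < s" "s < 1" "R (p 1) - R (p 0) = (1 - 0) * FD R (p s) (imul (rv b))"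
   using MVT2[of 0 1 "%t. R (p t)" "%t. FD R (p t) (imul (rv b))"] dp by auto
  have "p 0 : ball 0 r1" using pb[of 0] r2 by simp
  then obtain e where "e : B" "f (p 0) = lift e" using freal[of a] by (auto simp: p_def)
  hence "R (p 0) = 0" using rh_graph by (simp add: R_def lift_def)
  moreover have "p 1 = v" by (simp add: p_def vab)
  ultimately have "R v = FD R (p s) (imul (rv b))" using s(3) by simp
  also have "... = FD R 0 (imul (rv b)) + (FDL R (p s) - FDL R 0) (imul (rv b))"
   using FDL_apply[OF smooth_diff[OF sR]] pb[of s] s r1 r2 by (simp add: blinfun.diff_left)
  also have "(FDL R (p s) - FDL R 0) (imul (rv b)) <= norm (FDL R (p s) - FDL R 0) * norm (imul (rv b :: complex^'d))"
   using norm_blinfun[of "FDL R (p s) - FDL R 0" "imul (rv b)"] by simp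
  also have "... <= \<bar>c0\<bar> / 2 * (SU i. b $ i)"
   using d(2)[of "p s"] pb[of s] s r2 sb by (intro mult_mono) auto
  also have "FD R 0 (imul (rv b)) = - \<bar>c0\<bar> * (SU i. b $ i)"
  proof -
   have "Im (ios (imul (rv b))) = ta * (SU i. b $ i)" by (simp add: ios_def of_real_vec_def)
   thus ?thesis unfolding dR by (simp add: ta(2)[symmetric] mult.assoc)
  qed
  finally have "R v <= - \<bar>c0\<bar> * (SU i. b $ i) + \<bar>c0\<bar> / 2 * (SU i. b $ i)" by simp
  also have "... < 0" using spos c0 by (simp add: algebra_simps)
  finally show ?thesis .
 qed
 have cl: "f v : closure P" if v: "v : ball 0 r2" and im: "(ALL i. Im (v $ i) > 0) | (ALL i. Im (v $ i) = 0)" for v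
 proof (cases "ALL i. Im (v $ i) > 0")
  case True
  hence "f v : P" using neg[OF v] fW[of v] v r2 by (simp add: P_eq R_def)
  thus ?thesis using closure_subset by blast
 next
  case False
  hence "ALL i. Im (v $ i) = 0" using im by blast
  hence "v = rv (\<chi> i. Re (v $ i))" by (simp add: vec_eq_iff of_real_vec_def complex_eq_iff)
  then obtain e where "e : B" "f v = lift e" using freal[of "\<chi> i. Re (v $ i)"] v r2 by auto
  thus ?thesis using lift_in(2) by simp
 qed
 have ch: "cholo f v" if v: "v : ball 0 r2" and im: "(ALL i. Im (v $ i) > 0) | (ALL i. Im (v $ i) = 0)" for v
 proof -
  have v1: "v : ball 0 r1" using v r2 by simp
  have "Ps (t .* io v) : PE" if t: "t : {0..1}" for t
  proof -
   have tv: "t .* v : ball 0 r2" by (rule scale_ball[OF t v])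
   have "(ALL i. Im ((t .* v) $ i) > 0) | (ALL i. Im ((t .* v) $ i) = 0)"
    using im t by (cases "t = 0") auto
   hence "f (t .* v) : closure P" by (rule cl[OF tv])
   thus ?thesis using Ps(2)[OF scale_ball[OF t iob[OF v1]]] by (simp add: f_def PE_def io_linear)
  qed
  from Ps(5)[OF iob[OF v1] this] have 1: "cholo Ps (io v)" .
  have 2: "cholo io v" by (rule cholo_linear[OF bounded_linear_io io_linear(3)])
  have "cholo (%v. Ps (io v)) v" by (rule cholo_compose[OF 2 1])
  thus ?thesis unfolding f_def[abs_def] using cholo_jt[of "Ps (io v)"] Ps(2)[OF iob[OF v1]] UEA
   by (intro cholo_compose[where f="%v. Ps (io v)" and g=jt]) auto
 qed
 show ?thesis
 proof (rule that[of r2 f])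
  show "smooth_on (ball 0 r2) f" by (rule smooth_on_subset[OF sf]) (use r2 in auto)
 qed (use r2 fW f0 dfb freal cl ch in auto)
qed

end

lemma hol_side_prod [hol_sides]: "open W ==> (!!i. i : I ==> hol_side W P (a i)) ==> hol_side W P (%x. \<Prod>i\<in>I. a i x)"
 by (induction I rule: infinite_finite_induct) (auto intro!: hol_side_mult hol_side_const)

lemma hol_side_det: "open W ==> (!!i j. hol_side W P (%x. M x $ i $ j)) ==> hol_side W P (%x. det (M x :: complex^'a::finite^'a))"
 unfolding det_def by (intro hol_sides)

text \<open>Cramer's rule: the solution of a nondegenerate linear system depends holomorphically on the
 parameters wherever the coefficients do.\<close>

lemma hol_side_solve:
 fixes M :: "'p::complex_space => complex^'a::finite^'a"
 assumes "open W" and M: "!!i j. hol_side W P (%x. M x $ i $ j)" and nz: "!!x. x : W ==> det (M x) ~= 0" and "P <= W"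
 obtains s where "!!k. hol_side W P (%x. s x $ k)" "!!x. x : W ==> M x *v s x = b"
proof
 define s where "s x = (\<chi> k. det (\<chi> i j. if j = k then b $ i else M x $ i $ j) / det (M x))" for x
 show "M x *v s x = b" if "x : W" for x using cramer[OF nz[OF that], of "s x" b] by (simp add: s_def)
 fix k
 have "hol_side W P (%x. det (\<chi> i j. if j = k then b $ i else M x $ i $ j))"
 proof (intro hol_side_det assms(1))
  show "hol_side W P (%x. (\<chi> i j. if j = k then b $ i else M x $ i $ j) $ i $ j)" for i j
   using M[of i j] by (cases "j = k") (simp_all add: hol_side_const)
 qed
 moreover have "hol_side W P (%x. det (M x))" by (rule hol_side_det[OF assms(1) M])
 ultimately show "hol_side W P (%x. s x $ k)"
  using nz assms(1,4) unfolding hol_side_def s_def by (auto intro!: smooth_on_divide cholo_divide)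
qed

lemma cholo_vec_expand:
 fixes a :: "complex^'d::finite => complex"
 assumes a: "cholo a x"
 shows "FD a x v = (SU i. v $ i * FD a x (axis i 1))"
proof -
 interpret linear "FD a x" using FD_linear[OF cholo_differentiable[OF a]] by (rule bounded_linear.linear)
 have ax: "axis i u = Re u .* axis i 1 + Im u .* imul (axis i (1::complex) :: complex^'d)" for i u
  by (auto simp: vec_eq_iff axis_def complex_eq_iff)
 have "v = (SU i. axis i (v $ i))" using vec_lambda_axis[of "%i. v $ i"] by simp
 hence "FD a x v = (SU i. FD a x (axis i (v $ i)))" by (metis sum)
 thus ?thesis by (subst (asm) ax) (simp only: cholo_scale[OF a])
qed

context one_sided
begin

text \<open>A complex tangent vector of the hypersurface whose image in the jets differs from one of
 type (1,0) by translations in directions of symmetry is, up to these translations, of type (1,0).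
 This is where nondegeneracy of the Levi form enters.\<close>

lemma type_10_modulo_symmetries:
 fixes X :: "'i::finite => complex" and tt :: "'i => (complex^'n) \<times> real" and a c :: "'n => complex"
 assumes e: "e : B" and rigid: "!!e j. e : B ==> j ~: K ==> FD ph e (axis j 1, 0) = 0"
 defines "Xh \<equiv> %f. SU ka. X ka * FD f e (tt ka)"
 assumes z: "!!i. Xh (z i) = a i + (if i : K then 0 else c i)" and w: "Xh w = (SU i. ze i e * a i)"
  and ze: "!!l. Xh (ze l) = (SU i. g i l (lift e) * a i)"
 shows "Xh (%e. cnj (z i e)) = (if i : K then 0 else c i)" "Xh wb = 0"
proof -
 define x where "x i = (SU ka. X ka * fst (tt ka) $ i)" for i
 define y where "y i = (SU ka. X ka * cnj (fst (tt ka) $ i))" for i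
 define th where "th = (SU ka. X ka * cnj (FD w e (tt ka) - (SU i. ze i e * fst (tt ka) $ i)))"
 have F: "Xh f = (SU i. x i * L i f e + y i * Lb i f e) + th * T f e" if "smooth_on B f" for f
 proof -
  have "FD f e (tt ka) = (SU i. fst (tt ka) $ i * L i f e + cnj (fst (tt ka) $ i) * Lb i f e)
   + cnj (FD w e (tt ka) - (SU i. ze i e * fst (tt ka) $ i)) * T f e" for ka
   using FD_frame[OF e that, of "fst (tt ka)" "snd (tt ka)"] by simp
  hence "Xh f = (SU ka. SU i. X ka * fst (tt ka) $ i * L i f e + X ka * cnj (fst (tt ka) $ i) * Lb i f e) + th * T f e"
   unfolding Xh_def th_def by (simp only: distrib_left sum.distrib sum_distrib_left sum_distrib_right mult.assoc)
  also have "(SU ka. SU i. X ka * fst (tt ka) $ i * L i f e + X ka * cnj (fst (tt ka) $ i) * Lb i f e) = (SU i. x i * L i f e + y i * Lb i f e)"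
   unfolding x_def y_def by (subst sum.swap) (simp add: sum.distrib sum_distrib_right)
  finally show ?thesis .
 qed
 have xz: "x i = a i + (if i : K then 0 else c i)" for i using z[of i] by (simp add: Xh_def x_def FD_z)
 have yz: "Xh (%e. cnj (z i e)) = y i" for i by (simp add: Xh_def y_def FD_zb)
 have sym: "ze j e = - kap e * cnj (ze j e)" "g j l (lift e) = cnj (ze j e) * T (ze l) e - kap e * La l j e" if "j ~: K" for j l
 proof -
  have dw: "FD w e (axis j 1, 0) = 0" by (simp add: FD_w[OF e] rigid[OF e that])
  have ax: "(SU i. ze i e * axis j 1 $ i) = ze j e" "(SU i. axis j 1 $ i * L i f e + cnj (axis j 1 $ i) * Lb i f e) = L j f e + Lb j f e" for f
   by (simp_all add: axis_def if_distrib[of cnj] if_distrib[of "%x. x * _"] if_distrib[of "%x. _ * x"] sum.distrib cong: if_cong)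
  have fr: "FD f e (axis j 1, 0) = L j f e + Lb j f e - cnj (ze j e) * T f e" if "smooth_on B f" for f
   unfolding FD_frame[OF e that] ax dw by simp
  show "ze j e = - kap e * cnj (ze j e)" using fr[OF smooth_w(1)] by (simp add: dw L_w[OF e] eq_neg_iff_add_eq_0 mult.commute)
  have "FD (ze l) e (axis j 1, 0) = 0"
  proof -
   have k: "((%e. complex_of_real (FD ph e v)) has_derivative FD (%e. complex_of_real (FD ph e v)) e) (at e)"
    "FD (%e. complex_of_real (FD ph e v)) e (axis j 1, 0) = 0" for v
   proof -
    have s: "smooth_on B (%e. FD ph e v)" by (rule smooth_on_FD[OF sphi])
    thus "((%e. complex_of_real (FD ph e v)) has_derivative FD (%e. complex_of_real (FD ph e v)) e) (at e)"
     by (intro smooth_on_has_derivative[OF _ e] smooths openB)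
    have "FD (%e. FD ph e v) e (axis j 1, 0) = FD (%e. FD ph e (axis j 1, 0)) e v"
     by (rule second_sym_real[OF openB sphi e])
    also have "... = FD (%e. 0) e v" using FD_cong[OF openB e, of "%e. FD ph e (axis j 1, 0)" "%e. 0"] rigid that by simp
    finally have "FD (%e. FD ph e v) e (axis j 1, 0) = 0" by simp
    moreover have "FD (%e. complex_of_real (FD ph e v)) e x = of_real (FD (%e. FD ph e v) e x)" for x
     by (rule FD_linear_compose[OF bounded_linear_of_real dB[OF s e]])
    ultimately show "FD (%e. complex_of_real (FD ph e v)) e (axis j 1, 0) = 0" by simp
   qed
   have 1: "FD (%e. 1 - \<i> * of_real (phs e)) e (axis j 1, 0) = 0"
    unfolding phs_def using FD_eq[OF has_derivative_diff[OF has_derivative_const has_derivative_mult_right[OF k(1)]]] k(2) by simp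
   have 2: "FD (%e. \<i> * (of_real (FD ph e (axis l 1, 0)) - \<i> * of_real (FD ph e (axis l \<i>, 0)))) e (axis j 1, 0) = 0"
    using FD_eq[OF has_derivative_mult_right[OF has_derivative_diff[OF k(1) has_derivative_mult_right[OF k(1)]]]] k(2) by simp
   have "ze l x * (1 - \<i> * of_real (phs x)) = \<i> * (of_real (FD ph x (axis l 1, 0)) - \<i> * of_real (FD ph x (axis l \<i>, 0)))" for x
    using den_nz(1)[of x] by (simp add: ze_def phz_def ch_def)
   with 2 have "FD (%x. ze l x * (1 - \<i> * of_real (phs x))) e (axis j 1, 0) = 0" by simp
   moreover have "smooth_on B (%x. 1 - \<i> * of_real (phs x))" by (intro smooths openB smooth_phs)
   ultimately have "FD (ze l) e (axis j 1, 0) * (1 - \<i> * of_real (phs e)) = 0"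
    using FD_mult[OF dB[OF smooth_ze e] dB[OF _ e]] 1 by simp
   thus ?thesis using den_nz(1)[of e] by simp
  qed
  thus "g j l (lift e) = cnj (ze j e) * T (ze l) e - kap e * La l j e"
   using fr[OF smooth_ze, of l] L_ze[OF e, of j l] by (simp add: Lb_ze[OF e] lift_def algebra_simps)
 qed
 have t0: "kap e * th = (\<Sum>j\<in>- K. ze j e * c j)"
 proof -
  have "(SU i. ze i e * a i) = (SU i. x i * ze i e) - kap e * th"
   using F[OF smooth_w(1)] w by (simp add: L_w[OF e] mult.commute)
  also have "(SU i. x i * ze i e) = (SU i. ze i e * a i) + (SU i. if i : - K then ze i e * c i else 0)"
   unfolding xz sum.distrib[symmetric] by (rule sum.cong) (auto simp: algebra_simps)
  finally show ?thesis by (simp add: sum.If_cases Compl_eq)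
 qed
 have t1: "th = - (\<Sum>j\<in>- K. cnj (ze j e) * c j)"
 proof -
  have "kap e * th = kap e * (- (\<Sum>j\<in>- K. cnj (ze j e) * c j))"
   unfolding t0 by (simp add: sum_distrib_left sum_negf[symmetric]) (rule sum.cong, simp, subst sym(1), auto)
  thus ?thesis using kap_nz[of e] by (simp only: mult_cancel_left) simp
 qed
 have flip: "(if x ~: K then q else (0::complex)) = (if x : K then 0 else q)" for x q by simp
 define d where "d i = y i - (if i : K then 0 else c i)" for i
 have "(SU i. La l i e * d i) = 0" for l
 proof -
  have "(SU i. g i l (lift e) * a i) = (SU i. x i * g i l (lift e)) + kap e * (SU i. La l i e * y i) + th * T (ze l) e"
   using F[OF smooth_ze, of l] ze[of l] L_ze[OF e, of _ l, folded lift_def]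
   by (simp add: Lb_ze[OF e] sum.distrib sum_distrib_left mult_ac)
  also have "(SU i. x i * g i l (lift e)) = (SU i. g i l (lift e) * a i) + (SU i. if i : - K then g i l (lift e) * c i else 0)"
   unfolding xz sum.distrib[symmetric] by (rule sum.cong) (auto simp: algebra_simps)
  also have "(SU i. if i : - K then g i l (lift e) * c i else 0) = (\<Sum>i\<in>- K. (cnj (ze i e) * T (ze l) e - kap e * La l i e) * c i)"
   by (simp add: sum.If_cases Compl_eq sym(2))
  also have "... = - th * T (ze l) e - kap e * (\<Sum>i\<in>- K. La l i e * c i)"
   unfolding t1 by (simp add: algebra_simps sum_subtractf sum_distrib_left sum_distrib_right)
  finally have "kap e * ((SU i. La l i e * y i) - (\<Sum>i\<in>- K. La l i e * c i)) = 0" by (auto simp: algebra_simps)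
  hence "(SU i. La l i e * y i) - (SU i. if i : - K then La l i e * c i else 0) = 0" using kap_nz[of e] by (simp add: sum.If_cases Compl_eq)
  thus ?thesis unfolding d_def sum_subtractf[symmetric] by (simp add: flip right_diff_distrib if_distrib[of "%x. _ * x"] cong: if_cong)
 qed
 hence "(\<chi> i j. La i j e) *v (\<chi> i. d i) = 0" by (simp add: matrix_vector_mult_def vec_eq_iff)
 hence "(\<chi> i. d i) = 0" using La_nondegenerate[OF e] matrix_left_invertible_ker[of "\<chi> i j. La i j e"]
  by (metis invertible_det_nz invertible_left_inverse)
 hence yc: "y i = (if i : K then 0 else c i)" for i by (simp add: vec_eq_iff d_def)
 thus "Xh (%e. cnj (z i e)) = (if i : K then 0 else c i)" by (simp add: yz)
 have "Xh wb = (SU i. if i : - K then cnj (ze i e) * c i else 0) + th"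
  unfolding F[OF smooth_w(2)] by (simp add: flip L_w[OF e] yc) (rule sum.cong, auto)
 thus "Xh wb = 0" by (simp add: t1 sum.If_cases Compl_eq)
qed

end

lemma index_cases:
 obtains l where "i = Inl l" | "i = Inr None" | k where "i = Inr (Some k)"
 by (metis sum.exhaust option.exhaust)

lemma complex_linear_expand:
 fixes F :: "complex^'a::finite => complex"
 assumes "!!x y. F (x + y) = F x + F y" "!!c x. F (c *s x) = c * F x"
 shows "F x = (SU p. x $ p * F (axis p 1))"
proof -
 have 0: "F 0 = 0" using assms(2)[of 0 0] by simp
 have "F (\<Sum>p\<in>I. x $ p *s axis p 1) = (\<Sum>p\<in>I. x $ p * F (axis p 1))" if "finite I" for I
  using that by induction (simp_all add: assms 0)
 from this[of UNIV] show ?thesis by (simp add: basis_expansion)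
qed

lemma cnj_vec_simps: "cnj_vec (cnj_vec x) = x" "cnj_vec (imul x) = - imul (cnj_vec x)" "cnj_vec x $ i = cnj (x $ i)"
 by (simp_all add: cnj_vec_def vec_eq_iff)

lemma bounded_linear_cnj_vec: "bounded_linear (cnj_vec :: complex^'a::finite => _)"
 by (subst linear_conv_bounded_linear[symmetric]) (auto intro!: linearI simp: cnj_vec_def vec_eq_iff)

lemma cholo_reflect:
 assumes "cholo h (cnj_vec x)" shows "cholo (%x. cnj (h (cnj_vec x) :: complex)) x"
proof (rule choloI)
 have d: "(h has_derivative FD h (cnj_vec x)) (at (cnj_vec x))" by (rule FD_works[OF cholo_differentiable[OF assms]])
 show "((%x. cnj (h (cnj_vec x))) has_derivative (%v. cnj (FD h (cnj_vec x) (cnj_vec v)))) (at x)"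
  by (rule bounded_linear.has_derivative[OF bounded_linear_cnj has_derivative_compose[OF bounded_linear_imp_has_derivative[OF bounded_linear_cnj_vec] d]])
 interpret linear "FD h (cnj_vec x)" by (rule bounded_linear.linear[OF FD_linear[OF cholo_differentiable[OF assms]]])
 show "cnj (FD h (cnj_vec x) (cnj_vec (imul v))) = imul (cnj (FD h (cnj_vec x) (cnj_vec v)))" for v
  by (simp add: cnj_vec_simps neg cholo_imul[OF assms])
qed

section \<open>Conjugate frames on the edge\<close>

locale slice_param = real_slice B ph W P g rh U c0 K lab
 for B :: "((complex^'n::finite) \<times> real) set" and ph W P g rh U c0 K and lab :: "'d::finite => 'n coord" +
 fixes r :: real and f :: "complex^'d => 'n jet"
 assumes r: "r > 0" and sf: "smooth_on (ball 0 r) f" and fW: "!!v. v : ball 0 r ==> f v : W" and f0: "f 0 = 0"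
  and df0: "!!v. fst (FD f 0 v) = (\<chi> k. ioal v k, ios v)"
  and freal: "!!a. rv a : ball 0 r ==> EX e:B. f (rv a) = lift e"
  and fhol: "!!v. v : ball 0 r ==> (ALL i. Im (v $ i) > 0) | (ALL i. Im (v $ i) = 0) ==> cholo f v & f v : closure P"
begin

definition "zc k x = fst (fst (f x)) $ k"
definition "wc x = snd (fst (f x))"
definition "ec l x = snd (f x) $ l"
definition Pw :: "(complex^'d) set" where "Pw = {v : ball 0 r. ALL i. Im (v $ i) > 0}"

lemma open_P: "open Pw"
proof -
 have "Pw = ball 0 r \<inter> (\<Inter>i. {v. Im (v $ i) > 0})" by (auto simp: Pw_def)
 moreover have "open {v :: complex^'d. Im (v $ i) > 0}" for i by (intro open_Collect_less continuous_intros)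
 ultimately show ?thesis by (simp add: open_INT open_Int)
qed

lemma P_ball: "Pw <= ball 0 r" by (auto simp: Pw_def)

lemma hol_comp: "hol_side (ball 0 r) Pw (zc k)" "hol_side (ball 0 r) Pw wc" "hol_side (ball 0 r) Pw (ec l)"
 unfolding hol_side_def zc_def[abs_def] wc_def[abs_def] ec_def[abs_def]
 using fhol by (auto intro!: smooths sf cholos simp: Pw_def)

lemma cholo_comp:
 assumes "cholo f x" shows "cholo (zc k) x" "cholo wc x" "cholo (ec l) x"
 unfolding zc_def[abs_def] wc_def[abs_def] ec_def[abs_def] using assms by (auto intro!: cholos)

lemma hol_gf: "hol_side (ball 0 r) Pw (%x. g i l (f x))"
 unfolding hol_side_def
proof (intro conjI ballI)
 show "smooth_on (ball 0 r) (%x. g i l (f x))"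
  by (rule smooth_on_compose[OF _ sf open_ball openW fW]) (use g in \<open>auto simp: hol_side_def\<close>)
 fix x assume "x : Pw"
 hence "x : ball 0 r" "cholo f x" "f x : closure P" using fhol[of x] by (auto simp: Pw_def)
 thus "cholo (%x. g i l (f x)) x" using cholo_compose[where f=f and g="g i l"] cholo_closure[OF openW PW g fW] by blast
qed

definition "DZ x v k = FD (zc k) x v"
definition "DW x v = FD wc x v"
definition "DE x v l = FD (ec l) x v"
definition vv :: "complex^('n + 'n option) => complex^'d" where
 "vv y = (\<chi> i. case lab i of CX k => y $ Inr (Some k) | CY k => y $ Inl k | CS => y $ Inr None | CT k => y $ Inl k)"
definition "cc y k = (if k : K then 0 else y $ Inr (Some k))"
definition "SA x y k = DZ x (vv y) k - cc y k"
text \<open>The zeros of RR x, with the first components left free, are the vectors in the kernel of dw and of dz k for k in K;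
  the components of y with index outside K absorb dz k for the other k. RR' does the same for the
  equations saying that the image in the jets is of type (1,0) modulo the translations, and is
  normalized by the components of type (1,0).\<close>

definition RR :: "complex^'d => complex^('n + 'n option) => complex^('n + 'n option)" where
 "RR x y = (\<chi> q. case q of Inl k => iobt (vv y) k | Inr None => DW x (vv y) | Inr (Some k) => SA x y k)"
definition RR' :: "complex^'d => complex^('n + 'n option) => complex^('n + 'n option)" where
 "RR' x y = (\<chi> q. case q of Inl l => DE x (vv y) l - (SU i. g i l (f x) * SA x y i)
  | Inr None => DW x (vv y) - (SU i. ec i x * SA x y i) | Inr (Some k) => ioal (vv y) k)"

lemma vv_lc: "k : K ==> vv y $ lc (CX k) = y $ Inr (Some k)" "k : K ==> vv y $ lc (CY k) = y $ Inl k"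
 "vv y $ lc CS = y $ Inr None" "k ~: K ==> vv y $ lc (CT k) = y $ Inl k"
 by (simp_all add: vv_def lab_lc labels)

lemma vec_eq_labels:
 assumes "!!k. k : K ==> v $ lc (CX k) = v' $ lc (CX k)" "!!k. k : K ==> v $ lc (CY k) = v' $ lc (CY k)"
  "v $ lc CS = v' $ lc CS" "!!k. k ~: K ==> v $ lc (CT k) = v' $ lc (CT k)"
 shows "v = v'"
proof -
 have "v $ lc c = v' $ lc c" if "c : coord_labels K" for c using that assms by (auto simp: coord_labels_def)
 thus ?thesis using lab_in lc_lab by (metis vec_eq_iff)
qed



lemma io_injective:
 assumes "!!k. k : K ==> ioal v k = 0" "!!k. iobt v k = 0" "ios v = 0"
 shows "v = 0"
proof -
 have XY: "v $ lc (CX k) = 0" "v $ lc (CY k) = 0" if "k : K" for k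
  using assms(1)[OF that] assms(2)[of k] that by (simp_all add: ioal_def iobt_def)
 have T: "v $ lc (CT k) = 0" if "k ~: K" for k using assms(2)[of k] that by (simp add: iobt_def)
 have nS: "v $ i = 0" if "i ~= lc CS" for i
 proof -
  have "v $ lc (lab i) = 0" using lab_in[of i] XY T that lc_lab[of i] by (auto simp: coord_labels_def)
  thus ?thesis by (simp add: lc_lab)
 qed
 have "(SU i. v $ i) = v $ lc CS"
  using sum.mono_neutral_right[of UNIV "{lc CS}" "%i. v $ i"] nS by simp
 hence "v $ lc CS = 0" using assms(3) ta(1) by (simp add: ios_def)
 thus ?thesis using nS by (metis vec_eq_iff zero_index)
qed

lemma linear_parts: "vv (y + y') = vv y + vv y'" "vv (c *s y) = c *s vv y" "cc (y + y') k = cc y k + cc y' k" "cc (c *s y) k = c * cc y k"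
 "ioal (v + v') k = ioal v k + ioal v' k" "ioal (c *s v) k = c * ioal v k"
 "iobt (v + v') k = iobt v k + iobt v' k" "iobt (c *s v) k = c * iobt v k"
 by (auto simp: vv_def cc_def vec_eq_iff ioal_def iobt_def algebra_simps split: coord.split)

lemma D_linear:
 assumes c: "cholo f x"
 shows "DZ x (v + v') k = DZ x v k + DZ x v' k" "DZ x (b *s v) k = b * DZ x v k"
  "DW x (v + v') = DW x v + DW x v'" "DW x (b *s v) = b * DW x v"
  "DE x (v + v') k = DE x v k + DE x v' k" "DE x (b *s v) k = b * DE x v k"
proof -
 have "FD a x (v + v') = FD a x v + FD a x v'" "FD a x (b *s v) = b * FD a x v" if "cholo a x" for a
  unfolding cholo_vec_expand[OF that, of "v + v'"] cholo_vec_expand[OF that, of "b *s v"] cholo_vec_expand[OF that, of v] cholo_vec_expand[OF that, of v']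
  by (simp_all add: algebra_simps sum.distrib sum_distrib_left)
 thus "DZ x (v + v') k = DZ x v k + DZ x v' k" "DZ x (b *s v) k = b * DZ x v k"
  "DW x (v + v') = DW x v + DW x v'" "DW x (b *s v) = b * DW x v"
  "DE x (v + v') k = DE x v k + DE x v' k" "DE x (b *s v) k = b * DE x v k"
  using cholo_comp[OF c] by (simp_all add: DZ_def DW_def DE_def)
qed

definition "M x = (\<chi> q p. RR x (axis p 1) $ q)"
definition "M' x = (\<chi> q p. RR' x (axis p 1) $ q)"

lemma M_RR: assumes c: "cholo f x" shows "M x *v y = RR x y" "M' x *v y = RR' x y"
proof -
 have SA: "SA x (y + y') k = SA x y k + SA x y' k" "SA x (b *s y) k = b * SA x y k" for y y' b k
  by (simp_all add: SA_def linear_parts D_linear[OF c] algebra_simps)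
 have "RR x (y + y') $ q = RR x y $ q + RR x y' $ q" "RR x (b *s y) $ q = b * RR x y $ q" for y y' b q
  by (auto simp: RR_def SA linear_parts D_linear[OF c] split: sum.split option.split)
 hence "RR x y $ q = (SU p. y $ p * RR x (axis p 1) $ q)" for q by (rule complex_linear_expand)
 thus "M x *v y = RR x y" by (simp add: M_def matrix_vector_mult_def vec_eq_iff mult.commute)
 have "RR' x (y + y') $ q = RR' x y $ q + RR' x y' $ q" "RR' x (b *s y) $ q = b * RR' x y $ q" for y y' b q
  by (auto simp: RR'_def SA linear_parts D_linear[OF c] algebra_simps sum.distrib sum_distrib_left split: sum.split option.split)
 hence "RR' x y $ q = (SU p. y $ p * RR' x (axis p 1) $ q)" for q by (rule complex_linear_expand)
 thus "M' x *v y = RR' x y" by (simp add: M'_def matrix_vector_mult_def vec_eq_iff mult.commute)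
qed

lemma hol_M: "hol_side (ball 0 r) Pw (%x. M x $ i $ j)" "hol_side (ball 0 r) Pw (%x. M' x $ i $ j)"
proof -
 have D: "hol_side (ball 0 r) Pw (%x. DZ x v k)" "hol_side (ball 0 r) Pw (%x. DW x v)" "hol_side (ball 0 r) Pw (%x. DE x v k)" for v k
  unfolding DZ_def DW_def DE_def by (intro hol_side_FD open_ball open_P P_ball hol_comp)+
 have SA: "hol_side (ball 0 r) Pw (%x. SA x y k)" for y k unfolding SA_def by (intro hol_sides open_ball D)
 show "hol_side (ball 0 r) Pw (%x. M x $ i $ j)"
  by (cases i rule: index_cases) (simp_all add: M_def RR_def D SA hol_side_const)
 show "hol_side (ball 0 r) Pw (%x. M' x $ i $ j)"
  by (cases i rule: index_cases) (simp_all add: M'_def RR'_def, (intro hol_sides open_ball D SA hol_gf hol_comp)+)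
qed

lemma io_cnj: "iobt (cnj_vec v) k = cnj (ioal v k)" "ioal (cnj_vec v) k = cnj (iobt v k)" "ios (cnj_vec v) = cnj (ios v)"
 by (simp_all add: ioal_def iobt_def ios_def cnj_vec_def)

text \<open>On the edge, the second system describes the conjugates of the solutions of the first.\<close>

lemma edge_conjugate:
 assumes a: "rv a : ball 0 r" and y: "!!l. RR' (rv a) y $ Inl l = 0" "RR' (rv a) y $ Inr None = 0"
 shows "DZ (rv a) (cnj_vec (vv y)) k = cnj (cc y k)" "DW (rv a) (cnj_vec (vv y)) = 0"
proof -
 let ?x = "rv a :: complex^'d"
 define S where "S = {b :: real^'d. rv b : ball 0 r}"
 have oS: "open S" unfolding S_def
  using continuous_open_preimage[OF linear_continuous_on[OF bounded_linear_of_real_vec] open_UNIV open_ball[of 0 r]] by (simp add: vimage_def)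
 have aS: "a : S" using a by (simp add: S_def)
 define E where "E b = (fst (fst (f (rv b))), Re (snd (fst (f (rv b)))))" for b :: "real^'d"
 have lE: "f (rv b) = lift (E b)" "E b : B" if "b : S" for b
 proof -
  have "rv b : ball 0 r" using that unfolding S_def by blast
  from freal[OF this] obtain e where e: "e : B" "f (rv b) = lift e" by blast
  hence "E b = e" by (simp add: E_def lift_def w_def prod_eq_iff)
  thus "f (rv b) = lift (E b)" "E b : B" using e by simp_all
 qed
 have cf: "cholo f ?x" using fhol[OF a] by (simp add: of_real_vec_def)
 have dor: "(rv has_derivative rv) (at b)" for b :: "real^'d"
  by (rule bounded_linear_imp_has_derivative[OF bounded_linear_of_real_vec])
 have sfo: "smooth_on S (%b. f (rv b))"
  by (rule smooth_on_compose[OF sf smooth_on_linear[OF bounded_linear_of_real_vec] oS open_ball]) (simp add: S_def)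
 have "smooth_on S E" unfolding E_def[abs_def] by (intro smooths oS sfo)
 hence dE: "E differentiable (at a)" using smooth_diff aS by blast
 let ?e = "E a" and ?t = "%ka. FD E a (axis ka 1)"
 have ax: "rv (axis ka 1 :: real^'d) = axis ka 1" for ka by (simp add: of_real_vec_def axis_def vec_eq_iff)
 have ch: "FD h ?e (?t ka) = FD c ?x (axis ka 1)" if h: "smooth_on B h" and c: "cholo c ?x" and hc: "!!b. b : S ==> h (E b) = c (rv b)" for h :: "_ => complex" and c ka
 proof -
  have "FD h ?e (?t ka) = FD (%b. h (E b)) a (axis ka 1)" by (rule FD_compose[OF dE dB[OF h lE(2)[OF aS]], symmetric])
  also have "... = FD (%b. c (rv b)) a (axis ka 1)" by (subst FD_cong[OF oS aS hc]) auto
  also have "... = FD c ?x (FD rv a (axis ka 1))"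
   by (rule FD_compose[where f=rv and g=c]) (use dor cholo_differentiable[OF c] in \<open>auto simp: differentiable_def\<close>)
  finally show ?thesis by (simp add: FD_eq[OF dor] ax)
 qed
 have X: "(SU ka. v $ ka * FD h ?e (?t ka)) = FD c ?x v" if h: "smooth_on B h" and c: "cholo c ?x" and hc: "!!b. b : S ==> h (E b) = c (rv b)" for h :: "_ => complex" and c v
  by (subst cholo_vec_expand[OF c]) (simp only: ch[OF h c hc])
 have hz: "z i (E b) = zc i (rv b)" "w (E b) = wc (rv b)" "ze i (E b) = ec i (rv b)" if "b : S" for i b
  using lE(1)[OF that] by (simp_all add: z_def zc_def wc_def ec_def lift_def)
 have Xz: "(SU ka. v $ ka * FD (z i) ?e (?t ka)) = DZ ?x v i" "(SU ka. v $ ka * FD w ?e (?t ka)) = DW ?x v"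
  "(SU ka. v $ ka * FD (ze i) ?e (?t ka)) = DE ?x v i" for v i
  unfolding DZ_def DW_def DE_def using hz cholo_comp[OF cf] smooth_z smooth_w(1) smooth_ze by (intro X; blast)+
 have t: "(SU ka. vv y $ ka * FD (%e. cnj (z i e)) ?e (?t ka)) = (if i : K then 0 else cc y i)"
  "(SU ka. vv y $ ka * FD wb ?e (?t ka)) = 0" for i
 proof -
  have 1: "(SU ka. vv y $ ka * FD (z i) ?e (?t ka)) = SA ?x y i + (if i : K then 0 else cc y i)" for i
   by (simp add: Xz SA_def cc_def)
  have 2: "(SU ka. vv y $ ka * FD w ?e (?t ka)) = (SU i. ze i ?e * SA ?x y i)"
   using y(2) by (simp add: Xz RR'_def hz(3)[OF aS])
  have 3: "(SU ka. vv y $ ka * FD (ze l) ?e (?t ka)) = (SU i. g i l (lift ?e) * SA ?x y i)" for l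
   using y(1)[of l] by (simp add: Xz RR'_def lE(1)[OF aS])
  from type_10_modulo_symmetries[OF lE(2)[OF aS] rigid 1 2 3]
  show "(SU ka. vv y $ ka * FD (%e. cnj (z i e)) ?e (?t ka)) = (if i : K then 0 else cc y i)"
   "(SU ka. vv y $ ka * FD wb ?e (?t ka)) = 0" by blast+
 qed
 have "DZ ?x (cnj_vec (vv y)) k = cnj (SU ka. vv y $ ka * FD (%e. cnj (z k e)) ?e (?t ka))"
  unfolding Xz(1)[symmetric] by (simp add: FD_zb FD_z cnj_vec_def)
 thus "DZ ?x (cnj_vec (vv y)) k = cnj (cc y k)" by (simp add: t cc_def)
 have wbw: "wb = (%e. cnj (w e))" by (auto simp: w_def wb_def fun_eq_iff)
 have "DW ?x (cnj_vec (vv y)) = cnj (SU ka. vv y $ ka * FD wb ?e (?t ka))"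
  unfolding Xz(2)[symmetric] wbw by (simp add: FD_cnj[OF dB[OF smooth_w(1) lE(2)[OF aS]]] cnj_vec_def)
 thus "DW ?x (cnj_vec (vv y)) = 0" by (simp add: t)
qed

lemma D_0: "DZ 0 v k = ioal v k" "DW 0 v = ios v"
proof -
 have d: "f differentiable (at 0)" using smooth_diff[OF sf] r by simp
 have "FD (%x. fst (fst (f x)) $ k) 0 v = fst (fst (FD f 0 v)) $ k"
  by (rule FD_linear_compose[OF bounded_linear_compose[OF bounded_linear_vec_nth bounded_linear_compose[OF bounded_linear_fst bounded_linear_fst]] d])
 thus "DZ 0 v k = ioal v k" by (simp add: DZ_def zc_def[abs_def] df0)
 have "FD (%x. snd (fst (f x))) 0 v = snd (fst (FD f 0 v))"
  by (rule FD_linear_compose[OF bounded_linear_compose[OF bounded_linear_snd bounded_linear_fst] d])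
 thus "DW 0 v = ios v" by (simp add: DW_def wc_def[abs_def] df0)
qed

lemma vv_zero: assumes "vv y = 0" "!!k. k ~: K ==> cc y k = 0" shows "y = 0"
proof -
 have "y $ Inl k = 0" for k using vv_lc(2,4)[of k y] assms(1) by (cases "k : K") auto
 moreover have "y $ Inr None = 0" using vv_lc(3)[of y] assms(1) by simp
 moreover have "y $ Inr (Some k) = 0" for k using vv_lc(1)[of k y] assms by (cases "k : K") (auto simp: cc_def)
 ultimately show ?thesis by (metis vec_eq_iff zero_index sum.exhaust option.exhaust)
qed

lemma det_M_0: "det (M 0) ~= 0" "det (M' 0) ~= 0"
proof -
 have c0: "cholo f 0" using fhol[of 0] r by simp
 have inj: "det N ~= 0" if "!!y. N *v y = 0 ==> y = 0" for N :: "complex^('n + 'n option)^('n + 'n option)"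
  using that matrix_left_invertible_ker[of N] by (simp add: invertible_det_nz[symmetric] invertible_left_inverse)
 show "det (M 0) ~= 0"
 proof (rule inj)
  fix y assume "M 0 *v y = 0"
  hence R: "RR 0 y = 0" by (simp add: M_RR c0)
  have "iobt (vv y) k = 0" "SA 0 y k = 0" for k
   using arg_cong[OF R, of "%v. v $ Inl k"] arg_cong[OF R, of "%v. v $ Inr (Some k)"] by (simp_all add: RR_def)
  moreover have "ios (vv y) = 0" using arg_cong[OF R, of "%v. v $ Inr None"] by (simp add: RR_def D_0)
  moreover have "k : K ==> ioal (vv y) k = 0" for k using \<open>SA 0 y k = 0\<close> by (simp add: SA_def D_0 cc_def)
  ultimately have "vv y = 0" by (intro io_injective)
  moreover have "ioal 0 k = 0" for k by (simp add: ioal_def)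
  ultimately show "y = 0" using \<open>!!k. SA 0 y k = 0\<close> by (intro vv_zero) (simp_all add: SA_def D_0)
 qed
 show "det (M' 0) ~= 0"
 proof (rule inj)
  fix y assume "M' 0 *v y = 0"
  hence R: "RR' 0 y = 0" by (simp add: M_RR c0)
  have R': "RR' (rv 0) y = 0" using R by (simp add: of_real_vec_def zero_vec_def)
  have z0: "rv 0 = (0 :: complex^'d)" by (simp add: of_real_vec_def zero_vec_def)
  have A: "ioal (vv y) k = 0" for k using arg_cong[OF R, of "%v. v $ Inr (Some k)"] by (simp add: RR'_def)
  have "DZ 0 (cnj_vec (vv y)) k = cnj (cc y k)" "DW 0 (cnj_vec (vv y)) = 0" for k
   using edge_conjugate[of 0 y] r R unfolding z0 by simp_all
  hence b: "iobt (vv y) k = cc y k" "ios (vv y) = 0" for k by (simp_all add: D_0 io_cnj)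
  have "cc y k = 0" for k
  proof (cases "k : K")
   case False
   hence "iobt (vv y) k = - ioal (vv y) k" by (simp add: ioal_def iobt_def)
   thus ?thesis using A[of k] b(1)[of k] by simp
  qed (simp add: cc_def)
  thus "y = 0" using A b by (intro vv_zero io_injective) simp_all
 qed
qed

end

section \<open>Analyticity of the frame\<close>

lemma real_analytic_scale:
 fixes h :: "real^'d::finite => 'b::real_normed_vector"
 assumes h: "real_analytic_on (ball 0 R) (%x. h (s .* x))" and s: "s > 0"
 shows "real_analytic_on (ball 0 (s * R)) h"
 unfolding real_analytic_on_def
proof
 fix a :: "real^'d" assume "a : ball 0 (s * R)"
 hence "norm a < s * R" by simp
 hence "inverse s .* a : ball 0 R" using s by (simp add: field_simps)
 then obtain r c where r: "r > 0" and c: "!!x. x : ball (inverse s .* a) r ==>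
  ((%al. (\<Prod>i\<in>UNIV. (x $ i - (inverse s .* a) $ i) ^ al i) .* c al) has_sum h (s .* x)) UNIV"
  using h unfolding real_analytic_on_def by blast
 have "((%al. (\<Prod>i\<in>UNIV. (y $ i - a $ i) ^ al i) .* ((\<Prod>i\<in>UNIV. inverse s ^ al i) .* c al)) has_sum h y) UNIV"
  if y: "y : ball a (s * r)" for y
 proof -
  have "norm (inverse s .* a - inverse s .* y) = inverse s * norm (a - y)"
   using s by (simp add: scaleR_diff_right[symmetric])
  also have "... < r" using y s by (simp add: dist_norm field_simps)
  finally have "inverse s .* y : ball (inverse s .* a) r" by (simp add: dist_norm)
  note c[OF this]
  moreover have "(\<Prod>i\<in>UNIV. ((inverse s .* y) $ i - (inverse s .* a) $ i) ^ al i) = (\<Prod>i\<in>UNIV. (y $ i - a $ i) ^ al i) * (\<Prod>i\<in>UNIV. inverse s ^ al i)" for al :: "'d => nat"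
   unfolding prod.distrib[symmetric] power_mult_distrib[symmetric]
   by (rule prod.cong) (simp_all add: right_diff_distrib[symmetric] mult.commute)
  ultimately show ?thesis using s by simp
 qed
 thus "EX r>0. EX c. ALL x:ball a r. ((%al. (\<Prod>i\<in>UNIV. (x $ i - a $ i) ^ al i) .* c al) has_sum h x) UNIV"
  using r s by (intro exI[of _ "s * r"] conjI exI[of _ "%al. (\<Prod>i\<in>UNIV. inverse s ^ al i) .* c al"]) auto
qed

lemma has_sum_sum: "finite I ==> (!!i. i : I ==> ((f i) has_sum s i) A) ==> ((%x. \<Sum>i\<in>I. f i x) has_sum (\<Sum>i\<in>I. s i)) A"
 for f :: "'i => 'x => 'b::{topological_comm_monoid_add}"
 by (induction I rule: finite_induct) (auto intro!: has_sum_add)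

lemma real_analytic_vec:
 fixes h :: "real^'d::finite => complex^'a::finite"
 assumes h: "!!k. real_analytic_on S (%x. h x $ k)"
 shows "real_analytic_on S h"
 unfolding real_analytic_on_def
proof
 fix a assume a: "a : S"
 let ?Q = "%k r c. r > 0 & (ALL x:ball a r. ((%al. (\<Prod>i\<in>UNIV. (x $ i - a $ i) ^ al i) .* c al) has_sum h x $ k) UNIV)"
 have "EX p. ?Q k (fst p) (snd p)" for k
  using h[of k] a unfolding real_analytic_on_def by force
 then obtain p where p: "!!k. ?Q k (fst (p k)) (snd (p k))" using choice[of "%k p. ?Q k (fst p) (snd p)"] by blast
 define r c where "r k = fst (p k)" and "c k = snd (p k)" for k
 have r: "!!k. r k > 0" and c: "!!k x. x : ball a (r k) ==> ((%al. (\<Prod>i\<in>UNIV. (x $ i - a $ i) ^ al i) .* c k al) has_sum h x $ k) UNIV"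
  using p unfolding r_def c_def by blast+
 define R where "R = Min (range r)"
 have R: "R > 0" "!!k. R <= r k" using r by (auto simp: R_def)
 have "((%al. (\<Prod>i\<in>UNIV. (x $ i - a $ i) ^ al i) .* (\<chi> k. c k al)) has_sum h x) UNIV" if x: "x : ball a R" for x
 proof -
  have "((%al. axis k ((\<Prod>i\<in>UNIV. (x $ i - a $ i) ^ al i) .* c k al)) has_sum (axis k (h x $ k) :: complex^'a)) UNIV" for k
   using has_sum_bounded_linear[OF bounded_linear_axis c[of x k]] x R(2)[of k] by auto
  hence "((%al. SU k. axis k ((\<Prod>i\<in>UNIV. (x $ i - a $ i) ^ al i) .* c k al)) has_sum (SU k. (axis k (h x $ k) :: complex^'a))) UNIV"
   by (intro has_sum_sum) auto
  moreover have "(\<chi> k. (\<Prod>i\<in>UNIV. (x $ i - a $ i) ^ al i) .* c k al) = (\<Prod>i\<in>UNIV. (x $ i - a $ i) ^ al i) .* (\<chi> k. c k al)" for al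
   by (simp add: vec_eq_iff)
  ultimately show ?thesis by (simp only: vec_lambda_axis[symmetric] vec_nth_inverse)
 qed
 thus "EX r>0. EX c. ALL x:ball a r. ((%al. (\<Prod>i\<in>UNIV. (x $ i - a $ i) ^ al i) .* c al) has_sum h x) UNIV"
  using R(1) by (intro exI[of _ R] conjI exI[of _ "%al. \<chi> k. c k al"] ballI)
qed

text \<open>A function on the edge of a wedge which extends to the wedge, and whose conjugate extends to
 the same wedge, is analytic: the reflected extension lives on the opposite wedge.\<close>

lemma edge_of_the_wedge_reflected:
 fixes h k :: "complex^'d::finite => complex"
 assumes R: "R > 0" and h: "hol_side (ball 0 R) {v : ball 0 R. ALL i. Im (v $ i) > 0} h"
  and k: "hol_side (ball 0 R) {v : ball 0 R. ALL i. Im (v $ i) > 0} k"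
  and edge: "!!a. rv a : ball 0 R ==> h (rv a) = cnj (k (rv a))"
 shows "real_analytic_on (ball 0 (R / (24 * CARD('d)))) (%a. h (rv a))"
proof -
 define s where "s = R / (6 * CARD('d))"
 have s: "s > 0" using R by (simp add: s_def)
 have sb: "s .* x : ball 0 R" if "x : tube 6" for x :: "complex^'d"
 proof -
  have "norm x <= (SU i. norm (x $ i))" unfolding norm_vec_def by (rule L2_set_le_sum) simp
  also have "... < (\<Sum>i\<in>(UNIV::'d set). 6)" using that by (intro sum_strict_mono) (auto simp: tube_def polydisc_def)
  finally show ?thesis using s R by (simp add: s_def field_simps)
 qed
 define m where "m x = cnj (k (cnj_vec x))" for x
 define F where "F x = (if ALL i. Im (x $ i) < 0 then m (s .* x) else h (s .* x))" for x :: "complex^'d"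
 have ch: "continuous_on (ball 0 R) h" "continuous_on (ball 0 R) k"
  using h k smooth_cont by (auto simp: hol_side_def)
 have nc: "norm (cnj_vec x) = norm x" for x :: "complex^'d" by (simp add: norm_vec_def cnj_vec_def)
 have cm: "continuous_on (ball 0 R) m" unfolding m_def
  by (intro continuous_intros continuous_on_compose2[OF ch(2)] linear_continuous_on[OF bounded_linear_cnj_vec]) (auto simp: nc)
 have cs: "continuous_on (tube 6) (%x. h (s .* x))" "continuous_on (tube 6) (%x. m (s .* x))"
  by (intro continuous_intros continuous_on_compose2[OF ch(1)] continuous_on_compose2[OF cm]; use sb in blast)+
 have real: "x = rv (\<chi> i. Re (x $ i))" if "ALL i. Im (x $ i) = 0" for x :: "complex^'d"
  using that by (simp add: vec_eq_iff of_real_vec_def complex_eq_iff)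
 interpret wedge_function F
 proof
  define A :: "(complex^'d) set" where "A = {x : tube 6. ALL i. Im (x $ i) <= 0}"
  define D :: "(complex^'d) set" where "D = {x : tube 6. ALL i. Im (x $ i) >= 0}"
  have AD: "tube 6 = A \<union> D" unfolding A_def D_def tube_def by (auto simp: less_imp_le)
  have cl: "closed {x :: complex^'d. ALL i. Im (x $ i) <= 0}" "closed {x :: complex^'d. ALL i. Im (x $ i) >= 0}"
   by (intro closed_Collect_all closed_Collect_le continuous_intros)+
  have "A = tube 6 \<inter> {x. ALL i. Im (x $ i) <= 0}" "D = tube 6 \<inter> {x. ALL i. Im (x $ i) >= 0}" by (auto simp: A_def D_def)
  hence "closedin (top_of_set (tube 6)) A" "closedin (top_of_set (tube 6)) D"
   using cl closedin_closed_Int by metis+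
  thus "continuous_on (tube 6) F" unfolding F_def unfolding AD
  proof (rule continuous_on_cases_local)
   show "continuous_on A (%x. m (s .* x))" "continuous_on D (%x. h (s .* x))"
    using cs AD continuous_on_subset by blast+
   fix x assume "x : A & \<not> (ALL i. Im (x $ i) < 0) | x : D & (ALL i. Im (x $ i) < 0)"
   hence x: "x : tube 6" "ALL i. Im (x $ i) = 0"
    unfolding A_def D_def tube_def by (auto simp: not_less) (smt (verit))+
   have "ALL i. Im ((s .* x) $ i) = 0" using x(2) by simp
   from real[OF this] obtain a where a: "s .* x = rv a" by blast
   have "cnj_vec (s .* x) = s .* x" using x(2) by (simp add: cnj_vec_def vec_eq_iff complex_eq_iff)
   thus "m (s .* x) = h (s .* x)" using edge[of a] sb[OF x(1)] by (simp add: m_def a)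
  qed
  fix x :: "complex^'d" assume x: "x : tube 6" and nz: "!!i. Im (x $ i) ~= 0"
  have lin: "cholo (%x :: complex^'d. s .* x) x"
   by (rule cholo_linear[OF bounded_linear_scaleR_right]) (simp add: imul_scaleR)
  have o: "open {x :: complex^'d. ALL i. Im (x $ i) < 0}" "open {x :: complex^'d. ALL i. Im (x $ i) > 0}"
  proof -
   have "{x :: complex^'d. ALL i. Im (x $ i) < 0} = (\<Inter>i. {x. Im (x $ i) < 0})" "{x :: complex^'d. ALL i. Im (x $ i) > 0} = (\<Inter>i. {x. Im (x $ i) > 0})" by auto
   thus "open {x :: complex^'d. ALL i. Im (x $ i) < 0}" "open {x :: complex^'d. ALL i. Im (x $ i) > 0}"
    by (simp_all add: open_INT open_Collect_less continuous_intros)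
  qed
  consider "ALL i. Im (x $ i) < 0" | "ALL i. Im (x $ i) > 0" using x nz by (auto simp: tube_def)
  thus "cholo F x"
  proof cases
   case 1
   have "Im (cnj_vec (s .* x) $ i) > 0" for i using 1 s by (simp add: cnj_vec_def mult_pos_neg)
   moreover have "cnj_vec (s .* x) : ball 0 R" using sb[OF x] by (simp only: mem_ball_0 nc)
   ultimately have "cnj_vec (s .* x) : {v : ball 0 R. ALL i. Im (v $ i) > 0}" by blast
   hence "cholo m (s .* x)" unfolding m_def[abs_def] using k by (intro cholo_reflect) (auto simp: hol_side_def)
   hence "cholo (%x. m (s .* x)) x" by (rule cholo_compose[OF lin])
   thus ?thesis using cholo_cong[OF o(1), of x F "%x. m (s .* x)"] 1 by (simp add: F_def)
  next
   case 2
   have "s .* x : {v : ball 0 R. ALL i. Im (v $ i) > 0}" using sb[OF x] 2 s by simp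
   hence "cholo (%x. h (s .* x)) x" using h by (intro cholo_compose[OF lin]) (auto simp: hol_side_def)
   moreover have "F y = h (s .* y)" if "ALL i. Im (y $ i) > 0" for y using that by (auto simp: F_def dest: spec) (metis less_asym)
   ultimately show ?thesis using cholo_cong[OF o(2), of x F "%x. h (s .* x)"] 2 by simp
  qed
 qed
 have "F (rv a) = h (rv (s .* a))" for a
 proof -
  have "s .* rv a = (rv (s .* a) :: complex^'d)" by (simp add: of_real_vec_def vec_eq_iff complex_eq_iff)
  thus ?thesis by (simp add: F_def) (simp add: of_real_vec_def)
 qed
 hence "real_analytic_on (ball 0 (1/4)) (%a :: real^'d. h (rv (s .* a)))" using real_analytic by simp
 from real_analytic_scale[OF this s] show ?thesis by (simp add: s_def field_simps)
qed

lemma hol_side_subset: "hol_side W P a ==> W' <= W ==> P' <= P ==> hol_side W' P' a"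
 unfolding hol_side_def using smooth_on_subset by blast

context slice_param
begin

definition ext :: "complex^'d => complex^'d => complex^('n + 'n option)" where
 "ext x v = (\<chi> q. case q of Inl k => if k : K then v $ lc (CY k) else v $ lc (CT k)
  | Inr None => v $ lc CS | Inr (Some k) => if k : K then v $ lc (CX k) else DZ x v k)"

lemma vv_ext: "vv (ext x v) = v"
 by (rule vec_eq_labels) (simp_all add: vv_lc ext_def)

definition in_kernel :: "complex^'d => complex^'d => bool" where
 "in_kernel x v \<longleftrightarrow> (ALL k:K. DZ x v k = 0) & DW x v = 0"

lemma RR_ext: "in_kernel x v ==> RR x (ext x v) = (\<chi> q. case q of Inl k => iobt v k | Inr _ => 0)"
 unfolding vec_eq_iff
 by (intro allI, rename_tac q, case_tac q rule: index_cases) (auto simp: RR_def vv_ext SA_def cc_def in_kernel_def, simp_all add: ext_def)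

lemma in_kernel_RR: "(!!p. RR x y $ Inr p = 0) ==> in_kernel x (vv y)"
proof -
 assume a: "!!p. RR x y $ Inr p = 0"
 show ?thesis using a[of None] a[of "Some _"] by (auto simp: in_kernel_def RR_def SA_def cc_def)
qed

text \<open>The frame consists of the solutions of RR normalized on the components of type (0,1). By Cramer's rule it is
  holomorphic in the wedge, where the determinant is nonzero near the origin. On the edge its
  conjugate is the normalized solution of RR', so that the reflection principle applies to each
  component.\<close>

theorem analytic_frame:
 obtains R v where "R > 0" "R <= r" "!!m. real_analytic_on (ball 0 R) (v m)" "!!m. smooth_on (ball 0 R) (v m)"
  "!!a m. a : ball 0 R ==> in_kernel (rv a) (v m a)"
  "!!a m k. a : ball 0 R ==> iobt (v m a) k = (if k = m then 1 else 0)"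
  "!!a x. a : ball 0 R ==> in_kernel (rv a) x ==> x = (SU m. iobt x m *s v m a)"
proof -
 have sd: "smooth_on (ball 0 r) (%x. det (M x) * det (M' x))"
  using hol_side_det[OF open_ball hol_M(1)] hol_side_det[OF open_ball hol_M(2)]
  by (intro smooth_on_mult open_ball) (auto simp: hol_side_def)
 define S where "S = {x : ball 0 r. det (M x) * det (M' x) ~= 0}"
 have "open S"
 proof -
  have "S = ball 0 r \<inter> (%x. det (M x) * det (M' x)) -` (- {0})" by (auto simp: S_def)
  thus ?thesis using continuous_open_preimage[OF smooth_cont[OF sd] open_ball, of "- {0}"] by auto
 qed
 moreover have "0 : S" using det_M_0 r by (simp add: S_def)
 ultimately obtain R0 where R0: "R0 > 0" "ball 0 R0 <= S" using open_contains_ball by blast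
 have R0r: "ball 0 R0 <= ball (0 :: complex^'d) r" using R0(2) by (auto simp: S_def)
 define P0 :: "(complex^'d) set" where "P0 = {v : ball 0 R0. ALL i. Im (v $ i) > 0}"
 have P0: "P0 <= Pw" "P0 <= ball 0 R0" using R0r by (auto simp: P0_def Pw_def)
 have sol: "EX s. (ALL q. hol_side (ball 0 R0) P0 (%x. s x $ q)) & (ALL x:ball 0 R0. M x *v s x = b)"
  "EX s. (ALL q. hol_side (ball 0 R0) P0 (%x. s x $ q)) & (ALL x:ball 0 R0. M' x *v s x = b)" for b
 proof -
  have nz: "det (M x) ~= 0" "det (M' x) ~= 0" if "x : ball 0 R0" for x using R0(2) that by (auto simp: S_def)
  show "EX s. (ALL q. hol_side (ball 0 R0) P0 (%x. s x $ q)) & (ALL x:ball 0 R0. M x *v s x = b)"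
   by (rule hol_side_solve[OF open_ball hol_side_subset[OF hol_M(1) R0r P0(1)] nz(1) P0(2), of b]) blast+
  show "EX s. (ALL q. hol_side (ball 0 R0) P0 (%x. s x $ q)) & (ALL x:ball 0 R0. M' x *v s x = b)"
   by (rule hol_side_solve[OF open_ball hol_side_subset[OF hol_M(2) R0r P0(1)] nz(2) P0(2), of b]) blast+
 qed
 from sol(1)[of "axis (Inl _) 1"] obtain s where s: "!!m q. hol_side (ball 0 R0) P0 (%x. s m x $ q)" "!!m x. x : ball 0 R0 ==> M x *v s m x = axis (Inl m) 1"
  by metis
 from sol(2)[of "axis (Inr (Some _)) 1"] obtain s' where s': "!!m q. hol_side (ball 0 R0) P0 (%x. s' m x $ q)" "!!m x. x : ball 0 R0 ==> M' x *v s' m x = axis (Inr (Some m)) 1"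
  by metis
 have hv: "hol_side (ball 0 R0) P0 (%x. vv (s m x) $ ka)" "hol_side (ball 0 R0) P0 (%x. vv (s' m x) $ ka)" for m ka
  by (cases "lab ka"; simp add: vv_def s s')+
 have fc: "cholo f (rv a)" if "rv a : ball 0 R0" for a
 proof -
  have "rv a : ball 0 r" using that R0r by blast
  from fhol[OF this] show ?thesis by (simp add: of_real_vec_def)
 qed
 have uniq: "y = y'" if "rv a : ball 0 R0" "RR (rv a) y = RR (rv a) y'" for a y y'
 proof -
  have "M (rv a) *v y = M (rv a) *v y'" using that M_RR(1)[OF fc] by simp
  moreover have "invertible (M (rv a))" using R0(2) that(1) by (auto simp: S_def invertible_det_nz)
  ultimately show ?thesis by (meson inj_eq invertible_eq_bij bij_is_inj inj_matrix_vector_mult)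
 qed
 have edge: "vv (s m (rv a)) = cnj_vec (vv (s' m (rv a)))" if a: "rv a : ball 0 R0" for a m
 proof -
  let ?x = "rv a :: complex^'d" and ?y = "s' m (rv a)"
  let ?v = "cnj_vec (vv ?y)"
  have ar: "?x : ball 0 r" using a R0r by blast
  have R': "RR' ?x ?y = axis (Inr (Some m)) 1" using s'(2)[OF a, of m] M_RR(2)[OF fc[OF a]] by simp
  have E: "DZ ?x ?v k = cnj (cc ?y k)" "DW ?x ?v = 0" for k
   by (rule edge_conjugate[OF ar]; simp add: R' axis_def)+
  have iv: "in_kernel ?x ?v" using E by (simp add: in_kernel_def cc_def)
  have "ioal (vv ?y) k = RR' ?x ?y $ Inr (Some k)" for k by (simp add: RR'_def)
  hence "iobt ?v k = (if k = m then 1 else 0)" for k by (simp add: io_cnj R' axis_def)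
  hence "RR ?x (ext ?x ?v) = axis (Inl m) 1" unfolding RR_ext[OF iv] by (auto simp: vec_eq_iff axis_def split: sum.split)
  also have "... = RR ?x (s m ?x)" using s(2)[OF a, of m] M_RR(1)[OF fc[OF a]] by simp
  finally have "ext ?x ?v = s m ?x" by (rule uniq[OF a])
  thus ?thesis using vv_ext by metis
 qed
 define R where "R = R0 / (24 * CARD('d))"
 have R: "R > 0" "R <= R0"
 proof -
  have "real CARD('d) >= 1" using zero_less_card_finite[where 'a='d] by linarith
  hence "1 <= 24 * real CARD('d)" by linarith
  thus "R > 0" "R <= R0" using R0(1) by (auto simp only: R_def divide_le_eq) (simp_all add: divide_le_eq)
 qed
 have R0r': "R0 <= r"
 proof -
  have "CARD('d) > 0" by simp
  show ?thesis using R0r R0(1) r by (simp add: ball_subset_ball_iff)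
 qed
 have nr: "norm (rv a :: complex^'d) = norm a" for a :: "real^'d" by (simp add: norm_vec_def of_real_vec_def)
 have aR: "rv a : (ball 0 R0 :: (complex^'d) set)" if "a : ball 0 R" for a using that R(2) by (simp add: nr)
 define v where "v m a = vv (s m (rv a))" for m a
 show ?thesis
 proof (rule that[of R v])
  show "R > 0" "R <= r" using R R0r' by auto
  fix m
  show "real_analytic_on (ball 0 R) (v m)" unfolding v_def R_def
  proof (rule real_analytic_vec)
   fix ka
   have "vv (s m (rv a)) $ ka = cnj (vv (s' m (rv a)) $ ka)" if "rv a : ball 0 R0" for a
    using edge[OF that, of m] by (simp add: cnj_vec_def)
   thus "real_analytic_on (ball 0 (R0 / (24 * CARD('d)))) (%a. vv (s m (rv a)) $ ka)"
    by (rule edge_of_the_wedge_reflected[OF R0(1) hv(1)[unfolded P0_def] hv(2)[unfolded P0_def]])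
  qed
  have sv: "smooth_on (ball 0 R) (%a. vv (s m (rv a)) $ ka)" for ka
   by (rule smooth_on_compose[OF _ smooth_on_linear[OF bounded_linear_of_real_vec] open_ball open_ball aR]) (use hv in \<open>auto simp: hol_side_def\<close>)
  have "smooth_on (ball 0 R) (%a. \<chi> ka. vv (s m (rv a)) $ ka)" by (intro smooth_on_vec_lambda open_ball sv)
  thus "smooth_on (ball 0 R) (v m)" by (simp add: v_def[abs_def])
 next
  fix a :: "real^'d" and m assume a: "a : ball 0 R"
  have RRs: "RR (rv a) (s m (rv a)) = axis (Inl m) 1" for m
   using s(2)[OF aR[OF a]] M_RR(1)[OF fc[OF aR[OF a]]] by simp
  show "in_kernel (rv a) (v m a)" unfolding v_def by (rule in_kernel_RR) (simp add: RRs axis_def)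
  have "iobt (v m a) k = RR (rv a) (s m (rv a)) $ Inl k" for m k by (simp add: v_def RR_def)
  thus b: "iobt (v m a) k = (if k = m then 1 else 0)" for k m by (simp add: RRs axis_def)
  fix x assume x: "in_kernel (rv a) x"
  have c: "cholo f (rv a)" by (rule fc[OF aR[OF a]])
  have mv: "N *v (SU m. b m *s y m) = (SU m. b m *s (N *v y m))"
   for N :: "complex^('n + 'n option)^('n + 'n option)" and b :: "'n => complex" and y
   unfolding vec_eq_iff by (simp add: matrix_vector_mult_def sum_component sum_distrib_left) (subst sum.swap, simp add: mult_ac)
  have "RR (rv a) (SU m. iobt x m *s s m (rv a)) = (SU m. iobt x m *s axis (Inl m) 1)"
   unfolding M_RR(1)[OF c, symmetric] using s(2)[OF aR[OF a]]
   by (simp add: mv)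
  also have "... = RR (rv a) (ext (rv a) x)" unfolding RR_ext[OF x]
   by (auto simp: vec_eq_iff sum_component axis_def if_distrib[of "%x. _ * x"] split: sum.split cong: if_cong)
  finally have "(SU m. iobt x m *s s m (rv a)) = ext (rv a) x" by (rule uniq[OF aR[OF a]])
  hence "x = vv (SU m. iobt x m *s s m (rv a))" by (simp add: vv_ext)
  also have "... = (SU m. iobt x m *s v m a)"
  proof -
   have "vv (\<Sum>m\<in>I. iobt x m *s s m (rv a)) = (\<Sum>m\<in>I. iobt x m *s vv (s m (rv a)))" if "finite I" for I
    using that
   proof induction
    case empty
    show ?case using linear_parts(2)[of 0 0] by simp
   qed (simp add: linear_parts)
   thus ?thesis by (simp add: v_def)
  qed
  finally show "x = (SU m. iobt x m *s v m a)" .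
 qed
qed

end

section \<open>Transport of a structure by a chart\<close>

lemma pairing_linear: "pairing wm (a + b) = pairing wm a + pairing wm b" "pairing wm (c *s a) = c * pairing wm a"
 "pairing (wm + et) a = pairing wm a + pairing et a" "pairing (c *s wm) a = c * pairing wm a" "pairing wm 0 = 0" "pairing 0 a = 0"
 by (simp_all add: pairing_def algebra_simps sum.distrib sum_distrib_left)

lemma pairing_span: "(!!wm. wm : S ==> pairing wm v = 0) ==> wm : vec.span S ==> pairing wm v = 0"
 by (rule vec.span_induct[where P="%wm. pairing wm v = 0" and S=S]) (auto simp: vec.subspace_def pairing_linear)

text \<open>The orthogonal complement of S with respect to the Hermitian product consists of conjugates of annihilating vectors.\<close>

lemma double_annihilator:
 fixes S :: "(complex^'d::finite) set"
 assumes S: "vec.subspace S" and wm: "!!v. (!!s. s : S ==> pairing s v = 0) ==> pairing wm v = 0"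
 shows "wm : S"
proof -
 have "subspace S"
  using S by (auto simp: vec.subspace_def subspace_def scaleR_vec_scale)
 hence sp: "span S = S" by (simp only: span_eq_iff)
 obtain y z where y: "y : S" and z: "!!s. s : S ==> orthogonal z s" and yz: "wm = y + z"
  using orthogonal_subspace_decomp_exists[of S wm] unfolding sp by blast
 have re: "z \<bullet> s = Re (pairing s (cnj_vec z))" for s
  by (simp add: inner_vec_def pairing_def cnj_vec_def inner_complex_def algebra_simps)
 have p0: "pairing s (cnj_vec z) = 0" if "s : S" for s
 proof -
  have "\<i> *s s : S" using S that by (simp add: vec.subspace_def)
  hence "Re (pairing (\<i> *s s) (cnj_vec z)) = 0" "Re (pairing s (cnj_vec z)) = 0"
   using z[of "\<i> *s s"] z[OF that] by (simp_all add: re[symmetric] orthogonal_def)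
  thus ?thesis by (simp add: pairing_linear complex_eq_iff)
 qed
 from wm[OF p0] have "pairing y (cnj_vec z) + pairing z (cnj_vec z) = 0" unfolding yz by (simp add: pairing_linear)
 hence "z \<bullet> z = 0" using p0[OF y] by (simp add: re)
 thus ?thesis using y yz by simp
qed

lemma FD_partial: "h differentiable (at x) ==> FD h x w = (SU k. w $ k .* partial k h x)" for h :: "real^'d::finite => 'b::real_normed_vector"
proof -
 assume "h differentiable (at x)"
 then interpret linear "FD h x" by (rule bounded_linear.linear[OF FD_linear])
 have "w = (SU k. w $ k .* axis k 1)" by (simp add: vec_eq_iff axis_def sum_component if_distrib cong: if_cong)
 hence "FD h x w = (SU k. FD h x (w $ k .* axis k 1))" by (metis sum)
 thus ?thesis by (simp add: scale partial_def)
qed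

lemma partial_compose:
 fixes g :: "real^'d::finite => real^'d" and h :: "real^'d => 'b::real_normed_vector"
 assumes "g differentiable (at x)" "h differentiable (at (g x))"
 shows "partial i (%x. h (g x)) x = (SU k. partial i g x $ k .* partial k h (g x))"
 unfolding partial_def[of i "%x. h (g x)"] FD_compose[OF assms] FD_partial[OF assms(2)] by (simp add: partial_def)

lemma cdiff_compose:
 fixes g h :: "real^'d::finite => real^'d"
 assumes "g differentiable (at x)" "h differentiable (at (g x))"
 shows "cdiff (%x. h (g x)) x v = cdiff h (g x) (cdiff g x v)"
 unfolding vec_eq_iff cdiff_def partial_compose[OF assms]
 by (simp add: sum_component sum_distrib_left sum_distrib_right mult_ac) (intro allI sum.swap)

lemma pairing_cdiff:
 fixes g :: "real^'d::finite => real^'d" and h :: "real^'d => complex"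
 assumes "g differentiable (at x)" "h differentiable (at (g x))"
 shows "pairing (differential h (g x)) (cdiff g x v) = pairing (differential (%x. h (g x)) x) v"
 unfolding pairing_def cdiff_def differential_def
 by (simp add: partial_compose[OF assms] sum_component sum_distrib_left sum_distrib_right scaleR_conv_of_real mult_ac) (rule sum.swap)

lemma cdiff_cong: "open S ==> x : S ==> (!!y. y : S ==> g y = h y) ==> cdiff g x = cdiff h x"
 unfolding cdiff_def partial_def using FD_cong[of S x g h] by simp

lemma cdiff_id: "cdiff (%x. x) x v = v"
proof -
 have "FD (%x::real^'a. x) x = (%v. v)" by (rule FD_eq[OF has_derivative_ident])
 hence "partial i (%x. x) x = axis i 1" for i by (simp add: partial_def)
 thus ?thesis by (simp add: cdiff_def vec_eq_iff axis_def if_distrib[of "%x. _ * x"] if_distrib[of of_real] cong: if_cong)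
qed

text \<open>The inverse function theorem in the smooth category: by Cramer's rule the derivative of the
 inverse is a smooth function of the inverse.\<close>

lemma smooth_inverse:
 fixes Tt :: "real^'d::finite => real^'d"
 assumes S: "open S" "x0 : S" and sm: "smooth_on S Tt" and inj: "!!v. FD Tt x0 v = 0 ==> v = 0"
 obtains U' V' g where "open U'" "x0 : U'" "U' <= S" "open V'" "homeomorphism U' V' Tt g" "smooth_on V' g"
proof -
 define A where "A x = (\<chi> j i. partial i Tt x $ j)" for x
 have AF: "A x *v w = FD Tt x w" if "x : S" for x w
  unfolding FD_partial[OF smooth_diff[OF sm that]] by (simp add: A_def matrix_vector_mult_def vec_eq_iff sum_component mult.commute)
 have sA: "smooth_on S (%x. A x $ i $ j)" for i j
  unfolding A_def partial_def by simp (intro smooths S smooth_on_FD[OF sm])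
 have sdet: "smooth_on S (%x. det (M x))" if "!!i j. smooth_on S (%x. M x $ i $ j)" for M :: "real^'d => real^'d^'d"
  unfolding det_def by (intro smooths S that)
 define S0 where "S0 = {x : S. det (A x) ~= 0}"
 have oS0: "open S0"
 proof -
  have "S0 = S \<inter> (%x. det (A x)) -` (- {0})" by (auto simp: S0_def)
  thus ?thesis using continuous_open_preimage[OF smooth_cont[OF sdet[OF sA]] S(1), of "- {0}"] by auto
 qed
 have x0: "x0 : S0"
 proof -
  have "v = 0" if "A x0 *v v = 0" for v using that inj AF[OF S(2)] by simp
  hence "invertible (A x0)" using matrix_left_invertible_ker[of "A x0"] by (simp add: invertible_left_inverse)
  thus ?thesis using S(2) by (simp add: S0_def invertible_det_nz)
 qed
 have S0S: "S0 <= S" by (auto simp: S0_def)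
 have d: "(Tt has_derivative blinfun_apply (FDL Tt x)) (at x)" if "x : S0" for x
  using FDL_has_derivative[OF smooth_diff[OF sm]] that S0S by blast
 have ap: "blinfun_apply (FDL Tt x) = (*v) (A x)" if "x : S0" for x
  using FDL_apply[OF smooth_diff[OF sm], of x] AF[of x] that S0S by (auto simp: fun_eq_iff)
 have cF: "continuous_on S0 (FDL Tt)"
  by (rule continuous_on_subset[OF smooth_cont[OF smooth_on_FDL[OF S(1) sm]] S0S])
 obtain N where N: "N ** A x0 = mat 1" using x0 by (auto simp: S0_def invertible_det_nz[symmetric] invertible_def)
 have inv: "Blinfun ((*v) N) o\<^sub>L FDL Tt x0 = id_blinfun"
 proof (rule blinfun_eqI)
  fix v
  have "N *v (A x0 *v v) = v" by (simp add: matrix_vector_mul_assoc N)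
  thus "(Blinfun ((*v) N) o\<^sub>L FDL Tt x0) v = id_blinfun v"
   using ap[OF x0] by (simp add: bounded_linear_Blinfun_apply[OF matrix_vector_mul_bounded_linear])
 qed
 have "EX U' V' g g'. open U' & U' <= S0 & x0 : U' & open V' & homeomorphism U' V' Tt g &
  (ALL y:V'. (g has_derivative g' y) (at y) & g' y = inv (blinfun_apply (FDL Tt (g y))) & bij (blinfun_apply (FDL Tt (g y))))"
 proof (rule inverse_function_theorem[OF oS0 d cF x0 inv])
  fix U' V' g and g' :: "real^'d => real^'d => real^'d"
  assume a: "open U'" "U' <= S0" "x0 : U'" "open V'" "homeomorphism U' V' Tt g" "!!y. y : V' ==> (g has_derivative g' y) (at y)"
   "!!y. y : V' ==> g' y = inv (blinfun_apply (FDL Tt (g y)))" "!!y. y : V' ==> bij (blinfun_apply (FDL Tt (g y)))"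
  show ?thesis
   by (rule exI[of _ U'], rule exI[of _ V'], rule exI[of _ g], rule exI[of _ g']) (use a in blast)
 qed
 then obtain U' V' g g' where "open U' & U' <= S0 & x0 : U' & open V' & homeomorphism U' V' Tt g &
  (ALL y:V'. (g has_derivative g' y) (at y) & g' y = inv (blinfun_apply (FDL Tt (g y))) & bij (blinfun_apply (FDL Tt (g y))))" by blast
 hence UV: "open U'" "U' <= S0" "x0 : U'" "open V'" "homeomorphism U' V' Tt g"
  and dg: "!!y. y : V' ==> (g has_derivative g' y) (at y)" "!!y. y : V' ==> g' y = inv (blinfun_apply (FDL Tt (g y)))"
  "!!y. y : V' ==> bij (blinfun_apply (FDL Tt (g y)))" by blast+
 have gS: "g y : S0" if "y : V'" for y using UV(2,5) that by (auto simp: homeomorphism_def)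
 define s where "s v x = (\<chi> k. det (\<chi> i j. if j = k then v $ i else A x $ i $ j) / det (A x))" for v x
 have ss: "smooth_on S0 (s v)" for v
 proof -
  have "smooth_on S0 (%x. det (\<chi> i j. if j = k then v $ i else A x $ i $ j))" for k
  proof (rule smooth_on_subset[OF _ S0S], rule sdet)
   show "smooth_on S (%x. (\<chi> i j. if j = k then v $ i else A x $ i $ j) $ i $ j)" for i j
    using sA[of i j] by (cases "j = k") (simp_all add: smooth_on_const)
  qed
  thus ?thesis unfolding s_def[abs_def]
   by (intro smooth_on_vec_lambda smooth_on_divide oS0 smooth_on_subset[OF sdet[OF sA] S0S]) (auto simp: S0_def)
 qed
 have FDg: "FD g y v = s v (g y)" if y: "y : V'" for y v
 proof -
  have "FDL Tt (g y) (FD g y v) = v"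
   using FD_eq[OF dg(1)[OF y]] dg(2)[OF y] bij_inv_eq_iff[OF dg(3)[OF y]] by metis
  hence "A (g y) *v (FD g y v) = v" using ap[OF gS[OF y]] by simp
  thus ?thesis using cramer[of "A (g y)" "FD g y v" v] gS[OF y] by (simp add: s_def S0_def)
 qed
 have "hdiff k V' g" for k
 proof (induction k)
  case 0 show ?case using UV(5) by (simp add: homeomorphism_def)
 next
  case (Suc k)
  have "hdiff k V' (%y. s v (g y))" for v
   by (rule hdiff_compose[OF UV(4) oS0 gS Suc]) (use ss in \<open>auto simp: smooth_on_def\<close>)
  hence "hdiff k V' (%y. FD g y v)" for v
   by (subst hdiff_cong[OF UV(4) FDg])
  thus ?case using dg(1) by (auto simp: differentiable_def)
 qed
 thus ?thesis using that[OF UV(1,3) _ UV(4,5)] UV(2) S0S by (auto simp: smooth_on_def)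
qed

lemma real_analytic_ident: assumes "open S" shows "real_analytic_on S (%x :: real^'d::finite. x)"
 unfolding real_analytic_on_def
proof
 fix a :: "real^'d"
 define dl where "dl k = (%i. if i = k then 1 else 0 :: nat)" for k :: 'd
 define c :: "('d => nat) => real^'d" where "c al = (if al = (%_. 0) then a else if EX k. al = dl k then axis (THE k. al = dl k) 1 else 0)" for al
 have inj: "dl k = dl l \<longleftrightarrow> k = l" for k l by (auto simp: dl_def fun_eq_iff split: if_splits)
 have nz: "dl k ~= (%_. 0)" for k by (auto simp: dl_def fun_eq_iff)
 have cdl: "c (dl k) = axis k 1" for k using nz by (auto simp: c_def inj)
 have "((%al. (\<Prod>i\<in>UNIV. (x $ i - a $ i) ^ al i) .* c al) has_sum x) UNIV" for x
 proof -
  let ?F = "%al. (\<Prod>i\<in>UNIV. (x $ i - a $ i) ^ al i) .* c al"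
  let ?I = "insert (%_. 0) (range dl)"
  have "(?F has_sum sum ?F ?I) ?I" by (rule has_sum_finite) simp
  moreover have "sum ?F ?I = x"
  proof -
   have "(\<Prod>i\<in>UNIV. (x $ i - a $ i) ^ dl k i) = x $ k - a $ k" for k
   proof -
    have "(\<Prod>i\<in>UNIV. (x $ i - a $ i) ^ dl k i) = (\<Prod>i\<in>UNIV. if i = k then x $ k - a $ k else 1)"
     by (rule prod.cong) (auto simp: dl_def)
    thus ?thesis by simp
   qed
   hence "sum ?F (range dl) = (SU k. (x $ k - a $ k) .* axis k 1)"
    by (subst sum.reindex) (auto simp: cdl inj inj_on_def)
   also have "... = x - a" by (simp add: vec_eq_iff axis_def sum_component if_distrib cong: if_cong)
   finally show ?thesis using nz nz[symmetric] by (subst sum.insert) (auto simp: c_def)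
  qed
  moreover have "?F al = 0" if "al ~: ?I" for al using that by (auto simp: c_def)
  ultimately show ?thesis using has_sum_cong_neutral[of UNIV ?I ?F ?F x] by auto
 qed
 thus "EX r>0. EX c. ALL x:ball a r. ((%al. (\<Prod>i\<in>UNIV. (x $ i - a $ i) ^ al i) .* c al) has_sum x) UNIV"
  by (intro exI[of _ "1::real"] conjI exI[of _ c] ballI) simp_all
qed

lemma real_analytic_cong:
 assumes "open S" "!!x. x : S ==> g x = h x" "real_analytic_on S h" shows "real_analytic_on S g"
 unfolding real_analytic_on_def
proof
 fix a assume a: "a : S"
 obtain r c where r: "r > 0" "!!x. x : ball a r ==> ((%al. (\<Prod>i\<in>UNIV. (x $ i - a $ i) ^ al i) .* c al) has_sum h x) UNIV"
  using assms(3) a unfolding real_analytic_on_def by blast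
 obtain d where d: "d > 0" "ball a d <= S" using assms(1) a open_contains_ball by blast
 show "EX r>0. EX c. ALL x:ball a r. ((%al. (\<Prod>i\<in>UNIV. (x $ i - a $ i) ^ al i) .* c al) has_sum g x) UNIV"
  using r d assms(2) by (intro exI[of _ "min r d"] conjI exI[of _ c]) auto
qed

text \<open>A family of subspaces which is locally the common kernel of exact forms is involutive, and
 its annihilator is spanned by these forms.\<close>

definition exact_kernel :: "(real^'d) set => 'd::finite fibres => bool" where
 "exact_kernel Om V \<longleftrightarrow> (ALL x:Om. EX W k Z. open W & x : W & W <= Om & (ALL j<k. smooth_on W (Z j)) &
  (ALL y:W. V y = {v. ALL j<(k::nat). pairing (differential (Z j) y) v = 0}))"

lemma exact_kernel_locally_exact:
 assumes "exact_kernel Om V" shows "locally_exact Om (annihilator V)"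
 unfolding locally_exact_def
proof
 fix x assume x: "x : Om"
 from bspec[OF assms[unfolded exact_kernel_def] x]
 obtain W k Z where "open W & x : W & W <= Om & (ALL j<k. smooth_on W (Z j)) &
  (ALL y:W. V y = {v. ALL j<(k::nat). pairing (differential (Z j) y) v = 0})" by blast
 hence W: "open W" "x : W" "W <= Om" "!!j. j < k ==> smooth_on W (Z j)"
  "!!y. y : W ==> V y = {v. ALL j<(k::nat). pairing (differential (Z j) y) v = 0}" by blast+
 have ann: "annihilator V y = vec.span ((%j. differential (Z j) y) ` {..<k})" if y: "y : W" for y
 proof
  show "vec.span ((%j. differential (Z j) y) ` {..<k}) <= annihilator V y"
   using W(5)[OF y] by (auto simp: annihilator_def intro: pairing_span[rotated])
  show "annihilator V y <= vec.span ((%j. differential (Z j) y) ` {..<k})"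
  proof
   fix wm assume wm: "wm : annihilator V y"
   show "wm : vec.span ((%j. differential (Z j) y) ` {..<k})"
   proof (rule double_annihilator[OF vec.subspace_span])
    fix v assume "!!s. s : vec.span ((%j. differential (Z j) y) ` {..<k}) ==> pairing s v = 0"
    hence "!!j. j < k ==> pairing (differential (Z j) y) v = 0" by (meson imageI lessThan_iff vec.span_base)
    thus "pairing wm v = 0" using wm W(5)[OF y] by (simp add: annihilator_def)
   qed
  qed
 qed
 show "EX W k Z. open W & x : W & W <= Om & (ALL j<(k::nat). smooth_on W (Z j)) &
    (ALL y:W. annihilator V y = vec.span ((%j. differential (Z j) y) ` {..<k}))"
  by (rule exI[of _ W], rule exI[of _ k], rule exI[of _ Z]) (use W(1-4) ann in blast)
qed

lemma smooth_on_partial: "smooth_on S f ==> smooth_on S (partial i f)"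
 unfolding partial_def[abs_def] by (rule smooth_on_FD)

lemma exact_kernel_involutive:
 assumes "exact_kernel Om V" shows "involutive Om V"
 unfolding involutive_def
proof (intro allI impI)
 fix W L M assume a: "open W & W <= Om & smooth_section W V L & smooth_section W V M"
 hence W: "open W" "W <= Om" and L: "smooth_on W L" "!!y. y : W ==> L y : V y" and M: "smooth_on W M" "!!y. y : W ==> M y : V y"
  by (auto simp: smooth_section_def)
 have "smooth_on W (%x. SU i. (\<chi> j. L x $ i * partial i M x $ j) - (\<chi> j. M x $ i * partial i L x $ j))"
  by (intro smooths W L(1) M(1) smooth_on_partial)
 hence "smooth_on W (lie_bracket L M)"
  unfolding lie_bracket_def[abs_def] vector_scalar_mult_def .
 moreover have "lie_bracket L M x : V x" if x: "x : W" for x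
 proof -
  from bspec[OF assms[unfolded exact_kernel_def] subsetD[OF W(2) x]]
  obtain W' k Z where "open W' & x : W' & W' <= Om & (ALL j<k. smooth_on W' (Z j)) &
   (ALL y:W'. V y = {v. ALL j<(k::nat). pairing (differential (Z j) y) v = 0})" by blast
  hence W': "open W'" "x : W'" "!!j. j < k ==> smooth_on W' (Z j)"
   "!!y. y : W' ==> V y = {v. ALL j<(k::nat). pairing (differential (Z j) y) v = 0}" by blast+
  have "pairing (differential (Z j) x) (lie_bracket L M x) = 0" if j: "j < k" for j
  proof -
   let ?S = "W \<inter> W'" and ?h = "Z j"
   have S: "open ?S" "x : ?S" using W W' x by auto
   have sh: "smooth_on ?S ?h" by (rule smooth_on_subset[OF W'(3)[OF j]]) simp
   have dh: "partial i ?h differentiable (at x)" for i by (rule smooth_diff[OF smooth_on_partial[OF sh] S(2)])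
   have der: "(SU l. partial i N x $ l * partial l ?h x) + (SU l. N x $ l * partial i (partial l ?h) x) = 0"
    if N: "smooth_on W N" "!!y. y : W ==> N y : V y" for N i
   proof -
    have dN: "N differentiable (at x)" by (rule smooth_diff[OF N(1) x])
    have dNl: "(%y. N y $ l) differentiable (at x)" for l
     using smooth_diff[OF smooth_on_vec_nth[OF N(1) W(1)] x] .
    have "(SU l. N y $ l * partial l ?h y) = 0" if "y : ?S" for y
     using N(2)[of y] W'(4)[of y] j that by (auto simp: pairing_def differential_def mult.commute)
    hence "FD (%y. SU l. N y $ l * partial l ?h y) x (axis i 1) = 0"
     using FD_cong[OF S, of "%y. SU l. N y $ l * partial l ?h y" "%y. 0"] by simp
    moreover have "FD (%y. SU l. N y $ l * partial l ?h y) x = (%v. SU l. N x $ l * FD (partial l ?h) x v + FD (%y. N y $ l) x v * partial l ?h x)"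
     by (rule FD_eq) (intro has_derivative_sum has_derivative_mult FD_works dh dNl)
    ultimately have "(SU l. N x $ l * FD (partial l ?h) x (axis i 1) + FD (%y. N y $ l) x (axis i 1) * partial l ?h x) = 0" by simp
    thus ?thesis unfolding FD_vec_nth[OF dN] by (simp add: sum.distrib partial_def[of i] add.commute)
   qed
   have sym: "partial i (partial l ?h) x = partial l (partial i ?h) x" for i l
    unfolding partial_def using second_sym[OF S(1) sh S(2)] by blast
   have "(SU i. L x $ i * ((SU l. partial i M x $ l * partial l ?h x) + (SU l. M x $ l * partial i (partial l ?h) x)))
    - (SU i. M x $ i * ((SU l. partial i L x $ l * partial l ?h x) + (SU l. L x $ l * partial i (partial l ?h) x))) = 0"
    by (simp only: der[OF L] der[OF M]) simp
   moreover have "(SU i. L x $ i * (SU l. M x $ l * partial i (partial l ?h) x)) = (SU i. M x $ i * (SU l. L x $ l * partial i (partial l ?h) x))"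
    unfolding sum_distrib_left by (subst sum.swap) (intro sum.cong refl, subst sym, simp add: mult_ac)
   moreover have "pairing (differential ?h x) (lie_bracket L M x) =
    (SU i. L x $ i * (SU l. partial i M x $ l * partial l ?h x)) - (SU i. M x $ i * (SU l. partial i L x $ l * partial l ?h x))"
   proof -
    have q: "(SU i. a i * (SU l. b i l * c l)) = (SU l. SU i. c l * (a i * b i l))"
     for a c :: "'d => complex" and b
     by (simp add: sum_distrib_left mult_ac) (rule sum.swap)
    show ?thesis unfolding q pairing_def differential_def lie_bracket_def
     by (simp add: sum_component sum_distrib_left right_diff_distrib sum_subtractf)
   qed
   ultimately show ?thesis by (simp add: distrib_left sum.distrib)
  qed
  thus ?thesis using W'(4)[OF W'(2)] by simp
 qed
 ultimately show "smooth_section W V (lie_bracket L M)" by (simp add: smooth_section_def)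
qed

lemma homeomorphism_homeomorphic_map: "homeomorphism S T f g ==> homeomorphic_map (top_of_set S) (top_of_set T) f"
 unfolding homeomorphic_map_maps homeomorphic_maps_def
 by (rule exI[of _ g]) (auto simp: homeomorphism_def continuous_map_in_subtopology)

lemma chart_facts:
 assumes m: "manifold reg X \<A>" and c: "(U, ps) : \<A>"
 shows "openin X U" "open (ps ` U)" "homeomorphic_map (subtopology X U) (top_of_set (ps ` U)) ps" "inj_on ps U"
  "!!A. openin X A ==> A <= U ==> open (ps ` A)" "U <= topspace X"
proof -
 have "is_chart X (U, ps)" using m c unfolding manifold_def by blast
 thus U: "openin X U" "open (ps ` U)" and h: "homeomorphic_map (subtopology X U) (top_of_set (ps ` U)) ps"
  by (simp_all add: is_chart_def)
 show UX: "U <= topspace X" by (rule openin_subset[OF U(1)])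
 have ts: "topspace (subtopology X U) = U" using UX by auto
 show "inj_on ps U" using homeomorphic_imp_injective_map[OF h] by (simp only: ts)
 show "open (ps ` A)" if "openin X A" "A <= U" for A
 proof -
  have "openin (subtopology X U) A" using that by (simp add: openin_open_subtopology U(1))
  hence "openin (top_of_set (ps ` U)) (ps ` A)" using homeomorphic_map_openness[OF h, of A] that(2) unfolding ts by simp
  thus ?thesis using U(2) by (simp add: openin_open_eq)
 qed
qed

lemma exact_kernel_pullback:
 fixes Tt :: "real^'d::finite => real^'d"
 assumes V: "subbundle smooth_on n Om V" "locally_exact Om (annihilator V)"
  and T: "open T" "smooth_on T Tt" "!!a. a : T ==> Tt a : Om"
 shows "exact_kernel T (%a. {x. cdiff Tt a x : V (Tt a)})"
 unfolding exact_kernel_def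
proof
 fix a assume a: "a : T"
 obtain W k Z where W: "open W" "Tt a : W" "W <= Om" "!!j. j < (k::nat) ==> smooth_on W (Z j)"
  "!!y. y : W ==> annihilator V y = vec.span ((%j. differential (Z j) y) ` {..<k})"
  using bspec[OF V(2)[unfolded locally_exact_def] T(3)[OF a]] by blast
 have VW: "V y = {v. ALL j<k. pairing (differential (Z j) y) v = 0}" if y: "y : W" for y
 proof
  have dn: "differential (Z j) y : annihilator V y" if "j < k" for j unfolding W(5)[OF y] using that by (intro vec.span_base) auto
  thus "V y <= {v. ALL j<k. pairing (differential (Z j) y) v = 0}" by (auto simp: annihilator_def)
  obtain L :: "nat => real^'d => complex^'d" where "V y = vec.span ((%i. L i y) ` {..<n})"
   using bspec[OF V(1)[unfolded subbundle_def], of y] y W(3) by blast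
  hence S: "vec.subspace (V y)" by (simp add: vec.subspace_span)
  show "{v. ALL j<k. pairing (differential (Z j) y) v = 0} <= V y"
  proof
   fix v assume v: "v : {v. ALL j<k. pairing (differential (Z j) y) v = 0}"
   have sy: "pairing a b = pairing b a" for a b :: "complex^'d" by (simp add: pairing_def mult.commute)
   show "v : V y"
   proof (rule double_annihilator[OF S])
    fix wm assume "!!s. s : V y ==> pairing s wm = 0"
    hence "wm : annihilator V y" by (simp add: annihilator_def sy)
    thus "pairing v wm = 0" unfolding W(5)[OF y] sy[of v] by (rule pairing_span[rotated]) (use v in auto)
   qed
  qed
 qed
 define W' where "W' = T \<inter> Tt -` W"
 have W': "open W'" "a : W'" "W' <= T"
  using continuous_open_preimage[OF smooth_cont[OF T(2)] T(1) W(1)] a W(2) by (auto simp: W'_def)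
 have "smooth_on W' (%x. Z j (Tt x))" if "j < k" for j
  by (rule smooth_on_compose[OF W(4)[OF that] smooth_on_subset[OF T(2) W'(3)] W'(1) W(1)]) (simp add: W'_def)
 moreover have "{x. cdiff Tt b x : V (Tt b)} = {v. ALL j<k. pairing (differential (%x. Z j (Tt x)) b) v = 0}" if b: "b : W'" for b
 proof -
  have bW: "Tt b : W" "b : T" using b by (auto simp: W'_def)
  have "pairing (differential (Z j) (Tt b)) (cdiff Tt b x) = pairing (differential (%x. Z j (Tt x)) b) x" if "j < k" for j x
   by (rule pairing_cdiff[OF smooth_diff[OF T(2) bW(2)] smooth_diff[OF W(4)[OF that] bW(1)]])
  thus ?thesis unfolding VW[OF bW(1)] by auto
 qed
 ultimately show "EX W k Z. open W & a : W & W <= T & (ALL j<(k::nat). smooth_on W (Z j)) &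
   (ALL y:W. {x. cdiff Tt y x : V (Tt y)} = {v. ALL j<k. pairing (differential (Z j) y) v = 0})"
  by (intro exI[of _ W'] exI[of _ k] exI[of _ "%j x. Z j (Tt x)"] conjI allI impI ballI W')
qed

lemma subbundle_frame:
 fixes v :: "'n::finite => real^'d::finite => complex^'d"
 assumes T: "open T" and reg: "!!m. reg T (v m)" and V: "!!a. a : T ==> V a = vec.span (range (%m. v m a))"
  and ind: "!!a b m. a : T ==> (SU m. b m *s v m a) = 0 ==> b m = 0"
 shows "subbundle reg CARD('n) T V"
 unfolding subbundle_def
proof
 fix x assume x: "x : T"
 obtain e :: "nat => 'n" where e: "bij_betw e {..<CARD('n)} UNIV"
  using ex_bij_betw_nat_finite[of "UNIV :: 'n set"] by (auto simp: atLeast0LessThan)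
 have im: "(%i. v (e i) y) ` {..<CARD('n)} = range (%m. v m y)" for y
  using e by (auto simp: bij_betw_def image_image[symmetric, of "%m. v m y" e])
 have "vec.dim (V y) = CARD('n)" if y: "y : T" for y
 proof -
  have inj: "inj (%m. v m y)"
  proof
   fix k l assume "v k y = v l y"
   have "(SU m. ((if m = k then 1 else 0) - (if m = l then 1 else 0)) *s v m y) = v k y - v l y"
    by (simp add: vec_eq_iff sum_component left_diff_distrib sum_subtractf if_distrib[of "%x. x * _"] cong: if_cong)
   hence "(if k = k then 1 else 0) - (if k = l then 1 else 0) = (0::complex)"
    using \<open>v k y = v l y\<close> by (intro ind[OF y, of "%m. (if m = k then 1 else 0) - (if m = l then 1 else 0)" k]) simp
   thus "k = l" by (simp split: if_splits)
  qed
  have "vec.independent (range (%m. v m y))"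
  proof
   assume "vec.dependent (range (%m. v m y))"
   then obtain u where u: "EX x:range (%m. v m y). u x ~= 0" "(\<Sum>x\<in>range (%m. v m y). u x *s x) = 0"
    using vec.dependent_finite[of "range (%m. v m y)"] by auto
   have "(SU m. u (v m y) *s v m y) = 0" using u(2) inj by (simp add: sum.reindex)
   thus False using ind[OF y, of "%m. u (v m y)"] u(1) by auto
  qed
  hence "vec.dim (vec.span (range (%m. v m y))) = card (range (%m. v m y))" by (rule vec.dim_span_eq_card_independent)
  thus ?thesis using inj by (simp add: V[OF y] card_image)
 qed
 thus "EX W L. open W & x : W & W <= T & (ALL i<CARD('n). reg W (L i)) &
   (ALL y:W. V y = vec.span ((%i. L i y) ` {..<CARD('n)}) & vec.dim (V y) = CARD('n))"
  using T x reg V by (intro exI[of _ T] exI[of _ "%i. v (e i)"]) (simp add: im)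
qed

text \<open>The model manifold is a neighbourhood of 0 in the coordinate space, with the identity as its only chart, and it carries the pullback of
  the structure by Tt, a diffeomorphism near the origin. The pullback is locally the kernel of exact forms,
  hence involutive with locally exact annihilator; the given frame makes it real analytic.\<close>

theorem regularizable_by_analytic_frame:
 fixes X :: "'a topology" and \<A> :: "('a, 'd::finite) chart set" and V :: "('a, 'd) structure_on"
  and Tt :: "real^'d => real^'d" and v :: "'n::finite => real^'d => complex^'d"
 assumes man: "manifold smooth_on X \<A>" and lis: "locally_integrable_structure n \<A> V"
  and c: "(U, ps) : \<A>" and p: "p : U" "ps p = Tt 0"
  and R: "R > 0" and sTt: "smooth_on (ball 0 R) Tt" and TtU: "!!a. a : ball 0 R ==> Tt a : ps ` U"
  and inj: "!!v. FD Tt 0 v = 0 ==> v = 0" and n: "n = CARD('n)"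
  and va: "!!m. real_analytic_on (ball 0 R) (v m)" and vs: "!!m. smooth_on (ball 0 R) (v m)"
  and frame: "!!a. a : ball 0 R ==> {x. cdiff Tt a x : V (U, ps) (Tt a)} = vec.span (range (%m. v m a))"
  and ind: "!!a b m. a : ball 0 R ==> (SU m. b m *s v m a) = 0 ==> b m = 0"
 shows "analytically_regularizable_near n X \<A> V p"
proof -
 have "(0 :: real^'d) : ball 0 R" using R by simp
 then obtain T V1 g where T: "open T" "0 : T" "T <= ball 0 R" "open V1" "homeomorphism T V1 Tt g" "smooth_on V1 g"
  using smooth_inverse[OF open_ball _ sTt inj] by blast
 have hom: "continuous_on T Tt" "Tt ` T = V1" "g ` V1 = T" "!!x. x : T ==> g (Tt x) = x" "!!y. y : V1 ==> Tt (g y) = y"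
  using T(5) by (auto simp: homeomorphism_def)
 have sT: "smooth_on T Tt" by (rule smooth_on_subset[OF sTt T(3)])
 note cU = chart_facts[OF man c]
 have V1U: "V1 <= ps ` U" using hom(2) TtU T(3) by auto
 define VV where "VV a = {x. cdiff Tt a x : V (U, ps) (Tt a)}" for a
 have lU: "subbundle smooth_on n (ps ` U) (V (U, ps))" "locally_exact (ps ` U) (annihilator (V (U, ps)))"
  and tf: "tangent_family \<A> V" using lis c by (auto simp: locally_integrable_structure_def)
 have ek: "exact_kernel T VV" unfolding VV_def[abs_def]
  by (rule exact_kernel_pullback[OF lU T(1) sT]) (use TtU T(3) in blast)
 have sub: "subbundle reg n T VV" if "!!m. reg T (v m)" for reg
  unfolding n
 proof (rule subbundle_frame[where reg=reg and v=v, OF T(1) that])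
  fix a assume "a : T"
  hence a: "a : ball 0 R" using T(3) by blast
  show "VV a = vec.span (range (%m. v m a))" unfolding VV_def by (rule frame[OF a])
  show "b m = 0" if "(SU m. b m *s v m a) = 0" for b m by (rule ind[OF a that])
 qed
 have vaT: "real_analytic_on T (v m)" "smooth_on T (v m)" for m
  using va[of m] T(3) smooth_on_subset[OF vs T(3)] by (auto simp: real_analytic_on_def)
 have idT: "(id \<circ> inv_into T id) x = x" if "x : T" for x using inv_into_f_f[of id T x] that by simp
 let ?A = "{(T, id)} :: (real^'d, 'd) chart set"
 let ?X = "top_of_set T"
 have man': "manifold real_analytic_on ?X ?A"
 proof -
  have "is_chart ?X (T, id)"
   using T(1) homeomorphic_map_id[of "top_of_set T" "top_of_set T"] by (auto simp: is_chart_def subtopology_subtopology)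
  moreover have "real_analytic_on T (id \<circ> inv_into T id)"
   by (rule real_analytic_cong[OF T(1) _ real_analytic_ident[OF T(1)]]) (rule idT)
  moreover have "second_countable ?X"
  proof (rule second_countable_subtopology)
   obtain \<B> :: "(real^'d) set set" where B: "countable \<B>" "!!C. C : \<B> ==> open C" "!!S. open S ==> EX U. U <= \<B> & S = \<Union>U"
    using univ_second_countable by blast
   have "EX V:\<B>. x : V & V <= S" if "open S" "x : S" for S x using B(3)[OF that(1)] that(2) by blast
   thus "second_countable (euclidean :: (real^'d) topology)" unfolding second_countable_def using B(1,2) by auto
  qed
  ultimately show ?thesis by (simp add: manifold_def Hausdorff_space_subtopology)
 qed
 have rlis: "real_analytic_locally_integrable_structure n ?A (%_. VV)"
 proof -
  have "cdiff (id \<circ> inv_into T id) x = (%v. v)" if "x : T" for x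
   using cdiff_cong[OF T(1) that, of "id \<circ> inv_into T id" "%x. x"] idT by (simp add: fun_eq_iff cdiff_id)
  hence "tangent_family ?A (%_. VV)" by (simp add: tangent_family_def)
  thus ?thesis
   using sub[of smooth_on] sub[of real_analytic_on] vaT exact_kernel_involutive[OF ek] exact_kernel_locally_exact[OF ek]
   by (simp add: real_analytic_locally_integrable_structure_def locally_integrable_structure_def)
 qed
 define G where "G = {q : U. ps q : V1}"
 define f where "f q = g (ps q)" for q
 have GU: "G <= U" by (auto simp: G_def)
 have psG: "ps ` G = V1" using V1U by (auto simp: G_def)
 have oG: "openin X G"
 proof -
  have "openin (top_of_set (ps ` U)) V1" using T(4) V1U by (simp add: open_subset)
  hence "openin (subtopology X U) G"
   using homeomorphic_map_openness[OF cU(3), of G] cU(6) GU psG by (simp add: Int_absorb1)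
  thus ?thesis using openin_trans_full cU(1) by blast
 qed
 have hmf: "homeomorphic_map (subtopology X G) (subtopology ?X T) f"
 proof -
  have "homeomorphic_map (subtopology (subtopology X U) G) (subtopology (top_of_set (ps ` U)) V1) ps"
   by (rule homeomorphic_map_subtopologies[OF cU(3)]) (use cU(6) GU psG V1U in \<open>auto simp: Int_absorb1\<close>)
  hence "homeomorphic_map (subtopology X G) (top_of_set V1) ps"
   using GU V1U by (simp add: subtopology_subtopology Int_absorb1)
  moreover have "homeomorphic_map (top_of_set V1) (top_of_set T) g"
   by (rule homeomorphism_homeomorphic_map[OF homeomorphism_symD[OF T(5)]])
  ultimately have "homeomorphic_map (subtopology X G) (top_of_set T) (g \<circ> ps)" by (rule homeomorphic_map_compose)
  thus ?thesis by (simp add: f_def[abs_def] comp_def subtopology_subtopology)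
 qed
 have injf: "inj_on f G" using homeomorphic_imp_injective_map[OF hmf] cU(6) GU by (simp add: Int_absorb1 subset_trans)
 have fT: "f q : T" if "q : G" for q using that hom(3) by (auto simp: f_def G_def)
 have trans: "smooth_on (ps ` (U \<inter> U')) (ps' \<circ> inv_into U ps)" if "(U, ps) : \<A>" "(U', ps') : \<A>" for U ps U' ps'
 proof -
  have "ALL (U, ps):\<A>. ALL (U', ps'):\<A>. smooth_on (ps ` (U \<inter> U')) (ps' \<circ> inv_into U ps)" using man by (simp add: manifold_def)
  from bspec[OF this that(1)] have "ALL (U', ps'):\<A>. smooth_on (ps ` (U \<inter> U')) (ps' \<circ> inv_into U ps)" by simp
  from bspec[OF this that(2)] show ?thesis by simp
 qed
 have oI: "open (ps2 ` (A \<inter> U2))" if "(U2, ps2) : \<A>" "openin X A" for U2 ps2 A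
  by (rule chart_facts(5)[OF man that(1)]) (use that chart_facts(1)[OF man that(1)] in auto)
 have inv: "inv_into U2 ps2 (ps2 q) = q" if "(U2, ps2) : \<A>" "q : U2" for U2 ps2 q
  using chart_facts(4)[OF man that(1)] that(2) by simp
 have fi: "(id \<circ> f \<circ> inv_into U2 ps2) y = g ((ps \<circ> inv_into U2 ps2) y)" for U2 and ps2 :: "'a => real^'d" and y
  by (simp add: f_def)
 have smf: "smooth_on (ps2 ` (G \<inter> U2)) (id \<circ> f \<circ> inv_into U2 ps2)"
  and smt: "smooth_on (ps2 ` (G \<inter> U2)) (ps \<circ> inv_into U2 ps2)" and tV1: "!!y. y : ps2 ` (G \<inter> U2) ==> (ps \<circ> inv_into U2 ps2) y : V1"
  if c2: "(U2, ps2) : \<A>" for U2 ps2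
 proof -
  show st: "smooth_on (ps2 ` (G \<inter> U2)) (ps \<circ> inv_into U2 ps2)"
   by (rule smooth_on_subset[OF trans[OF c2 c]]) (use GU in auto)
  show tV: "(ps \<circ> inv_into U2 ps2) y : V1" if "y : ps2 ` (G \<inter> U2)" for y using that inv[OF c2] by (auto simp: G_def)
  have "smooth_on (ps2 ` (G \<inter> U2)) (%y. g ((ps \<circ> inv_into U2 ps2) y))"
   by (rule smooth_on_compose[OF T(6) st oI[OF c2 oG] T(4) tV])
  thus "smooth_on (ps2 ` (G \<inter> U2)) (id \<circ> f \<circ> inv_into U2 ps2)"
   by (rule iffD2[OF smooth_on_cong[OF oI[OF c2 oG] fi]])
 qed
 have sm1: "smooth_map \<A> ?A G f"
 proof -
  have "{q : G \<inter> U2. f q : T} = G \<inter> U2" for U2 using fT by auto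
  thus ?thesis using smf by (auto simp: smooth_map_def)
 qed
 have sm2: "smooth_map ?A \<A> T (inv_into G f)"
 proof -
  have "smooth_on (id ` {q : T \<inter> T. inv_into G f q : U2}) (ps2 \<circ> inv_into G f \<circ> inv_into T id)" if c2: "(U2, ps2) : \<A>" for U2 ps2
  proof -
   have iv: "inv_into G f x = inv_into U ps (Tt x)" if x: "x : T" for x
   proof -
    have "Tt x : V1" using x hom(2) by blast
    then obtain q where q: "q : G" "ps q = Tt x" using psG by (metis imageE)
    hence "f q = x" using hom(4)[OF x] by (simp add: f_def)
    thus ?thesis using inv_into_f_f[OF injf q(1)] inv[OF c] q GU by (metis subsetD)
   qed
   define S where "S = T \<inter> Tt -` (ps ` (U \<inter> U2))"
   have oS: "open S" unfolding S_def
    by (rule continuous_open_preimage[OF hom(1) T(1)]) (use oI[OF c chart_facts(1)[OF man c2]] in \<open>simp add: Int_commute\<close>)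
   have SE: "id ` {q : T \<inter> T. inv_into G f q : U2} = S"
   proof -
    have "inv_into U ps (Tt x) : U2 \<longleftrightarrow> Tt x : ps ` (U \<inter> U2)" if "x : T" for x
    proof -
     have "Tt x : ps ` U" using that hom(2) V1U by blast
     then obtain q where "q : U" "Tt x = ps q" by blast
     thus ?thesis using inv[OF c] cU(4) by (auto simp: inj_on_def)
    qed
    thus ?thesis using iv by (auto simp: S_def inv[OF c])
   qed
   have st: "smooth_on S (%x. (ps2 \<circ> inv_into U ps) (Tt x))"
    by (rule smooth_on_compose[OF trans[OF c c2] smooth_on_subset[OF sT] oS]) (use oI[OF c chart_facts(1)[OF man c2]] in \<open>auto simp: S_def Int_commute\<close>)
   have eq: "(ps2 \<circ> inv_into G f \<circ> inv_into T id) x = (ps2 \<circ> inv_into U ps) (Tt x)" if "x : S" for x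
    using that iv idT[of x] by (simp add: S_def)
   show ?thesis unfolding SE by (rule iffD2[OF smooth_on_cong[OF oS eq] st])
  qed
  thus ?thesis by (auto simp: smooth_map_def)
 qed
 have fib: "VV (f q) = cdiff (id \<circ> f \<circ> inv_into U2 ps2) (ps2 q) ` V (U2, ps2) (ps2 q)"
  if c2: "(U2, ps2) : \<A>" and q: "q : G" "q : U2" for U2 ps2 q
 proof -
  let ?t = "ps \<circ> inv_into U2 ps2" and ?y = "ps2 q"
  have y: "?y : ps2 ` (G \<inter> U2)" using q by blast
  have ty: "?t ?y = ps q" using inv[OF c2 q(2)] by simp
  have qV1: "ps q : V1" and qU: "q : U" using q by (auto simp: G_def)
  have d: "?t differentiable (at ?y)" "g differentiable (at (ps q))"
   using smooth_diff[OF smt[OF c2] y] smooth_diff[OF T(6) qV1] by auto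
  have "cdiff (id \<circ> f \<circ> inv_into U2 ps2) ?y x = cdiff g (ps q) (cdiff ?t ?y x)" for x
   using cdiff_compose[of ?t ?y g x] d ty fi[of U2 ps2] by (simp add: comp_def)
  hence "cdiff (id \<circ> f \<circ> inv_into U2 ps2) ?y ` V (U2, ps2) ?y = cdiff g (ps q) ` (cdiff ?t ?y ` V (U2, ps2) ?y)"
   by (simp add: image_image)
  also have "cdiff ?t ?y ` V (U2, ps2) ?y = V (U, ps) (ps q)"
   using tf c c2 qU q(2) unfolding tangent_family_def by fastforce
  also have "cdiff g (ps q) ` V (U, ps) (ps q) = VV (f q)"
  proof -
   have fq: "f q : T" "Tt (f q) = ps q" using fT[OF q(1)] hom(5)[OF qV1] by (simp_all add: f_def)
   have dTt: "Tt differentiable (at (f q))" by (rule smooth_diff[OF sT fq(1)])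
   have gT: "cdiff g (ps q) (cdiff Tt (f q) x) = x" for x
    using cdiff_compose[OF dTt, of g x] d(2) cdiff_cong[OF T(1) fq(1), of "%x. g (Tt x)" "%x. x"] hom(4)
    by (simp add: fq(2) cdiff_id)
   have Tg: "cdiff Tt (f q) (cdiff g (ps q) x) = x" for x
    using cdiff_compose[OF d(2), of Tt x] dTt cdiff_cong[OF T(4) qV1, of "%x. Tt (g x)" "%x. x"] hom(5)
    by (simp add: f_def[symmetric] cdiff_id)
   show ?thesis unfolding VV_def fq(2)
   proof
    show "cdiff g (ps q) ` V (U, ps) (ps q) <= {x. cdiff Tt (f q) x : V (U, ps) (ps q)}" using Tg by auto
    show "{x. cdiff Tt (f q) x : V (U, ps) (ps q)} <= cdiff g (ps q) ` V (U, ps) (ps q)" using gT by (metis (no_types, lifting) image_iff mem_Collect_eq subsetI)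
   qed
  qed
  finally show ?thesis by (simp add: comp_def)
 qed
 have pG: "p : G" using p hom(2) T(2) by (auto simp: G_def)
 show ?thesis unfolding analytically_regularizable_near_def
 proof (intro exI conjI)
  show "manifold real_analytic_on ?X ?A" by (rule man')
  show "real_analytic_locally_integrable_structure n ?A (%_. VV)" by (rule rlis)
  show "openin X G" "p : G" by (rule oG, rule pG)
  show "openin ?X T" by simp
  show "f p : T" by (rule fT[OF pG])
  show "diffeo X \<A> ?X ?A G T f" using hmf sm1 sm2 by (simp add: diffeo_def)
  show "f p = f p" ..
  show "ALL (U, ps):\<A>. ALL (U', ps'):?A. ALL q:G \<inter> U. f q : U' --> VV (ps' (f q)) = cdiff (ps' \<circ> f \<circ> inv_into U ps) (ps q) ` V (U, ps) (ps q)"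
   using fib by auto
 qed
qed

section \<open>The defining function\<close>

lemma FD_scale_pt:
 assumes "g differentiable (at q)"
 shows "FD g q (scale_pt c v) = of_real (Re c) * FD g q v + of_real (Im c) * FD g q (scale_pt \<i> v)"
proof -
 interpret linear "FD g q" by (rule bounded_linear.linear[OF FD_linear[OF assms]])
 have "scale_pt c v = Re c .* v + Im c .* scale_pt \<i> v"
  by (simp add: scale_pt_def prod_eq_iff vec_eq_iff complex_eq_iff)
 thus ?thesis by (simp add: add scale scaleR_conv_of_real)
qed

lemma wirt_linear:
 assumes g: "g differentiable (at q)"
 shows "wirt (v + v') g q = wirt v g q + wirt v' g q" "wirt_bar (v + v') g q = wirt_bar v g q + wirt_bar v' g q"
  "wirt (scale_pt c v) g q = c * wirt v g q" "wirt_bar (scale_pt c v) g q = cnj c * wirt_bar v g q"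
  "FD g q v = wirt v g q + wirt_bar v g q"
proof -
 interpret linear "FD g q" by (rule bounded_linear.linear[OF FD_linear[OF g]])
 have s: "scale_pt \<i> (v + v') = scale_pt \<i> v + scale_pt \<i> v'" for v v' :: "(complex^'a) \<times> complex"
  by (simp add: scale_pt_def prod_eq_iff vec_eq_iff algebra_simps)
 show "wirt (v + v') g q = wirt v g q + wirt v' g q" "wirt_bar (v + v') g q = wirt_bar v g q + wirt_bar v' g q"
  unfolding wirt_def wirt_bar_def s add by (simp_all only: distrib_left add_divide_distrib diff_divide_distrib) simp_all
 have ss: "scale_pt \<i> (scale_pt c v) = scale_pt (\<i> * c) v" by (simp add: scale_pt_def)
 have c: "c = of_real (Re c) + \<i> * of_real (Im c)" by (simp add: complex_eq_iff)
 show "wirt (scale_pt c v) g q = c * wirt v g q"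
  unfolding wirt_def ss FD_scale_pt[OF g, of "\<i> * c"] FD_scale_pt[OF g, of c] by (subst (5) c) (simp add: algebra_simps add_divide_distrib diff_divide_distrib)
 show "wirt_bar (scale_pt c v) g q = cnj c * wirt_bar v g q"
  unfolding wirt_bar_def ss FD_scale_pt[OF g, of "\<i> * c"] FD_scale_pt[OF g, of c] by (subst (5) c) (simp add: algebra_simps add_divide_distrib diff_divide_distrib)
 show "FD g q v = wirt v g q + wirt_bar v g q" by (simp add: wirt_def wirt_bar_def add_divide_distrib[symmetric])
qed

lemma wirt_Pair: "g differentiable (at q) ==> wirt (v, c) g q = wirt (v, 0) g q + c * wirt (0, 1) g q"
 using wirt_linear(1)[of g q "(v, 0)" "scale_pt c (0, 1)"] wirt_linear(3)[of g q c "(0, 1)"] by (simp add: scale_pt_def)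

lemma wirt_sum: "g differentiable (at q) ==> wirt (\<Sum>k\<in>I. scale_pt (c k) (v k)) g q = (\<Sum>k\<in>I. c k * wirt (v k) g q)"
proof (induction I rule: infinite_finite_induct)
 case empty
 thus ?case using wirt_linear(3)[of g q 0 0] by (simp add: scale_pt_def) (simp add: zero_prod_def)
next
 case (infinite I)
 thus ?case using wirt_linear(3)[of g q 0 0] by (simp add: scale_pt_def) (simp add: zero_prod_def)
qed (simp add: wirt_linear)

lemma smooth_on_wirt: "open U ==> smooth_on U g ==> smooth_on U (wirt v g)" "open U ==> smooth_on U g ==> smooth_on U (wirt_bar v g)"
 unfolding wirt_def[abs_def] wirt_bar_def[abs_def] by (intro smooths smooth_on_FD; simp)+

lemma wirt_commute:
 assumes U: "open U" "q : U" and g: "smooth_on U g" shows "wirt u (wirt v g) q = wirt v (wirt u g) q"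
proof -
 have F: "FD (wirt v g) q x = (FD (%q. FD g q v) q x - \<i> * FD (%q. FD g q (scale_pt \<i> v)) q x) / 2" for v x
 proof -
  have d: "(%q. FD g q w) differentiable (at q)" for w by (rule smooth_diff[OF smooth_on_FD[OF g] U(2)])
  have "((%q. (FD g q v - \<i> * FD g q (scale_pt \<i> v)) / 2) has_derivative (%x. (FD (%q. FD g q v) q x - \<i> * FD (%q. FD g q (scale_pt \<i> v)) q x) / 2)) (at q)"
   by (intro bounded_linear.has_derivative[OF bounded_linear_divide] has_derivative_diff has_derivative_mult_right FD_works d)
  thus ?thesis unfolding wirt_def[abs_def] by (simp only: FD_eq)
 qed
 have sy: "FD (%q. FD g q a) q b = FD (%q. FD g q b) q a" for a b by (rule second_sym[OF U(1) g U(2)])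
 show ?thesis unfolding wirt_def[of u "wirt v g"] wirt_def[of v "wirt u g"] F
  using sy[of v u] sy[of "scale_pt \<i> v" u] sy[of v "scale_pt \<i> u"] sy[of "scale_pt \<i> v" "scale_pt \<i> u"]
  by (simp add: field_simps)
qed

context cr_graph
begin

definition "gr e = (fst e, w e)"

lemma smooth_gr: "smooth_on B gr" unfolding gr_def[abs_def] by (intro smooths openB)

lemma FD_gr: assumes "e : B" shows "FD gr e v = (fst v, FD w e v)"
 unfolding gr_def[abs_def]
 by (rule FD_eq[THEN fun_cong]) (intro has_derivative_Pair smooth_on_has_derivative[OF smooth_w(1) assms] has_derivative_fst has_derivative_ident)

lemma vf_graph:
 assumes e: "e : B" "gr e : U" and U: "open U" and a: "smooth_on U a"
 shows "vf p q (%e. a (gr e)) e = wirt (\<chi> i. vf p q (z i) e, vf p q w e) a (gr e)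
  + wirt_bar (\<chi> i. cnj (vf p q (%e. cnj (z i e)) e), cnj (vf p q wb e)) a (gr e)"
proof -
 have da: "a differentiable (at (gr e))" by (rule smooth_diff[OF a e(2)])
 have F: "FD (%e. a (gr e)) e v = wirt (fst v, FD w e v) a (gr e) + wirt_bar (fst v, FD w e v) a (gr e)" for v
  using FD_compose[OF dB[OF smooth_gr e(1)] da] wirt_linear(5)[OF da] by (simp add: FD_gr[OF e(1)])
 have wb: "FD wb e v = cnj (FD w e v)" for v by (simp add: FD_w[OF e(1)])
 have "vf p q (%e. a (gr e)) e = (wirt (fst (p e), FD w e (p e)) a (gr e) + \<i> * wirt (fst (q e), FD w e (q e)) a (gr e))
  + (wirt_bar (fst (p e), FD w e (p e)) a (gr e) + \<i> * wirt_bar (fst (q e), FD w e (q e)) a (gr e))"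
  by (simp add: vf_def F algebra_simps)
 also have "wirt (fst (p e), FD w e (p e)) a (gr e) + \<i> * wirt (fst (q e), FD w e (q e)) a (gr e)
  = wirt ((fst (p e), FD w e (p e)) + scale_pt \<i> (fst (q e), FD w e (q e))) a (gr e)"
  by (simp add: wirt_linear[OF da] del: add_Pair)
 also have "wirt_bar (fst (p e), FD w e (p e)) a (gr e) + \<i> * wirt_bar (fst (q e), FD w e (q e)) a (gr e)
  = wirt_bar ((fst (p e), FD w e (p e)) + scale_pt (- \<i>) (fst (q e), FD w e (q e))) a (gr e)"
  by (simp add: wirt_linear[OF da] del: add_Pair)
 also have "(fst (p e), FD w e (p e)) + scale_pt \<i> (fst (q e), FD w e (q e)) = (\<chi> i. vf p q (z i) e, vf p q w e)"
  by (simp add: scale_pt_def vf_def FD_z vec_eq_iff)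
 also have "(fst (p e), FD w e (p e)) + scale_pt (- \<i>) (fst (q e), FD w e (q e)) = (\<chi> i. cnj (vf p q (%e. cnj (z i e)) e), cnj (vf p q wb e))"
  by (simp add: scale_pt_def vf_def FD_zb wb vec_eq_iff)
 finally show ?thesis .
qed

lemma L_graph:
 assumes e: "e : B" "gr e : U" and U: "open U" and a: "smooth_on U a"
 shows "L i (%e. a (gr e)) e = wirt (axis i 1, ze i e) a (gr e)"
proof -
 have "(\<chi> j. if i = j then 1 else 0) = (axis i 1 :: complex^'n)" by (simp add: vec_eq_iff axis_def eq_commute)
 moreover have "(\<chi> j. L i (z j) e) = axis i 1" "(\<chi> j. cnj (L i (%e. cnj (z j e)) e)) = 0"
  by (auto simp: L_coord vec_eq_iff axis_def)
 moreover have "wirt_bar (0, 0) a (gr e) = 0"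
  using wirt_linear(4)[OF smooth_diff[OF a e(2)], of 0 0] by (simp add: scale_pt_def)
 ultimately show ?thesis unfolding L_def using vf_graph[OF e U a, of "pL i" "qL i"]
  by (simp add: L_def[symmetric] L_w[OF e(1)])
qed

lemma smooth_pull_graph: "open U ==> (!!e. e : B ==> gr e : U) ==> smooth_on U a ==> smooth_on B (%e. a (gr e))"
 by (rule smooth_on_compose[OF _ smooth_gr openB]) auto

context
 fixes rh :: "(complex^'n) \<times> complex => real" and U R
 defines "R \<equiv> %q. complex_of_real (rh q)"
 assumes U: "open U" and srh: "smooth_on U rh" and gU: "!!e. e : B ==> gr e : U" and gr0: "!!e. e : B ==> rh (gr e) = 0"
  and Rw: "!!q. q : U ==> d_w R q ~= 0"
begin

lemma sR: "smooth_on U R" unfolding R_def by (intro smooths U srh)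
lemma dR: "q : U ==> R differentiable (at q)" by (rule smooth_diff[OF sR])

text \<open>Differentiate the equation rh = 0 on the graph.\<close>

lemma graph_equation: assumes e: "e : B" shows "d_z j R (gr e) + ze j e * d_w R (gr e) = 0"
proof -
 have "L j (%e. R (gr e)) e = 0" unfolding L_def by (rule vf_const_on[OF e, where c=0]) (simp add: R_def gr0)
 thus ?thesis using L_graph[OF e gU[OF e] U sR, of j] wirt_Pair[OF dR[OF gU[OF e]], of "axis j 1" "ze j e"] by simp
qed

lemma graph_jet_lift: assumes e: "e : B" shows "jet_lift R (gr e) = (gr e, \<chi> k. ze k e)"
proof -
 have "- d_z j R (gr e) / d_w R (gr e) = ze j e" for j
 proof -
  have "d_z j R (gr e) = - ze j e * d_w R (gr e)" using graph_equation[OF e, of j] by (simp add: eq_neg_iff_add_eq_0)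
  thus ?thesis using Rw[OF gU[OF e]] by simp
 qed
 thus ?thesis by (simp add: jet_lift_def)
qed

lemma graph_Phi: assumes e: "e : B" shows "L i (ze j) e = Phi R i j (gr e)"
proof -
 let ?q = "gr e"
 have q: "?q : U" by (rule gU[OF e])
 have sz: "smooth_on U (d_z j R)" "smooth_on U (d_w R)" by (rule smooth_on_wirt(1)[OF U sR])+
 have dz: "d_z j R differentiable (at ?q)" "d_w R differentiable (at ?q)" using smooth_diff[OF sz(1) q] smooth_diff[OF sz(2) q] by auto
 have "L i (%e. d_z j R (gr e) + ze j e * d_w R (gr e)) e = 0"
  unfolding L_def by (rule vf_const_on[OF e, where c=0]) (rule graph_equation)
 moreover have "L i (%e. d_z j R (gr e) + ze j e * d_w R (gr e)) e
  = L i (%e. d_z j R (gr e)) e + (ze j e * L i (%e. d_w R (gr e)) e + d_w R ?q * L i (ze j) e)"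
  using e by (simp add: LT_add LT_mult smooths openB smooth_pull_graph[OF U gU sz(1)] smooth_pull_graph[OF U gU sz(2)])
 moreover have "L i (%e. d_z j R (gr e)) e = d_z i (d_z j R) ?q + ze i e * d_z j (d_w R) ?q"
  using L_graph[OF e q U sz(1), of i] wirt_Pair[OF dz(1), of "axis i 1" "ze i e"] wirt_commute[OF U q sR, of "(0, 1)" "(axis j 1, 0)"] by simp
 moreover have "L i (%e. d_w R (gr e)) e = d_z i (d_w R) ?q + ze i e * d_w (d_w R) ?q"
  using L_graph[OF e q U sz(2), of i] wirt_Pair[OF dz(2), of "axis i 1" "ze i e"] by simp
 ultimately have E: "d_w R ?q * L i (ze j) e = - (d_z i (d_z j R) ?q + ze i e * d_z j (d_w R) ?q + ze j e * (d_z i (d_w R) ?q + ze i e * d_w (d_w R) ?q))"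
  by (simp add: eq_neg_iff_add_eq_0 algebra_simps)
 have R0: "R ?q = 0" by (simp add: R_def gr0[OF e])
 have w0: "d_w R ?q ~= 0" by (rule Rw[OF q])
 have zz: "d_z k R ?q = - ze k e * d_w R ?q" for k using graph_equation[OF e, of k] by (simp add: eq_neg_iff_add_eq_0)
 have "Phi R i j ?q = 1 / (d_w R ?q) ^ 3 * (d_w R ?q ^ 3 * L i (ze j) e)"
 proof -
  have c3: "d_w R ?q ^ 3 * L i (ze j) e = d_w R ?q ^ 2 * (d_w R ?q * L i (ze j) e)" by (simp add: power3_eq_cube power2_eq_square)
  show ?thesis unfolding c3 E Phi_def
   by (intro arg_cong2[where f="(*)"] refl) (simp add: det_3 vector_3 R0 zz power2_eq_square algebra_simps)
 qed
 thus ?thesis using w0 by simp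
qed

text \<open>On vectors of type (1,0) tangent to the hypersurface the complex Hessian of rh is a nonzero multiple
  of La, so a vector in the kernel of La would contradict its positivity.\<close>

lemma graph_Levi_nondegenerate:
 assumes spc: "!!e v. e : B ==> v ~= 0 ==> wirt v R (gr e) = 0 ==> Re (wirt v (wirt_bar v R) (gr e)) > 0"
  and e: "e : B"
 shows "det (\<chi> i j. La i j e) ~= 0"
proof
 assume "det (\<chi> i j. La i j e) = 0"
 hence "det (transpose (\<chi> i j. La i j e)) = 0" by (simp add: det_transpose)
 hence "\<not> invertible (transpose (\<chi> i j. La i j e))" by (simp add: invertible_det_nz)
 then obtain v where v: "transpose (\<chi> i j. La i j e) *v v = 0" "v ~= 0"
  using matrix_left_invertible_ker[of "transpose (\<chi> i j. La i j e)"] invertible_left_inverse by blast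
 have La0: "(SU k. v $ k * La k i e) = 0" for i
  using arg_cong[OF v(1), of "%x. x $ i"] by (simp add: matrix_vector_mult_def transpose_def mult.commute)
 define c where "c = (SU k. ze k e * v $ k)"
 let ?v = "(v, c)" and ?q = "gr e"
 let ?a = "wirt_bar ?v R"
 have q: "?q : U" by (rule gU[OF e])
 have vs: "(v, b) = (SU k. scale_pt (v $ k) (axis k 1, 0)) + scale_pt b (0, 1)" for b
  using vec_lambda_axis[of "%i. v $ i"] by (simp add: scale_pt_def prod_eq_iff fst_sum snd_sum) (simp add: vec_eq_iff sum_component axis_def if_distrib cong: if_cong)
 have vs': "?v = (SU k. scale_pt (v $ k) (axis k 1, ze k e))"
  by (simp add: scale_pt_def prod_eq_iff fst_sum snd_sum c_def mult.commute) (simp add: vec_eq_iff sum_component axis_def if_distrib cong: if_cong)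
 have wv: "wirt ?v R (gr x) = d_w R (gr x) * (c - (SU k. v $ k * ze k x))" if x: "x : B" for x
 proof -
  have zz: "d_z k R (gr x) = - ze k x * d_w R (gr x)" for k using graph_equation[OF x, of k] by (simp add: eq_neg_iff_add_eq_0)
  have "wirt ?v R (gr x) = (SU k. v $ k * d_z k R (gr x)) + c * d_w R (gr x)"
   unfolding vs by (simp only: wirt_linear(1,3)[OF dR[OF gU[OF x]]] wirt_sum[OF dR[OF gU[OF x]]])
  thus ?thesis by (simp add: zz algebra_simps sum_distrib_left sum_negf)
 qed
 have wb: "?a (gr x) = cnj (wirt ?v R (gr x))" if x: "x : B" for x
 proof -
  have "FD R (gr x) u = of_real (FD rh (gr x) u)" for u
   unfolding R_def by (rule FD_linear_compose[OF bounded_linear_of_real smooth_diff[OF srh gU[OF x]]])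
  thus ?thesis by (simp add: wirt_def wirt_bar_def)
 qed
 have sa: "smooth_on U ?a" by (rule smooth_on_wirt(2)[OF U sR])
 have "wirt ?v ?a ?q = (SU k. v $ k * wirt (axis k 1, ze k e) ?a ?q)"
  by (subst (1) vs') (rule wirt_sum[OF smooth_diff[OF sa q]])
 also have "... = (SU k. v $ k * L k (%e. ?a (gr e)) e)" by (simp only: L_graph[OF e q U sa])
 also have "... = (SU k. v $ k * (- cnj (d_w R ?q) * (SU i. cnj (v $ i) * La k i e)))"
 proof (intro sum.cong refl arg_cong2[where f="(*)"])
  fix k
  have sw: "smooth_on B (%x. cnj (d_w R (gr x)))" by (intro smooths openB smooth_pull_graph[OF U gU smooth_on_wirt(1)[OF U sR]])
  have "L k (%e. ?a (gr e)) e = L k (%x. cnj (d_w R (gr x)) * (cnj c - (SU i. cnj (v $ i) * cnj (ze i x)))) e"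
   by (rule LT_cong[OF e]) (simp add: wb wv)
  also have "... = cnj (d_w R ?q) * (- (SU i. cnj (v $ i) * La k i e)) + (cnj c - (SU i. cnj (v $ i) * cnj (ze i e))) * L k (%x. cnj (d_w R (gr x))) e"
   using e by (simp add: LT_mult LT_diff LT_sum smooths openB sw La_def)
  also have "cnj c - (SU i. cnj (v $ i) * cnj (ze i e)) = 0" by (simp add: c_def mult.commute)
  finally show "L k (%e. ?a (gr e)) e = - cnj (d_w R ?q) * (SU i. cnj (v $ i) * La k i e)" by simp
 qed
 also have "... = - cnj (d_w R ?q) * (SU i. cnj (v $ i) * (SU k. v $ k * La k i e))"
  unfolding sum_distrib_left by (subst sum.swap) (simp add: mult_ac)
 finally have "wirt ?v ?a ?q = 0" by (simp add: La0)
 moreover have "wirt ?v R ?q = 0" using wv[OF e] by (simp add: c_def mult.commute)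
 moreover have "?v ~= 0" using v(2) by (simp add: prod_eq_iff)
 ultimately show False using spc[OF e, of ?v] by simp
qed

end

end

section \<open>Regularizability\<close>

context slice_param
begin

lemma norm_of_real_vec: "norm (rv a :: complex^'d) = norm a"
 by (simp add: norm_vec_def of_real_vec_def)

lemma cholo_real: "norm a < r ==> cholo f (rv a)"
 using fhol[of "rv a"] by (simp add: norm_of_real_vec) (simp add: of_real_vec_def)

lemma pairing_real:
 fixes a :: "real^'d"
 assumes "cholo c (rv a)"
 shows "pairing (differential (%b. c (rv b)) a) x = FD c (rv a) x"
proof -
 have d: "((rv :: real^'d => complex^'d) has_derivative rv) (at a)" by (rule bounded_linear_imp_has_derivative[OF bounded_linear_of_real_vec])
 have "FD (%b. c (rv b)) a v = FD c (rv a) (FD rv a v)" for v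
  by (rule FD_compose[where f=rv and g=c]) (use d cholo_differentiable[OF assms] in \<open>auto simp: differentiable_def\<close>)
 moreover have "rv (axis i 1 :: real^'d) = axis i 1" for i by (simp add: of_real_vec_def axis_def vec_eq_iff)
 ultimately have "partial i (%b. c (rv b)) a = FD c (rv a) (axis i 1)" for i
  by (simp add: partial_def FD_eq[OF d])
 thus ?thesis using cholo_vec_expand[OF assms, of x] by (simp add: pairing_def differential_def mult.commute)
qed

lemma in_kernel_span:
 assumes a: "norm a < r" and k: "!!m. in_kernel (rv a) (v m)" and x: "x : vec.span (range v)"
 shows "in_kernel (rv a) x"
proof (rule vec.span_induct[OF x])
 have "in_kernel (rv a) 0"
  using D_linear(2,4)[OF cholo_real[OF a], of 0 0] by (simp add: in_kernel_def)
 thus "vec.subspace {x. in_kernel (rv a) x}"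
  by (auto simp: vec.subspace_def in_kernel_def D_linear[OF cholo_real[OF a]])
qed (use k in auto)

lemma iobt_sum: "iobt (\<Sum>m\<in>I. b m *s v m) k = (\<Sum>m\<in>I. b m * iobt (v m) k)"
 by (induction I rule: infinite_finite_induct) (simp_all add: linear_parts, simp_all add: iobt_def)

end

lemma closure_negative_side:
 fixes rh :: "'a::euclidean_space => real" and W :: "('a \<times> 'b::euclidean_space) set"
 assumes W: "open W" "x : W" and d: "rh differentiable (at (fst x))" and 0: "rh (fst x) = 0" and nz: "FD rh (fst x) ~= (%_. 0)"
 shows "x : closure {y : W. rh (fst y) < 0}"
 unfolding closure_approachable
proof (intro allI impI)
 fix e :: real assume e: "e > 0"
 interpret linear "FD rh (fst x)" by (rule bounded_linear.linear[OF FD_linear[OF d]])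
 obtain v where v: "FD rh (fst x) v < 0"
 proof -
  obtain u where "FD rh (fst x) u ~= 0" using nz by auto
  thus ?thesis using that[of u] that[of "- u"] by (cases "FD rh (fst x) u < 0") (simp_all add: neg)
 qed
 have "((%t. fst x + t .* v) has_derivative (%t. t .* v)) (at 0)" by (auto intro!: derivative_eq_intros)
 hence "((%t. rh (fst x + t .* v)) has_derivative (%t. FD rh (fst x) (t .* v))) (at 0)"
  using has_derivative_compose[of "%t. fst x + t .* v" "%t. t .* v" 0 UNIV rh "FD rh (fst x)"] FD_works[OF d] by simp
 hence "((%t. rh (fst x + t .* v)) has_real_derivative FD rh (fst x) v) (at 0)"
  by (simp add: has_field_derivative_def scale mult.commute[of _ "FD rh (fst x) v"])
 from DERIV_neg_dec_right[OF this v] obtain d1 where d1: "d1 > 0" "!!h. 0 < h ==> h < d1 ==> rh (fst x + h .* v) < 0"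
  by (auto simp: 0)
 obtain d2 where d2: "d2 > 0" "ball x d2 <= W" using W open_contains_ball by blast
 define h where "h = min (d1 / 2) (min d2 e / (2 * (norm v + 1)))"
 have h: "0 < h" "h < d1" using d1 d2 e by (auto simp: h_def add_nonneg_pos)
 have "h * norm v < min d2 e"
 proof -
  have "h * norm v <= min d2 e / (2 * (norm v + 1)) * norm v" unfolding h_def by (intro mult_right_mono) auto
  also have "... = min d2 e * (norm v / (2 * (norm v + 1)))" by simp
  also have "... < min d2 e * 1"
  proof (rule mult_strict_left_mono)
   have "2 * (norm v + 1) > 0" using norm_ge_zero[of v] unfolding distrib_left by linarith
   moreover have "norm v < 2 * (norm v + 1)" using norm_ge_zero[of v] unfolding distrib_left by linarith
   ultimately show "norm v / (2 * (norm v + 1)) < 1" by simp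
  qed (use d2(1) e in simp)
  also have "... = min d2 e" by simp
  finally show ?thesis .
 qed
 moreover define y where "y = (fst x + h .* v, snd x)"
 have dist: "dist y x = h * norm v" using h(1) by (simp add: y_def dist_norm norm_prod_def prod_eq_iff fst_diff[symmetric] norm_Pair minus_prod_def)
 ultimately have "y : W" "dist y x < e" using d2(2) by (auto simp: dist_commute)
 thus "EX y:{y : W. rh (fst y) < 0}. dist y x < e" using d1(2)[OF h] by (intro bexI[of _ y]) (simp_all add: y_def)
qed

lemma bounded_linear_ext_subst: "bounded_linear (ext_subst lab)"
proof (subst linear_conv_bounded_linear[symmetric], rule linearI)
 show "ext_subst lab (x + y) = ext_subst lab x + ext_subst lab y" for x y
  by (cases x; cases y) (auto simp: ext_subst_def vec_eq_iff split: coord.split)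
 show "ext_subst lab (c .* x) = c .* ext_subst lab x" for c x
  by (cases x) (auto simp: ext_subst_def vec_eq_iff split: coord.split)
qed

theorem theorem1p3:
 fixes X :: "'a topology" and \<A> :: "('a, 'd::finite) chart set"
  and V :: "('a, 'd) structure_on" and n :: nat and p :: 'a
  and U :: "'a set" and \<psi> :: "'a \<Rightarrow> real^'d"
  and K :: "'n::finite set" and lab :: "'d \<Rightarrow> 'n coord"
  and \<Omega> :: "(real^'d) set" and \<phi> :: "real^'d \<Rightarrow> real"
 assumes "manifold smooth_on X \<A>"
  and "locally_integrable_structure n \<A> V"
  and "hypersurface_type \<A> V"
  and "nondegenerate_structure \<A> V"
  and "n = CARD('n)"
  and "(U, \<psi>) \<in> \<A>" and "p \<in> U" and "\<psi> p = 0"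
  and "char_set (V (U, \<psi>)) 0 \<noteq> {0}"
  and "levi_definite (V (U, \<psi>)) 0"
  and "bij_betw lab UNIV (coord_labels K)"
  and "open \<Omega>" and "0 \<in> \<Omega>" and "\<Omega> \<subseteq> \<psi> ` U"
  and "smooth_on \<Omega> \<phi>" and "\<phi> 0 = 0" and "(\<phi> has_derivative (\<lambda>_. 0)) (at 0)"
  and "\<And>x. x \<in> \<Omega> \<Longrightarrow> annihilator (V (U, \<psi>)) x =
     vec.span (insert (differential (w_fun lab \<phi>) x) ((\<lambda>k. differential (z_fun lab k) x) ` K))"
  and "condition_E (external_hypersurface lab \<Omega> \<phi>) 0"
 shows "analytically_regularizable_near n X \<A> V p"
proof -
 note man = assms(1) and lis = assms(2) and n = assms(5) and c = assms(6) and p = assms(7,8) and lab = assms(11)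
  and \<Omega> = assms(12,13,14) and s\<phi> = assms(15) and \<phi>0 = assms(16,17) and ann = assms(18) and E = assms(19)
 let ?H = "external_hypersurface lab \<Omega> \<phi>"
 have labK: "lab i : coord_labels K" for i using lab by (auto simp: bij_betw_def)
 have labi: "lab (inv lab l) = l" if "l : coord_labels K" for l using lab that by (simp add: bij_betw_def f_inv_into_f)
 define ex :: "(complex^'n) \<times> real => real^'d" where "ex e = ext_subst lab (fst e, of_real (snd e))" for e
 define \<phi>b where "\<phi>b e = \<phi> (ex e)" for e
 have bex: "bounded_linear ex" unfolding ex_def
  by (intro bounded_linear_compose[OF bounded_linear_ext_subst] bounded_linear_Pair bounded_linear_fst
    bounded_linear_compose[OF bounded_linear_of_real] bounded_linear_snd)
 have ex0: "ex 0 = 0" by (rule linear_0[OF bounded_linear.linear[OF bex]])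
 \<comment> \<open>The graph is parametrized by B0; B1 and B are the parts over which the defining function and the extended functions are given.\<close>
 define B0 where "B0 = {e. ex e : \<Omega>}"
 have oB0: "open B0" unfolding B0_def using open_vimage[OF \<Omega>(1) linear_continuous_on[OF bex, of UNIV]] by (simp add: vimage_def)
 have s\<phi>b: "smooth_on B0 \<phi>b" unfolding \<phi>b_def
  by (rule smooth_on_compose[OF s\<phi> smooth_on_linear[OF bex] oB0 \<Omega>(1)]) (simp add: B0_def)
 interpret C0: cr_graph B0 \<phi>b by unfold_locales (rule oB0, rule s\<phi>b)
 have grex: "ext_subst lab (C0.gr e) = ex e" for e
  by (simp add: C0.gr_def C0.w_def ex_def ext_subst_def cong: coord.case_cong)
 have grH: "C0.gr e : ?H" if "e : B0" for e
 proof -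
  have "Im (snd (C0.gr e)) = \<phi> (ext_subst lab (C0.gr e))" unfolding grex by (simp add: C0.gr_def C0.w_def \<phi>b_def)
  moreover have "ext_subst lab (C0.gr e) : \<Omega>" using that by (simp add: grex B0_def)
  ultimately show ?thesis by (cases "C0.gr e") (simp add: external_hypersurface_def)
 qed
 obtain U1 rh where spc: "spc_defining_function ?H 0 U1 rh"
  and EF: "EX \<O> F. open \<O> & jet_lift (%q. of_real (rh q)) 0 : \<O> & \<O> <= U1 \<times> UNIV &
   (ALL i j. smooth_up_to (\<O> \<inter> (({q:U1. rh q < 0} \<union> (?H \<inter> U1)) \<times> UNIV)) (F i j) &
       holomorphic_jet_on (\<O> \<inter> ({q:U1. rh q < 0} \<times> UNIV)) (F i j) &
       (ALL x:\<O> \<inter> jet_lift (%q. of_real (rh q)) ` (?H \<inter> U1). F i j x = Phi (%q. of_real (rh q)) i j (fst x)))"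
  using E unfolding condition_E_def Let_def by (elim conjE exE) (rule that, assumption, intro exI conjI, assumption+)
 define R where "R = (%q. complex_of_real (rh q))"
 have U1: "open U1" "0 : U1" and srh: "smooth_on U1 rh" and HU: "?H \<inter> U1 = {q:U1. rh q = 0}"
  and drhnz: "!!q. q : U1 ==> FD rh q ~= (%_. 0)" and Rw: "!!q. q : U1 ==> d_w R q ~= 0"
  and Lev: "!!q v. q : ?H \<inter> U1 ==> v ~= 0 ==> wirt v R q = 0 ==> Re (wirt v (wirt_bar v R) q) > 0"
  using spc unfolding spc_defining_function_def Let_def R_def[symmetric] by (simp_all del: split_paired_All)
 obtain \<O> F where O: "open \<O>" "jet_lift R 0 : \<O>" "\<O> <= U1 \<times> UNIV"
  and Fs: "!!i j. smooth_up_to (\<O> \<inter> (({q:U1. rh q < 0} \<union> (?H \<inter> U1)) \<times> UNIV)) (F i j)"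
  and Fh: "!!i j. holomorphic_jet_on (\<O> \<inter> ({q:U1. rh q < 0} \<times> UNIV)) (F i j)"
  and FP: "!!i j x. x : \<O> \<inter> jet_lift R ` (?H \<inter> U1) ==> F i j x = Phi R i j (fst x)"
 proof -
  from EF obtain \<O> F where EO: "open \<O>" "jet_lift R 0 : \<O>" "\<O> <= U1 \<times> UNIV"
   and EF: "ALL i j. smooth_up_to (\<O> \<inter> (({q:U1. rh q < 0} \<union> (?H \<inter> U1)) \<times> UNIV)) (F i j) &
       holomorphic_jet_on (\<O> \<inter> ({q:U1. rh q < 0} \<times> UNIV)) (F i j) &
       (ALL x:\<O> \<inter> jet_lift R ` (?H \<inter> U1). F i j x = Phi R i j (fst x))"
   unfolding R_def[symmetric] by (elim exE conjE)
  show ?thesis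
  proof (rule that[OF EO])
   fix i j
   note Fij = EF[THEN spec[of _ i], THEN spec[of _ j]]
   show "smooth_up_to (\<O> \<inter> (({q:U1. rh q < 0} \<union> (?H \<inter> U1)) \<times> UNIV)) (F i j)" by (rule Fij[THEN conjunct1])
   show "holomorphic_jet_on (\<O> \<inter> ({q:U1. rh q < 0} \<times> UNIV)) (F i j)" by (rule Fij[THEN conjunct2, THEN conjunct1])
   show "F i j x = Phi R i j (fst x)" if "x : \<O> \<inter> jet_lift R ` (?H \<inter> U1)" for x
    by (rule bspec[OF Fij[THEN conjunct2, THEN conjunct2] that])
  qed
 qed
 define B1 where "B1 = {e : B0. C0.gr e : U1}"
 have oB1: "open B1"
 proof -
  have "B1 = B0 \<inter> C0.gr -` U1" by (auto simp: B1_def)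
  thus ?thesis using continuous_open_preimage[OF smooth_cont[OF C0.smooth_gr] oB0 U1(1)] by simp
 qed
 interpret C1: cr_graph B1 \<phi>b
  by unfold_locales (rule oB1, rule smooth_on_subset[OF s\<phi>b], auto simp: B1_def)
 have g1: "C1.gr e : U1" "rh (C1.gr e) = 0" "C1.gr e : ?H \<inter> U1" if "e : B1" for e
  using that grH[of e] HU by (auto simp: B1_def)
 have jl: "jet_lift R (C1.gr e) = (C1.gr e, \<chi> k. C1.ze k e)" if "e : B1" for e
  unfolding R_def by (rule C1.graph_jet_lift[OF U1(1) srh g1(1,2) Rw[unfolded R_def] that])
 have Ph: "C1.L i (C1.ze j) e = Phi R i j (C1.gr e)" if "e : B1" for i j e
  unfolding R_def by (rule C1.graph_Phi[OF U1(1) srh g1(1,2) Rw[unfolded R_def] that])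
 have zB1: "0 : B1" using \<Omega>(2) U1(2) by (simp add: B1_def B0_def ex0 C0.gr_def C0.w_def \<phi>b_def \<phi>0(1) zero_prod_def[symmetric])
 have gr00: "C1.gr 0 = 0" using ex0 \<phi>0(1) by (simp add: C1.gr_def C1.w_def \<phi>b_def zero_prod_def)
 define S where "S = \<O> \<inter> (({q:U1. rh q < 0} \<union> (?H \<inter> U1)) \<times> UNIV)"
 have pS: "jet_lift R 0 : S" using O(2) g1(3)[OF zB1] by (simp add: S_def jet_lift_def gr00)
 have "EX Wg. open (fst Wg) & jet_lift R 0 : fst Wg & smooth_on (fst Wg) (snd Wg) & (ALL y:fst Wg \<inter> S. F i j y = snd Wg y)" for i j
  using bspec[OF Fs[of i j, folded S_def, unfolded smooth_up_to_def] pS] by auto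
 then obtain Wg where Wg: "!!i j. open (fst (Wg i j)) & jet_lift R 0 : fst (Wg i j) & smooth_on (fst (Wg i j)) (snd (Wg i j)) & (ALL y:fst (Wg i j) \<inter> S. F i j y = snd (Wg i j) y)"
  by metis
 \<comment> \<open>Near the jet of the origin the F i j are restrictions of smooth functions g i j, defined on both sides.\<close>
 define W where "W = \<O> \<inter> (\<Inter>i. \<Inter>j. fst (Wg i j))"
 define g where "g i j = snd (Wg i j)" for i j
 have W: "open W" "jet_lift R 0 : W" "W <= \<O>" "!!i j. W <= fst (Wg i j)" using O Wg by (auto simp: W_def open_INT)
 have WU: "fst ` W <= U1" using W(3) O(3) by auto
 have gF: "F i j y = g i j y" if "y : W" "y : S" for i j y using that Wg[of i j] W(4)[of i j] by (auto simp: g_def)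
 define P where "P = {x : W. rh (fst x) < 0}"
 have oP: "open P"
 proof -
  have "smooth_on W (%x. rh (fst x))"
   by (rule smooth_on_compose[OF srh smooth_on_linear[OF bounded_linear_fst] W(1) U1(1)]) (use WU in auto)
  moreover have "P = W \<inter> (%x. rh (fst x)) -` {..<0}" by (auto simp: P_def)
  ultimately show ?thesis using continuous_open_preimage[OF smooth_cont W(1) open_lessThan] by simp
 qed
 have PS: "P <= S" "P <= \<O> \<inter> ({q:U1. rh q < 0} \<times> UNIV)" using W(3) WU by (auto simp: P_def S_def)
 have hg: "hol_side W P (g i j)" for i j
  unfolding hol_side_def
 proof (intro conjI ballI)
  show "smooth_on W (g i j)" using Wg[of i j] smooth_on_subset[OF _ W(4)] unfolding g_def by blast
  fix x assume x: "x : P"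
  obtain D where D: "(F i j has_derivative D) (at x)" "!!q ze. D (scale_pt \<i> q, \<i> *s ze) = \<i> * D (q, ze)"
   using Fh[of i j] PS(2) x unfolding holomorphic_jet_on_def by blast
  have "imul v = (scale_pt \<i> (fst v), \<i> *s snd v)" for v :: "'n jet" by (simp add: prod_eq_iff scale_pt_def imul_vec_scale)
  hence "cholo (F i j) x" by (intro choloI[OF D(1)]) (simp add: D(2))
  moreover have "F i j y = g i j y" if "y : P" for y using gF[of y] that PS(1) by (auto simp: P_def)
  ultimately show "cholo (g i j) x" using cholo_cong[OF oP x, of "F i j" "g i j"] by blast
 qed
 have lift_eq: "((fst e, C1.w e), \<chi> k. C1.ze k e) = jet_lift R (C1.gr e)" if "e : B1" for e
  unfolding jl[OF that] by (simp add: C1.gr_def)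
 define B where "B = {e : B1. jet_lift R (C1.gr e) : W}"
 have oB: "open B"
 proof -
  have "smooth_on B1 (%e. ((fst e, C1.w e), \<chi> k. C1.ze k e))" by (intro smooths oB1)
  moreover have "B = B1 \<inter> (%e. ((fst e, C1.w e), \<chi> k. C1.ze k e)) -` W" using lift_eq by (auto simp: B_def)
  ultimately show ?thesis using continuous_open_preimage[OF smooth_cont oB1 W(1)] by simp
 qed
 have BB: "B <= B1" by (auto simp: B_def)
 have zB: "0 : B" using zB1 W(2) by (simp add: B_def gr00)
 have dex: "\<phi> differentiable (at (ex e))" if "e : B0" for e using smooth_diff[OF s\<phi>] that by (simp add: B0_def)
 have d\<phi>b: "FD \<phi>b e v = FD \<phi> (ex e) (ex v)" if "e : B0" for e v
  unfolding \<phi>b_def using FD_compose[OF bounded_linear_imp_differentiable[OF bex] dex[OF that]] by (simp add: FD_bounded_linear[OF bex])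
 \<comment> \<open>As the graph is tangent to Im w = 0 at the origin, the differential of the defining function is a multiple of Im.\<close>
 define c0 where "c0 = FD rh 0 (0, \<i>)"
 have drh: "FD rh 0 (v, a) = c0 * Im a" for v a
 proof -
  have d0: "rh differentiable (at 0)" using smooth_diff[OF srh U1(2)] .
  interpret linear "FD rh 0" by (rule bounded_linear.linear[OF FD_linear[OF d0]])
  have "FD (%e. rh (C1.gr e)) 0 (v, Re a) = 0"
   using FD_cong[OF oB1 zB1, of "%e. rh (C1.gr e)" "%e. 0"] g1(2) by simp
  moreover have "FD (%e. rh (C1.gr e)) 0 (v, Re a) = FD rh 0 (FD C1.gr 0 (v, Re a))"
   using FD_compose[OF smooth_diff[OF C1.smooth_gr zB1], of rh] d0 by (simp add: gr00)
  moreover have "FD C1.gr 0 (v, Re a) = (v, of_real (Re a))"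
   using d\<phi>b[of 0 "(v, Re a)"] zB1 FD_eq[OF \<phi>0(2)] by (simp add: C1.FD_gr[OF zB1] C1.FD_w[OF zB1] B1_def ex0)
  ultimately have "FD rh 0 (v, of_real (Re a)) = 0" by simp
  moreover have "(v, a) = (v, of_real (Re a)) + Im a .* (0, \<i>)" by (simp add: complex_eq_iff)
  ultimately show ?thesis by (simp only: add scale c0_def) simp
 qed
 have c0: "c0 ~= 0"
 proof
  assume "c0 = 0"
  hence "FD rh 0 = (%_. 0)" using drh by (auto simp: fun_eq_iff)
  thus False using drhnz[OF U1(2)] by simp
 qed
 interpret D: real_slice B \<phi>b W P g rh U1 c0 K lab
 proof unfold_locales
  show "open B" by (rule oB)
  show "smooth_on B \<phi>b" by (rule smooth_on_subset[OF s\<phi>b]) (use BB in \<open>auto simp: B1_def\<close>)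
  show "open W" "open P" "P <= W" "!!i j. hol_side W P (g i j)" using W oP hg by (auto simp: P_def)
  show "((fst e, C1.w e), \<chi> k. C1.ze k e) : W \<inter> closure P" if e: "e : B" for e
  proof -
   have e1: "e : B1" using e BB by blast
   have q: "C1.gr e : U1" "rh (C1.gr e) = 0" using g1[OF e1] by auto
   have "jet_lift R (C1.gr e) : W" using e by (simp add: B_def)
   moreover from this have "jet_lift R (C1.gr e) : closure P" unfolding P_def
    using q drhnz[OF q(1)] smooth_diff[OF srh q(1)] by (intro closure_negative_side[OF W(1)]) (simp_all add: jet_lift_def)
   ultimately show ?thesis unfolding lift_eq[OF e1] by blast
  qed
  show "C1.L i (C1.ze j) e = g i j ((fst e, C1.w e), \<chi> k. C1.ze k e)" if e: "e : B" for i j e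
  proof -
   have e1: "e : B1" and l: "jet_lift R (C1.gr e) : W" using e by (auto simp: B_def)
   have "jet_lift R (C1.gr e) : S" using l W(3) g1(3)[OF e1] by (auto simp: S_def jet_lift_def)
   moreover have "F i j (jet_lift R (C1.gr e)) = Phi R i j (C1.gr e)"
    using FP[of "jet_lift R (C1.gr e)" i j] l W(3) g1(3)[OF e1] by (auto simp: jet_lift_def)
   ultimately show ?thesis unfolding lift_eq[OF e1] Ph[OF e1] using gF[OF l] by metis
  qed
  show "det (\<chi> i j. C1.La i j e) ~= 0" if e: "e : B" for e
  proof (rule C1.graph_Levi_nondegenerate[OF U1(1) srh g1(1,2) Rw[unfolded R_def]])
   show "e : B1" using e BB by blast
   fix e v assume "e : B1" "v ~= 0" "wirt v (%q. complex_of_real (rh q)) (C1.gr e) = 0"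
   thus "Re (wirt v (wirt_bar v (%q. complex_of_real (rh q))) (C1.gr e)) > 0"
    using Lev[OF g1(3), of e v] by (simp add: R_def)
  qed
  show "0 : B" by (rule zB)
  show "\<phi>b 0 = 0" by (simp add: \<phi>b_def ex0 \<phi>0(1))
  show "FD \<phi>b 0 = (%_. 0)" using d\<phi>b[of 0] zB1 FD_eq[OF \<phi>0(2)] by (auto simp: B1_def ex0)
  show "P = {X : W. rh (fst X) < 0}" by (rule P_def)
  show "open U1" "smooth_on U1 rh" "fst ` W <= U1" "c0 ~= 0" by (fact U1(1) srh WU c0)+
  show "rh (fst e, C1.w e) = 0" if "e : B" for e using g1(2)[of e] that BB by (auto simp: C1.gr_def)
  show "FD rh 0 (v, a) = c0 * Im a" for v a by (rule drh)
  show "bij_betw lab UNIV (coord_labels K)" by (rule lab)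
  show "FD \<phi>b e (axis j 1, 0) = 0" if "e : B" "j ~: K" for e j
  proof -
   have eB0: "e : B0" using that(1) BB by (auto simp: B1_def)
   have nX: "lab i ~= CX j" for i using labK[of i] that(2) by (auto simp: coord_labels_def)
   have "ex (axis j 1, 0) = 0"
    using nX by (auto simp: ex_def ext_subst_def vec_eq_iff axis_def split: coord.split)
   thus ?thesis using d\<phi>b[OF eB0] linear_0[OF bounded_linear.linear[OF FD_linear[OF dex[OF eB0]]]] by simp
  qed
 qed
 obtain r f where f: "r > 0" "smooth_on (ball 0 r) f" "!!v. v : ball 0 r ==> f v : W" "f (0 :: complex^'d) = 0"
  "!!v. fst (FD f 0 v) = (\<chi> k. D.ioal v k, D.ios v)"
  "!!a. rv a : ball 0 r ==> EX e:B. f (rv a) = D.lift e"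
  "!!v. v : ball 0 r ==> (ALL i. Im (v $ i) > 0) | (ALL i. Im (v $ i) = 0) ==> cholo f v & f v : closure P"
 proof (rule D.slice_map, goal_cases)
  case (1 r f) from 1(1)[OF 1(2-)] show ?case .
 qed
 interpret Q: slice_param B \<phi>b W P g rh U1 c0 K lab r f
  by unfold_locales (fact f)+
 obtain r' v where v: "r' > 0" "r' <= r" "!!m. real_analytic_on (ball 0 r') (v m)" "!!m. smooth_on (ball 0 r') (v m)"
  "!!a m. a : ball 0 r' ==> Q.in_kernel (rv a) (v m a)"
  "!!a m k. a : ball 0 r' ==> D.iobt (v m a) k = (if k = m then 1 else 0)"
  "!!a x. a : ball 0 r' ==> Q.in_kernel (rv a) x ==> x = (SU m. D.iobt x m *s v m a)"
 proof (rule Q.analytic_frame, goal_cases)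
  case (1 r' v) from 1(1)[OF 1(2-)] show ?case .
 qed
 define Tt where "Tt a = ext_subst lab (fst (f (rv a)))" for a
 have ab: "rv a : (ball 0 r :: (complex^'d) set)" "norm a < r" if "a : ball 0 r'" for a
  using that v(2) by (auto simp: Q.norm_of_real_vec)
 have bl: "bounded_linear (%x :: 'n jet. ext_subst lab (fst x))" by (rule bounded_linear_compose[OF bounded_linear_ext_subst bounded_linear_fst])
 have sfo: "smooth_on (ball 0 r') (%a. f (rv a))"
  by (rule smooth_on_compose[OF f(2) smooth_on_linear[OF D.bounded_linear_of_real_vec] open_ball open_ball ab(1)])
 have sTt: "smooth_on (ball 0 r') Tt" unfolding Tt_def by (rule smooth_linear_compose[OF bl sfo open_ball])
 have Tte: "EX e:B. fst (f (rv a)) = C1.gr e & Tt a = ex e & ex e : \<Omega>" if a: "a : ball 0 r'" for a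
 proof -
  obtain e where e: "e : B" "f (rv a) = D.lift e" using f(6)[OF ab(1)[OF a]] by blast
  have "fst (f (rv a)) = C1.gr e" by (simp add: e(2) D.lift_def C1.gr_def)
  thus ?thesis using e(1) BB grex[of e] by (intro bexI[of _ e]) (auto simp: Tt_def B1_def B0_def)
 qed
 have Tt0: "Tt 0 = 0"
 proof -
  have "rv 0 = (0 :: complex^'d)" by (simp add: of_real_vec_def zero_vec_def)
  thus ?thesis using linear_0[OF bounded_linear.linear[OF bounded_linear_ext_subst]] by (simp add: Tt_def f(4))
 qed
 let ?V = "V (U, \<psi>)"
 have lc: "D.lc = inv lab" by (simp add: fun_eq_iff D.lc_def)
 have comp: "k : K ==> z_fun lab k (Tt a) = Q.zc k (rv a)" "w_fun lab \<phi> (Tt a) = Q.wc (rv a)"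
  if a: "a : ball 0 r'" for a k
 proof -
  obtain e where e: "fst (f (rv a)) = C1.gr e" "Tt a = ex e" using Tte[OF a] by blast
  have "lab (inv lab CS) = CS" "k : K ==> lab (inv lab (CX k)) = CX k" "k : K ==> lab (inv lab (CY k)) = CY k"
   by (auto intro!: labi simp: coord_labels_def)
  thus "k : K ==> z_fun lab k (Tt a) = Q.zc k (rv a)" "w_fun lab \<phi> (Tt a) = Q.wc (rv a)"
   by (simp_all add: z_fun_def w_fun_def Q.zc_def Q.wc_def e C1.gr_def C1.w_def \<phi>b_def ex_def ext_subst_def complex_eq_iff)
 qed
 have chol: "cholo f (rv a)" if "a : ball 0 r'" for a using Q.cholo_real ab(2)[OF that] by simp
 have nth: "((%x :: real^'d. x $ i) has_derivative (%x. x $ i)) (at y)" for i y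
  by (rule bounded_linear_imp_has_derivative[OF bounded_linear_vec_nth])
 have dz: "z_fun lab k differentiable (at y)" for k y
 proof -
  have "z_fun lab k = (%x. of_real (x $ inv lab (CX k)) + \<i> * of_real (x $ inv lab (CY k)))" by (auto simp: z_fun_def complex_eq_iff)
  thus ?thesis by (auto simp: differentiable_def intro!: derivative_eq_intros nth exI)
 qed
 have dw: "w_fun lab \<phi> differentiable (at y)" if "y : \<Omega>" for y
 proof -
  have "w_fun lab \<phi> = (%x. of_real (x $ inv lab CS) + \<i> * of_real (\<phi> x))" by (auto simp: w_fun_def complex_eq_iff)
  moreover have "(\<phi> has_derivative FD \<phi> y) (at y)" by (rule FD_works[OF smooth_diff[OF s\<phi> that]])
  ultimately show ?thesis by (auto simp: differentiable_def intro!: derivative_eq_intros nth exI)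
 qed
 have Vsub: "vec.subspace (?V y)" if y: "y : \<Omega>" for y
 proof -
  have "subbundle smooth_on n (\<psi> ` U) ?V" "y : \<psi> ` U"
   using lis c y \<Omega>(3) by (auto simp: locally_integrable_structure_def)
  then obtain L where "?V y = vec.span (L :: (complex^'d) set)" unfolding subbundle_def by metis
  thus ?thesis by simp
 qed
 \<comment> \<open>The structure is the common kernel of dw and the dz k, being the annihilator of its annihilator.\<close>
 have mem: "x : ?V y \<longleftrightarrow> pairing (differential (w_fun lab \<phi>) y) x = 0 & (ALL k:K. pairing (differential (z_fun lab k) y) x = 0)"
  if y: "y : \<Omega>" for x y
 proof
  assume x: "x : ?V y"
  have "wm : annihilator ?V y" if "wm : insert (differential (w_fun lab \<phi>) y) ((%k. differential (z_fun lab k) y) ` K)" for wm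
   unfolding ann[OF y] by (rule vec.span_base[OF that])
  thus "pairing (differential (w_fun lab \<phi>) y) x = 0 & (ALL k:K. pairing (differential (z_fun lab k) y) x = 0)"
   using x by (auto simp: annihilator_def)
 next
  assume x: "pairing (differential (w_fun lab \<phi>) y) x = 0 & (ALL k:K. pairing (differential (z_fun lab k) y) x = 0)"
  have sy: "pairing u u' = pairing u' u" for u u' :: "complex^'d" by (simp add: pairing_def mult.commute)
  show "x : ?V y"
  proof (rule double_annihilator[OF Vsub[OF y]])
   fix wm assume "!!s. s : ?V y ==> pairing s wm = 0"
   hence "wm : annihilator ?V y" by (simp add: annihilator_def sy[of wm])
   thus "pairing x wm = 0" unfolding ann[OF y] sy[of x] by (rule pairing_span[rotated]) (use x in auto)
  qed
 qed
 have Tt\<Omega>: "Tt a : \<Omega>" if "a : ball 0 r'" for a using Tte[OF that] by auto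
 have pull: "pairing (differential h (Tt a)) (cdiff Tt a x) = FD c (rv a) x"
  if a: "a : ball 0 r'" and h: "h differentiable (at (Tt a))" and hc: "!!b. b : ball 0 r' ==> h (Tt b) = c (rv b)"
   and cc: "cholo c (rv a)" for h c a x
 proof -
  have "differential (%b. h (Tt b)) a = differential (%b. c (rv b)) a"
   using FD_cong[OF open_ball a hc] by (simp add: differential_def partial_def)
  thus ?thesis using pairing_cdiff[OF smooth_diff[OF sTt a] h] Q.pairing_real[OF cc] by simp
 qed
 have ker: "cdiff Tt a x : ?V (Tt a) \<longleftrightarrow> Q.in_kernel (rv a) x" if a: "a : ball 0 r'" for a x
  unfolding mem[OF Tt\<Omega>[OF a]] Q.in_kernel_def Q.DZ_def Q.DW_def
  using pull[OF a dw[OF Tt\<Omega>[OF a]] comp(2) Q.cholo_comp(2)[OF chol[OF a]]]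
   pull[OF a dz comp(1) Q.cholo_comp(1)[OF chol[OF a]]] by auto
 have inj: "v = 0" if "FD Tt 0 v = 0" for v
 proof -
  have z: "0 : ball 0 r'" using v(1) by simp
  have o0: "rv 0 = (0 :: complex^'d)" by (simp add: of_real_vec_def zero_vec_def)
  have "FD Tt 0 v = ext_subst lab (fst (FD (%a. f (rv a)) 0 v))"
   unfolding Tt_def using FD_compose[OF smooth_diff[OF sfo z] bounded_linear_imp_differentiable[OF bl]]
   by (simp add: FD_bounded_linear[OF bl])
  also have "FD (%a. f (rv a)) 0 v = FD f 0 (rv v)"
   using FD_compose[OF bounded_linear_imp_differentiable[OF D.bounded_linear_of_real_vec], of f 0 v]
    cholo_differentiable[OF chol[OF z]] by (simp add: o0 FD_bounded_linear[OF D.bounded_linear_of_real_vec])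
  finally have "ext_subst lab (\<chi> k. D.ioal (rv v) k, D.ios (rv v)) = 0" using that f(5) by simp
  hence l: "ext_subst lab (\<chi> k. D.ioal (rv v) k, D.ios (rv v)) $ inv lab l = 0" for l by simp
  note defs = ext_subst_def D.ioal_def D.iobt_def D.ios_def lc of_real_vec_def complex_eq_iff
  have "lab (inv lab CS) = CS" using labi by (simp add: coord_labels_def)
  hence s: "D.ios (rv v) = 0" using l[of CS] by (simp add: defs)
  have XY: "v $ inv lab (CX k) = 0" "v $ inv lab (CY k) = 0" if "k : K" for k
  proof -
   have "lab (inv lab (CX k)) = CX k" "lab (inv lab (CY k)) = CY k" using that by (auto intro!: labi simp: coord_labels_def)
   thus "v $ inv lab (CX k) = 0" "v $ inv lab (CY k) = 0" using l[of "CX k"] l[of "CY k"] that by (simp_all add: defs)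
  qed
  have T: "v $ inv lab (CT k) = 0" if "k ~: K" for k
  proof -
   have "lab (inv lab (CT k)) = CT k" using that by (auto intro!: labi simp: coord_labels_def)
   thus ?thesis using l[of "CT k"] that by (simp add: defs)
  qed
  have "rv v = (0 :: complex^'d)"
   using XY T s by (intro Q.io_injective) (auto simp: D.ioal_def D.iobt_def lc of_real_vec_def)
  thus ?thesis by (simp add: of_real_vec_def vec_eq_iff)
 qed
 show ?thesis
 proof (rule regularizable_by_analytic_frame[OF man lis c p(1) _ v(1) sTt _ inj n v(3,4)])
  show "\<psi> p = Tt 0" using p(2) Tt0 by simp
  show "Tt a : \<psi> ` U" if "a : ball 0 r'" for a using Tt\<Omega>[OF that] \<Omega>(3) by auto
  fix a :: "real^'d" assume a: "a : ball 0 r'"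
  show "{x. cdiff Tt a x : ?V (Tt a)} = vec.span (range (%m. v m a))"
  proof (intro equalityI subsetI)
   fix x assume "x : {x. cdiff Tt a x : ?V (Tt a)}"
   hence "Q.in_kernel (rv a) x" using ker[OF a] by simp
   hence x: "x = (SU m. D.iobt x m *s v m a)" by (rule v(7)[OF a])
   have "(SU m. D.iobt x m *s v m a) : vec.span (range (%m. v m a))"
    by (intro vec.span_sum vec.span_scale vec.span_base) simp
   thus "x : vec.span (range (%m. v m a))" by (simp only: x[symmetric])
  next
   fix x assume "x : vec.span (range (%m. v m a))"
   hence "Q.in_kernel (rv a) x" by (rule Q.in_kernel_span[OF ab(2)[OF a] v(5)[OF a]])
   thus "x : {x. cdiff Tt a x : ?V (Tt a)}" using ker[OF a] by simp
  qed
  show "b k = 0" if b: "(SU m. b m *s v m a) = 0" for b k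
  proof -
   have "(SU m. b m * D.iobt (v m a) k) = D.iobt 0 k" by (simp only: Q.iobt_sum[symmetric] b)
   moreover have "D.iobt 0 k = 0" by (simp add: D.iobt_def)
   ultimately show ?thesis by (simp add: v(6)[OF a] if_distrib cong: if_cong)
  qed
 qed
qed

end
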